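(* Let $\alpha\in(0,2)$ and suppose that $Z_1,\dots,Z_d$ are independent real-valued $\alpha$-stable processes (the cylindrical $\alpha$-stable case), and that $b\in C^2(\mathbb{R}^d,\mathbb{R}^d)$ has bounded first and second order partial derivatives. Then there is a random field $Y(t,x)$, $t>0$, $x\in\mathbb{R}^d$, with values in $\mathbb{R}^d$ and not depending on $f$, such that $$\nabla P_tf(x)=\mathbb{E}\,f(X^x(t))\,Y(t,x),\qquad f\in B_b(\mathbb{R}^d),\ t>0,\ x\in\mathbb{R}^d,$$ and for every $T>0$ there is a constant $C_T$, independent of $x$ and $t$, such that $$\mathbb{E}\,|Y(t,x)|\le C_T\,t^{-\frac1\alpha},\qquad t\in(0,T],\ x\in\mathbb{R}^d.$$ Consequently, for every $T>0$ there is a constant $C_T$ such that $$\|\nabla P_tf\|_\infty\le C_T\,t^{-\frac1\alpha}\,\|f\|_\infty,\qquad t\in(0,T],\ f\in B_b(\mathbb{R}^d).$$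
   Context: $Z(t)=(Z_1(t),\dots,Z_d(t))^*$ is a Lévy process in $\mathbb{R}^d$ with independent real-valued coordinates; $m_j$ is the Lévy measure of $Z_j$. Each $Z_j$ is of purely jump type: $$Z_j(t)=\int_0^t\int_{\{|\xi|\ge1\}}\xi\,\Pi_j(\mathrm{d}s,\mathrm{d}\xi)+\int_0^t\int_{\{|\xi|<1\}}\xi\,[\Pi_j(\mathrm{d}s,\mathrm{d}\xi)-\mathrm{d}s\,m_j(\mathrm{d}\xi)],$$ where $\Pi_j$ is a Poisson random measure on $[0,+\infty)\times\mathbb{R}$ with intensity measure $\mathrm{d}s\,m_j(\mathrm{d}\xi)$. $X^x$ is the solution of $\mathrm{d}X^x(t)=b(X^x(t))\,\mathrm{d}t+\mathrm{d}Z(t)$, $X^x(0)=x\in\mathbb{R}^d$. $B_b(\mathbb{R}^d)$ is the space of bounded Borel functions $f\colon\mathbb{R}^d\to\mathbb{R}$, $P_tf(x)=\mathbb{E}f(X^x(t))$, $\|f\|_\infty$ is the supremum norm, and $\|\nabla P_tf\|_\infty=\sup_{x\in\mathbb{R}^d}|\nabla P_tf(x)|$. *)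

theory Defs
  imports "HOL-Probability.Probability"
begin

section \<open>Levy processes and stable laws\<close>

definition cadlag :: "(real \<Rightarrow> 'b::topological_space) \<Rightarrow> bool" where
  "cadlag g \<longleftrightarrow> (\<forall>t\<ge>0. (g \<longlongrightarrow> g t) (at_right t)) \<and> (\<forall>t>0. \<exists>l. (g \<longlongrightarrow> l) (at_left t))"

text \<open>Processes are indexed by \<^typ>\<open>real\<close>; only times \<open>t \<ge> 0\<close> are meaningful.\<close>

definition levy_process :: "'a measure \<Rightarrow> (real \<Rightarrow> 'a \<Rightarrow> 'b::euclidean_space) \<Rightarrow> bool" where
  "levy_process M Z \<longleftrightarrow>
     (\<forall>t\<ge>0. Z t \<in> borel_measurable M) \<and>
     (AE \<omega> in M. Z 0 \<omega> = 0) \<and>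
     (\<forall>n (t :: nat \<Rightarrow> real). 0 \<le> t 0 \<and> (\<forall>i<n. t i \<le> t (Suc i)) \<longrightarrow>
        prob_space.indep_vars M (\<lambda>_. borel) (\<lambda>i \<omega>. Z (t (Suc i)) \<omega> - Z (t i) \<omega>) {..<n}) \<and>
     (\<forall>s\<ge>0. \<forall>h\<ge>0. distr M borel (\<lambda>\<omega>. Z (s + h) \<omega> - Z s \<omega>) = distr M borel (Z h)) \<and>
     (AE \<omega> in M. cadlag (\<lambda>t. Z t \<omega>))"

text \<open>Independence of the coordinates as processes, i.e. as random elements of the product
  space \<open>\<real>\<^sup>[\<^sup>0\<^sup>,\<^sup>\<infinity>\<^sup>)\<close>.\<close>

definition independent_coordinates :: "'a measure \<Rightarrow> (real \<Rightarrow> 'a \<Rightarrow> real ^ 'd) \<Rightarrow> bool" where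
  "independent_coordinates M Z \<longleftrightarrow>
     prob_space.indep_vars M (\<lambda>_. \<Pi>\<^sub>M t\<in>{0..}. borel)
       (\<lambda>j \<omega>. \<lambda>t\<in>{0..}. Z t \<omega> $ j) (UNIV :: 'd set)"

text \<open>\<open>\<mu>\<close> is stable of index \<open>\<alpha>\<close> (not necessarily strictly stable, nor symmetric): if
  \<open>\<xi>\<^sub>1\<close>, \<open>\<xi>\<^sub>2\<close> and \<open>\<xi>\<close> have law \<open>\<mu>\<close> and \<open>\<xi>\<^sub>1\<close>, \<open>\<xi>\<^sub>2\<close> are independent, then for all \<open>A, B > 0\<close>
  the laws of \<open>A \<xi>\<^sub>1 + B \<xi>\<^sub>2\<close> and \<open>(A\<^sup>\<alpha> + B\<^sup>\<alpha>)\<^sup>1\<^sup>/\<^sup>\<alpha> \<xi> + D\<close> agree for some \<open>D\<close>. Point masses satisfy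
  this for every \<open>\<alpha>\<close> and are excluded.\<close>

definition stable_law :: "real \<Rightarrow> real measure \<Rightarrow> bool" where
  "stable_law \<alpha> \<mu> \<longleftrightarrow>
     prob_space \<mu> \<and> sets \<mu> = sets borel \<and> (\<forall>c. \<mu> \<noteq> return borel c) \<and>
     (\<forall>A>0. \<forall>B>0. \<exists>D.
        distr (\<mu> \<Otimes>\<^sub>M \<mu>) borel (\<lambda>(x, y). A * x + B * y) =
        distr \<mu> borel (\<lambda>x. (A powr \<alpha> + B powr \<alpha>) powr (1 / \<alpha>) * x + D))"

definition stable_process :: "real \<Rightarrow> 'a measure \<Rightarrow> (real \<Rightarrow> 'a \<Rightarrow> real) \<Rightarrow> bool" where
  "stable_process \<alpha> M \<zeta> \<longleftrightarrow>
     levy_process M \<zeta> \<and> (\<forall>t>0. stable_law \<alpha> (distr M borel (\<zeta> t)))"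

section \<open>Poisson random measures and purely jump type processes\<close>

definition levy_measure :: "real measure \<Rightarrow> bool" where
  "levy_measure m \<longleftrightarrow>
     sets m = sets borel \<and> emeasure m {0} = 0 \<and> (\<integral>\<^sup>+ \<xi>. ennreal (min 1 (\<xi>\<^sup>2)) \<partial>m) < \<infinity>"

definition poisson_random_measure ::
  "'a measure \<Rightarrow> 'b measure \<Rightarrow> ('a \<Rightarrow> 'b measure) \<Rightarrow> bool" where
  "poisson_random_measure M \<mu> N \<longleftrightarrow>
     (\<forall>\<omega>\<in>space M. sets (N \<omega>) = sets \<mu>) \<and>
     (\<forall>A\<in>sets \<mu>. (\<lambda>\<omega>. emeasure (N \<omega>) A) \<in> borel_measurable M) \<and>
     (\<forall>A\<in>sets \<mu>. emeasure \<mu> A < \<infinity> \<longrightarrow>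
        (\<forall>k::nat. measure M {\<omega>\<in>space M. emeasure (N \<omega>) A = of_nat k} =
           measure \<mu> A ^ k / fact k * exp (- measure \<mu> A))) \<and>
     (\<forall>A\<in>sets \<mu>. emeasure \<mu> A = \<infinity> \<longrightarrow> (AE \<omega> in M. emeasure (N \<omega>) A = \<infinity>)) \<and>
     (\<forall>n (A :: nat \<Rightarrow> 'b set). A ` {..<n} \<subseteq> sets \<mu> \<and> disjoint_family_on A {..<n} \<longrightarrow>
        prob_space.indep_vars M (\<lambda>_. borel) (\<lambda>i \<omega>. emeasure (N \<omega>) (A i)) {..<n})"

definition jump_intensity :: "real measure \<Rightarrow> (real \<times> real) measure" where
  "jump_intensity m = restrict_space lborel {0..} \<Otimes>\<^sub>M m"

definition large_jumps :: "('a \<Rightarrow> (real \<times> real) measure) \<Rightarrow> real \<Rightarrow> 'a \<Rightarrow> real" where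
  "large_jumps N t \<omega> = (LINT z : {0..t} \<times> {\<xi>. \<bar>\<xi>\<bar> \<ge> 1} | N \<omega>. snd z)"

definition small_jumps ::
  "real measure \<Rightarrow> ('a \<Rightarrow> (real \<times> real) measure) \<Rightarrow> real \<Rightarrow> real \<Rightarrow> 'a \<Rightarrow> real" where
  "small_jumps m N \<epsilon> t \<omega> =
     (LINT z : {0..t} \<times> {\<xi>. \<epsilon> \<le> \<bar>\<xi>\<bar> \<and> \<bar>\<xi>\<bar> < 1} | N \<omega>. snd z) -
     t * (LINT \<xi> : {\<xi>. \<epsilon> \<le> \<bar>\<xi>\<bar> \<and> \<bar>\<xi>\<bar> < 1} | m. \<xi>)"

text \<open>The integral of \<open>\<xi>\<close> over \<open>\<bar>\<xi>\<bar> < 1\<close> against the compensated measure is in general not a pathwise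
  integral. It is the limit in \<open>L\<^sup>2\<close>, as \<open>\<epsilon> \<rightarrow> 0+\<close>, of the integrals over \<open>\<epsilon> \<le> \<bar>\<xi>\<bar> < 1\<close>.\<close>

definition purely_jump ::
  "'a measure \<Rightarrow> real measure \<Rightarrow> ('a \<Rightarrow> (real \<times> real) measure) \<Rightarrow> (real \<Rightarrow> 'a \<Rightarrow> real) \<Rightarrow> bool" where
  "purely_jump M m N \<zeta> \<longleftrightarrow>
     levy_measure m \<and>
     poisson_random_measure M (jump_intensity m) N \<and>
     (\<forall>t\<ge>0. ((\<lambda>\<epsilon>. \<integral>\<^sup>+ \<omega>. ennreal ((\<zeta> t \<omega> - large_jumps N t \<omega> - small_jumps m N \<epsilon> t \<omega>)\<^sup>2) \<partial>M)
        \<longlongrightarrow> 0) (at_right 0))"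

section \<open>The stochastic equation and its transition semigroup\<close>

definition sde_solution ::
  "'a measure \<Rightarrow> ('b \<Rightarrow> 'b) \<Rightarrow> (real \<Rightarrow> 'a \<Rightarrow> 'b) \<Rightarrow> 'b \<Rightarrow> (real \<Rightarrow> 'a \<Rightarrow> 'b::euclidean_space) \<Rightarrow> bool"
where
  "sde_solution M b Z x X \<longleftrightarrow>
     (\<forall>t\<ge>0. X t \<in> borel_measurable M) \<and>
     (AE \<omega> in M. \<forall>t\<ge>0. (\<lambda>s. b (X s \<omega>)) integrable_on {0..t} \<and>
        X t \<omega> = x + integral {0..t} (\<lambda>s. b (X s \<omega>)) + Z t \<omega>)"

definition bounded_borel :: "('b::topological_space \<Rightarrow> real) set" where
  "bounded_borel = {f. f \<in> borel_measurable borel \<and> bounded (range f)}"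

definition transition ::
  "'a measure \<Rightarrow> ('b \<Rightarrow> real \<Rightarrow> 'a \<Rightarrow> 'b) \<Rightarrow> real \<Rightarrow> ('b \<Rightarrow> real) \<Rightarrow> 'b \<Rightarrow> real" where
  "transition M X t f x = (LINT \<omega> | M. f (X x t \<omega>))"

section \<open>Derivatives and norms\<close>

definition partial :: "'d \<Rightarrow> (real ^ 'd \<Rightarrow> 'b::real_normed_vector) \<Rightarrow> real ^ 'd \<Rightarrow> 'b" where
  "partial i g x = vector_derivative (\<lambda>h. g (x + h *\<^sub>R axis i 1)) (at 0)"

definition C1_map :: "(real ^ 'd \<Rightarrow> 'b::real_normed_vector) \<Rightarrow> bool" where
  "C1_map g \<longleftrightarrow> (\<forall>i. (\<forall>x. (\<lambda>h::real. g (x + h *\<^sub>R axis i 1)) differentiable (at 0)) \<and>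
                  continuous_on UNIV (partial i g))"

definition C2_map :: "(real ^ 'd \<Rightarrow> 'b::real_normed_vector) \<Rightarrow> bool" where
  "C2_map g \<longleftrightarrow> C1_map g \<and> (\<forall>i. C1_map (partial i g))"

definition grad :: "('b::real_inner \<Rightarrow> real) \<Rightarrow> 'b \<Rightarrow> 'b" where
  "grad g x = (THE D. GDERIV g x :> D)"

text \<open>The supremum norm is \<^typ>\<open>ennreal\<close>-valued so that it is meaningful for unbounded functions.\<close>

definition sup_norm :: "('b \<Rightarrow> 'c::real_normed_vector) \<Rightarrow> ennreal" where
  "sup_norm g = (SUP x. ennreal (norm (g x)))"

end

theory Submission
  imports Defs
begin

text \<open>No Malliavin calculus is used. The semigroup is approximated by powers of the Euler operator
  \<open>S \<tau> f x = \<integral> f (x + \<tau> b x + z) d\<mu>\<^sub>\<tau>\<close>, where \<open>\<mu>\<^sub>\<tau>\<close> is the law of the driftless noise. Replacing \<open>m\<close>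
  consecutive Euler steps by \<open>m\<close> deterministic steps followed by a single convolution with \<open>\<mu>\<close> at time
  \<open>m \<tau>\<close> produces the smoothing rate \<open>t powr (-1/\<alpha>)\<close> of the stable law, at the price of commutators of
  the flow of \<open>b\<close> with convolutions. Their size is \<open>\<tau> \<sigma> powr (\<alpha>/4 - 1)\<close> at scale \<open>\<sigma>\<close>, which is summable,
  so a discrete Duhamel formula gives Lipschitz bounds and second difference bounds of order
  \<open>1 + \<alpha>\<^sup>2/16\<close> which are uniform in the step size. These pass to the limit, since the Euler scheme
  converges pathwise, and extend from continuous to Borel functions. They show that the laws of \<open>X\<^sup>x(t)\<close>
  are differentiable in \<open>x\<close> in total variation, with derivative \<open>y\<close> times the law, and \<open>Y = y(X\<^sup>x(t))\<close>.

  The smoothing of the noise follows from the form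
  \<open>w u powr \<alpha> + a u ln u + i p u\<close> (\<open>u > 0\<close>) of the characteristic exponent, where \<open>a = 0\<close> unless
  \<open>\<alpha> = 1\<close>; the drift \<open>p\<close> is moved into \<open>b\<close>.\<close>

section \<open>Approximate linearity and second differences\<close>

text \<open>The gradient of a convolution with the noise at time s is of order s powr (-1/\<alpha>),
  which is not integrable at 0 when \<alpha> \<le> 1, and \<open>b\<close> may grow linearly; so
  \<open>b\<close> cannot be treated as a perturbation of the noise semigroup. Moving the points by
  the deterministic steps cures this: over a time s the flow differs from the identity by a map with
  Lipschitz constant of order s, and this factor absorbs the gradient. The other obstacle is that
  the jumps need not have a variance nor, for small \<alpha>, a mean. First-order terms are
  therefore controlled by the mean of a sine and second-order terms by a truncated square, both read
  off the characteristic function. The exponent \<alpha>/4 instead of \<alpha>/2 leaves room for the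
  logarithm at \<alpha> = 1. Lipschitz bounds alone give no gradient. A smooth part is split off at
  an intermediate time s, with a Lipschitz remainder of size s powr (\<alpha>/4); taking s
  proportional to r powr (\<alpha>/4) for increments of size r gives the exponent
  \<open>1 + \<alpha>\<^sup>2/16\<close>.\<close>

lemma approx_linear:
  fixes u :: "'b::real_normed_vector \<Rightarrow> 'c::banach"
  assumes \<gamma>: "\<gamma> > 0" and A: "A \<ge> 0"
    and second: "\<And>h k. norm (u (h + k) - u h - u k + u 0) \<le> A * (norm h + norm k) powr (1 + \<gamma>)"
    and lip: "\<And>h. norm (u h - u 0) \<le> L * norm h"
  obtains D where "bounded_linear D" "\<And>h. norm (D h) \<le> L * norm h"
    "\<And>h. norm (u h - u 0 - D h) \<le> A / (1 - 2 powr - \<gamma>) * norm h powr (1 + \<gamma>)"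
proof -
  \<comment> \<open>The difference quotients of \<open>u\<close> at 0 with dyadic steps. The second
    difference bound makes their increments geometric with ratio \<open>q\<close>, so the derivative
    can be built as their limit.\<close>
  define a where "a h n = (2::real) ^ n *\<^sub>R (u ((1 / 2 ^ n) *\<^sub>R h) - u 0)" for h n
  define q where "q = (2::real) powr - \<gamma>"
  have q: "0 < q" "q < 1"
    using \<gamma> powr_less_mono[of "-\<gamma>" 0 2] by (auto simp: q_def)
  have pow: "2 ^ n * (r / 2 ^ n) powr (1 + \<gamma>) = r powr (1 + \<gamma>) * q ^ n" if "r \<ge> 0" for r :: real and n
  proof (cases "r = 0")
    case False
    then have r: "r > 0" using that by simp
    have "(r / 2 ^ n) powr (1 + \<gamma>) = r powr (1 + \<gamma>) * (2 powr - real n) powr (1 + \<gamma>)"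
      using r by (simp add: powr_mult powr_divide powr_minus powr_realpow field_simps)
    moreover have "2 ^ n * (2 powr - real n) powr (1 + \<gamma>) = q ^ n"
      unfolding q_def by (simp add: powr_powr powr_realpow[symmetric] powr_power powr_add[symmetric] algebra_simps)
    ultimately show ?thesis by (metis mult.left_commute)
  qed simp
  have inc: "norm (a h (Suc n) - a h n) \<le> A * norm h powr (1 + \<gamma>) * q ^ n" for h n
  proof -
    \<comment> \<open>With two equal increments \<open>k\<close>, passing from step n to step n + 1
      is minus one second difference, scaled by \<open>2 ^ n\<close>.\<close>
    define k where "k = (1 / 2 ^ Suc n) *\<^sub>R h"
    have kk: "k + k = (1 / 2 ^ n) *\<^sub>R h"
      unfolding k_def by (simp add: scaleR_left_distrib[symmetric])
    have nk: "norm k + norm k = norm h / 2 ^ n" unfolding k_def by simp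
    have "a h (Suc n) - a h n = - ((2::real) ^ n *\<^sub>R (u (k + k) - u k - u k + u 0))"
      unfolding a_def kk k_def[symmetric]
      by (simp add: algebra_simps) (simp add: scaleR_2[symmetric] mult.commute add.assoc[symmetric])
    then have "norm (a h (Suc n) - a h n) = 2 ^ n * norm (u (k + k) - u k - u k + u 0)"
      by simp
    also have "\<dots> \<le> 2 ^ n * (A * (norm h / 2 ^ n) powr (1 + \<gamma>))"
      using second[of k k] unfolding nk by simp
    also have "\<dots> = A * norm h powr (1 + \<gamma>) * q ^ n"
      using pow[of "norm h" n] by (simp add: algebra_simps)
    finally show ?thesis .
  qed
  have geo: "summable (\<lambda>n. A * norm h powr (1 + \<gamma>) * q ^ n)" for h
    using q by (intro summable_mult summable_geometric) auto
  define s where "s h n = a h (Suc n) - a h n" for h n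
  have summ: "summable (s h)" "norm (suminf (s h)) \<le> A / (1 - q) * norm h powr (1 + \<gamma>)" for h
  proof -
    have nn: "summable (\<lambda>n. norm (s h n))"
      by (rule summable_comparison_test'[OF geo[of h], of 0]) (use inc in \<open>auto simp: s_def\<close>)
    then show "summable (s h)" by (rule summable_norm_cancel)
    have "norm (suminf (s h)) \<le> (\<Sum>n. norm (s h n))" by (rule summable_norm[OF nn])
    also have "\<dots> \<le> (\<Sum>n. A * norm h powr (1 + \<gamma>) * q ^ n)"
      by (rule suminf_le[OF _ nn geo]) (use inc in \<open>auto simp: s_def\<close>)
    also have "\<dots> = A * norm h powr (1 + \<gamma>) * (1 / (1 - q))"
      using q by (simp add: suminf_mult summable_geometric suminf_geometric)
    finally show "norm (suminf (s h)) \<le> A / (1 - q) * norm h powr (1 + \<gamma>)" by simp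
  qed
  \<comment> \<open>The limit is written as first term plus telescoping series: up to sign the
    series is the linearisation error, and its geometric bound is the last claim.\<close>
  define D where "D h = u h - u 0 + suminf (s h)" for h
  have aD: "a h \<longlonglongrightarrow> D h" for h
  proof -
    have "(\<lambda>n. (\<Sum>i<n. s h i)) \<longlonglongrightarrow> suminf (s h)" using summ(1) by (rule summable_LIMSEQ)
    moreover have "(\<Sum>i<n. s h i) = a h n - a h 0" for n
      unfolding s_def by (rule sum_lessThan_telescope)
    ultimately have "(\<lambda>n. (a h n - a h 0) + a h 0) \<longlonglongrightarrow> suminf (s h) + a h 0"
      by (intro tendsto_add) auto
    moreover have "suminf (s h) + a h 0 = D h" by (simp add: D_def a_def)
    ultimately show ?thesis by simp
  qed
  have Dn: "norm (D h) \<le> L * norm h" for h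
  proof (rule LIMSEQ_le_const2[OF tendsto_norm[OF aD]])
    have "norm (a h n) \<le> L * norm h" for n
    proof -
      have "norm (a h n) = 2 ^ n * norm (u ((1 / 2 ^ n) *\<^sub>R h) - u 0)" by (simp add: a_def)
      also have "\<dots> \<le> 2 ^ n * (L * norm ((1 / 2 ^ n) *\<^sub>R h))" by (intro mult_left_mono lip) auto
      finally show ?thesis by simp
    qed
    then show "\<exists>N. \<forall>n\<ge>N. norm (a h n) \<le> L * norm h" by auto
  qed
  \<comment> \<open>The defect of additivity of \<open>a\<close> is again a scaled second difference
    and vanishes like \<open>q ^ n\<close>.\<close>
  have Dadd: "D (h + k) = D h + D k" for h k
  proof -
    have "norm (a (h + k) n - a h n - a k n) \<le> A * (norm h + norm k) powr (1 + \<gamma>) * q ^ n" for n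
    proof -
      let ?h = "(1 / 2 ^ n) *\<^sub>R h" and ?k = "(1 / 2 ^ n) *\<^sub>R k"
      have "a (h + k) n - a h n - a k n = 2 ^ n *\<^sub>R (u (?h + ?k) - u ?h - u ?k + u 0)"
        by (simp add: a_def algebra_simps)
      then have "norm (a (h + k) n - a h n - a k n) = 2 ^ n * norm (u (?h + ?k) - u ?h - u ?k + u 0)"
        by simp
      also have "\<dots> \<le> 2 ^ n * (A * ((norm h + norm k) / 2 ^ n) powr (1 + \<gamma>))"
        using second[of ?h ?k] by (simp add: add_divide_distrib)
      also have "\<dots> = A * (norm h + norm k) powr (1 + \<gamma>) * q ^ n"
        using pow[of "norm h + norm k" n] by (simp add: algebra_simps)
      finally show ?thesis .
    qed
    then have le: "\<forall>\<^sub>F n in sequentially. norm (a (h + k) n - a h n - a k n) \<le> A * (norm h + norm k) powr (1 + \<gamma>) * q ^ n"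
      by (intro always_eventually allI)
    have "(\<lambda>n. A * (norm h + norm k) powr (1 + \<gamma>) * q ^ n) \<longlonglongrightarrow> 0"
      using q by (intro tendsto_mult_right_zero LIMSEQ_power_zero) auto
    with le have "(\<lambda>n. a (h + k) n - a h n - a k n) \<longlonglongrightarrow> 0"
      by (rule Lim_null_comparison)
    moreover have "(\<lambda>n. a (h + k) n - a h n - a k n) \<longlonglongrightarrow> D (h + k) - D h - D k"
      by (intro tendsto_diff aD)
    ultimately have "D (h + k) - D h - D k = 0" using LIMSEQ_unique by blast
    then show ?thesis by (simp add: algebra_simps)
  qed
  interpret D: additive D by standard (rule Dadd)
  have Dlip: "norm (D h - D k) \<le> L * norm (h - k)" for h k
    using Dn[of "h - k"] by (simp add: D.diff)
  \<comment> \<open>Continuity upgrades additivity to linearity: homogeneity is obtained for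
    integers, for rationals, and for reals by density. A Lipschitz constant has to be nonnegative,
    so L \<le> 0, which forces \<open>D\<close> to vanish, is a separate case.\<close>
  have "continuous_on UNIV D"
  proof (cases "L > 0")
    case True
    then have "L-lipschitz_on UNIV D" using Dlip by (auto simp: lipschitz_on_def dist_norm)
    then show ?thesis by (rule lipschitz_on_continuous_on)
  next
    case False
    then have "L * norm h \<le> 0" for h :: 'b by (simp add: mult_nonpos_nonneg)
    then have "D h = 0" for h using Dn[of h] by (meson norm_le_zero_iff order_trans)
    then have "D = (\<lambda>h. 0)" by blast
    then show ?thesis by simp
  qed
  then have Dcont: "isCont D h" for h by (simp add: continuous_on_eq_continuous_at)
  have Dnat: "D (real n *\<^sub>R h) = real n *\<^sub>R D h" for n h
    by (induction n) (simp_all add: D.zero Dadd scaleR_left_distrib)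
  have Dint: "D (of_int n *\<^sub>R h) = of_int n *\<^sub>R D h" for n h
    using Dnat[of "nat n" h] Dnat[of "nat (- n)" h] D.minus[of "real (nat (-n)) *\<^sub>R h"]
    by (cases "n \<ge> 0") simp_all
  have Drat: "D (of_rat r *\<^sub>R h) = of_rat r *\<^sub>R D h" for r h
  proof -
    obtain p m where r: "r = Fract p m" "m > 0" by (cases r) auto
    have "of_int m *\<^sub>R D (of_rat r *\<^sub>R h) = D (of_int m *\<^sub>R of_rat r *\<^sub>R h)" by (simp only: Dint)
    also have "\<dots> = of_int p *\<^sub>R D h" using r by (simp add: of_rat_rat Dint)
    finally have "(1 / of_int m) *\<^sub>R of_int m *\<^sub>R D (of_rat r *\<^sub>R h) = (1 / of_int m) *\<^sub>R of_int p *\<^sub>R D h"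
      by (rule arg_cong)
    then show ?thesis using r by (simp add: of_rat_rat)
  qed
  have Dscale: "D (c *\<^sub>R h) = c *\<^sub>R D h" for c h
  proof -
    obtain r :: "nat \<Rightarrow> rat" where r: "(\<lambda>n. of_rat (r n)) \<longlonglongrightarrow> c"
    proof -
      have "\<exists>r. \<bar>real_of_rat r - c\<bar> < 1 / Suc n" for n
      proof -
        have "c - 1 / Suc n < c + 1 / Suc n" by (simp add: field_simps)
        from of_rat_dense[OF this] obtain q where "c - 1 / Suc n < real_of_rat q" "real_of_rat q < c + 1 / Suc n"
          by blast
        then have "\<bar>real_of_rat q - c\<bar> < 1 / Suc n" by linarith
        then show ?thesis ..
      qed
      then obtain r where r: "\<And>n. \<bar>real_of_rat (r n) - c\<bar> < 1 / Suc n" by metis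
      have "(\<lambda>n. real_of_rat (r n) - c) \<longlonglongrightarrow> 0"
      proof (rule Lim_null_comparison)
        show "\<forall>\<^sub>F n in sequentially. norm (real_of_rat (r n) - c) \<le> 1 / Suc n"
          using r by (intro always_eventually allI) (simp add: less_imp_le)
        show "(\<lambda>n. 1 / real (Suc n)) \<longlonglongrightarrow> 0" by (rule LIMSEQ_Suc[OF lim_1_over_n])
      qed
      then show ?thesis using that LIM_zero_iff[of "\<lambda>n. real_of_rat (r n)" c sequentially] by blast
    qed
    have "(\<lambda>n. D (of_rat (r n) *\<^sub>R h)) \<longlonglongrightarrow> D (c *\<^sub>R h)"
      by (rule isCont_tendsto_compose[OF Dcont]) (intro tendsto_intros r)
    moreover have "(\<lambda>n. of_rat (r n) *\<^sub>R D h) \<longlonglongrightarrow> c *\<^sub>R D h" by (intro tendsto_intros r)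
    ultimately show ?thesis by (simp add: Drat LIMSEQ_unique)
  qed
  have "bounded_linear D"
    by (rule bounded_linear_intro[where K = L]) (use Dadd Dscale Dn in \<open>auto simp: mult.commute\<close>)
  moreover have "norm (u h - u 0 - D h) \<le> A / (1 - 2 powr - \<gamma>) * norm h powr (1 + \<gamma>)" for h
    using summ(2)[of h] by (simp add: D_def q_def)
  ultimately show ?thesis using that Dn by blast
qed

section \<open>Calculus of Lipschitz and second difference bounds\<close>

definition lip :: "real \<Rightarrow> ('b::real_normed_vector \<Rightarrow> 'c::real_normed_vector) \<Rightarrow> bool" where
  "lip A f \<longleftrightarrow> (\<forall>x h. norm (f (x + h) - f x) \<le> A * norm h)"

text \<open>A Lipschitz bound on the gradient, phrased with increments so that it passes through
  integrals and compositions without any differentiation.\<close>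

definition second_diff :: "real \<Rightarrow> ('b::real_normed_vector \<Rightarrow> 'c::real_normed_vector) \<Rightarrow> bool" where
  "second_diff A f \<longleftrightarrow> (\<forall>x h k. norm (f (x + h + k) - f (x + h) - f (x + k) + f x) \<le> A * norm h * norm k)"

definition bounded_meas :: "real \<Rightarrow> ('b::topological_space \<Rightarrow> real) \<Rightarrow> bool" where
  "bounded_meas B f \<longleftrightarrow> f \<in> borel_measurable borel \<and> (\<forall>x. \<bar>f x\<bar> \<le> B)"

lemma lipD: "lip A f \<Longrightarrow> norm (f (x + h) - f x) \<le> A * norm h"
  by (simp add: lip_def)

lemma lipD': "lip A f \<Longrightarrow> norm (f y - f x) \<le> A * norm (y - x)"
  using lipD[of A f x "y - x"] by simp

lemma second_diffD:
  "second_diff A f \<Longrightarrow> norm (f (x + h + k) - f (x + h) - f (x + k) + f x) \<le> A * norm h * norm k"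
  by (simp add: second_diff_def)

lemma lip_mono: "lip A f \<Longrightarrow> A \<le> A' \<Longrightarrow> lip A' f"
  unfolding lip_def by (meson mult_right_mono norm_ge_zero order_trans)

lemma second_diff_mono: "second_diff A f \<Longrightarrow> A \<le> A' \<Longrightarrow> second_diff A' f"
  unfolding second_diff_def by (meson mult_right_mono norm_ge_zero order_trans)

lemma lip_continuous: "lip A f \<Longrightarrow> continuous_on UNIV f"
proof -
  assume l: "lip A f"
  have "\<bar>A\<bar>-lipschitz_on UNIV f"
  proof (rule lipschitz_onI)
    show "dist (f x) (f y) \<le> \<bar>A\<bar> * dist x y" for x y
      using lipD'[OF l, of x y] abs_ge_self[of A] unfolding dist_norm
      by (meson mult_right_mono norm_ge_zero order_trans)
  qed simp
  then show ?thesis by (rule lipschitz_on_continuous_on)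
qed

lemma lip_measurable: "lip A f \<Longrightarrow> f \<in> borel_measurable borel"
  by (intro borel_measurable_continuous_onI lip_continuous)

lemma lip_comp:
  assumes "lip A g" "lip E \<Phi>" "A \<ge> 0"
  shows "lip (A * E) (\<lambda>x. g (\<Phi> x))"
  unfolding lip_def
proof (intro allI)
  fix x h
  have "norm (g (\<Phi> (x + h)) - g (\<Phi> x)) \<le> A * norm (\<Phi> (x + h) - \<Phi> x)" by (rule lipD'[OF assms(1)])
  also have "\<dots> \<le> A * (E * norm h)" by (intro mult_left_mono lipD assms)
  finally show "norm (g (\<Phi> (x + h)) - g (\<Phi> x)) \<le> A * E * norm h" by simp
qed

lemma lip_add: "lip A f \<Longrightarrow> lip B g \<Longrightarrow> lip (A + B) (\<lambda>x. f x + g x)"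
  unfolding lip_def
proof (intro allI)
  fix x h
  assume "\<forall>x h. norm (f (x + h) - f x) \<le> A * norm h" "\<forall>x h. norm (g (x + h) - g x) \<le> B * norm h"
  then have "norm (f (x + h) - f x) \<le> A * norm h" "norm (g (x + h) - g x) \<le> B * norm h" by auto
  moreover have "f (x + h) + g (x + h) - (f x + g x) = (f (x + h) - f x) + (g (x + h) - g x)" by simp
  ultimately show "norm (f (x + h) + g (x + h) - (f x + g x)) \<le> (A + B) * norm h"
    using norm_triangle_ineq[of "f (x + h) - f x" "g (x + h) - g x"] by (simp only: distrib_right)
qed

lemma second_diff_add:
  "second_diff A f \<Longrightarrow> second_diff B g \<Longrightarrow> second_diff (A + B) (\<lambda>x. f x + g x)"
  unfolding second_diff_def
proof (intro allI)
  fix x h k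
  let ?f = "f (x + h + k) - f (x + h) - f (x + k) + f x"
  let ?g = "g (x + h + k) - g (x + h) - g (x + k) + g x"
  assume "\<forall>x h k. norm (f (x + h + k) - f (x + h) - f (x + k) + f x) \<le> A * norm h * norm k"
    "\<forall>x h k. norm (g (x + h + k) - g (x + h) - g (x + k) + g x) \<le> B * norm h * norm k"
  then have "norm ?f \<le> A * norm h * norm k" "norm ?g \<le> B * norm h * norm k" by auto
  moreover have "f (x + h + k) + g (x + h + k) - (f (x + h) + g (x + h)) - (f (x + k) + g (x + k)) + (f x + g x)
    = ?f + ?g" by simp
  ultimately show "norm (f (x + h + k) + g (x + h + k) - (f (x + h) + g (x + h)) - (f (x + k) + g (x + k)) + (f x + g x))
      \<le> (A + B) * norm h * norm k"
    using norm_triangle_ineq[of ?f ?g] by (simp only: distrib_right)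
qed

lemma lip_scaleR: "lip A f \<Longrightarrow> c \<ge> 0 \<Longrightarrow> lip (c * A) (\<lambda>x. c *\<^sub>R f x)"
  unfolding lip_def scaleR_diff_right[symmetric] by (auto simp: mult.assoc intro: mult_left_mono)

lemma second_diff_scaleR: "second_diff A f \<Longrightarrow> c \<ge> 0 \<Longrightarrow> second_diff (c * A) (\<lambda>x. c *\<^sub>R f x)"
  unfolding second_diff_def scaleR_diff_right[symmetric] scaleR_add_right[symmetric]
  by (auto simp: mult.assoc intro: mult_left_mono)

lemma lip_id: "lip 1 (\<lambda>x. x)" by (simp add: lip_def)

lemma second_diff_id: "second_diff 0 (\<lambda>x. x)" by (simp add: second_diff_def)

text \<open>A chain rule for increments. The four values of \<open>\<Phi>\<close> are y, y + p, y +
  q and y + p + q + r: the parallelogram spanned by p and q is charged to the second difference of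
  \<open>g\<close>, and the defect r, which is of second order, to its Lipschitz constant.\<close>

lemma second_diff_comp:
  assumes g: "lip A1 g" "second_diff A2 g" and \<Phi>: "lip E \<Phi>" "second_diff A \<Phi>"
    and "A1 \<ge> 0" "A2 \<ge> 0" "E \<ge> 0"
  shows "second_diff (A2 * E\<^sup>2 + A1 * A) (\<lambda>x. g (\<Phi> x))"
  unfolding second_diff_def
proof (intro allI)
  fix x h k
  define p q where "p = \<Phi> (x + h) - \<Phi> x" and "q = \<Phi> (x + k) - \<Phi> x"
  define y where "y = \<Phi> x"
  define r where "r = \<Phi> (x + h + k) - \<Phi> (x + h) - \<Phi> (x + k) + \<Phi> x"
  have e: "\<Phi> (x + h) = y + p" "\<Phi> (x + k) = y + q" "\<Phi> x = y" "\<Phi> (x + h + k) = (y + p + q) + r"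
    by (simp_all add: p_def q_def r_def y_def)
  have np: "norm p \<le> E * norm h" "norm q \<le> E * norm k"
    using lipD[OF \<Phi>(1)] by (auto simp: p_def q_def)
  have nr: "norm r \<le> A * norm h * norm k" unfolding r_def by (rule second_diffD[OF \<Phi>(2)])
  have 1: "norm (g (y + p + q + r) - g (y + p + q)) \<le> A1 * norm r" by (rule lipD[OF g(1)])
  have 2: "norm (g (y + p + q) - g (y + p) - g (y + q) + g y) \<le> A2 * norm p * norm q"
    by (rule second_diffD[OF g(2)])
  have "A1 * norm r \<le> A1 * (A * norm h * norm k)" using nr assms by (intro mult_left_mono) auto
  moreover have "A2 * norm p * norm q \<le> A2 * (E * norm h) * (E * norm k)"
    using np assms by (intro mult_mono mult_nonneg_nonneg) auto
  moreover have eq: "g (\<Phi> (x + h + k)) - g (\<Phi> (x + h)) - g (\<Phi> (x + k)) + g (\<Phi> x)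
     = (g (y + p + q + r) - g (y + p + q)) + (g (y + p + q) - g (y + p) - g (y + q) + g y)"
    by (simp add: e)
  ultimately have "norm (g (\<Phi> (x + h + k)) - g (\<Phi> (x + h)) - g (\<Phi> (x + k)) + g (\<Phi> x))
     \<le> A1 * (A * norm h * norm k) + A2 * (E * norm h) * (E * norm k)"
    unfolding eq using 1 2 norm_triangle_ineq[of "g (y + p + q + r) - g (y + p + q)" "g (y + p + q) - g (y + p) - g (y + q) + g y"]
    by linarith
  then show "norm (g (\<Phi> (x + h + k)) - g (\<Phi> (x + h)) - g (\<Phi> (x + k)) + g (\<Phi> x)) \<le> (A2 * E\<^sup>2 + A1 * A) * norm h * norm k"
    by (simp add: power2_eq_square algebra_simps)
qed

text \<open>The case \<gamma> = 1 of \<open>approx_linear\<close>; its factor 1 / (1 - 1/2) is the 2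
  in the conclusion.\<close>

lemma second_diff_linear:
  fixes u :: "'b::real_normed_vector \<Rightarrow> 'c::banach"
  assumes "lip L u" "second_diff A u" "A \<ge> 0"
  obtains D where "bounded_linear D" "\<And>h. norm (D h) \<le> L * norm h"
    "\<And>h. norm (u (x + h) - u x - D h) \<le> 2 * A * (norm h)\<^sup>2"
proof -
  obtain D where D: "bounded_linear D" "\<And>h. norm (D h) \<le> L * norm h"
    "\<And>h. norm (u (x + h) - u (x + 0) - D h) \<le> A / (1 - 2 powr - 1) * norm h powr (1 + 1)"
  proof (rule approx_linear[of 1 A "\<lambda>h. u (x + h)" L])
    fix h k
    have "norm (u (x + (h + k)) - u (x + h) - u (x + k) + u (x + 0)) \<le> A * norm h * norm k"
      using second_diffD[OF assms(2), of x h k] by (simp add: add.assoc)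
    also have "\<dots> \<le> A * (norm h + norm k)\<^sup>2"
      using assms(3) by (simp add: power2_eq_square algebra_simps)
    also have "(norm h + norm k)\<^sup>2 = (norm h + norm k) powr (1 + 1)"
      by (simp add: powr_numeral)
    finally show "norm (u (x + (h + k)) - u (x + h) - u (x + k) + u (x + 0)) \<le> A * (norm h + norm k) powr (1 + 1)" .
  qed (use assms in \<open>auto intro: lipD\<close>)
  show ?thesis
  proof (rule that[OF D(1,2)])
    show "norm (u (x + h) - u x - D h) \<le> 2 * A * (norm h)\<^sup>2" for h
      using D(3)[of h] by (simp add: powr_numeral powr_minus)
  qed
qed

section \<open>The commutator of a flow with a convolution\<close>

lemma (in prob_space) abs_integral_le:
  fixes X :: "'a \<Rightarrow> real"
  assumes "X \<in> borel_measurable M" "\<And>\<omega>. \<bar>X \<omega>\<bar> \<le> c"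
  shows "\<bar>expectation X\<bar> \<le> c"
proof -
  have i: "integrable M X" by (rule integrable_const_bound[where B = c]) (use assms in auto)
  then have "expectation X \<le> c" "- c \<le> expectation X"
    using assms(2) by (auto intro!: integral_le_const integral_ge_const AE_I2 simp: abs_le_iff minus_le_iff)
  then show ?thesis by simp
qed

text \<open>This allows \<open>commutator_bound\<close> to replace a coordinate, which may have no
  mean, by a bounded sine at the cost of a quadratic error.\<close>

lemma abs_sin_diff_le: "\<bar>y - sin y\<bar> \<le> y\<^sup>2" for y :: real
proof -
  have "\<bar>sin y - (\<Sum>m<2. sin_coeff m * y ^ m)\<bar> \<le> inverse (fact 2) * \<bar>y\<bar> ^ 2"
    by (rule Maclaurin_sin_bound)
  moreover have "(\<Sum>m<2. sin_coeff m * y ^ m) = y"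
    by (simp add: numeral_2_eq_2 sin_coeff_def)
  ultimately have "\<bar>sin y - y\<bar> \<le> y\<^sup>2 / 2" by (simp add: power2_eq_square)
  then show ?thesis by (smt (verit) zero_le_power2 field_sum_of_halves)
qed

text \<open>Compares moving by \<open>\<Phi>\<close> after a jump z with moving before it. In the
  application \<open>g\<close> is a convolution over time \<sigma>, which varies on the scale
  1/\<kappa> with \<kappa> = \<sigma> powr (-1/\<alpha>), and \<open>\<Phi>\<close> is the flow over
  time \<sigma>. Jumps for which some coordinate has reached its truncation level are estimated
  trivially through the bound of \<open>g\<close>. For the others the difference is linearised in z,
  and the factor \<sigma> of the displacement survives in every quadratic error.\<close>

lemma commutator_bound:
  fixes M :: "'b::euclidean_space measure" and g :: "'b \<Rightarrow> real" and \<Phi> :: "'b \<Rightarrow> 'b"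
    and K m \<sigma> \<kappa> \<epsilon> :: real
  assumes M: "prob_space M" "sets M = sets borel"
    and g: "bounded_meas K g" "lip (K * \<kappa>) g" "second_diff (K * \<kappa>\<^sup>2) g"
    and \<Phi>: "\<Phi> \<in> borel_measurable borel" "lip (m * \<sigma>) (\<lambda>x. \<Phi> x - x)" "second_diff (m * \<sigma>) (\<lambda>x. \<Phi> x - x)"
    and pos: "m \<ge> 0" "0 < \<sigma>" "\<sigma> \<le> 1" "\<kappa> \<ge> 1"
    and sin: "\<And>i. i \<in> Basis \<Longrightarrow> \<sigma> * \<bar>\<integral>z. sin (\<kappa> * (z \<bullet> i)) \<partial>M\<bar> \<le> \<epsilon>"
    and trunc: "\<And>i. i \<in> Basis \<Longrightarrow> (\<integral>z. min 1 (\<sigma> * \<kappa>\<^sup>2 * (z \<bullet> i)\<^sup>2) \<partial>M) \<le> \<epsilon>"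
  shows "\<bar>\<integral>z. g (\<Phi> (x + z)) - g (\<Phi> x + z) \<partial>M\<bar>
    \<le> K * (2 + (5 + 2 * DIM('b)) * m + 2 * m\<^sup>2) * DIM('b) * \<epsilon>"
proof -
  interpret prob_space M by (rule M)
  note [measurable_cong] = M(2)
  have gm [measurable]: "g \<in> borel_measurable borel" and gK: "\<And>x. \<bar>g x\<bar> \<le> K"
    using g(1) by (auto simp: bounded_meas_def)
  note \<Phi>(1) [measurable]
  have K: "K \<ge> 0" using gK[of 0] by linarith
  define d where "d = real DIM('b)"
  define y where "y = \<Phi> x"
  define w where "w z = \<Phi> (x + z) - (x + z) - (\<Phi> x - x)" for z
  obtain J where J: "bounded_linear J" "\<And>h. norm (J h) \<le> m * \<sigma> * norm h"
    "\<And>h. norm (w h - J h) \<le> 2 * (m * \<sigma>) * (norm h)\<^sup>2"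
    unfolding w_def
    by (rule second_diff_linear[OF \<Phi>(2,3), of x]) (use pos in auto)
  obtain G where G: "bounded_linear G" "\<And>h. norm (G h) \<le> K * \<kappa> * norm h"
    "\<And>h. norm (g (y + h) - g y - G h) \<le> 2 * (K * \<kappa>\<^sup>2) * (norm h)\<^sup>2"
    by (rule second_diff_linear[OF g(2,3), of y]) (use pos K in auto)
  interpret J: bounded_linear J by (rule J)
  interpret G: bounded_linear G by (rule G)
  \<comment> \<open>Coefficients of the linear part of the difference: the derivative of
    \<open>g\<close> at \<open>y\<close> applied to the derivative of the displacement.\<close>
  define l where "l i = G (J i)" for i
  have l: "\<bar>l i\<bar> \<le> K * \<kappa> * (m * \<sigma>)" if "i \<in> Basis" for i
  proof -
    have "\<bar>l i\<bar> \<le> K * \<kappa> * norm (J i)" using G(2)[of "J i"] by (simp add: l_def)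
    also have "\<dots> \<le> K * \<kappa> * (m * \<sigma> * norm i)" using K pos by (intro mult_left_mono J) auto
    finally show ?thesis using that by simp
  qed
  define F where "F z = g (\<Phi> (x + z)) - g (\<Phi> x + z)" for z
  \<comment> \<open>\<open>H\<close> is the linearisation of \<open>F\<close> with \<open>sin (\<kappa> x) / \<kappa>\<close> in place of \<open>x\<close>: it is bounded, and its mean is
    controlled by the characteristic function although \<open>z\<close> need not have a mean.\<close>
  define H where "H z = (\<Sum>i\<in>Basis. l i * (sin (\<kappa> * (z \<bullet> i)) / \<kappa>))" for z
  \<comment> \<open>Dominates both estimates of \<open>F z - H z\<close>: 4 m + 2 m^2 collects the
    four quadratic errors, and 2 + d m is the trivial bound.\<close>
  define R where "R = 2 + (4 + d) * m + 2 * m\<^sup>2"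
  have nrm2: "(\<Sum>i\<in>Basis. (z \<bullet> i)\<^sup>2) = (norm z)\<^sup>2" for z :: 'b
    unfolding power2_norm_eq_inner unfolding euclidean_inner[of z z] power2_eq_square ..
  have nw: "norm (w z) \<le> m * \<sigma> * norm z" for z
    using lipD[OF \<Phi>(2), of x z] by (simp add: w_def)
  have quad: "\<bar>F z - H z\<bar> \<le> K * R * (\<sigma> * \<kappa>\<^sup>2 * (norm z)\<^sup>2)" for z
  proof -
    let ?q = "K * (\<sigma> * \<kappa>\<^sup>2 * (norm z)\<^sup>2)"
    have \<sigma>2: "\<sigma>\<^sup>2 \<le> \<sigma>" using pos by (simp add: power2_eq_square mult_left_le)
    have \<kappa>2: "\<kappa> \<le> \<kappa>\<^sup>2" using pos by (simp add: power2_eq_square)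
    have e: "\<Phi> (x + z) = y + z + w z" by (simp add: w_def y_def)
    have "norm (g (y + z + w z) - g (y + z) - g (y + w z) + g y) \<le> K * \<kappa>\<^sup>2 * norm z * norm (w z)"
      by (rule second_diffD[OF g(3)])
    also have "\<dots> \<le> K * \<kappa>\<^sup>2 * norm z * (m * \<sigma> * norm z)" using K by (intro mult_left_mono nw) auto
    also have "\<dots> = m * ?q" by (simp add: power2_eq_square)
    finally have 1: "\<bar>g (y + z + w z) - g (y + z) - g (y + w z) + g y\<bar> \<le> m * ?q" by simp
    have "norm (g (y + w z) - g y - G (w z)) \<le> 2 * (K * \<kappa>\<^sup>2) * (norm (w z))\<^sup>2" by (rule G)
    also have "\<dots> \<le> 2 * (K * \<kappa>\<^sup>2) * (m * \<sigma> * norm z)\<^sup>2" using K by (intro mult_left_mono power_mono nw) auto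
    also have "\<dots> = \<sigma>\<^sup>2 * (2 * (K * \<kappa>\<^sup>2) * (m\<^sup>2 * (norm z)\<^sup>2))" by (simp add: power_mult_distrib)
    also have "\<dots> \<le> \<sigma> * (2 * (K * \<kappa>\<^sup>2) * (m\<^sup>2 * (norm z)\<^sup>2))" using \<sigma>2 K by (intro mult_right_mono) auto
    also have "\<dots> = 2 * m\<^sup>2 * ?q" by simp
    finally have 2: "\<bar>g (y + w z) - g y - G (w z)\<bar> \<le> 2 * m\<^sup>2 * ?q" by simp
    have "norm (G (w z - J z)) \<le> K * \<kappa> * norm (w z - J z)" by (rule G)
    also have "\<dots> \<le> K * \<kappa> * (2 * (m * \<sigma>) * (norm z)\<^sup>2)" using K pos by (intro mult_left_mono J) auto
    also have "\<dots> = \<kappa> * (K * (2 * (m * \<sigma>) * (norm z)\<^sup>2))" by simp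
    also have "\<dots> \<le> \<kappa>\<^sup>2 * (K * (2 * (m * \<sigma>) * (norm z)\<^sup>2))" using \<kappa>2 K pos by (intro mult_right_mono) auto
    also have "\<dots> = 2 * m * ?q" by simp
    finally have 3: "\<bar>G (w z) - G (J z)\<bar> \<le> 2 * m * ?q" by (simp add: G.diff)
    have GJ: "G (J z) = (\<Sum>i\<in>Basis. l i * (z \<bullet> i))"
    proof -
      have "G (J z) = G (J (\<Sum>i\<in>Basis. (z \<bullet> i) *\<^sub>R i))" by (simp add: euclidean_representation)
      also have "\<dots> = (\<Sum>i\<in>Basis. l i * (z \<bullet> i))"
        by (simp add: J.sum G.sum J.scaleR G.scaleR l_def mult.commute)
      finally show ?thesis .
    qed
    have "\<bar>G (J z) - H z\<bar> \<le> (\<Sum>i\<in>Basis. \<bar>l i * (z \<bullet> i - sin (\<kappa> * (z \<bullet> i)) / \<kappa>)\<bar>)"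
      unfolding GJ H_def sum_subtractf[symmetric] right_diff_distrib[symmetric] by (rule sum_abs)
    also have "\<dots> \<le> (\<Sum>i\<in>Basis. m * (K * (\<sigma> * \<kappa>\<^sup>2 * (z \<bullet> i)\<^sup>2)))"
    proof (rule sum_mono)
      fix i :: 'b assume i: "i \<in> Basis"
      have "z \<bullet> i - sin (\<kappa> * (z \<bullet> i)) / \<kappa> = (\<kappa> * (z \<bullet> i) - sin (\<kappa> * (z \<bullet> i))) / \<kappa>"
        using pos by (simp add: field_simps)
      then have "\<bar>z \<bullet> i - sin (\<kappa> * (z \<bullet> i)) / \<kappa>\<bar> \<le> (\<kappa> * (z \<bullet> i))\<^sup>2 / \<kappa>"
        using abs_sin_diff_le[of "\<kappa> * (z \<bullet> i)"] pos by (simp add: abs_div divide_right_mono)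
      also have "\<dots> = \<kappa> * (z \<bullet> i)\<^sup>2" using pos by (simp add: power2_eq_square)
      finally have "\<bar>l i * (z \<bullet> i - sin (\<kappa> * (z \<bullet> i)) / \<kappa>)\<bar> \<le> (K * \<kappa> * (m * \<sigma>)) * (\<kappa> * (z \<bullet> i)\<^sup>2)"
        unfolding abs_mult using K pos by (intro mult_mono l i) auto
      then show "\<bar>l i * (z \<bullet> i - sin (\<kappa> * (z \<bullet> i)) / \<kappa>)\<bar> \<le> m * (K * (\<sigma> * \<kappa>\<^sup>2 * (z \<bullet> i)\<^sup>2))"
        by (simp add: power2_eq_square mult_ac)
    qed
    also have "\<dots> = m * ?q" by (simp add: sum_distrib_left[symmetric] nrm2)
    finally have 4: "\<bar>G (J z) - H z\<bar> \<le> m * ?q" .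
    \<comment> \<open>The four errors are the mixed second difference of \<open>g\<close>, the
      linearisation of \<open>g\<close> at \<open>y\<close>, the linearisation of the displacement,
      and the replacement of coordinates by sines.\<close>
    have "F z - H z = (g (y + z + w z) - g (y + z) - g (y + w z) + g y) + (g (y + w z) - g y - G (w z))
      + (G (w z) - G (J z)) + (G (J z) - H z)" by (simp add: F_def e y_def)
    then have "\<bar>F z - H z\<bar> \<le> m * ?q + 2 * m\<^sup>2 * ?q + 2 * m * ?q + m * ?q"
      using 1 2 3 4 by linarith
    also have "\<dots> = (4 * m + 2 * m\<^sup>2) * ?q" by (simp add: algebra_simps)
    also have "\<dots> \<le> R * ?q" using K pos unfolding R_def d_def
      by (intro mult_right_mono mult_nonneg_nonneg) (auto simp: algebra_simps)
    finally show ?thesis by (simp add: mult_ac)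
  qed
  have triv: "\<bar>F z - H z\<bar> \<le> K * R" for z
  proof -
    have "\<bar>H z\<bar> \<le> (\<Sum>i\<in>Basis. \<bar>l i * (sin (\<kappa> * (z \<bullet> i)) / \<kappa>)\<bar>)" unfolding H_def by (rule sum_abs)
    also have "\<dots> \<le> (\<Sum>i\<in>(Basis::'b set). K * m)"
    proof (rule sum_mono)
      fix i :: 'b assume i: "i \<in> Basis"
      have "\<bar>l i * (sin (\<kappa> * (z \<bullet> i)) / \<kappa>)\<bar> = \<bar>l i\<bar> * (\<bar>sin (\<kappa> * (z \<bullet> i))\<bar> / \<kappa>)"
        using pos by (simp add: abs_mult)
      also have "\<dots> \<le> (K * \<kappa> * (m * \<sigma>)) * (1 / \<kappa>)"
        using K pos by (intro mult_mono l i divide_right_mono abs_sin_le_one) auto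
      also have "\<dots> = K * m * \<sigma>" using pos by simp
      also have "\<dots> \<le> K * m" using K pos by (simp add: mult_left_le)
      finally show "\<bar>l i * (sin (\<kappa> * (z \<bullet> i)) / \<kappa>)\<bar> \<le> K * m" .
    qed
    also have "\<dots> = K * (d * m)" by (simp add: d_def)
    finally have "\<bar>H z\<bar> \<le> K * (d * m)" .
    moreover have "\<bar>F z\<bar> \<le> 2 * K" unfolding F_def using gK[of "\<Phi> (x + z)"] gK[of "\<Phi> x + z"] by linarith
    ultimately have "\<bar>F z - H z\<bar> \<le> K * (2 + d * m)" by (simp add: algebra_simps)
    also have "\<dots> \<le> K * R" using K pos by (intro mult_left_mono) (auto simp: R_def d_def algebra_simps)
    finally show ?thesis .
  qed
  define T where "T i z = min 1 (\<sigma> * \<kappa>\<^sup>2 * (z \<bullet> i)\<^sup>2)" for i z :: 'b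
  have T0: "T i z \<ge> 0" "\<bar>T i z\<bar> \<le> 1" for i z using pos by (auto simp: T_def)
  have R0: "R \<ge> 0" using pos by (auto simp: R_def d_def)
  \<comment> \<open>Either some truncation \<open>T i\<close> equals 1, and the trivial bound
    suffices, or none is active, and their sum is the full quadratic term.\<close>
  have pw: "\<bar>F z - H z\<bar> \<le> K * R * (\<Sum>i\<in>Basis. T i z)" for z
  proof (cases "\<exists>i\<in>Basis. \<sigma> * \<kappa>\<^sup>2 * (z \<bullet> i)\<^sup>2 \<ge> 1")
    case True
    then obtain i where i: "i \<in> Basis" "\<sigma> * \<kappa>\<^sup>2 * (z \<bullet> i)\<^sup>2 \<ge> 1" by blast
    have "1 = T i z" using i by (simp add: T_def)
    also have "\<dots> \<le> (\<Sum>i\<in>Basis. T i z)" using i T0 by (intro member_le_sum) auto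
    finally have "K * R * 1 \<le> K * R * (\<Sum>i\<in>Basis. T i z)" using K R0 by (intro mult_left_mono) auto
    then show ?thesis using triv[of z] by simp
  next
    case False
    then have "T i z = \<sigma> * \<kappa>\<^sup>2 * (z \<bullet> i)\<^sup>2" if "i \<in> Basis" for i using that by (force simp: T_def)
    then have "(\<Sum>i\<in>Basis. T i z) = \<sigma> * \<kappa>\<^sup>2 * (norm z)\<^sup>2" by (simp add: sum_distrib_left[symmetric] nrm2)
    then show ?thesis using quad[of z] by simp
  qed
  have [measurable]: "F \<in> borel_measurable M" "H \<in> borel_measurable M" "T i \<in> borel_measurable M" for i
    unfolding F_def H_def T_def by measurable
  have iT: "integrable M (T i)" for i
    by (rule integrable_const_bound[where B = 1]) (use T0 in auto)
  have isin: "integrable M (\<lambda>z. sin (\<kappa> * (z \<bullet> i)))" for i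
    by (rule integrable_const_bound[where B = 1]) auto
  then have iH: "integrable M H" unfolding H_def by (intro Bochner_Integration.integrable_sum integrable_mult_right integrable_divide)
  have iF: "integrable M F"
    by (rule integrable_const_bound[where B = "2 * K"])
       (use gK in \<open>auto simp: F_def intro!: order_trans[OF abs_triangle_ineq4] AE_I2 add_mono[of _ K _ K, simplified]\<close>)
  have iHe: "expectation H = (\<Sum>i\<in>Basis. l i * (expectation (\<lambda>z. sin (\<kappa> * (z \<bullet> i))) / \<kappa>))"
    unfolding H_def using isin by (subst Bochner_Integration.integral_sum) auto
  have "\<bar>expectation H\<bar> \<le> (\<Sum>i\<in>Basis. \<bar>l i * (expectation (\<lambda>z. sin (\<kappa> * (z \<bullet> i))) / \<kappa>)\<bar>)"
    unfolding iHe by (rule sum_abs)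
  also have "\<dots> \<le> (\<Sum>i\<in>(Basis::'b set). K * m * \<epsilon>)"
  proof (rule sum_mono)
    fix i :: 'b assume i: "i \<in> Basis"
    have "\<bar>l i * (expectation (\<lambda>z. sin (\<kappa> * (z \<bullet> i))) / \<kappa>)\<bar> = \<bar>l i\<bar> * (\<bar>expectation (\<lambda>z. sin (\<kappa> * (z \<bullet> i)))\<bar> / \<kappa>)"
      using pos by (simp add: abs_mult)
    also have "\<dots> \<le> (K * \<kappa> * (m * \<sigma>)) * (\<bar>expectation (\<lambda>z. sin (\<kappa> * (z \<bullet> i)))\<bar> / \<kappa>)"
      using pos by (intro mult_right_mono l i) auto
    also have "\<dots> = K * m * (\<sigma> * \<bar>expectation (\<lambda>z. sin (\<kappa> * (z \<bullet> i)))\<bar>)" using pos by simp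
    also have "\<dots> \<le> K * m * \<epsilon>" using K pos by (intro mult_left_mono sin i) auto
    finally show "\<bar>l i * (expectation (\<lambda>z. sin (\<kappa> * (z \<bullet> i))) / \<kappa>)\<bar> \<le> K * m * \<epsilon>" .
  qed
  also have "\<dots> = K * m * d * \<epsilon>" by (simp add: d_def)
  finally have a: "\<bar>expectation H\<bar> \<le> K * m * d * \<epsilon>" .
  have "\<bar>expectation (\<lambda>z. F z - H z)\<bar> \<le> expectation (\<lambda>z. \<bar>F z - H z\<bar>)" by (rule integral_abs_bound)
  also have "\<dots> \<le> expectation (\<lambda>z. K * R * (\<Sum>i\<in>Basis. T i z))"
    using iF iH iT by (intro integral_mono integrable_abs Bochner_Integration.integrable_diff integrable_mult_right Bochner_Integration.integrable_sum pw) auto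
  also have "\<dots> = K * R * (\<Sum>i\<in>Basis. expectation (T i))"
    using iT by (simp add: Bochner_Integration.integral_sum)
  also have "\<dots> \<le> K * R * (\<Sum>i\<in>(Basis::'b set). \<epsilon>)"
    using K R0 trunc unfolding T_def by (intro mult_left_mono sum_mono mult_nonneg_nonneg) auto
  also have "\<dots> = K * R * d * \<epsilon>" by (simp add: d_def)
  finally have b: "\<bar>expectation F - expectation H\<bar> \<le> K * R * d * \<epsilon>" using iF iH by simp
  have "\<bar>expectation F\<bar> \<le> K * m * d * \<epsilon> + K * R * d * \<epsilon>" using a b by linarith
  also have "\<dots> = K * (m + R) * d * \<epsilon>" by (simp add: algebra_simps)
  also have "\<dots> \<le> K * (2 + (5 + 2 * d) * m + 2 * m\<^sup>2) * d * \<epsilon>"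
  proof -
    have "0 \<le> \<epsilon>" using pos by (intro order_trans[OF _ sin[OF SOME_Basis]]) auto
    then show ?thesis using K pos
      by (intro mult_right_mono mult_left_mono) (auto simp: R_def d_def algebra_simps)
  qed
  finally show ?thesis unfolding F_def[abs_def] d_def by simp
qed

section \<open>The Euler operator\<close>

text \<open>The average over an independent displacement of law \<open>M\<close>. With this sign it
  is the transition operator of adding the noise, that is, convolution with the reflected
  measure.\<close>

definition conv_op :: "'b::euclidean_space measure \<Rightarrow> ('b \<Rightarrow> real) \<Rightarrow> 'b \<Rightarrow> real" where
  "conv_op M f x = (\<integral>z. f (x + z) \<partial>M)"

lemma bounded_meas_nonneg: "bounded_meas B f \<Longrightarrow> B \<ge> 0"
  unfolding bounded_meas_def by (meson abs_ge_zero order_trans)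

lemma bounded_meas_mono: "bounded_meas B f \<Longrightarrow> B \<le> B' \<Longrightarrow> bounded_meas B' f"
  unfolding bounded_meas_def by (meson order_trans)

lemma bounded_meas_add: "bounded_meas A f \<Longrightarrow> bounded_meas B g \<Longrightarrow> bounded_meas (A + B) (\<lambda>x. f x + g x)"
  unfolding bounded_meas_def by (auto intro: order_trans[OF abs_triangle_ineq add_mono])

lemma bounded_meas_diff: "bounded_meas A f \<Longrightarrow> bounded_meas B g \<Longrightarrow> bounded_meas (A + B) (\<lambda>x. f x - g x)"
  unfolding bounded_meas_def by (auto intro: order_trans[OF abs_triangle_ineq4 add_mono])

lemma bounded_meas_comp: "bounded_meas B f \<Longrightarrow> \<Phi> \<in> borel_measurable borel \<Longrightarrow> bounded_meas B (\<lambda>x. f (\<Phi> x))"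
  unfolding bounded_meas_def by (auto intro: measurable_compose[of \<Phi> borel borel f])

context
  fixes M :: "'b::euclidean_space measure"
  assumes M: "prob_space M" and sM [measurable_cong]: "sets M = sets borel"
begin

interpretation prob_space M by (rule M)

lemma integrable_conv: "bounded_meas B f \<Longrightarrow> integrable M (\<lambda>z. f (x + z))"
  unfolding bounded_meas_def
  by (intro integrable_const_bound[where B = B]) auto

lemma bounded_meas_conv_op:
  assumes "bounded_meas B f"
  shows "bounded_meas B (conv_op M f)"
proof -
  have [measurable]: "f \<in> borel_measurable borel" and b: "\<And>x. \<bar>f x\<bar> \<le> B"
    using assms by (auto simp: bounded_meas_def)
  have "conv_op M f \<in> borel_measurable borel" unfolding conv_op_def by measurable
  moreover have "\<bar>conv_op M f x\<bar> \<le> B" for x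
    unfolding conv_op_def by (rule abs_integral_le) (use b in auto)
  ultimately show ?thesis by (simp add: bounded_meas_def)
qed

lemma conv_op_add:
  "bounded_meas A f \<Longrightarrow> bounded_meas B g \<Longrightarrow> conv_op M (\<lambda>x. f x + g x) = (\<lambda>x. conv_op M f x + conv_op M g x)"
  unfolding conv_op_def by (intro ext Bochner_Integration.integral_add integrable_conv)

lemma lip_conv_op:
  assumes f: "bounded_meas B f" "lip A f"
  shows "lip A (conv_op M f)"
  unfolding lip_def
proof (intro allI)
  fix x h
  have [measurable]: "f \<in> borel_measurable borel" using f by (auto simp: bounded_meas_def)
  have "conv_op M f (x + h) - conv_op M f x = (\<integral>z. f (x + z + h) - f (x + z) \<partial>M)"
    unfolding conv_op_def using integrable_conv[OF f(1), of "x + h"] integrable_conv[OF f(1), of x]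
    by (simp add: add_ac)
  also have "\<bar>\<dots>\<bar> \<le> A * norm h"
    by (rule abs_integral_le) (use lipD[OF f(2)] in auto)
  finally show "norm (conv_op M f (x + h) - conv_op M f x) \<le> A * norm h" by simp
qed

lemma second_diff_conv_op:
  assumes f: "bounded_meas B f" "second_diff A f"
  shows "second_diff A (conv_op M f)"
  unfolding second_diff_def
proof (intro allI)
  fix x h k
  have [measurable]: "f \<in> borel_measurable borel" using f by (auto simp: bounded_meas_def)
  note i = integrable_conv[OF f(1)]
  have "conv_op M f (x + h + k) - conv_op M f (x + h) - conv_op M f (x + k) + conv_op M f x
    = (\<integral>z. f (x + h + k + z) - f (x + h + z) - f (x + k + z) + f (x + z) \<partial>M)"
    unfolding conv_op_def
    using i[of "x + h + k"] i[of "x + h"] i[of "x + k"] i[of x] by simp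
  also have "\<dots> = (\<integral>z. f ((x + z) + h + k) - f ((x + z) + h) - f ((x + z) + k) + f (x + z) \<partial>M)"
    by (simp add: add_ac)
  also have "\<bar>\<dots>\<bar> \<le> A * norm h * norm k"
    by (rule abs_integral_le) (use second_diffD[OF f(2)] in auto)
  finally show "norm (conv_op M f (x + h + k) - conv_op M f (x + h) - conv_op M f (x + k) + conv_op M f x)
    \<le> A * norm h * norm k" by simp
qed

end

text \<open>Comparison with the integral of s powr (\<beta> - 1), which converges at 0 because
  \<beta> > 0. On one cell it is the tangent inequality for the concave function s powr \<beta>,
  obtained from Young's inequality; this form includes the cell that starts at 0.\<close>

lemma sum_powr_le:
  assumes \<beta>: "0 < \<beta>" "\<beta> < 1" and \<tau>: "\<tau> > 0"
  shows "(\<Sum>j = 1..<m. \<tau> * (real j * \<tau>) powr (\<beta> - 1)) \<le> (real m * \<tau>) powr \<beta> / \<beta>"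
proof -
  have step: "\<tau> * (real m * \<tau>) powr (\<beta> - 1) \<le> ((real m * \<tau>) powr \<beta> - (real (m - 1) * \<tau>) powr \<beta>) / \<beta>" if "m \<ge> 1" for m
  proof -
    define a c where "a = real (m - 1) * \<tau>" and "c = real m * \<tau>"
    have c: "c > 0" "a \<ge> 0" and ac: "c - a = \<tau>" using that \<tau> by (auto simp: a_def c_def of_nat_diff algebra_simps)
    have "a powr \<beta> * c powr (1 - \<beta>) \<le> \<beta> * a + (1 - \<beta>) * c"
      using \<beta> c by (cases "a = 0") (auto intro!: Youngs_inequality_0)
    then have "a powr \<beta> * c powr (1 - \<beta>) * c powr (\<beta> - 1) \<le> (\<beta> * a + (1 - \<beta>) * c) * c powr (\<beta> - 1)"
      by (intro mult_right_mono) auto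
    moreover have "\<beta> * a + (1 - \<beta>) * c = c - \<beta> * \<tau>" using ac by (simp add: algebra_simps)
    ultimately have "a powr \<beta> * (c powr (1 - \<beta>) * c powr (\<beta> - 1)) \<le> (c - \<beta> * \<tau>) * c powr (\<beta> - 1)"
      by (simp only: mult.assoc)
    moreover have "c powr (1 - \<beta>) * c powr (\<beta> - 1) = 1" using c by (simp add: powr_add[symmetric])
    moreover have "c * c powr (\<beta> - 1) = c powr \<beta>"
      using c powr_add[of c 1 "\<beta> - 1"] by simp
    ultimately have "a powr \<beta> \<le> c powr \<beta> - \<beta> * \<tau> * c powr (\<beta> - 1)"
      by (simp add: left_diff_distrib)
    then show ?thesis using \<beta> unfolding a_def[symmetric] c_def[symmetric] by (simp add: field_simps)
  qed
  show ?thesis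
  proof (cases m)
    case (Suc n)
    have "(\<Sum>j = 1..<m. \<tau> * (real j * \<tau>) powr (\<beta> - 1)) \<le> (real n * \<tau>) powr \<beta> / \<beta>"
      unfolding Suc
    proof (induction n)
      case (Suc n)
      have "{1..<Suc (Suc n)} = insert (Suc n) {1..<Suc n}" by auto
      then show ?case using Suc step[of "Suc n"] by (simp add: diff_divide_distrib)
    qed simp
    also have "\<dots> \<le> (real m * \<tau>) powr \<beta> / \<beta>"
      using \<beta> \<tau> Suc by (intro divide_right_mono powr_mono2) auto
    finally show ?thesis .
  qed simp
qed

lemma one_plus_power_le_exp:
  fixes x y :: real
  assumes "0 \<le> x" "0 \<le> y" "real k * x \<le> 1"
  shows "(1 + x * y) ^ k \<le> exp y"
proof -
  have "(1 + x * y) ^ k \<le> exp (x * y) ^ k"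
    using assms by (intro power_mono exp_ge_add_one_self) auto
  also have "\<dots> = exp (real k * x * y)" by (simp add: exp_of_nat_mult[symmetric] mult.assoc)
  also have "\<dots> \<le> exp y" using mult_right_mono[OF assms(3,2)] by simp
  finally show ?thesis .
qed

text \<open>What is used of the noise, so that the analysis below does not refer to stability.
  \<open>tv\<close> is the smoothing of the law at time t in total variation, stated by duality for
  all bounded measurable functions. \<open>sine\<close> and \<open>trunc\<close> supply the last two
  hypotheses of \<open>commutator_bound\<close> for \<kappa> = \<sigma> powr (-1/\<alpha>). They are
  linear in the duration \<tau>, and the power of \<sigma> is integrable at 0, so that the errors of
  many short steps can be added.\<close>

locale euler_scheme =
  fixes \<mu> :: "real \<Rightarrow> 'b::euclidean_space measure" and b :: "'b \<Rightarrow> 'b" and \<alpha> C L :: real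
  assumes \<alpha>: "0 < \<alpha>" "\<alpha> < 2" and C: "C \<ge> 1" and L: "L \<ge> 0"
    and prob: "t > 0 \<Longrightarrow> prob_space (\<mu> t)" and sets_\<mu>: "t > 0 \<Longrightarrow> sets (\<mu> t) = sets borel"
    and semigroup: "s > 0 \<Longrightarrow> t > 0 \<Longrightarrow> bounded_meas B f \<Longrightarrow>
      conv_op (\<mu> s) (conv_op (\<mu> t) f) = conv_op (\<mu> (s + t)) f"
    and tv: "t > 0 \<Longrightarrow> bounded_meas B f \<Longrightarrow> lip (C * t powr (-1/\<alpha>) * B) (conv_op (\<mu> t) f)"
    and sine: "\<tau> > 0 \<Longrightarrow> 0 < \<sigma> \<Longrightarrow> \<sigma> \<le> 1 \<Longrightarrow> i \<in> Basis \<Longrightarrow>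
      \<sigma> * \<bar>\<integral>z. sin (\<sigma> powr (-1/\<alpha>) * (z \<bullet> i)) \<partial>\<mu> \<tau>\<bar> \<le> C * \<tau> * \<sigma> powr (\<alpha>/4 - 1)"
    and trunc: "\<tau> > 0 \<Longrightarrow> 0 < \<sigma> \<Longrightarrow> \<sigma> \<le> 1 \<Longrightarrow> i \<in> Basis \<Longrightarrow>
      (\<integral>z. min 1 (\<sigma> * (\<sigma> powr (-1/\<alpha>))\<^sup>2 * (z \<bullet> i)\<^sup>2) \<partial>\<mu> \<tau>) \<le> C * \<tau> * \<sigma> powr (\<alpha>/4 - 1)"
    and b: "lip L b" "second_diff L b"
begin

abbreviation Q :: "real \<Rightarrow> ('b \<Rightarrow> real) \<Rightarrow> 'b \<Rightarrow> real" where
  "Q t \<equiv> conv_op (\<mu> t)"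

definition step :: "real \<Rightarrow> 'b \<Rightarrow> 'b" where "step \<tau> x = x + \<tau> *\<^sub>R b x"

definition S :: "real \<Rightarrow> ('b \<Rightarrow> real) \<Rightarrow> 'b \<Rightarrow> real" where
  "S \<tau> f x = Q \<tau> f (step \<tau> x)"

text \<open>The growth factor of the deterministic steps over a total time of at most 1; all
  estimates of this locale are made on that horizon.\<close>

definition E :: real where "E = exp L"

lemma E: "E \<ge> 1" using L by (simp add: E_def)

lemma lip_step: "\<tau> \<ge> 0 \<Longrightarrow> lip (1 + \<tau> * L) (step \<tau>)"
  unfolding step_def[abs_def] by (intro lip_add lip_id lip_scaleR b)

lemma second_diff_step: "\<tau> \<ge> 0 \<Longrightarrow> second_diff (\<tau> * L) (step \<tau>)"
  using second_diff_add[OF second_diff_id second_diff_scaleR[OF b(2), of \<tau>]]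
  by (simp add: step_def[abs_def])

lemma lip_steps: "\<tau> \<ge> 0 \<Longrightarrow> lip ((1 + \<tau> * L) ^ j) (step \<tau> ^^ j)"
proof (induction j)
  case (Suc j)
  then show ?case using lip_comp[OF lip_step[of \<tau>] Suc.IH] L by (simp add: comp_def)
qed (simp add: lip_def)

lemma power_le_E: "\<tau> \<ge> 0 \<Longrightarrow> real j * \<tau> \<le> 1 \<Longrightarrow> (1 + \<tau> * L) ^ j \<le> E"
  unfolding E_def using L by (intro one_plus_power_le_exp) auto

lemma lip_steps_E: "\<tau> \<ge> 0 \<Longrightarrow> real j * \<tau> \<le> 1 \<Longrightarrow> lip E (step \<tau> ^^ j)"
  using lip_steps power_le_E lip_mono by blast

lemma meas_steps [measurable]: "\<tau> \<ge> 0 \<Longrightarrow> step \<tau> ^^ j \<in> borel_measurable borel"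
  by (rule lip_measurable[OF lip_steps])

text \<open>Both bounds must keep the factor \<open>real j * \<tau>\<close>, the elapsed time. The
  power in the second one closes the induction as in Gronwall's inequality: each step adds
  \<open>\<tau> * L\<close> times the second difference bound of the iterate itself.
  \<open>displacement'\<close> absorbs it into a further factor \<open>E\<close>.\<close>

lemma displacement:
  assumes "\<tau> \<ge> 0" "real j * \<tau> \<le> 1"
  shows "lip (real j * \<tau> * (L * E)) (\<lambda>x. (step \<tau> ^^ j) x - x)"
    and "second_diff (real j * \<tau> * (L * E\<^sup>2) * (1 + \<tau> * L) ^ j) (\<lambda>x. (step \<tau> ^^ j) x - x)"
  using assms(2)
proof (induction j)
  case 0
  { case 1 then show ?case by (simp add: lip_def) }
  { case 2 then show ?case by (simp add: second_diff_def) }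
next
  case (Suc j)
  have eq: "(\<lambda>x. (step \<tau> ^^ Suc j) x - x) = (\<lambda>x. ((step \<tau> ^^ j) x - x) + \<tau> *\<^sub>R b ((step \<tau> ^^ j) x))"
    by (simp add: step_def algebra_simps)
  have j: "real j * \<tau> \<le> 1" if "real (Suc j) * \<tau> \<le> 1"
    using that assms(1) by (simp add: algebra_simps)
  { case 1
    have "lip (real j * \<tau> * (L * E) + \<tau> * (L * E)) (\<lambda>x. ((step \<tau> ^^ j) x - x) + \<tau> *\<^sub>R b ((step \<tau> ^^ j) x))"
      using assms(1) L j[OF 1] Suc by (intro lip_add lip_scaleR lip_comp[OF b(1)] lip_steps_E) auto
    then show ?case unfolding eq by (simp add: algebra_simps) }
  { case 2
    let ?A = "real j * \<tau> * (L * E\<^sup>2) * (1 + \<tau> * L) ^ j"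
    have A: "second_diff ?A (\<lambda>x. (step \<tau> ^^ j) x - x)" using Suc j[OF 2] by blast
    then have A': "second_diff ?A (step \<tau> ^^ j)"
      using second_diff_add[OF A second_diff_id] by simp
    have "second_diff (?A + \<tau> * (L * E\<^sup>2 + L * ?A)) (\<lambda>x. ((step \<tau> ^^ j) x - x) + \<tau> *\<^sub>R b ((step \<tau> ^^ j) x))"
      using assms(1) L j[OF 2] E
      by (intro second_diff_add A second_diff_scaleR second_diff_comp b lip_steps_E A') auto
    moreover have "?A + \<tau> * (L * E\<^sup>2 + L * ?A) \<le> real (Suc j) * \<tau> * (L * E\<^sup>2) * (1 + \<tau> * L) ^ Suc j"
    proof -
      have "1 \<le> (1 + \<tau> * L) ^ Suc j" using assms(1) L by (intro one_le_power) auto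
      then have "\<tau> * (L * E\<^sup>2) * 1 \<le> \<tau> * (L * E\<^sup>2) * (1 + \<tau> * L) ^ Suc j"
        using assms(1) L by (intro mult_left_mono) auto
      then show ?thesis by (simp add: algebra_simps)
    qed
    ultimately show ?case unfolding eq by (rule second_diff_mono) }
qed

text \<open>This is the constant \<open>m\<close> of \<open>commutator_bound\<close>: displacement
  per unit of time, in first and second order alike.\<close>

definition m\<^sub>\<Phi> :: real where "m\<^sub>\<Phi> = L * E ^ 3"

lemma displacement':
  assumes "\<tau> \<ge> 0" "real j * \<tau> \<le> 1"
  shows "lip (m\<^sub>\<Phi> * (real j * \<tau>)) (\<lambda>x. (step \<tau> ^^ j) x - x)"
    and "second_diff (m\<^sub>\<Phi> * (real j * \<tau>)) (\<lambda>x. (step \<tau> ^^ j) x - x)"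
proof -
  have "E ^ 1 \<le> E ^ 3" using E by (intro power_increasing) auto
  then have "L * E \<le> m\<^sub>\<Phi>" using L unfolding m\<^sub>\<Phi>_def by (intro mult_left_mono) auto
  then have "real j * \<tau> * (L * E) \<le> m\<^sub>\<Phi> * (real j * \<tau>)"
    using mult_left_mono[of "L * E" "m\<^sub>\<Phi>" "real j * \<tau>"] assms by (simp add: mult.commute)
  then show "lip (m\<^sub>\<Phi> * (real j * \<tau>)) (\<lambda>x. (step \<tau> ^^ j) x - x)"
    using displacement(1)[OF assms] lip_mono by blast
  have "real j * \<tau> * (L * E\<^sup>2) * (1 + \<tau> * L) ^ j \<le> real j * \<tau> * (L * E\<^sup>2) * E"
    using assms L E by (intro mult_left_mono power_le_E) auto
  also have "\<dots> = m\<^sub>\<Phi> * (real j * \<tau>)" by (simp add: m\<^sub>\<Phi>_def power2_eq_square power3_eq_cube)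
  finally show "second_diff (m\<^sub>\<Phi> * (real j * \<tau>)) (\<lambda>x. (step \<tau> ^^ j) x - x)"
    using displacement(2)[OF assms] second_diff_mono by blast
qed

lemma S_eq: "S \<tau> f = (\<lambda>x. Q \<tau> f (step \<tau> x))" by (simp add: fun_eq_iff S_def)

lemma meas_step: "\<tau> \<ge> 0 \<Longrightarrow> step \<tau> \<in> borel_measurable borel"
  by (rule lip_measurable[OF lip_step])

lemma bounded_meas_S: "\<tau> > 0 \<Longrightarrow> bounded_meas B f \<Longrightarrow> bounded_meas B (S \<tau> f)"
  unfolding S_eq
  by (rule bounded_meas_comp[OF bounded_meas_conv_op[OF prob sets_\<mu>] meas_step]) auto

lemma bounded_meas_Sk: "\<tau> > 0 \<Longrightarrow> bounded_meas B f \<Longrightarrow> bounded_meas B ((S \<tau> ^^ k) f)"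
  by (induction k) (auto intro: bounded_meas_S)

lemma S_add:
  "\<tau> > 0 \<Longrightarrow> bounded_meas A f \<Longrightarrow> bounded_meas B g \<Longrightarrow> S \<tau> (\<lambda>x. f x + g x) = (\<lambda>x. S \<tau> f x + S \<tau> g x)"
  unfolding S_eq by (subst conv_op_add[OF prob sets_\<mu>]) auto

lemma Sk_add:
  assumes "\<tau> > 0" "bounded_meas A f" "bounded_meas B g"
  shows "(S \<tau> ^^ k) (\<lambda>x. f x + g x) = (\<lambda>x. (S \<tau> ^^ k) f x + (S \<tau> ^^ k) g x)"
proof (induction k)
  case (Suc k)
  then show ?case using assms by (simp add: S_add[OF _ bounded_meas_Sk bounded_meas_Sk])
qed simp

text \<open>Convolution preserves both moduli, so only the deterministic step costs: a factor
  \<open>1 + \<tau> * L\<close> on the Lipschitz constant, and its square on second differences plus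
  \<open>\<tau> * L\<close> times the Lipschitz constant. No smoothing is gained here; the lemma
  carries smoothness gained elsewhere through the remaining steps.\<close>

lemma smooth_Sk:
  assumes \<tau>: "\<tau> > 0" and g: "bounded_meas B g" "lip A1 g" "second_diff A2 g" and pos: "A1 \<ge> 0" "A2 \<ge> 0"
    and k: "real k * \<tau> \<le> 1"
  shows "lip ((1 + \<tau> * L) ^ k * A1) ((S \<tau> ^^ k) g)"
    and "second_diff ((1 + \<tau> * L) ^ (2 * k) * (A2 + real k * \<tau> * (L * E * A1))) ((S \<tau> ^^ k) g)"
  using k
proof (induction k)
  case 0
  { case 1 then show ?case using g by simp }
  { case 2 then show ?case using g by simp }
next
  case (Suc k)
  have k: "real k * \<tau> \<le> 1" if "real (Suc k) * \<tau> \<le> 1"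
    using that \<tau> by (simp add: algebra_simps)
  note bm = bounded_meas_Sk[OF \<tau> g(1), of k]
  have Suc_eq: "(S \<tau> ^^ Suc k) g = (\<lambda>x. Q \<tau> ((S \<tau> ^^ k) g) (step \<tau> x))"
    by (simp add: fun_eq_iff S_def)
  { case 1
    have "lip ((1 + \<tau> * L) ^ k * A1) (Q \<tau> ((S \<tau> ^^ k) g))"
      using Suc k[OF 1] by (intro lip_conv_op[OF prob sets_\<mu> bm] \<tau>) auto
    then have "lip ((1 + \<tau> * L) ^ k * A1 * (1 + \<tau> * L)) (\<lambda>x. Q \<tau> ((S \<tau> ^^ k) g) (step \<tau> x))"
      using \<tau> L pos by (intro lip_comp[OF _ lip_step]) auto
    then show ?case unfolding Suc_eq by (simp add: mult_ac) }
  { case 2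
    let ?A1 = "(1 + \<tau> * L) ^ k * A1"
    let ?A2 = "(1 + \<tau> * L) ^ (2 * k) * (A2 + real k * \<tau> * (L * E * A1))"
    have l: "lip ?A1 (Q \<tau> ((S \<tau> ^^ k) g))" "second_diff ?A2 (Q \<tau> ((S \<tau> ^^ k) g))"
      using Suc k[OF 2] by (auto intro!: lip_conv_op[OF prob sets_\<mu> bm] second_diff_conv_op[OF prob sets_\<mu> bm] \<tau>)
    have "second_diff (?A2 * (1 + \<tau> * L)\<^sup>2 + ?A1 * (\<tau> * L)) (\<lambda>x. Q \<tau> ((S \<tau> ^^ k) g) (step \<tau> x))"
      using \<tau> L pos E by (intro second_diff_comp l lip_step second_diff_step) auto
    moreover have "?A2 * (1 + \<tau> * L)\<^sup>2 + ?A1 * (\<tau> * L)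
      \<le> (1 + \<tau> * L) ^ (2 * Suc k) * (A2 + real (Suc k) * \<tau> * (L * E * A1))"
    proof -
      have "?A1 * (\<tau> * L) \<le> E * A1 * (\<tau> * L)"
        using \<tau> L pos k[OF 2] by (intro mult_right_mono power_le_E) auto
      also have "\<dots> \<le> (1 + \<tau> * L) ^ (2 * Suc k) * (E * A1 * (\<tau> * L))"
      proof -
        have "1 \<le> (1 + \<tau> * L) ^ (2 * Suc k)" using \<tau> L by (intro one_le_power) auto
        moreover have "0 \<le> E * A1 * (\<tau> * L)" using \<tau> L E pos by (intro mult_nonneg_nonneg) auto
        ultimately have "1 * (E * A1 * (\<tau> * L)) \<le> (1 + \<tau> * L) ^ (2 * Suc k) * (E * A1 * (\<tau> * L))"
          by (rule mult_right_mono)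
        then show ?thesis by (simp only: mult_1_left)
      qed
      finally have le: "?A1 * (\<tau> * L) \<le> (1 + \<tau> * L) ^ (2 * Suc k) * (\<tau> * (L * E * A1))"
        by (simp only: mult_ac)
      have gen: "p * (A2 + r) * q + X \<le> p * q * (A2 + (r + c))" if "X \<le> p * q * c" for p q r c X :: real
        using that by (simp add: algebra_simps)
      define p2k p2 P r c where "p2k = (1 + \<tau> * L) ^ (2 * k)" and "p2 = (1 + \<tau> * L)\<^sup>2"
        and "P = (1 + \<tau> * L) ^ (2 * Suc k)" and "r = real k * \<tau> * (L * E * A1)" and "c = \<tau> * (L * E * A1)"
      have P: "P = p2k * p2" by (simp add: P_def p2k_def p2_def power2_eq_square)
      have rc: "real (Suc k) * \<tau> * (L * E * A1) = r + c"
        unfolding r_def c_def of_nat_Suc by (simp add: distrib_right)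
      have "?A1 * (\<tau> * L) \<le> p2k * p2 * c"
        using le unfolding P_def[symmetric] c_def[symmetric] P .
      from gen[OF this] have "p2k * (A2 + r) * p2 + ?A1 * (\<tau> * L) \<le> P * (A2 + (r + c))"
        unfolding P .
      then show ?thesis unfolding rc by (simp only: p2k_def p2_def P_def r_def)
    qed
    ultimately show ?case unfolding Suc_eq by (rule second_diff_mono) }
qed

lemma smooth_Sk_E:
  assumes \<tau>: "\<tau> > 0" and g: "bounded_meas B g" "lip A1 g" "second_diff A2 g" and pos: "A1 \<ge> 0" "A2 \<ge> 0"
    and k: "real k * \<tau> \<le> 1"
  shows "lip (E * A1) ((S \<tau> ^^ k) g)" and "second_diff (E\<^sup>2 * (A2 + L * E * A1)) ((S \<tau> ^^ k) g)"
proof -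
  have p: "(1 + \<tau> * L) ^ k \<le> E" "0 \<le> (1 + \<tau> * L) ^ k" using \<tau> k L by (auto intro!: power_le_E)
  show "lip (E * A1) ((S \<tau> ^^ k) g)"
    by (rule lip_mono[OF smooth_Sk(1)[OF assms]]) (intro mult_right_mono p pos)
  have "(1 + \<tau> * L) ^ (2 * k) = ((1 + \<tau> * L) ^ k)\<^sup>2" by (simp only: power_mult[symmetric] mult.commute)
  also have "\<dots> \<le> E\<^sup>2" using p by (intro power_mono)
  finally have "(1 + \<tau> * L) ^ (2 * k) \<le> E\<^sup>2" .
  then have "(1 + \<tau> * L) ^ (2 * k) * (A2 + real k * \<tau> * (L * E * A1)) \<le> E\<^sup>2 * (A2 + 1 * (L * E * A1))"
    using \<tau> L E pos k by (intro mult_mono add_mono order_refl mult_nonneg_nonneg add_nonneg_nonneg) auto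
  then show "second_diff (E\<^sup>2 * (A2 + L * E * A1)) ((S \<tau> ^^ k) g)"
    using second_diff_mono[OF smooth_Sk(2)[OF assms]] by simp
qed

end

section \<open>Smoothing by the noise and the size of the commutators\<close>

context euler_scheme begin

text \<open>Two smoothings over half of the time, each of cost \<open>C\<close> times 2 powr
  (1/\<alpha>).\<close>

definition C\<^sub>0 :: real where "C\<^sub>0 = C\<^sup>2 * 2 powr (2/\<alpha>)"

lemma C\<^sub>0: "C \<le> C\<^sub>0" "1 \<le> C\<^sub>0"
proof -
  have "C * 1 \<le> C * C" using C by (intro mult_left_mono) auto
  moreover have "C\<^sup>2 * 1 \<le> C\<^sup>2 * 2 powr (2/\<alpha>)"
    using \<alpha> by (intro mult_left_mono ge_one_powr_ge_zero) auto
  ultimately show "C \<le> C\<^sub>0" by (simp add: C\<^sub>0_def power2_eq_square)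
  then show "1 \<le> C\<^sub>0" using C by simp
qed

text \<open>The second difference bound comes from the semigroup property: an increment of the
  function smoothed over half of the time is itself bounded by a multiple of \<open>norm h\<close>,
  so the total variation bound applies to it once more over the other half.\<close>

lemma smooth_Q:
  assumes \<sigma>: "\<sigma> > 0" and f: "bounded_meas B f"
  shows "bounded_meas (C\<^sub>0 * B) (Q \<sigma> f)"
    and "lip (C\<^sub>0 * B * \<sigma> powr (-1/\<alpha>)) (Q \<sigma> f)"
    and "second_diff (C\<^sub>0 * B * (\<sigma> powr (-1/\<alpha>))\<^sup>2) (Q \<sigma> f)"
proof -
  have B: "B \<ge> 0" using f by (rule bounded_meas_nonneg)
  have "1 * B \<le> C\<^sub>0 * B" using B C\<^sub>0 by (intro mult_right_mono) auto
  then show "bounded_meas (C\<^sub>0 * B) (Q \<sigma> f)"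
    using bounded_meas_mono[OF bounded_meas_conv_op[OF prob[OF \<sigma>] sets_\<mu>[OF \<sigma>] f]] by simp
  have "C * \<sigma> powr (-1/\<alpha>) * B \<le> C\<^sub>0 * B * \<sigma> powr (-1/\<alpha>)"
    using mult_right_mono[OF C\<^sub>0(1), of "\<sigma> powr (-1/\<alpha>) * B"] B by (simp add: mult_ac)
  then show "lip (C\<^sub>0 * B * \<sigma> powr (-1/\<alpha>)) (Q \<sigma> f)"
    by (rule lip_mono[OF tv[OF \<sigma> f]])
  define s where "s = \<sigma> / 2"
  have s: "s > 0" using \<sigma> by (simp add: s_def)
  define A where "A = C * s powr (-1/\<alpha>)"
  define g where "g = Q s f"
  have g: "bounded_meas B g" "lip (A * B) g"
    unfolding g_def A_def by (rule bounded_meas_conv_op[OF prob[OF s] sets_\<mu>[OF s] f], rule tv[OF s f])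
  have Qg: "Q \<sigma> f = Q s g" using semigroup[OF s s f] by (simp add: g_def s_def)
  have "second_diff (A * (A * B)) (Q s g)"
    unfolding second_diff_def
  proof (intro allI)
    fix x h k
    define v where "v x = g (x + h) - g x" for x
    have [measurable]: "g \<in> borel_measurable borel" using g by (auto simp: bounded_meas_def)
    have v: "bounded_meas (A * B * norm h) v"
      using lipD[OF g(2), of _ h] unfolding bounded_meas_def v_def by auto
    have "Q s v y = Q s g (y + h) - Q s g y" for y
      unfolding conv_op_def v_def
      using integrable_conv[OF prob[OF s] sets_\<mu>[OF s] g(1), of "y + h"] integrable_conv[OF prob[OF s] sets_\<mu>[OF s] g(1), of y]
      by (subst Bochner_Integration.integral_diff[symmetric]) (auto simp: add_ac)
    then have "Q s g (x + h + k) - Q s g (x + h) - Q s g (x + k) + Q s g x = Q s v (x + k) - Q s v x"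
      by (simp add: add_ac)
    also have "norm \<dots> \<le> A * (A * B * norm h) * norm k"
      unfolding A_def using lipD[OF tv[OF s v]] by (simp add: A_def)
    finally show "norm (Q s g (x + h + k) - Q s g (x + h) - Q s g (x + k) + Q s g x) \<le> A * (A * B) * norm h * norm k"
      by (simp add: mult_ac)
  qed
  moreover have "A * (A * B) = C\<^sub>0 * B * (\<sigma> powr (-1/\<alpha>))\<^sup>2"
  proof -
    have e: "s powr (-1/\<alpha>) = \<sigma> powr (-1/\<alpha>) * 2 powr (1/\<alpha>)"
      using \<sigma> by (simp add: s_def powr_divide powr_minus field_simps)
    have e2: "(2 powr (1/\<alpha>))\<^sup>2 = (2::real) powr (2/\<alpha>)"
      by (simp add: power2_eq_square powr_add[symmetric])
    have "A * (A * B) = C\<^sup>2 * (s powr (-1/\<alpha>))\<^sup>2 * B" by (simp add: A_def power2_eq_square)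
    then show ?thesis unfolding e power_mult_distrib e2 C\<^sub>0_def by (simp only: mult_ac)
  qed
  ultimately show "second_diff (C\<^sub>0 * B * (\<sigma> powr (-1/\<alpha>))\<^sup>2) (Q \<sigma> f)" by (simp add: Qg)
qed

definition C\<^sub>c :: real where
  "C\<^sub>c = C\<^sub>0 * (2 + (5 + 2 * DIM('b)) * m\<^sub>\<Phi> + 2 * m\<^sub>\<Phi>\<^sup>2) * DIM('b) * C"

lemma m\<^sub>\<Phi>: "m\<^sub>\<Phi> \<ge> 0" using L E by (simp add: m\<^sub>\<Phi>_def)

lemma C\<^sub>c: "C\<^sub>c > 0"
proof -
  have "2 + (5 + 2 * real DIM('b)) * m\<^sub>\<Phi> + 2 * m\<^sub>\<Phi>\<^sup>2 > 0"
    using m\<^sub>\<Phi> by (intro add_pos_nonneg) auto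
  then show ?thesis unfolding C\<^sub>c_def using C C\<^sub>0 by (auto intro!: mult_pos_pos simp: DIM_positive)
qed

definition G :: "real \<Rightarrow> nat \<Rightarrow> ('b \<Rightarrow> real) \<Rightarrow> 'b \<Rightarrow> real" where
  "G \<tau> j f x = Q (real j * \<tau>) f ((step \<tau> ^^ j) x)"

text \<open>The effect of exchanging the noise of one Euler step with the j deterministic steps that
  follow it.\<close>

definition D :: "real \<Rightarrow> nat \<Rightarrow> ('b \<Rightarrow> real) \<Rightarrow> 'b \<Rightarrow> real" where
  "D \<tau> j f x = S \<tau> (G \<tau> j f) x - G \<tau> (Suc j) f x"

lemma bounded_meas_G: "\<tau> > 0 \<Longrightarrow> j \<ge> 1 \<Longrightarrow> bounded_meas B f \<Longrightarrow> bounded_meas B (G \<tau> j f)"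
  unfolding G_def[abs_def]
  by (rule bounded_meas_comp[OF bounded_meas_conv_op[OF prob sets_\<mu>] meas_steps]) auto

lemma powr_ge_one: "0 < \<sigma> \<Longrightarrow> \<sigma> \<le> 1 \<Longrightarrow> 1 \<le> \<sigma> powr (-1/\<alpha>)"
  using powr_mono2'[of "-1/\<alpha>" \<sigma> 1] \<alpha> by simp

lemma smooth_G:
  assumes \<tau>: "\<tau> > 0" and j: "j \<ge> 1" "real j * \<tau> \<le> 1" and f: "bounded_meas B f"
  shows "lip (C\<^sub>0 * E * B * (real j * \<tau>) powr (-1/\<alpha>)) (G \<tau> j f)"
    and "second_diff (C\<^sub>0 * (E\<^sup>2 + m\<^sub>\<Phi>) * B * ((real j * \<tau>) powr (-1/\<alpha>))\<^sup>2) (G \<tau> j f)"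
proof -
  define \<sigma> where "\<sigma> = real j * \<tau>"
  define \<kappa> where "\<kappa> = \<sigma> powr (-1/\<alpha>)"
  have \<sigma>: "\<sigma> > 0" "\<sigma> \<le> 1" using \<tau> j by (auto simp: \<sigma>_def)
  have \<kappa>: "\<kappa> \<ge> 1" unfolding \<kappa>_def using \<sigma> by (rule powr_ge_one)
  have B: "B \<ge> 0" using f by (rule bounded_meas_nonneg)
  note q = smooth_Q[OF \<sigma>(1) f, folded \<kappa>_def]
  have G: "G \<tau> j f = (\<lambda>x. Q \<sigma> f ((step \<tau> ^^ j) x))" by (simp add: G_def fun_eq_iff \<sigma>_def)
  have l: "lip E (step \<tau> ^^ j)" using \<tau> j by (intro lip_steps_E) auto
  have "lip (C\<^sub>0 * B * \<kappa> * E) (G \<tau> j f)"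
    unfolding G using B C\<^sub>0 \<kappa> by (intro lip_comp[OF q(2) l]) auto
  then show "lip (C\<^sub>0 * E * B * (real j * \<tau>) powr (-1/\<alpha>)) (G \<tau> j f)"
    unfolding \<sigma>_def[symmetric] \<kappa>_def[symmetric] by (simp only: mult_ac)
  have "second_diff (m\<^sub>\<Phi> * \<sigma> + 0) (\<lambda>x. ((step \<tau> ^^ j) x - x) + x)"
    unfolding \<sigma>_def using \<tau> j by (intro second_diff_add second_diff_id displacement'(2)) auto
  then have "second_diff (m\<^sub>\<Phi> * \<sigma>) (step \<tau> ^^ j)" by simp
  then have d: "second_diff m\<^sub>\<Phi> (step \<tau> ^^ j)"
    by (rule second_diff_mono) (use \<sigma> m\<^sub>\<Phi> in \<open>simp add: mult_left_le\<close>)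
  have "second_diff (C\<^sub>0 * B * \<kappa>\<^sup>2 * E\<^sup>2 + C\<^sub>0 * B * \<kappa> * m\<^sub>\<Phi>) (G \<tau> j f)"
    unfolding G using B C\<^sub>0 \<kappa> E by (intro second_diff_comp[OF q(2,3) l d]) auto
  moreover have "C\<^sub>0 * B * \<kappa>\<^sup>2 * E\<^sup>2 + C\<^sub>0 * B * \<kappa> * m\<^sub>\<Phi> \<le> C\<^sub>0 * (E\<^sup>2 + m\<^sub>\<Phi>) * B * \<kappa>\<^sup>2"
  proof -
    have "\<kappa> * 1 \<le> \<kappa>\<^sup>2" using \<kappa> unfolding power2_eq_square by (intro mult_left_mono) auto
    then have "C\<^sub>0 * B * m\<^sub>\<Phi> * \<kappa> \<le> C\<^sub>0 * B * m\<^sub>\<Phi> * \<kappa>\<^sup>2"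
      using B C\<^sub>0 m\<^sub>\<Phi> by (intro mult_left_mono) auto
    then show ?thesis by (simp add: algebra_simps)
  qed
  ultimately show "second_diff (C\<^sub>0 * (E\<^sup>2 + m\<^sub>\<Phi>) * B * ((real j * \<tau>) powr (-1/\<alpha>))\<^sup>2) (G \<tau> j f)"
    unfolding \<sigma>_def[symmetric] \<kappa>_def[symmetric] by (rule second_diff_mono)
qed

text \<open>By the semigroup property the noise of duration (j + 1) \<tau> splits into parts of
  duration \<tau> and j \<tau>. Both terms of \<open>D\<close> then are averages over the same short
  jump z, taken before or after the j steps, and \<open>commutator_bound\<close> applies with
  \<open>g\<close> the convolution over time j \<tau>.\<close>

lemma bounded_meas_D:
  assumes \<tau>: "\<tau> > 0" and j: "j \<ge> 1" "real j * \<tau> \<le> 1" and f: "bounded_meas B f"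
  shows "bounded_meas (C\<^sub>c * B * (\<tau> * (real j * \<tau>) powr (\<alpha>/4 - 1))) (D \<tau> j f)"
  unfolding bounded_meas_def
proof (intro conjI allI)
  have "bounded_meas (B + B) (D \<tau> j f)"
    unfolding D_def[abs_def] using \<tau> j f
    by (intro bounded_meas_diff bounded_meas_S bounded_meas_G) auto
  then show "D \<tau> j f \<in> borel_measurable borel" by (simp add: bounded_meas_def)
next
  fix x
  define \<sigma> where "\<sigma> = real j * \<tau>"
  define \<kappa> where "\<kappa> = \<sigma> powr (-1/\<alpha>)"
  have \<sigma>: "\<sigma> > 0" "\<sigma> \<le> 1" using \<tau> j by (auto simp: \<sigma>_def)
  have \<kappa>: "\<kappa> \<ge> 1" unfolding \<kappa>_def using \<sigma> by (rule powr_ge_one)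
  let ?\<Phi> = "step \<tau> ^^ j"
  define y where "y = step \<tau> x"
  have Qf: "bounded_meas B (Q \<sigma> f)" by (rule bounded_meas_conv_op[OF prob[OF \<sigma>(1)] sets_\<mu>[OF \<sigma>(1)] f])
  have i1: "integrable (\<mu> \<tau>) (\<lambda>z. Q \<sigma> f (?\<Phi> (y + z)))"
    using integrable_conv[OF prob[OF \<tau>] sets_\<mu>[OF \<tau>] bounded_meas_G[OF \<tau> j(1) f], of y]
    by (simp add: G_def \<sigma>_def)
  have i2: "integrable (\<mu> \<tau>) (\<lambda>z. Q \<sigma> f (?\<Phi> y + z))"
    by (rule integrable_conv[OF prob[OF \<tau>] sets_\<mu>[OF \<tau>] Qf])
  have "G \<tau> (Suc j) f x = Q (\<tau> + \<sigma>) f (?\<Phi> y)"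
    by (simp add: G_def \<sigma>_def y_def funpow_swap1 algebra_simps)
  also have "\<dots> = Q \<tau> (Q \<sigma> f) (?\<Phi> y)" by (simp add: semigroup[OF \<tau> \<sigma>(1) f])
  finally have "D \<tau> j f x = (\<integral>z. Q \<sigma> f (?\<Phi> (y + z)) - Q \<sigma> f (?\<Phi> y + z) \<partial>\<mu> \<tau>)"
    using i1 i2 by (simp add: D_def S_def conv_op_def G_def \<sigma>_def y_def)
  also have "\<bar>\<dots>\<bar> \<le> C\<^sub>0 * B * (2 + (5 + 2 * DIM('b)) * m\<^sub>\<Phi> + 2 * m\<^sub>\<Phi>\<^sup>2) * DIM('b) * (C * \<tau> * \<sigma> powr (\<alpha>/4 - 1))"
  proof (rule commutator_bound[OF prob[OF \<tau>] sets_\<mu>[OF \<tau>] smooth_Q[OF \<sigma>(1) f, folded \<kappa>_def]])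
    show "?\<Phi> \<in> borel_measurable borel" using \<tau> by (intro meas_steps) auto
    show "lip (m\<^sub>\<Phi> * \<sigma>) (\<lambda>x. ?\<Phi> x - x)" "second_diff (m\<^sub>\<Phi> * \<sigma>) (\<lambda>x. ?\<Phi> x - x)"
      unfolding \<sigma>_def using \<tau> j by (auto intro!: displacement')
  qed (use \<sigma> \<kappa> m\<^sub>\<Phi> \<tau> sine[OF \<tau> \<sigma>] trunc[OF \<tau> \<sigma>] in \<open>auto simp: \<kappa>_def\<close>)
  also have "\<dots> = C\<^sub>c * B * (\<tau> * (real j * \<tau>) powr (\<alpha>/4 - 1))"
    by (simp add: C\<^sub>c_def \<sigma>_def)
  finally show "\<bar>D \<tau> j f x\<bar> \<le> C\<^sub>c * B * (\<tau> * (real j * \<tau>) powr (\<alpha>/4 - 1))" .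
qed

text \<open>A discrete Duhamel formula: replacing the last \<open>m\<close> Euler steps by \<open>G \<tau> m\<close>, the deterministic
  steps followed by one convolution, costs the commutators \<open>D\<close>, which are summable in \<open>j\<close>.\<close>

lemma duhamel:
  assumes \<tau>: "\<tau> > 0" and f: "bounded_meas B f" and l: "l \<ge> 0" and m: "1 \<le> m"
  shows "m \<le> n \<Longrightarrow> real m * \<tau> \<le> 1 \<Longrightarrow>
    (\<And>k f B. n \<le> k + m \<Longrightarrow> k + 2 \<le> n \<Longrightarrow> bounded_meas B f \<Longrightarrow> lip (l * B) ((S \<tau> ^^ k) f)) \<Longrightarrow>
    lip (l * C\<^sub>c * B * (\<Sum>j = 1..<m. \<tau> * (real j * \<tau>) powr (\<alpha>/4 - 1)))
      (\<lambda>x. (S \<tau> ^^ n) f x - (S \<tau> ^^ (n - m)) (G \<tau> m f) x)"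
  using m
proof (induction m rule: nat_induct_at_least)
  case base
  have "S \<tau> f = G \<tau> 1 f" by (simp add: fun_eq_iff S_def G_def)
  moreover have "(S \<tau> ^^ n) f = (S \<tau> ^^ (n - 1)) (S \<tau> f)"
    using base by (cases n) (simp_all add: funpow_swap1)
  ultimately show ?case by (simp add: lip_def)
next
  case (Suc m)
  \<comment> \<open>The commutator \<open>D \<tau> j f\<close> is seen through n - j - 1 outer Euler
    steps. For 1 \<le> j < m this number runs from n - m to n - 2, the range of k in the Lipschitz
    hypothesis.\<close>
  define k where "k = n - Suc m"
  have nk: "n = Suc (k + m)" "n - m = Suc k" using Suc by (auto simp: k_def)
  have m1: "real m * \<tau> \<le> 1" using Suc.prems(2) \<tau> by (simp add: algebra_simps)
  have Dm: "bounded_meas (C\<^sub>c * B * (\<tau> * (real m * \<tau>) powr (\<alpha>/4 - 1))) (D \<tau> m f)"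
    using Suc.hyps m1 by (intro bounded_meas_D \<tau> f) auto
  have Gm: "bounded_meas B (G \<tau> (Suc m) f)" using \<tau> f by (intro bounded_meas_G) auto
  have "(S \<tau> ^^ (n - m)) (G \<tau> m f) = (S \<tau> ^^ k) (S \<tau> (G \<tau> m f))"
    unfolding nk by (simp add: funpow_swap1)
  also have "S \<tau> (G \<tau> m f) = (\<lambda>x. G \<tau> (Suc m) f x + D \<tau> m f x)" by (simp add: D_def)
  also have "(S \<tau> ^^ k) \<dots> = (\<lambda>x. (S \<tau> ^^ k) (G \<tau> (Suc m) f) x + (S \<tau> ^^ k) (D \<tau> m f) x)"
    by (rule Sk_add[OF \<tau> Gm Dm])
  finally have eq: "(\<lambda>x. (S \<tau> ^^ n) f x - (S \<tau> ^^ (n - Suc m)) (G \<tau> (Suc m) f) x)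
     = (\<lambda>x. ((S \<tau> ^^ n) f x - (S \<tau> ^^ (n - m)) (G \<tau> m f) x) + (S \<tau> ^^ k) (D \<tau> m f) x)"
    by (simp add: k_def)
  have "lip (l * C\<^sub>c * B * (\<Sum>j = 1..<m. \<tau> * (real j * \<tau>) powr (\<alpha>/4 - 1))
      + l * (C\<^sub>c * B * (\<tau> * (real m * \<tau>) powr (\<alpha>/4 - 1))))
     (\<lambda>x. ((S \<tau> ^^ n) f x - (S \<tau> ^^ (n - m)) (G \<tau> m f) x) + (S \<tau> ^^ k) (D \<tau> m f) x)"
  proof (rule lip_add)
    show "lip (l * C\<^sub>c * B * (\<Sum>j = 1..<m. \<tau> * (real j * \<tau>) powr (\<alpha>/4 - 1)))
      (\<lambda>x. (S \<tau> ^^ n) f x - (S \<tau> ^^ (n - m)) (G \<tau> m f) x)"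
      by (rule Suc.IH) (use Suc.prems m1 in auto)
    show "lip (l * (C\<^sub>c * B * (\<tau> * (real m * \<tau>) powr (\<alpha>/4 - 1)))) ((S \<tau> ^^ k) (D \<tau> m f))"
      by (rule Suc.prems(3)[OF _ _ Dm]) (use nk Suc.hyps in auto)
  qed
  then show ?case unfolding eq using Suc.hyps by (simp add: sum.atLeastLessThan_Suc distrib_left mult_ac)
qed

section \<open>Lipschitz bounds uniform in the step size\<close>

lemma sum_le: "\<tau> > 0 \<Longrightarrow>
  (\<Sum>j = 1..<m. \<tau> * (real j * \<tau>) powr (\<alpha>/4 - 1)) \<le> (real m * \<tau>) powr (\<alpha>/4) / (\<alpha>/4)"
  using \<alpha> by (intro sum_powr_le) auto

text \<open>Up to such a time the summed commutators contribute at most half of the bound claimed in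
  \<open>lip_Sn\<close>; the factor 3 powr (1/\<alpha>) compares k steps with n \<le> 3 k steps
  there.\<close>

lemma ex_t\<^sub>0: "\<exists>t>0. t \<le> 1 \<and> 3 powr (1/\<alpha>) * C\<^sub>c * (t powr (\<alpha>/4) / (\<alpha>/4)) \<le> 1/2"
proof -
  define y where "y = (\<alpha>/4) / (2 * (3 powr (1/\<alpha>) * C\<^sub>c))"
  have y: "y > 0" using \<alpha> C\<^sub>c by (simp add: y_def)
  define t where "t = min 1 (y powr (4/\<alpha>))"
  have "t powr (\<alpha>/4) \<le> (y powr (4/\<alpha>)) powr (\<alpha>/4)"
    using \<alpha> y by (intro powr_mono2) (auto simp: t_def)
  also have "\<dots> = y" using \<alpha> y by (simp add: powr_powr)
  finally have "3 powr (1/\<alpha>) * C\<^sub>c * (t powr (\<alpha>/4) / (\<alpha>/4)) \<le> 3 powr (1/\<alpha>) * C\<^sub>c * (y / (\<alpha>/4))"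
    using \<alpha> C\<^sub>c by (intro mult_left_mono divide_right_mono) auto
  also have "\<dots> = 1/2" using \<alpha> C\<^sub>c by (simp add: y_def)
  finally show ?thesis using y by (intro exI[of _ t]) (auto simp: t_def)
qed

definition t\<^sub>0 :: real where
  "t\<^sub>0 = (SOME t. t > 0 \<and> t \<le> 1 \<and> 3 powr (1/\<alpha>) * C\<^sub>c * (t powr (\<alpha>/4) / (\<alpha>/4)) \<le> 1/2)"

lemma t\<^sub>0: "t\<^sub>0 > 0" "t\<^sub>0 \<le> 1" "3 powr (1/\<alpha>) * C\<^sub>c * (t\<^sub>0 powr (\<alpha>/4) / (\<alpha>/4)) \<le> 1/2"
  using someI_ex[OF ex_t\<^sub>0] unfolding t\<^sub>0_def by blast+

text \<open>Twice the constant of the smooth part in \<open>lip_Sn\<close>: that part uses one half,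
  the commutators the other.\<close>

definition \<Lambda> :: real where "\<Lambda> = 2 * (E\<^sup>2 * C\<^sub>0 * 2 powr (1/\<alpha>))"

lemma \<Lambda>: "\<Lambda> > 0" using E C\<^sub>0 by (simp add: \<Lambda>_def)

lemma powr_neg_le:
  assumes "0 < s" "s \<le> c * u" "0 < c"
  shows "u powr (-1/\<alpha>) \<le> c powr (1/\<alpha>) * s powr (-1/\<alpha>)"
proof -
  have u: "u > 0" using assms by (smt (verit) mult_nonneg_nonpos)
  have "(c * u) powr (-1/\<alpha>) \<le> s powr (-1/\<alpha>)"
    using assms \<alpha> by (intro powr_mono2') auto
  then have "c powr (1/\<alpha>) * (c * u) powr (-1/\<alpha>) \<le> c powr (1/\<alpha>) * s powr (-1/\<alpha>)"
    by (intro mult_left_mono) auto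
  moreover have "c powr (1/\<alpha>) * (c * u) powr (-1/\<alpha>) = u powr (-1/\<alpha>)"
    using assms u by (simp add: powr_mult powr_minus field_simps)
  ultimately show ?thesis by simp
qed

text \<open>Strong induction on the number of steps. About half of them are replaced by
  \<open>G\<close>, whose smoothness is explicit. Each commutator is a bounded function seen through
  at least a third of the n steps, so the induction hypothesis smooths it at the same rate, and the
  choice of \<open>t\<^sub>0\<close> lets the induction close with an unchanged constant.\<close>

lemma lip_Sn:
  assumes \<tau>: "\<tau> > 0"
  shows "1 \<le> n \<Longrightarrow> real n * \<tau> \<le> t\<^sub>0 \<Longrightarrow> bounded_meas B f \<Longrightarrow>
    lip (\<Lambda> * (real n * \<tau>) powr (-1/\<alpha>) * B) ((S \<tau> ^^ n) f)"
proof (induction n arbitrary: f B rule: less_induct)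
  case (less n)
  \<comment> \<open>Rounding up gives \<open>n \<le> 2 * m\<close>. The outer step numbers k that
    occur satisfy n \<le> 2 k + 1 and k \<ge> 1, hence n \<le> 3 k; this is the origin of the
    3.\<close>
  define m where "m = (n + 1) div 2"
  have m: "1 \<le> m" "m \<le> n" "n \<le> 2 * m" using less.prems(1) by (auto simp: m_def)
  define s where "s = (real n * \<tau>) powr (-1/\<alpha>)"
  have n0: "real n * \<tau> > 0" using less.prems \<tau> by auto
  have mn: "real m * \<tau> \<le> real n * \<tau>" using m \<tau> by simp
  then have m1: "real m * \<tau> \<le> 1" "real m * \<tau> \<le> t\<^sub>0" using less.prems t\<^sub>0 by auto
  have B: "B \<ge> 0" using less.prems(3) by (rule bounded_meas_nonneg)
  define l where "l = \<Lambda> * 3 powr (1/\<alpha>) * s"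
  have l0: "l \<ge> 0" using \<Lambda> by (simp add: l_def s_def)
  have V: "lip (l * C\<^sub>c * B * (\<Sum>j = 1..<m. \<tau> * (real j * \<tau>) powr (\<alpha>/4 - 1)))
      (\<lambda>x. (S \<tau> ^^ n) f x - (S \<tau> ^^ (n - m)) (G \<tau> m f) x)"
  proof (rule duhamel[OF \<tau> less.prems(3) l0 m(1,2) m1(1)])
    fix k :: nat and g :: "'b \<Rightarrow> real" and A assume k: "n \<le> k + m" "k + 2 \<le> n" and g: "bounded_meas A g"
    have k1: "1 \<le> k" "n \<le> 3 * k" using k m by (auto simp: m_def)
    have A: "A \<ge> 0" using g by (rule bounded_meas_nonneg)
    have "real k * \<tau> \<le> real n * \<tau>" using k \<tau> by simp
    then have "lip (\<Lambda> * (real k * \<tau>) powr (-1/\<alpha>) * A) ((S \<tau> ^^ k) g)"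
      using k k1 less.prems by (intro less.IH g) auto
    moreover have "real n * \<tau> \<le> 3 * (real k * \<tau>)"
      using k1 \<tau> mult_right_mono[of "real n" "3 * real k" \<tau>] by simp
    from powr_neg_le[OF n0 this] have "(real k * \<tau>) powr (-1/\<alpha>) \<le> 3 powr (1/\<alpha>) * s" by (simp add: s_def)
    then have "\<Lambda> * (real k * \<tau>) powr (-1/\<alpha>) * A \<le> l * A"
      unfolding l_def mult.assoc using \<Lambda> A by (intro mult_left_mono mult_right_mono) (auto simp flip: mult.assoc intro: mult_right_mono)
    ultimately show "lip (l * A) ((S \<tau> ^^ k) g)" by (rule lip_mono)
  qed
  have "(\<Sum>j = 1..<m. \<tau> * (real j * \<tau>) powr (\<alpha>/4 - 1)) \<le> (real m * \<tau>) powr (\<alpha>/4) / (\<alpha>/4)"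
    by (rule sum_le[OF \<tau>])
  also have "\<dots> \<le> t\<^sub>0 powr (\<alpha>/4) / (\<alpha>/4)"
    using \<alpha> m1 \<tau> by (intro divide_right_mono powr_mono2) auto
  finally have "l * C\<^sub>c * B * (\<Sum>j = 1..<m. \<tau> * (real j * \<tau>) powr (\<alpha>/4 - 1))
     \<le> l * C\<^sub>c * B * (t\<^sub>0 powr (\<alpha>/4) / (\<alpha>/4))"
    using l0 C\<^sub>c B by (intro mult_left_mono) auto
  also have "\<dots> = (\<Lambda> * s * B) * (3 powr (1/\<alpha>) * C\<^sub>c * (t\<^sub>0 powr (\<alpha>/4) / (\<alpha>/4)))"
    by (simp add: l_def)
  also have "\<dots> \<le> (\<Lambda> * s * B) * (1/2)"
    using \<Lambda> B t\<^sub>0 by (intro mult_left_mono) (auto simp: s_def)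
  finally have V': "lip (\<Lambda> * s * B / 2) (\<lambda>x. (S \<tau> ^^ n) f x - (S \<tau> ^^ (n - m)) (G \<tau> m f) x)"
    using V lip_mono by fastforce
  have G': "lip (E * (C\<^sub>0 * E * B * (real m * \<tau>) powr (-1/\<alpha>))) ((S \<tau> ^^ (n - m)) (G \<tau> m f))"
  proof (rule smooth_Sk_E(1)[OF \<tau> bounded_meas_G[OF \<tau> m(1) less.prems(3)] smooth_G[OF \<tau> m(1) m1(1) less.prems(3)]])
    have "real (n - m) * \<tau> \<le> real n * \<tau>" using \<tau> by simp
    then show "real (n - m) * \<tau> \<le> 1" using less.prems t\<^sub>0 by simp
  qed (use C\<^sub>0 E B m\<^sub>\<Phi> in auto)
  have "real n * \<tau> \<le> 2 * (real m * \<tau>)"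
    using m \<tau> mult_right_mono[of "real n" "2 * real m" \<tau>] by simp
  from powr_neg_le[OF n0 this] have "(real m * \<tau>) powr (-1/\<alpha>) \<le> 2 powr (1/\<alpha>) * s" by (simp add: s_def)
  then have "(C\<^sub>0 * E\<^sup>2 * B) * (real m * \<tau>) powr (-1/\<alpha>) \<le> (C\<^sub>0 * E\<^sup>2 * B) * (2 powr (1/\<alpha>) * s)"
    using C\<^sub>0 B by (intro mult_left_mono) auto
  also have "\<dots> = \<Lambda> * s * B / 2" by (simp add: \<Lambda>_def)
  finally have "lip (\<Lambda> * s * B / 2) ((S \<tau> ^^ (n - m)) (G \<tau> m f))"
    using G' by (elim lip_mono) (simp add: power2_eq_square mult_ac)
  from lip_add[OF V' this] show ?case by (simp add: s_def mult_ac)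
qed

lemma S_split: "k \<le> n \<Longrightarrow> (S \<tau> ^^ n) f = (S \<tau> ^^ k) ((S \<tau> ^^ (n - k)) f)"
  by (metis comp_apply funpow_add le_add_diff_inverse)

text \<open>Beyond the time \<open>t\<^sub>0\<close> only the k outer steps smooth; the others
  merely preserve the bound \<open>B\<close>.\<close>

theorem lip_euler:
  assumes "\<tau> > 0" "1 \<le> k" "k \<le> n" "real k * \<tau> \<le> t\<^sub>0" "bounded_meas B f"
  shows "lip (\<Lambda> * (real k * \<tau>) powr (-1/\<alpha>) * B) ((S \<tau> ^^ n) f)"
  unfolding S_split[OF assms(3)]
  by (rule lip_Sn[OF assms(1,2,4) bounded_meas_Sk[OF assms(1,5)]])

section \<open>Second differences of the Euler scheme\<close>

definition C\<^sub>1 :: real where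
  "C\<^sub>1 = E\<^sup>2 * C\<^sub>0 * (E\<^sup>2 + m\<^sub>\<Phi> + L * E\<^sup>2) + 2 * (\<Lambda> * 2 powr (1/\<alpha>) * C\<^sub>c / (\<alpha>/4))"

text \<open>The number m is left free. The part smoothed over m steps has second differences of the
  rate of two derivatives, while the commutator part is only Lipschitz, but with a constant that is
  small with m \<tau>. The condition \<open>2 * m \<le> k\<close> keeps at least half of the k steps
  in front of every commutator. The two terms are balanced in
  \<open>limit_second_diff\<close>.\<close>

theorem second_diff_euler:
  assumes \<tau>: "\<tau> > 0" and m: "1 \<le> m" "2 * m \<le> k" "k \<le> n" and k: "real k * \<tau> \<le> t\<^sub>0" and f: "bounded_meas B f"
  shows "\<bar>(S \<tau> ^^ n) f (x + h + h') - (S \<tau> ^^ n) f (x + h) - (S \<tau> ^^ n) f (x + h') + (S \<tau> ^^ n) f x\<bar>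
    \<le> C\<^sub>1 * B * ((real m * \<tau>) powr (-2/\<alpha>) * (norm h * norm h')
         + (real k * \<tau>) powr (-1/\<alpha>) * (real m * \<tau>) powr (\<alpha>/4) * norm h)"
proof -
  define g where "g = (S \<tau> ^^ (n - k)) f"
  have g: "bounded_meas B g" unfolding g_def by (rule bounded_meas_Sk[OF \<tau> f])
  have Sg: "(S \<tau> ^^ n) f = (S \<tau> ^^ k) g" unfolding g_def by (rule S_split[OF m(3)])
  define s where "s = (real k * \<tau>) powr (-1/\<alpha>)"
  have k0: "real k * \<tau> > 0" using m \<tau> by auto
  have "real m * \<tau> \<le> real k * \<tau>" using m \<tau> by simp
  then have m1: "real m * \<tau> \<le> 1" "real m * \<tau> \<le> t\<^sub>0" using k t\<^sub>0 by auto
  define \<kappa> where "\<kappa> = (real m * \<tau>) powr (-1/\<alpha>)"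
  have \<kappa>: "\<kappa> \<ge> 1" unfolding \<kappa>_def using m \<tau> m1 by (intro powr_ge_one) auto
  have \<kappa>2: "\<kappa>\<^sup>2 = (real m * \<tau>) powr (-2/\<alpha>)"
    by (simp add: \<kappa>_def power2_eq_square powr_add[symmetric])
  have B: "B \<ge> 0" using f by (rule bounded_meas_nonneg)
  define l where "l = \<Lambda> * 2 powr (1/\<alpha>) * s"
  have l0: "l \<ge> 0" using \<Lambda> by (simp add: l_def s_def)
  define A where "A = l * C\<^sub>c * B * ((real m * \<tau>) powr (\<alpha>/4) / (\<alpha>/4))"
  define V where "V x = (S \<tau> ^^ k) g x - (S \<tau> ^^ (k - m)) (G \<tau> m g) x" for x
  have "lip (l * C\<^sub>c * B * (\<Sum>j = 1..<m. \<tau> * (real j * \<tau>) powr (\<alpha>/4 - 1))) V"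
    unfolding V_def[abs_def]
  proof (rule duhamel[OF \<tau> g l0 m(1) _ m1(1)])
    fix i :: nat and u :: "'b \<Rightarrow> real" and A assume i: "k \<le> i + m" "i + 2 \<le> k" and u: "bounded_meas A u"
    have i1: "1 \<le> i" "k \<le> 2 * i" using i m by auto
    have A: "A \<ge> 0" using u by (rule bounded_meas_nonneg)
    have "real i * \<tau> \<le> real k * \<tau>" using i \<tau> by simp
    then have "lip (\<Lambda> * (real i * \<tau>) powr (-1/\<alpha>) * A) ((S \<tau> ^^ i) u)"
      using i1 k by (intro lip_Sn[OF \<tau>] u) auto
    moreover have "real k * \<tau> \<le> 2 * (real i * \<tau>)"
      using i1 \<tau> mult_right_mono[of "real k" "2 * real i" \<tau>] by simp
    from powr_neg_le[OF k0 this] have "(real i * \<tau>) powr (-1/\<alpha>) \<le> 2 powr (1/\<alpha>) * s" by (simp add: s_def)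
    then have "\<Lambda> * (real i * \<tau>) powr (-1/\<alpha>) * A \<le> l * A"
      unfolding l_def mult.assoc using \<Lambda> A by (intro mult_left_mono mult_right_mono) (auto simp flip: mult.assoc intro: mult_right_mono)
    ultimately show "lip (l * A) ((S \<tau> ^^ i) u)" by (rule lip_mono)
  qed (use m in auto)
  moreover have "l * C\<^sub>c * B * (\<Sum>j = 1..<m. \<tau> * (real j * \<tau>) powr (\<alpha>/4 - 1)) \<le> A"
    unfolding A_def using l0 C\<^sub>c B by (intro mult_left_mono sum_le \<tau>) auto
  ultimately have V: "lip A V" by (rule lip_mono)
  define W where "W = (S \<tau> ^^ (k - m)) (G \<tau> m g)"
  have W: "second_diff (E\<^sup>2 * (C\<^sub>0 * (E\<^sup>2 + m\<^sub>\<Phi>) * B * \<kappa>\<^sup>2 + L * E * (C\<^sub>0 * E * B * \<kappa>))) W"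
    unfolding W_def
  proof (rule smooth_Sk_E(2)[OF \<tau> bounded_meas_G[OF \<tau> m(1) g] smooth_G[OF \<tau> m(1) m1(1) g, folded \<kappa>_def]])
    have "real (k - m) * \<tau> \<le> real k * \<tau>" using \<tau> by simp
    then show "real (k - m) * \<tau> \<le> 1" using k t\<^sub>0 by simp
  qed (use C\<^sub>0 E B m\<^sub>\<Phi> \<kappa> in auto)
  define K where "K = E\<^sup>2 * C\<^sub>0 * (E\<^sup>2 + m\<^sub>\<Phi> + L * E\<^sup>2)"
  have "E\<^sup>2 * (C\<^sub>0 * (E\<^sup>2 + m\<^sub>\<Phi>) * B * \<kappa>\<^sup>2 + L * E * (C\<^sub>0 * E * B * \<kappa>)) \<le> K * B * \<kappa>\<^sup>2"
  proof -
    have "\<kappa> * 1 \<le> \<kappa>\<^sup>2" using \<kappa> unfolding power2_eq_square by (intro mult_left_mono) auto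
    then have "(E\<^sup>2 * (L * E * (C\<^sub>0 * E * B))) * \<kappa> \<le> (E\<^sup>2 * (L * E * (C\<^sub>0 * E * B))) * \<kappa>\<^sup>2"
      using B C\<^sub>0 L E by (intro mult_left_mono) auto
    then show ?thesis by (simp add: K_def algebra_simps power2_eq_square)
  qed
  then have "norm (W (x + h + h') - W (x + h) - W (x + h') + W x) \<le> K * B * \<kappa>\<^sup>2 * norm h * norm h'"
    by (intro second_diffD second_diff_mono[OF W])
  \<comment> \<open>The remainder has no second difference bound, so its second difference is split
    into two increments by \<open>h\<close>; hence the second term of the claim contains
    \<open>norm h\<close> alone.\<close>
  moreover have "norm (V (x + h' + h) - V (x + h')) \<le> A * norm h" "norm (V (x + h) - V x) \<le> A * norm h"
    by (rule lipD[OF V])+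
  moreover have "(S \<tau> ^^ n) f y = V y + W y" for y by (simp add: V_def W_def Sg)
  ultimately have "\<bar>(S \<tau> ^^ n) f (x + h + h') - (S \<tau> ^^ n) f (x + h) - (S \<tau> ^^ n) f (x + h') + (S \<tau> ^^ n) f x\<bar>
    \<le> K * B * \<kappa>\<^sup>2 * norm h * norm h' + 2 * (A * norm h)"
    by (simp add: add_ac)
  also have "\<dots> = K * B * (\<kappa>\<^sup>2 * (norm h * norm h'))
     + 2 * (\<Lambda> * 2 powr (1/\<alpha>) * C\<^sub>c / (\<alpha>/4)) * B * (s * (real m * \<tau>) powr (\<alpha>/4) * norm h)"
    by (simp add: A_def l_def)
  also have "\<dots> \<le> C\<^sub>1 * B * (\<kappa>\<^sup>2 * (norm h * norm h')) + C\<^sub>1 * B * (s * (real m * \<tau>) powr (\<alpha>/4) * norm h)"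
    using \<alpha> B C\<^sub>0 L E m\<^sub>\<Phi> \<Lambda> C\<^sub>c
    by (intro add_mono mult_right_mono) (auto simp: C\<^sub>1_def K_def s_def intro!: mult_nonneg_nonneg)
  finally show ?thesis by (simp add: \<kappa>2 s_def distrib_left)
qed

end

section \<open>Convergence of the Euler scheme\<close>

text \<open>A modulus of continuity for cadlag paths: all jumps larger than e sit at finitely many
  points. Compactness enters through bisection (\<open>Bolzano\<close>). Near each point the
  one-sided limits control both sides, and the point itself is put into \<open>P\<close>. By right
  continuity the interval may be open on the left, so that r itself can lie in
  \<open>P\<close>.\<close>

lemma cadlag_partition:
  fixes g :: "real \<Rightarrow> 'c::metric_space"
  assumes g: "cadlag g" and t: "0 \<le> t" and e: "e > 0"
  obtains P where "finite P" "\<And>r s. 0 \<le> r \<Longrightarrow> r \<le> s \<Longrightarrow> s \<le> t \<Longrightarrow> P \<inter> {r<..s} = {} \<Longrightarrow> dist (g s) (g r) \<le> e"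
proof -
  \<comment> \<open>The local part of \<open>Bolzano\<close> also admits intervals that begin before
    0, where nothing is known of the path; hence the condition 0 \<le> r.\<close>
  define R where "R a b \<longleftrightarrow> (\<exists>P. finite P \<and> (\<forall>r s. 0 \<le> r \<longrightarrow> a \<le> r \<longrightarrow> r \<le> s \<longrightarrow> s \<le> b \<longrightarrow>
    P \<inter> {r<..s} = {} \<longrightarrow> dist (g s) (g r) \<le> e))" for a b
  have "R 0 t"
    using t
  proof (rule Bolzano)
    fix a b c assume trans: "R a b" "R b c" "a \<le> b" "b \<le> c"
    obtain P1 P2 where P1: "finite P1" "\<forall>r s. 0 \<le> r \<longrightarrow> a \<le> r \<longrightarrow> r \<le> s \<longrightarrow> s \<le> b \<longrightarrow> P1 \<inter> {r<..s} = {} \<longrightarrow> dist (g s) (g r) \<le> e"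
      and P2: "finite P2" "\<forall>r s. 0 \<le> r \<longrightarrow> b \<le> r \<longrightarrow> r \<le> s \<longrightarrow> s \<le> c \<longrightarrow> P2 \<inter> {r<..s} = {} \<longrightarrow> dist (g s) (g r) \<le> e"
      using trans unfolding R_def by metis
    show "R a c" unfolding R_def
    proof (intro exI[of _ "insert b (P1 \<union> P2)"] conjI allI impI)
      fix r s assume rs: "0 \<le> r" "a \<le> r" "r \<le> s" "s \<le> c" "insert b (P1 \<union> P2) \<inter> {r<..s} = {}"
      then have "s \<le> b \<or> b \<le> r" by force
      moreover have "P1 \<inter> {r<..s} = {}" "P2 \<inter> {r<..s} = {}" using rs by auto
      ultimately show "dist (g s) (g r) \<le> e" using P1(2) P2(2) rs by blast
    qed (use P1 P2 in auto)
  next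
    fix x assume local: "0 \<le> x" "x \<le> t"
    have "((\<lambda>s. g s) \<longlongrightarrow> g x) (at_right x)" using g local unfolding cadlag_def by auto
    then have "\<forall>\<^sub>F s in at_right x. dist (g s) (g x) < e / 2"
      using e by (intro tendstoD) auto
    then obtain c1 where c1: "c1 > x" "\<And>s. x < s \<Longrightarrow> s < c1 \<Longrightarrow> dist (g s) (g x) < e / 2"
      unfolding eventually_at_right_field by blast
    obtain l c2 where c2: "c2 < x" "\<And>s. 0 \<le> s \<Longrightarrow> c2 < s \<Longrightarrow> s < x \<Longrightarrow> dist (g s) l < e / 2"
    proof (cases "x = 0")
      case True then show ?thesis using that[of "-1"] by force
    next
      case False
      then obtain l where "(g \<longlongrightarrow> l) (at_left x)" using g local unfolding cadlag_def by force
      then have "\<forall>\<^sub>F s in at_left x. dist (g s) l < e / 2"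
        using e by (intro tendstoD) auto
      then show ?thesis using that unfolding eventually_at_left_field by blast
    qed
    show "\<exists>d>0. \<forall>a b. a \<le> x \<and> x \<le> b \<and> b - a < d \<longrightarrow> R a b"
    proof (intro exI[of _ "min (c1 - x) (x - c2)"] conjI allI impI)
      fix a b assume ab: "a \<le> x \<and> x \<le> b \<and> b - a < min (c1 - x) (x - c2)"
      show "R a b" unfolding R_def
      proof (intro exI[of _ "{x}"] conjI allI impI)
        fix r s assume rs: "0 \<le> r" "a \<le> r" "r \<le> s" "s \<le> b" "{x} \<inter> {r<..s} = {}"
        then consider "s < x" | "x \<le> r" by force
        then show "dist (g s) (g r) \<le> e"
        proof cases
          case 1
          have "c2 < r" "c2 < s" "r < x" "0 \<le> s" using rs ab 1 by auto
          then have "dist (g s) l < e / 2" "dist (g r) l < e / 2" using c2(2) rs 1 by blast+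
          then show ?thesis using dist_triangle2[of "g s" "g r" l] by linarith
        next
          case 2
          have "dist (g s) (g x) < e / 2" if "x \<le> s" "s \<le> b" for s
            using that ab e c1(2)[of s] by (cases "s = x") auto
          then have "dist (g s) (g x) < e / 2" "dist (g r) (g x) < e / 2" using rs 2 by auto
          then show ?thesis using dist_triangle2[of "g s" "g r" "g x"] by linarith
        qed
      qed simp
    qed (use c1 c2 in auto)
  qed
  then obtain P where "finite P"
    "\<forall>r s. 0 \<le> r \<longrightarrow> 0 \<le> r \<longrightarrow> r \<le> s \<longrightarrow> s \<le> t \<longrightarrow> P \<inter> {r<..s} = {} \<longrightarrow> dist (g s) (g r) \<le> e"
    unfolding R_def by metis
  then show ?thesis by (intro that[of P]) auto
qed

lemma cadlag_bounded:
  fixes g :: "real \<Rightarrow> 'c::real_normed_vector"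
  assumes g: "cadlag g" and t: "0 \<le> t"
  obtains B where "B \<ge> 0" "\<And>s. 0 \<le> s \<Longrightarrow> s \<le> t \<Longrightarrow> norm (g s) \<le> B"
proof -
  obtain P where P: "finite P" "\<And>r s. 0 \<le> r \<Longrightarrow> r \<le> s \<Longrightarrow> s \<le> t \<Longrightarrow> P \<inter> {r<..s} = {} \<Longrightarrow> dist (g s) (g r) \<le> 1"
    using cadlag_partition[OF g t, of 1] by auto
  \<comment> \<open>Adding 0 provides every time with a reference point on its left.\<close>
  define P' where "P' = insert 0 (P \<inter> {0..})"
  have fP': "finite P'" using P by (simp add: P'_def)
  define B where "B = (\<Sum>p\<in>P'. norm (g p)) + 1"
  have "norm (g s) \<le> B" if s: "0 \<le> s" "s \<le> t" for s
  proof -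
    define r where "r = Max (P' \<inter> {..s})"
    have ne: "P' \<inter> {..s} \<noteq> {}" "finite (P' \<inter> {..s})" using s fP' by (auto simp: P'_def)
    have r: "r \<in> P'" "r \<le> s" using Max_in[OF ne(2,1)] by (auto simp: r_def)
    then have r0: "0 \<le> r" by (auto simp: P'_def)
    have "P \<inter> {r<..s} = {}"
    proof (rule ccontr)
      assume "P \<inter> {r<..s} \<noteq> {}"
      then obtain p where "p \<in> P" "r < p" "p \<le> s" by auto
      then have "p \<le> r" unfolding r_def using ne r0 by (intro Max_ge) (auto simp: P'_def)
      then show False using \<open>r < p\<close> by simp
    qed
    then have "dist (g s) (g r) \<le> 1" using P(2) r r0 s by blast
    moreover have "norm (g r) \<le> (\<Sum>p\<in>P'. norm (g p))" using r fP' by (intro member_le_sum) auto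
    ultimately show ?thesis unfolding B_def dist_norm using norm_triangle_sub[of "g s" "g r"] by linarith
  qed
  moreover have "B \<ge> 0" by (auto simp: B_def intro!: add_nonneg_nonneg sum_nonneg)
  ultimately show ?thesis using that by blast
qed

lemma cadlag_riemann_sum:
  fixes g :: "real \<Rightarrow> 'c::euclidean_space"
  assumes g: "cadlag g" and t: "t > 0" and int: "g integrable_on {0..t}"
  defines "\<tau> \<equiv> \<lambda>n. t / real (Suc n)"
  shows "(\<lambda>n. \<Sum>k<Suc n. norm (integral {real k * \<tau> n..real (Suc k) * \<tau> n} (\<lambda>s. g s - g (real k * \<tau> n)))) \<longlonglongrightarrow> 0"
proof (rule LIMSEQ_I)
  fix e :: real assume e: "e > 0"
  obtain B where B: "B \<ge> 0" "\<And>s. 0 \<le> s \<Longrightarrow> s \<le> t \<Longrightarrow> norm (g s) \<le> B"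
    using cadlag_bounded[OF g less_imp_le[OF t]] by metis
  define d where "d = e / (2 * t)"
  have d: "d > 0" using e t by (simp add: d_def)
  obtain P where P: "finite P" "\<And>r s. 0 \<le> r \<Longrightarrow> r \<le> s \<Longrightarrow> s \<le> t \<Longrightarrow> P \<inter> {r<..s} = {} \<Longrightarrow> dist (g s) (g r) \<le> d"
    using cadlag_partition[OF g _ d, of t] t by auto
  define K where "K = 2 * B * t * card P"
  have K: "K \<ge> 0" using B t by (simp add: K_def)
  obtain N where N: "2 * K / e < real N" using reals_Archimedean2 by blast
  show "\<exists>N. \<forall>n\<ge>N. norm ((\<Sum>k<Suc n. norm (integral {real k * \<tau> n..real (Suc k) * \<tau> n} (\<lambda>s. g s - g (real k * \<tau> n)))) - 0) < e"
  proof (intro exI[of _ N] allI impI)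
    fix n assume n: "n \<ge> N"
    define u where "u = \<tau> n"
    have u: "u > 0" "real (Suc n) * u = t" using t by (auto simp: u_def \<tau>_def)
    define I where "I k = {real k * u<..real (Suc k) * u}" for k
    \<comment> \<open>Counts the points of \<open>P\<close> in the k-th cell. The cells are half
      open and hence disjoint, so these counts add up to at most \<open>card P\<close>.\<close>
    define c where "c k = (\<Sum>p\<in>P. of_bool (p \<in> I k) :: real)" for k
    have bound: "norm (integral {real k * u..real (Suc k) * u} (\<lambda>s. g s - g (real k * u))) \<le> u * (d + 2 * B * c k)"
      if k: "k < Suc n" for k
    proof -
      have ku: "0 \<le> real k * u" "real k * u \<le> real (Suc k) * u" "real (Suc k) * u \<le> t"
        using k u mult_right_mono[of "real (Suc k)" "real (Suc n)" u] by auto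
      have ig: "g integrable_on {real k * u..real (Suc k) * u}"
        by (rule integrable_on_subinterval[OF int]) (use ku in auto)
      have "norm (g s - g (real k * u)) \<le> d + 2 * B * c k" if s: "s \<in> {real k * u..real (Suc k) * u}" for s
      proof (cases "P \<inter> I k = {}")
        case True
        then have "P \<inter> {real k * u<..s} = {}" using s by (auto simp: I_def)
        then have "dist (g s) (g (real k * u)) \<le> d" using s ku by (intro P) auto
        moreover have "c k \<ge> 0" by (auto simp: c_def intro: sum_nonneg)
        ultimately show ?thesis using B by (simp add: dist_norm) (smt (verit) mult_nonneg_nonneg)
      next
        case False
        then obtain p where p: "p \<in> P" "p \<in> I k" by auto
        have "1 = (of_bool (p \<in> I k) :: real)" using p by simp
        also have "\<dots> \<le> c k" unfolding c_def using p P by (intro member_le_sum) auto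
        finally have "2 * B * 1 \<le> 2 * B * c k" using B by (intro mult_left_mono) auto
        moreover have "norm (g s - g (real k * u)) \<le> B + B"
          using s ku by (intro order_trans[OF norm_triangle_ineq4] add_mono B) auto
        ultimately show ?thesis using d by linarith
      qed
      moreover have "c k \<ge> 0" by (auto simp: c_def intro: sum_nonneg)
      ultimately have "norm (integral (cbox (real k * u) (real (Suc k) * u)) (\<lambda>s. g s - g (real k * u)))
         \<le> (d + 2 * B * c k) * measure lborel (cbox (real k * u) (real (Suc k) * u))"
        using d B ig by (intro integrable_bound) (auto intro!: integrable_diff add_nonneg_nonneg)
      also have "measure lborel (cbox (real k * u) (real (Suc k) * u)) = u" using ku by (simp add: algebra_simps)
      finally show ?thesis by (simp add: mult.commute)
    qed
    have cs: "(\<Sum>k<Suc n. c k) \<le> card P"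
    proof -
      have "(\<Sum>k<Suc n. c k) = (\<Sum>p\<in>P. \<Sum>k<Suc n. of_bool (p \<in> I k))"
        unfolding c_def by (rule sum.swap)
      also have "\<dots> \<le> (\<Sum>p\<in>P. 1)"
      proof (rule sum_mono)
        fix p
        have sub: "k = l" if "p \<in> I k" "p \<in> I l" for k l
        proof -
          have "real k * u < real (Suc l) * u" "real l * u < real (Suc k) * u" using that by (auto simp: I_def)
          then have "k < Suc l" "l < Suc k" using u by (simp_all only: mult_less_cancel_right_pos of_nat_less_iff)
          then show ?thesis by simp
        qed
        have "card {k. k < Suc n \<and> p \<in> I k} \<le> 1"
          by (rule card_le_Suc0_iff_eq[THEN iffD2, unfolded One_nat_def[symmetric]]) (use sub in auto)
        then show "(\<Sum>k<Suc n. of_bool (p \<in> I k) :: real) \<le> 1"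
          by (simp add: sum.If_cases of_bool_def Int_def del: sum.lessThan_Suc)
      qed
      also have "\<dots> = card P" by simp
      finally show ?thesis .
    qed
    have "(\<Sum>k<Suc n. norm (integral {real k * u..real (Suc k) * u} (\<lambda>s. g s - g (real k * u))))
      \<le> (\<Sum>k<Suc n. u * (d + 2 * B * c k))"
      by (intro sum_mono bound) auto
    also have "\<dots> = (real (Suc n) * u) * d + 2 * B * u * (\<Sum>k<Suc n. c k)"
      by (simp add: sum.distrib sum_distrib_left algebra_simps del: sum.lessThan_Suc)
    also have "\<dots> = t * d + 2 * B * u * (\<Sum>k<Suc n. c k)" by (simp only: u(2))
    also have "\<dots> \<le> t * d + 2 * B * u * card P"
      using B u cs by (intro add_left_mono mult_left_mono) auto
    also have "\<dots> = e / 2 + K / real (Suc n)"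
      using t by (simp add: d_def K_def u_def \<tau>_def)
    also have "\<dots> < e / 2 + e / 2"
    proof -
      have "2 * K / e < real (Suc n)" using N n by linarith
      then show ?thesis using e by (simp add: field_simps)
    qed
    finally show "norm ((\<Sum>k<Suc n. norm (integral {real k * \<tau> n..real (Suc k) * \<tau> n} (\<lambda>s. g s - g (real k * \<tau> n)))) - 0) < e"
      unfolding u_def[symmetric] by (simp add: sum_nonneg del: sum.lessThan_Suc)
  qed
qed

text \<open>The increments are an arbitrary sequence, so that the same expression serves for a fixed
  path and, with random increments, for the operator \<open>S\<close>.\<close>

primrec euler :: "('b \<Rightarrow> 'b) \<Rightarrow> real \<Rightarrow> 'b \<Rightarrow> (nat \<Rightarrow> 'b) \<Rightarrow> nat \<Rightarrow> 'b::real_vector" where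
  "euler b \<tau> x v 0 = x"
| "euler b \<tau> x v (Suc k) = euler b \<tau> x v k + \<tau> *\<^sub>R b (euler b \<tau> x v k) + v k"

lemma discrete_gronwall:
  fixes a :: "nat \<Rightarrow> real"
  assumes "a 0 \<le> 0" "\<And>k. k < n \<Longrightarrow> a (Suc k) \<le> (1 + c) * a k + r k" "c \<ge> 0" "\<And>k. r k \<ge> 0"
  shows "k \<le> n \<Longrightarrow> a k \<le> (1 + c) ^ k * (\<Sum>i<k. r i)"
proof (induction k)
  case (Suc k)
  have "1 \<le> (1 + c) ^ Suc k" using assms by (intro one_le_power) auto
  then have "1 * r k \<le> (1 + c) ^ Suc k * r k" by (rule mult_right_mono) (rule assms)
  moreover have "(1 + c) * a k \<le> (1 + c) * ((1 + c) ^ k * (\<Sum>i<k. r i))"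
    using Suc assms by (intro mult_left_mono) auto
  ultimately show ?case using assms(2)[of k] Suc.prems by (simp add: distrib_left mult.assoc)
qed (use assms in auto)

text \<open>The scheme reproduces the increments of z exactly, so the error of one step is the drift
  along the path minus its value at the left end point, integrated over the cell. X is z plus a
  continuous function, hence cadlag, and \<open>cadlag_riemann_sum\<close> makes the sum of these
  errors vanish; Gronwall's inequality propagates it.\<close>

lemma euler_converges:
  fixes X z :: "real \<Rightarrow> 'b::euclidean_space"
  assumes z: "cadlag z" and b: "lip L b" "L \<ge> 0" and t: "t > 0"
    and X: "\<And>t. t \<ge> 0 \<Longrightarrow> (\<lambda>s. b (X s)) integrable_on {0..t} \<and> X t = x + integral {0..t} (\<lambda>s. b (X s)) + z t"
    and z0: "z 0 = 0"
  defines "\<tau> \<equiv> \<lambda>n. t / real (Suc n)"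
  shows "(\<lambda>n. euler b (\<tau> n) x (\<lambda>k. z (real (Suc k) * \<tau> n) - z (real k * \<tau> n)) (Suc n)) \<longlonglongrightarrow> X t"
proof -
  define J where "J u = integral {0..u} (\<lambda>s. b (X s))" for u
  have J: "continuous_on {0..u} J" if "u \<ge> 0" for u
    unfolding J_def using X[OF that] by (intro indefinite_integral_continuous_1) auto
  have cad: "cadlag X"
    unfolding cadlag_def
  proof (intro conjI allI impI)
    fix u :: real assume u: "u \<ge> 0"
    have "continuous_on {u..u+1} J" using J[of "u + 1"] u by (auto intro: continuous_on_subset)
    then have "(J \<longlongrightarrow> J u) (at u within {u..u+1})" by (auto simp: continuous_on_def)
    then have "(J \<longlongrightarrow> J u) (at_right u)" by (simp add: at_within_Icc_at_right)
    then have "((\<lambda>s. x + J s + z s) \<longlongrightarrow> x + J u + z u) (at_right u)"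
      using z u by (intro tendsto_intros) (auto simp: cadlag_def)
    moreover have "\<forall>\<^sub>F s in at_right u. x + J s + z s = X s"
      using eventually_at_right_less[of u] u X by (auto elim!: eventually_mono simp: J_def)
    ultimately have "(X \<longlongrightarrow> x + J u + z u) (at_right u)" by (rule Lim_transform_eventually)
    then show "(X \<longlongrightarrow> X u) (at_right u)" using X[OF u] by (simp add: J_def)
  next
    fix u :: real assume u: "u > 0"
    obtain l where l: "(z \<longlongrightarrow> l) (at_left u)" using z u by (auto simp: cadlag_def)
    have "(J \<longlongrightarrow> J u) (at u within {0..u})" using J[of u] u by (auto simp: continuous_on_def)
    then have "(J \<longlongrightarrow> J u) (at_left u)" using u by (simp add: at_within_Icc_at_left)
    then have "((\<lambda>s. x + J s + z s) \<longlongrightarrow> x + J u + l) (at_left u)" by (intro tendsto_intros l)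
    moreover have "\<forall>\<^sub>F s in at_left u. x + J s + z s = X s"
      using eventually_at_left_real[OF u] X by (auto elim!: eventually_mono simp: J_def)
    ultimately show "\<exists>l. (X \<longlongrightarrow> l) (at_left u)" using Lim_transform_eventually by blast
  qed
  define g where "g s = b (X s)" for s
  have bc: "isCont b y" for y using lip_continuous[OF b(1)] by (simp add: continuous_on_eq_continuous_at)
  have g: "cadlag g"
    using cad unfolding cadlag_def g_def by (blast intro: isCont_tendsto_compose[OF bc])
  have gi: "g integrable_on {0..t}" using X[of t] t by (auto simp: g_def[abs_def])
  define \<rho> where "\<rho> n k = norm (integral {real k * \<tau> n..real (Suc k) * \<tau> n} (\<lambda>s. g s - g (real k * \<tau> n)))" for n k
  have lim: "(\<lambda>n. exp (L * t) * (\<Sum>k<Suc n. \<rho> n k)) \<longlonglongrightarrow> exp (L * t) * 0"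
    unfolding \<rho>_def \<tau>_def by (intro tendsto_mult_left cadlag_riemann_sum g t gi)
  have "norm (euler b (\<tau> n) x (\<lambda>k. z (real (Suc k) * \<tau> n) - z (real k * \<tau> n)) (Suc n) - X t)
     \<le> exp (L * t) * (\<Sum>k<Suc n. \<rho> n k)" for n
  proof -
    define u where "u = \<tau> n"
    have u: "u > 0" "real (Suc n) * u = t" using t by (auto simp: u_def \<tau>_def)
    define Y where "Y = euler b u x (\<lambda>k. z (real (Suc k) * u) - z (real k * u))"
    define a where "a k = norm (X (real k * u) - Y k)" for k
    have "a (Suc n) \<le> (1 + u * L) ^ Suc n * (\<Sum>i<Suc n. \<rho> n i)"
    proof (rule discrete_gronwall[where n = "Suc n"])
      have "X 0 = x" using X[of 0] z0 by simp
      then show "a 0 \<le> 0" by (simp add: a_def Y_def)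
    next
      fix k assume k: "k < Suc n"
      have ku: "0 \<le> real k * u" "real k * u \<le> real (Suc k) * u" "real (Suc k) * u \<le> t"
        using k u mult_right_mono[of "real (Suc k)" "real (Suc n)" u] by auto
      have ig: "g integrable_on {0..real (Suc k) * u}"
        by (rule integrable_on_subinterval[OF gi]) (use ku in auto)
      then have ig': "g integrable_on {real k * u..real (Suc k) * u}"
        by (rule integrable_on_subinterval) (use ku in auto)
      define I where "I = integral {real k * u..real (Suc k) * u} g"
      have "J (real (Suc k) * u) = J (real k * u) + I"
        unfolding J_def I_def g_def[symmetric, abs_def] using ku ig
        by (intro Henstock_Kurzweil_Integration.integral_combine[symmetric]) auto
      then have "X (real (Suc k) * u) - X (real k * u) = I + (z (real (Suc k) * u) - z (real k * u))"
        using X[of "real (Suc k) * u"] X[of "real k * u"] ku unfolding J_def[symmetric] by simp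
      then have "X (real (Suc k) * u) - Y (Suc k) = (X (real k * u) - Y k) + u *\<^sub>R (g (real k * u) - b (Y k)) + (I - u *\<^sub>R g (real k * u))"
        by (simp add: Y_def algebra_simps)
      moreover have "I - u *\<^sub>R g (real k * u) = integral {real k * u..real (Suc k) * u} (\<lambda>s. g s - g (real k * u))"
        using ig' ku by (subst Henstock_Kurzweil_Integration.integral_diff) (auto simp: I_def algebra_simps)
      then have "norm (I - u *\<^sub>R g (real k * u)) = \<rho> n k" by (simp add: \<rho>_def u_def)
      moreover have "norm (u *\<^sub>R (g (real k * u) - b (Y k))) \<le> u * (L * a k)"
        using u lipD'[OF b(1), of "X (real k * u)" "Y k"] by (simp add: g_def a_def)
      ultimately have "a (Suc k) \<le> a k + u * (L * a k) + \<rho> n k"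
        unfolding a_def[of "Suc k"]
        using norm_triangle_ineq[of "(X (real k * u) - Y k) + u *\<^sub>R (g (real k * u) - b (Y k))" "I - u *\<^sub>R g (real k * u)"]
          norm_triangle_ineq[of "X (real k * u) - Y k" "u *\<^sub>R (g (real k * u) - b (Y k))"]
        unfolding a_def[of k] by simp
      then show "a (Suc k) \<le> (1 + u * L) * a k + \<rho> n k" by (simp add: algebra_simps)
    qed (use u b in \<open>auto simp: \<rho>_def\<close>)
    also have "\<dots> \<le> exp (L * t) * (\<Sum>i<Suc n. \<rho> n i)"
    proof (intro mult_right_mono sum_nonneg)
      \<comment> \<open>Factored in this way because \<open>one_plus_power_le_exp\<close> wants a
        first factor whose product with the number of steps is at most 1; here that product is
        exactly 1.\<close>
      have "(1 + (u / t) * (L * t)) ^ Suc n \<le> exp (L * t)"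
        using u b t by (intro one_plus_power_le_exp) auto
      then show "(1 + u * L) ^ Suc n \<le> exp (L * t)" using t by simp
    qed (simp add: \<rho>_def)
    finally have "norm (X t - Y (Suc n)) \<le> exp (L * t) * (\<Sum>i<Suc n. \<rho> n i)" unfolding a_def u(2) .
    then show ?thesis unfolding Y_def u_def by (simp only: norm_minus_commute)
  qed
  then have "\<forall>\<^sub>F n in sequentially. norm (euler b (\<tau> n) x (\<lambda>k. z (real (Suc k) * \<tau> n) - z (real k * \<tau> n)) (Suc n) - X t)
     \<le> exp (L * t) * (\<Sum>k<Suc n. \<rho> n k)" by (intro always_eventually allI)
  from Lim_null_comparison[OF this lim[unfolded mult_zero_right]]
  show ?thesis by (rule LIM_zero_cancel)
qed

text \<open>That only the coordinates below k enter makes the k-th Euler point independent of the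
  k-th increment in \<open>expectation_euler\<close>.\<close>

lemma euler_measurable:
  fixes b :: "'b::euclidean_space \<Rightarrow> 'b"
  assumes [measurable]: "b \<in> borel_measurable borel"
  shows "(\<lambda>v. euler b \<tau> x v k) \<in> borel_measurable (Pi\<^sub>M {..<k} (\<lambda>_. borel))"
proof -
  have "k \<le> n \<Longrightarrow> (\<lambda>v. euler b \<tau> x v k) \<in> borel_measurable (Pi\<^sub>M {..<n} (\<lambda>_. borel))" for n
  proof (induction k)
    case (Suc k)
    then have [measurable]: "(\<lambda>v. euler b \<tau> x v k) \<in> borel_measurable (Pi\<^sub>M {..<n} (\<lambda>_. borel))" by simp
    have [measurable]: "(\<lambda>v. v k) \<in> borel_measurable (Pi\<^sub>M {..<n} (\<lambda>_. borel))"
      using Suc.prems by (intro measurable_component_singleton) auto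
    show ?case by simp
  qed simp
  then show ?thesis by blast
qed

lemma euler_cong: "(\<And>i. i < k \<Longrightarrow> v i = w i) \<Longrightarrow> euler b \<tau> x v k = euler b \<tau> x w k"
  by (induction k) auto

text \<open>The last increment is independent of the earlier ones, and integrating it out replaces f
  by \<open>S \<tau> f\<close> at the preceding Euler point. The induction therefore has to cover
  all f.\<close>

lemma (in euler_scheme) expectation_euler:
  assumes M: "prob_space M" and \<tau>: "\<tau> > 0"
    and indep: "prob_space.indep_vars M (\<lambda>_. borel) \<xi> {..<n}"
    and dist: "\<And>i. i < n \<Longrightarrow> distr M borel (\<xi> i) = \<mu> \<tau>"
  shows "k \<le> n \<Longrightarrow> bounded_meas B f \<Longrightarrow> (\<integral>\<omega>. f (euler b \<tau> x (\<lambda>i. \<xi> i \<omega>) k) \<partial>M) = (S \<tau> ^^ k) f x"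
proof (induction k arbitrary: f B)
  case 0
  then show ?case using prob_space.prob_space[OF M] by simp
next
  case (Suc k)
  interpret M: prob_space M by (rule M)
  have [measurable]: "b \<in> borel_measurable borel" by (rule lip_measurable[OF b(1)])
  have fm [measurable]: "f \<in> borel_measurable borel" and fB: "\<And>x. \<bar>f x\<bar> \<le> B"
    using Suc.prems by (auto simp: bounded_meas_def)
  define U where "U \<omega> = euler b \<tau> x (\<lambda>i. \<xi> i \<omega>) k" for \<omega>
  have "M.indep_var borel ((\<lambda>v. euler b \<tau> x v k) \<circ> (\<lambda>\<omega>. restrict (\<lambda>i. \<xi> i \<omega>) {..<k}))
      borel ((\<lambda>v. v k) \<circ> (\<lambda>\<omega>. restrict (\<lambda>i. \<xi> i \<omega>) {k}))"
    using Suc.prems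
    by (intro M.indep_var_compose[OF M.indep_var_restrict[OF indep]] euler_measurable measurable_component_singleton) auto
  also have "(\<lambda>v. v k) \<circ> (\<lambda>\<omega>. restrict (\<lambda>i. \<xi> i \<omega>) {k}) = \<xi> k" by (simp add: fun_eq_iff)
  also have "(\<lambda>v. euler b \<tau> x v k) \<circ> (\<lambda>\<omega>. restrict (\<lambda>i. \<xi> i \<omega>) {..<k}) = U"
    by (auto simp: fun_eq_iff U_def intro: euler_cong)
  finally have ind: "M.indep_var borel U borel (\<xi> k)" .
  have [measurable]: "U \<in> borel_measurable M" "\<xi> k \<in> borel_measurable M"
    using M.indep_var_rv1[OF ind] M.indep_var_rv2[OF ind] by auto
  interpret U: prob_space "distr M borel U" by (rule M.prob_space_distr) simp
  interpret \<xi>: prob_space "distr M borel (\<xi> k)" by (rule M.prob_space_distr) simp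
  interpret P: pair_prob_space "distr M borel U" "distr M borel (\<xi> k)" ..
  have "(\<integral>\<omega>. f (euler b \<tau> x (\<lambda>i. \<xi> i \<omega>) (Suc k)) \<partial>M) = (\<integral>\<omega>. f (step \<tau> (U \<omega>) + \<xi> k \<omega>) \<partial>M)"
    by (simp add: U_def step_def)
  also have "\<dots> = (\<integral>p. f (step \<tau> (fst p) + snd p) \<partial>distr M (borel \<Otimes>\<^sub>M borel) (\<lambda>\<omega>. (U \<omega>, \<xi> k \<omega>)))"
    using meas_step[of \<tau>] \<tau> by (subst integral_distr) auto
  also have "\<dots> = (\<integral>p. f (step \<tau> (fst p) + snd p) \<partial>(distr M borel U \<Otimes>\<^sub>M distr M borel (\<xi> k)))"
    using ind by (simp add: M.indep_var_distribution_eq)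
  also have "\<dots> = (\<integral>y. \<integral>z. f (step \<tau> y + z) \<partial>distr M borel (\<xi> k) \<partial>distr M borel U)"
  proof -
    have [measurable]: "step \<tau> \<in> borel_measurable borel" using \<tau> by (intro meas_step) auto
    have "integrable (distr M borel U \<Otimes>\<^sub>M distr M borel (\<xi> k)) (\<lambda>p. f (step \<tau> (fst p) + snd p))"
      by (rule P.integrable_const_bound[where B = B]) (use fB in auto)
    then show ?thesis by (subst P.integral_fst'[symmetric]) auto
  qed
  also have "\<dots> = (\<integral>y. S \<tau> f y \<partial>distr M borel U)"
    using Suc.prems by (simp add: S_def conv_op_def dist)
  also have "\<dots> = (\<integral>\<omega>. S \<tau> f (U \<omega>) \<partial>M)"
    using bounded_meas_S[OF \<tau> Suc.prems(2)] by (subst integral_distr) (auto simp: bounded_meas_def)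
  also have "\<dots> = (S \<tau> ^^ k) (S \<tau> f) x"
    unfolding U_def using Suc.prems by (intro Suc.IH[OF _ bounded_meas_S[OF \<tau>]]) auto
  also have "\<dots> = (S \<tau> ^^ Suc k) f x" by (simp add: funpow_swap1)
  finally show ?case .
qed

section \<open>Bounds for the limit of the Euler scheme\<close>

lemma floor_scale_tendsto:
  assumes "t > 0" "c \<ge> 0"
  shows "(\<lambda>n. real (nat \<lfloor>c / (t / real (Suc n))\<rfloor>) * (t / real (Suc n))) \<longlonglongrightarrow> c"
proof -
  have "norm (real (nat \<lfloor>c / (t / real (Suc n))\<rfloor>) * (t / real (Suc n)) - c) \<le> t * (1 / real (Suc n))" for n
  proof -
    define u where "u = t / real (Suc n)"
    have u: "u > 0" using assms by (simp add: u_def)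
    have f: "real (nat \<lfloor>c / u\<rfloor>) = of_int \<lfloor>c / u\<rfloor>" using u assms by simp
    have "of_int \<lfloor>c / u\<rfloor> * u \<le> c / u * u" "c / u * u \<le> (of_int \<lfloor>c / u\<rfloor> + 1) * u"
      using u by (intro mult_right_mono; linarith)+
    then have "\<bar>of_int \<lfloor>c / u\<rfloor> * u - c\<bar> \<le> u" using u by (simp add: distrib_right)
    then show ?thesis unfolding u_def[symmetric] f real_norm_def by (simp add: u_def)
  qed
  then have ev: "\<forall>\<^sub>F n in sequentially. norm (real (nat \<lfloor>c / (t / real (Suc n))\<rfloor>) * (t / real (Suc n)) - c) \<le> t * (1 / real (Suc n))"
    by (intro always_eventually allI)
  have lim: "(\<lambda>n. t * (1 / real (Suc n))) \<longlonglongrightarrow> t * 0"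
    by (intro tendsto_mult_left LIMSEQ_Suc[OF lim_1_over_n])
  show ?thesis
    by (rule LIM_zero_cancel[OF Lim_null_comparison[OF ev lim[unfolded mult_zero_right]]])
qed

context euler_scheme begin

text \<open>The bracket is the bound of \<open>second_diff_euler\<close> with intermediate time
  \<open>min t t\<^sub>0 / 2\<close>; the 4 covers increments larger than 1, for which only
  boundedness is used.\<close>

definition K\<^sub>t :: "real \<Rightarrow> real" where
  "K\<^sub>t t = C\<^sub>1 * ((min t t\<^sub>0 / 2) powr (-2/\<alpha>) + min t t\<^sub>0 powr (-1/\<alpha>) * (min t t\<^sub>0 / 2) powr (\<alpha>/4)) + 4"

lemma C\<^sub>1: "C\<^sub>1 \<ge> 0"
  unfolding C\<^sub>1_def using C\<^sub>0 E m\<^sub>\<Phi> L \<Lambda> C\<^sub>c \<alpha> by (intro add_nonneg_nonneg mult_nonneg_nonneg divide_nonneg_nonneg) auto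

context
  fixes t B f P
  assumes t: "t > 0" and f: "bounded_meas B f"
    and P: "\<And>x. (\<lambda>n. (S (t / real (Suc n)) ^^ Suc n) f x) \<longlonglongrightarrow> P x"
begin

private definition "\<tau> n = t / real (Suc n)"
private definition "t' = min t t\<^sub>0"
text \<open>The number of steps that fit into the time t'. Rounding down keeps it admissible for the
  discrete bounds, and the rounding error disappears in the limit.\<close>

private definition "k n = nat \<lfloor>t' / \<tau> n\<rfloor>"

private lemma \<tau>: "\<tau> n > 0" using t by (simp add: \<tau>_def)
private lemma t': "t' > 0" "t' \<le> t" "t' \<le> t\<^sub>0" using t t\<^sub>0 by (auto simp: t'_def)

private lemma floor_le: "c \<ge> 0 \<Longrightarrow> real (nat \<lfloor>c / \<tau> n\<rfloor>) * \<tau> n \<le> c"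
  using \<tau>[of n] mult_right_mono[OF of_int_floor_le[of "c / \<tau> n"], of "\<tau> n"] by simp

private lemma k_lim: "(\<lambda>n. real (k n) * \<tau> n) \<longlonglongrightarrow> t'"
  unfolding k_def \<tau>_def using t t' by (intro floor_scale_tendsto) auto

private lemma k_le: "k n \<le> Suc n"
proof -
  have "t' / \<tau> n \<le> t / \<tau> n" using t' \<tau> by (intro divide_right_mono) (auto simp: less_imp_le)
  also have "\<dots> = real (Suc n)" using t by (simp add: \<tau>_def)
  finally have "\<lfloor>t' / \<tau> n\<rfloor> \<le> \<lfloor>real (Suc n)\<rfloor>" by (rule floor_mono)
  then have "\<lfloor>t' / \<tau> n\<rfloor> \<le> int (Suc n)" by (simp only: floor_of_nat)
  then show ?thesis unfolding k_def by (rule nat_le_iff[THEN iffD2])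
qed

private lemma k_pos: "\<forall>\<^sub>F n in sequentially. 1 \<le> k n"
  using order_tendstoD(1)[OF k_lim t'(1)]
proof eventually_elim
  case (elim n)
  then show ?case by (cases "k n") auto
qed

lemma limit_bounded: "\<bar>P x\<bar> \<le> B"
proof (rule LIMSEQ_le_const2[OF tendsto_rabs[OF P]])
  have "bounded_meas B ((S (t / real (Suc n)) ^^ Suc n) f)" for n
    using t by (intro bounded_meas_Sk f) auto
  then show "\<exists>N. \<forall>n\<ge>N. \<bar>(S (t / real (Suc n)) ^^ Suc n) f x\<bar> \<le> B"
    by (simp only: bounded_meas_def) blast
qed

lemma limit_lip: "\<bar>P (x + h) - P x\<bar> \<le> \<Lambda> * min t t\<^sub>0 powr (-1/\<alpha>) * B * norm h"
proof -
  have "(\<lambda>n. \<Lambda> * (real (k n) * \<tau> n) powr (-1/\<alpha>) * B * norm h) \<longlonglongrightarrow> \<Lambda> * t' powr (-1/\<alpha>) * B * norm h"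
    using t' by (intro tendsto_intros k_lim) auto
  moreover have "(\<lambda>n. \<bar>(S (\<tau> n) ^^ Suc n) f (x + h) - (S (\<tau> n) ^^ Suc n) f x\<bar>) \<longlonglongrightarrow> \<bar>P (x + h) - P x\<bar>"
    unfolding \<tau>_def by (intro tendsto_intros P)
  moreover have "\<forall>\<^sub>F n in sequentially. \<bar>(S (\<tau> n) ^^ Suc n) f (x + h) - (S (\<tau> n) ^^ Suc n) f x\<bar>
     \<le> \<Lambda> * (real (k n) * \<tau> n) powr (-1/\<alpha>) * B * norm h"
    using k_pos
  proof eventually_elim
    case (elim n)
    have "real (k n) * \<tau> n \<le> t\<^sub>0" using floor_le[of t' n] t' by (simp add: k_def)
    from lipD[OF lip_euler[OF \<tau> elim k_le this f]] show ?case by simp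
  qed
  ultimately show ?thesis unfolding t'_def by (rule tendsto_le[OF trivial_limit_sequentially])
qed

text \<open>The intermediate time m \<tau> is sent to t' \<rho> / 2; the factor 1/2 together with
  \<rho> \<le> 1 ensures the condition 2 m \<le> k.\<close>

private lemma second_\<rho>:
  assumes \<rho>: "0 < \<rho>" "\<rho> \<le> 1"
  shows "\<bar>P (x + h + h') - P (x + h) - P (x + h') + P x\<bar>
    \<le> C\<^sub>1 * B * ((t' * \<rho> / 2) powr (-2/\<alpha>) * (norm h * norm h') + t' powr (-1/\<alpha>) * (t' * \<rho> / 2) powr (\<alpha>/4) * norm h)"
proof -
  define m where "m n = nat \<lfloor>(t' * \<rho> / 2) / \<tau> n\<rfloor>" for n
  have m_lim: "(\<lambda>n. real (m n) * \<tau> n) \<longlonglongrightarrow> t' * \<rho> / 2"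
    unfolding m_def \<tau>_def using t t' \<rho> by (intro floor_scale_tendsto) auto
  have "t' * \<rho> / 2 > 0" using t' \<rho> by simp
  from order_tendstoD(1)[OF m_lim this] have m_pos: "\<forall>\<^sub>F n in sequentially. 1 \<le> m n"
  proof eventually_elim
    case (elim n)
    then show ?case by (cases "m n") auto
  qed
  have m_le: "2 * m n \<le> k n" for n
  proof -
    have "real (m n) * \<tau> n \<le> t' * \<rho> / 2" unfolding m_def using t' \<rho> by (intro floor_le) auto
    also have "\<dots> \<le> t' / 2" using t' \<rho> by (simp add: mult_left_le)
    finally have "real (2 * m n) * \<tau> n \<le> t'" by simp
    then have "real (2 * m n) \<le> t' / \<tau> n" using \<tau>[of n] by (simp add: pos_le_divide_eq)
    then have "int (2 * m n) \<le> \<lfloor>t' / \<tau> n\<rfloor>" by (simp add: le_floor_iff)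
    then show ?thesis by (simp add: k_def)
  qed
  have "(\<lambda>n. C\<^sub>1 * B * ((real (m n) * \<tau> n) powr (-2/\<alpha>) * (norm h * norm h')
         + (real (k n) * \<tau> n) powr (-1/\<alpha>) * (real (m n) * \<tau> n) powr (\<alpha>/4) * norm h))
     \<longlonglongrightarrow> C\<^sub>1 * B * ((t' * \<rho> / 2) powr (-2/\<alpha>) * (norm h * norm h') + t' powr (-1/\<alpha>) * (t' * \<rho> / 2) powr (\<alpha>/4) * norm h)"
    using t' \<rho> by (intro tendsto_intros k_lim m_lim) auto
  moreover have "(\<lambda>n. \<bar>(S (\<tau> n) ^^ Suc n) f (x + h + h') - (S (\<tau> n) ^^ Suc n) f (x + h) - (S (\<tau> n) ^^ Suc n) f (x + h') + (S (\<tau> n) ^^ Suc n) f x\<bar>)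
    \<longlonglongrightarrow> \<bar>P (x + h + h') - P (x + h) - P (x + h') + P x\<bar>"
    unfolding \<tau>_def by (intro tendsto_intros P)
  moreover have "\<forall>\<^sub>F n in sequentially. \<bar>(S (\<tau> n) ^^ Suc n) f (x + h + h') - (S (\<tau> n) ^^ Suc n) f (x + h) - (S (\<tau> n) ^^ Suc n) f (x + h') + (S (\<tau> n) ^^ Suc n) f x\<bar>
    \<le> C\<^sub>1 * B * ((real (m n) * \<tau> n) powr (-2/\<alpha>) * (norm h * norm h')
         + (real (k n) * \<tau> n) powr (-1/\<alpha>) * (real (m n) * \<tau> n) powr (\<alpha>/4) * norm h)"
    using m_pos
  proof eventually_elim
    case (elim n)
    have "real (k n) * \<tau> n \<le> t\<^sub>0" using floor_le[of t' n] t' by (simp add: k_def)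
    from second_diff_euler[OF \<tau> elim m_le k_le this f] show ?case .
  qed
  ultimately show ?thesis by (rule tendsto_le[OF trivial_limit_sequentially])
qed

lemma limit_second_diff:
  "\<bar>P (x + h + h') - P (x + h) - P (x + h') + P x\<bar> \<le> K\<^sub>t t * B * (norm h + norm h') powr (1 + \<alpha>\<^sup>2/16)"
proof -
  define r where "r = norm h + norm h'"
  have B: "B \<ge> 0" using f by (rule bounded_meas_nonneg)
  have hr: "norm h \<le> r" "norm h' \<le> r" "r \<ge> 0" by (auto simp: r_def)
  define a1 a2 where "a1 = (t' / 2) powr (-2/\<alpha>)" and "a2 = t' powr (-1/\<alpha>) * (t' / 2) powr (\<alpha>/4)"
  have a: "a1 \<ge> 0" "a2 \<ge> 0" by (auto simp: a1_def a2_def)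
  have K: "K\<^sub>t t = C\<^sub>1 * (a1 + a2) + 4" by (simp add: K\<^sub>t_def t'_def a1_def a2_def)
  consider "r = 0" | "r > 1" | "0 < r" "r \<le> 1" using hr by linarith
  then show ?thesis
  proof cases
    case 1
    then have "h = 0" "h' = 0" by (auto simp: r_def add_nonneg_eq_0_iff)
    then show ?thesis by simp
  next
    case 2
    have "\<bar>P (x + h + h') - P (x + h) - P (x + h') + P x\<bar> \<le> 4 * B"
      using limit_bounded[of "x + h + h'"] limit_bounded[of "x + h"] limit_bounded[of "x + h'"] limit_bounded[of x] by linarith
    also have "\<dots> \<le> K\<^sub>t t * B" using B a C\<^sub>1 unfolding K by (intro mult_right_mono) auto
    also have "\<dots> * 1 \<le> K\<^sub>t t * B * r powr (1 + \<alpha>\<^sup>2/16)"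
      using 2 B a C\<^sub>1 unfolding K by (intro mult_left_mono ge_one_powr_ge_zero mult_nonneg_nonneg) auto
    finally show ?thesis by (simp add: r_def)
  next
    case 3
    \<comment> \<open>The balance of the two terms: the smooth part becomes of order r powr (3/2)
      and the Lipschitz remainder of order \<open>r powr (1 + \<alpha>\<^sup>2/16)\<close>. Any
      positive exponent below \<alpha>/2 would leave both powers above 1.\<close>
    define \<rho> where "\<rho> = r powr (\<alpha>/4)"
    have \<rho>: "0 < \<rho>" "\<rho> \<le> 1" using 3 \<alpha> by (auto simp: \<rho>_def powr_le1)
    have p1: "(t' * \<rho> / 2) powr (-2/\<alpha>) = a1 * r powr (-1/2)"
    proof -
      have "(t' * \<rho> / 2) powr (-2/\<alpha>) = ((t' / 2) * \<rho>) powr (-2/\<alpha>)" by (simp add: mult.commute)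
      also have "\<dots> = a1 * \<rho> powr (-2/\<alpha>)" using t' \<rho> by (simp only: powr_mult a1_def)
      also have "\<rho> powr (-2/\<alpha>) = r powr (-1/2)" using \<alpha> by (simp add: \<rho>_def powr_powr)
      finally show ?thesis .
    qed
    have p2: "t' powr (-1/\<alpha>) * (t' * \<rho> / 2) powr (\<alpha>/4) = a2 * r powr (\<alpha>\<^sup>2/16)"
    proof -
      have "(t' * \<rho> / 2) powr (\<alpha>/4) = ((t' / 2) * \<rho>) powr (\<alpha>/4)" by (simp add: mult.commute)
      also have "\<dots> = (t' / 2) powr (\<alpha>/4) * \<rho> powr (\<alpha>/4)" using t' \<rho> by (simp only: powr_mult)
      also have "\<rho> powr (\<alpha>/4) = r powr (\<alpha>\<^sup>2/16)" by (simp add: \<rho>_def powr_powr power2_eq_square)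
      finally show ?thesis by (simp add: a2_def)
    qed
    have g: "\<alpha>\<^sup>2/16 \<le> 1/2" using \<alpha> power_mono[of \<alpha> 2 2] by simp
    have q1: "r powr (-1/2) * (norm h * norm h') \<le> r powr (1 + \<alpha>\<^sup>2/16)"
    proof -
      have "r powr (-1/2) * (norm h * norm h') \<le> r powr (-1/2) * (r * r)"
        using hr by (intro mult_left_mono mult_mono) auto
      also have "r * r = r powr 2" using 3 by (simp add: powr_numeral power2_eq_square)
      also have "r powr (-1/2) * r powr 2 = r powr (3/2)" by (simp add: powr_add[symmetric])
      also have "\<dots> \<le> r powr (1 + \<alpha>\<^sup>2/16)" using 3 g by (intro powr_mono') auto
      finally show ?thesis .
    qed
    have q2: "r powr (\<alpha>\<^sup>2/16) * norm h \<le> r powr (1 + \<alpha>\<^sup>2/16)"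
    proof -
      have "r powr (\<alpha>\<^sup>2/16) * norm h \<le> r powr (\<alpha>\<^sup>2/16) * r powr 1" using hr 3 by (intro mult_left_mono) auto
      then show ?thesis by (simp only: powr_add[symmetric] add.commute)
    qed
    have "\<bar>P (x + h + h') - P (x + h) - P (x + h') + P x\<bar>
      \<le> C\<^sub>1 * B * (a1 * (r powr (-1/2) * (norm h * norm h')) + a2 * (r powr (\<alpha>\<^sup>2/16) * norm h))"
      using second_\<rho>[OF \<rho>, of x h h'] unfolding p1 p2 by (simp only: mult.assoc)
    also have "\<dots> \<le> C\<^sub>1 * B * (a1 * r powr (1 + \<alpha>\<^sup>2/16) + a2 * r powr (1 + \<alpha>\<^sup>2/16))"
      using C\<^sub>1 B a q1 q2 by (intro mult_left_mono add_mono) auto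
    also have "\<dots> = C\<^sub>1 * (a1 + a2) * (B * r powr (1 + \<alpha>\<^sup>2/16))" by (simp add: algebra_simps)
    also have "\<dots> \<le> K\<^sub>t t * (B * r powr (1 + \<alpha>\<^sup>2/16))" unfolding K using B by (intro mult_right_mono) auto
    finally show ?thesis by (simp only: r_def mult.assoc)
  qed
qed

end

text \<open>By stationarity and independence of increments the operator power is the expectation of
  f at the Euler point built from the path of Z itself. Pathwise convergence and dominated
  convergence finish the argument, and it is here that f has to be continuous.\<close>

lemma transition_limit:
  assumes M: "prob_space M" and Z: "levy_process M Z" and Z\<mu>: "\<And>t. t > 0 \<Longrightarrow> distr M borel (Z t) = \<mu> t"
    and X: "sde_solution M b Z x X" and t: "t > 0" and f: "continuous_on UNIV f" "bounded_meas B f"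
  shows "(\<lambda>n. (S (t / real (Suc n)) ^^ Suc n) f x) \<longlonglongrightarrow> (\<integral>\<omega>. f (X t \<omega>) \<partial>M)"
proof -
  interpret M: prob_space M by (rule M)
  define \<tau> where "\<tau> n = t / real (Suc n)" for n
  have \<tau>: "\<tau> n > 0" for n using t by (simp add: \<tau>_def)
  define \<xi> where "\<xi> n i \<omega> = Z (real (Suc i) * \<tau> n) \<omega> - Z (real i * \<tau> n) \<omega>" for n i \<omega>
  define F where "F n \<omega> = f (euler b (\<tau> n) x (\<lambda>i. \<xi> n i \<omega>) (Suc n))" for n \<omega>
  have Zm [measurable]: "Z s \<in> borel_measurable M" if "s \<ge> 0" for s using Z that by (simp add: levy_process_def)
  have Xm [measurable]: "X t \<in> borel_measurable M" using X t by (simp add: sde_solution_def)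
  have fm [measurable]: "f \<in> borel_measurable borel" and fB: "\<And>x. \<bar>f x\<bar> \<le> B" using f by (auto simp: bounded_meas_def)
  have bm [measurable]: "b \<in> borel_measurable borel" by (rule lip_measurable[OF b(1)])
  have \<xi>m [measurable]: "\<xi> n i \<in> borel_measurable M" for n i
    unfolding \<xi>_def[abs_def] using \<tau>[of n] by (intro borel_measurable_diff Zm) auto
  have eq: "(S (\<tau> n) ^^ Suc n) f x = (\<integral>\<omega>. F n \<omega> \<partial>M)" for n
    unfolding F_def
  proof (rule expectation_euler[OF M \<tau> _ _ order_refl f(2), symmetric])
    have "\<forall>n (s :: nat \<Rightarrow> real). 0 \<le> s 0 \<and> (\<forall>i<n. s i \<le> s (Suc i)) \<longrightarrow>
        M.indep_vars (\<lambda>_. borel) (\<lambda>i \<omega>. Z (s (Suc i)) \<omega> - Z (s i) \<omega>) {..<n}"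
      using Z unfolding levy_process_def by (elim conjE)
    from this[rule_format, of "\<lambda>i. real i * \<tau> n" "Suc n"]
    have "M.indep_vars (\<lambda>_. borel) (\<lambda>i \<omega>. Z (real (Suc i) * \<tau> n) \<omega> - Z (real i * \<tau> n) \<omega>) {..<Suc n}"
      using \<tau>[of n] by (simp add: mult_right_mono)
    then show "M.indep_vars (\<lambda>_. borel) (\<xi> n) {..<Suc n}" by (simp only: \<xi>_def[abs_def])
    fix i
    have "distr M borel (\<lambda>\<omega>. Z (real i * \<tau> n + \<tau> n) \<omega> - Z (real i * \<tau> n) \<omega>) = distr M borel (Z (\<tau> n))"
      using Z \<tau>[of n] unfolding levy_process_def by simp
    moreover have "real i * \<tau> n + \<tau> n = real (Suc i) * \<tau> n" by (simp add: algebra_simps)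
    ultimately show "distr M borel (\<xi> n i) = \<mu> (\<tau> n)" unfolding \<xi>_def[abs_def] by (simp add: Z\<mu>[OF \<tau>])
  qed
  have "(\<lambda>n. \<integral>\<omega>. F n \<omega> \<partial>M) \<longlonglongrightarrow> (\<integral>\<omega>. f (X t \<omega>) \<partial>M)"
  proof (rule integral_dominated_convergence[where w = "\<lambda>_. B"])
    show "(\<lambda>\<omega>. f (X t \<omega>)) \<in> borel_measurable M" by measurable
    have "(\<lambda>\<omega>. euler b (\<tau> n) x (\<lambda>i. \<xi> n i \<omega>) k) \<in> borel_measurable M" for n k
      by (induction k) auto
    then show "F n \<in> borel_measurable M" for n unfolding F_def by measurable
    have 1: "AE \<omega> in M. Z 0 \<omega> = 0" "AE \<omega> in M. cadlag (\<lambda>t. Z t \<omega>)" using Z by (auto simp: levy_process_def)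
    have 2: "AE \<omega> in M. \<forall>t\<ge>0. (\<lambda>s. b (X s \<omega>)) integrable_on {0..t} \<and>
        X t \<omega> = x + integral {0..t} (\<lambda>s. b (X s \<omega>)) + Z t \<omega>"
      using X by (simp add: sde_solution_def)
    from 1 2 show "AE \<omega> in M. (\<lambda>n. F n \<omega>) \<longlonglongrightarrow> f (X t \<omega>)"
    proof eventually_elim
      case (elim \<omega>)
      have "(\<lambda>n. euler b (\<tau> n) x (\<lambda>i. \<xi> n i \<omega>) (Suc n)) \<longlonglongrightarrow> X t \<omega>"
        unfolding \<tau>_def \<xi>_def by (rule euler_converges[OF elim(2) b(1) L t]) (use elim in auto)
      then show ?case unfolding F_def
        using f(1) by (intro isCont_tendsto_compose[where g = f]) (auto simp: continuous_on_eq_continuous_at)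
    qed
    show "AE \<omega> in M. norm (F n \<omega>) \<le> B" for n using fB by (simp add: F_def)
  qed simp
  then show ?thesis by (simp only: eq[symmetric] \<tau>_def)
qed

end

section \<open>Bounds for Borel functions\<close>

context
  fixes N :: "'i \<Rightarrow> 'b::metric_space measure" and I :: "'i set"
  assumes I: "finite I" and N: "\<And>i. i \<in> I \<Longrightarrow> prob_space (N i)" and sN: "\<And>i. i \<in> I \<Longrightarrow> sets (N i) = sets borel"
begin

private definition "T h = (\<Sum>i\<in>I. \<integral>x. \<bar>h x\<bar> \<partial>N i)" for h :: "'b \<Rightarrow> real"

text \<open>Membership in the closure of the bounded continuous functions under \<open>T\<close>,
  the \<open>L\<^sup>1\<close> seminorm of the sum of the given measures. The bound of the
  approximating function is left open, and is restored only in
  \<open>borel_functional_bound\<close>.\<close>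

private definition "app f \<longleftrightarrow> (\<exists>B. bounded_meas B f) \<and> (\<forall>e>0. \<exists>g B. continuous_on UNIV g \<and> bounded_meas B g \<and> T (\<lambda>x. f x - g x) < e)"
  for f :: "'b \<Rightarrow> real"

private lemma int: "i \<in> I \<Longrightarrow> bounded_meas B h \<Longrightarrow> integrable (N i) h"
proof -
  assume i: "i \<in> I" and h: "bounded_meas B h"
  interpret prob_space "N i" using N i .
  show ?thesis
    by (rule integrable_const_bound[where B = B]) (use h sN[OF i] in \<open>auto simp: bounded_meas_def cong: measurable_cong_sets\<close>)
qed

private lemma bounded_meas_abs: "bounded_meas B h \<Longrightarrow> bounded_meas B (\<lambda>x. \<bar>h x\<bar>)"
  by (auto simp: bounded_meas_def)

private lemma bounded_meas_cmult: "bounded_meas B h \<Longrightarrow> bounded_meas (\<bar>c\<bar> * B) (\<lambda>x. c * h x)"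
  by (auto simp: bounded_meas_def abs_mult intro: mult_left_mono)

private lemma T_mono:
  assumes "bounded_meas A f" "bounded_meas B g" "\<And>x. \<bar>f x\<bar> \<le> \<bar>g x\<bar>"
  shows "T f \<le> T g"
  unfolding T_def by (intro sum_mono integral_mono int[OF _ bounded_meas_abs[OF assms(1)]] int[OF _ bounded_meas_abs[OF assms(2)]] assms(3))

private lemma T_triangle:
  assumes f: "bounded_meas A f" and g: "bounded_meas B g"
  shows "T (\<lambda>x. f x + g x) \<le> T f + T g"
proof -
  have "(\<integral>x. \<bar>f x + g x\<bar> \<partial>N i) \<le> (\<integral>x. \<bar>f x\<bar> \<partial>N i) + (\<integral>x. \<bar>g x\<bar> \<partial>N i)" if i: "i \<in> I" for i
  proof -
    note ints = int[OF i bounded_meas_abs[OF f]] int[OF i bounded_meas_abs[OF g]]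
    have "(\<integral>x. \<bar>f x + g x\<bar> \<partial>N i) \<le> (\<integral>x. \<bar>f x\<bar> + \<bar>g x\<bar> \<partial>N i)"
      by (intro integral_mono int[OF i bounded_meas_abs[OF bounded_meas_add[OF f g]]] Bochner_Integration.integrable_add ints abs_triangle_ineq)
    then show ?thesis using ints by simp
  qed
  then show ?thesis unfolding T_def sum.distrib[symmetric] by (rule sum_mono)
qed

private lemma T_cmult: "T (\<lambda>x. c * f x) = \<bar>c\<bar> * T f"
  unfolding T_def by (simp add: abs_mult sum_distrib_left)

private lemma T_lim:
  assumes h: "\<And>n. bounded_meas B (h n)" and lim: "\<And>x. (\<lambda>n. h n x) \<longlonglongrightarrow> 0"
  shows "(\<lambda>n. T (h n)) \<longlonglongrightarrow> 0"
proof -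
  have "(\<lambda>n. \<integral>x. \<bar>h n x\<bar> \<partial>N i) \<longlonglongrightarrow> (\<integral>x. 0 \<partial>N i)" if i: "i \<in> I" for i
  proof (rule integral_dominated_convergence[where w = "\<lambda>_. B"])
    interpret prob_space "N i" using N i .
    show "integrable (N i) (\<lambda>_. B)" by simp
    show "AE x in N i. (\<lambda>n. \<bar>h n x\<bar>) \<longlonglongrightarrow> 0" using tendsto_rabs_zero[OF lim] by simp
    show "(\<lambda>x. \<bar>h n x\<bar>) \<in> borel_measurable (N i)" for n
      using int[OF i bounded_meas_abs[OF h]] by (rule borel_measurable_integrable)
    show "AE x in N i. norm \<bar>h n x\<bar> \<le> B" for n using h[of n] by (auto simp: bounded_meas_def)
  qed simp
  then have "(\<lambda>n. T (h n)) \<longlonglongrightarrow> (\<Sum>i\<in>I. 0)"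
    unfolding T_def by (intro tendsto_sum) simp
  then show ?thesis by simp
qed

private lemma app_bounded: "app f \<Longrightarrow> \<exists>B. bounded_meas B f" by (simp add: app_def)

private lemma app_add: assumes f: "app f" and g: "app g" shows "app (\<lambda>x. f x + g x)"
  unfolding app_def
proof (intro conjI allI impI)
  obtain A B where AB: "bounded_meas A f" "bounded_meas B g" using f g app_bounded by blast
  then show "\<exists>B. bounded_meas B (\<lambda>x. f x + g x)" using bounded_meas_add by blast
  fix e :: real assume "e > 0"
  then have "e / 2 > 0" by simp
  then obtain f' g' A' B' where f': "continuous_on UNIV f'" "bounded_meas A' f'" "T (\<lambda>x. f x - f' x) < e / 2"
    and g': "continuous_on UNIV g'" "bounded_meas B' g'" "T (\<lambda>x. g x - g' x) < e / 2"
    using f g unfolding app_def by blast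
  have "T (\<lambda>x. (f x - f' x) + (g x - g' x)) \<le> T (\<lambda>x. f x - f' x) + T (\<lambda>x. g x - g' x)"
    by (rule T_triangle[OF bounded_meas_diff[OF AB(1) f'(2)] bounded_meas_diff[OF AB(2) g'(2)]])
  moreover have "(\<lambda>x. (f x - f' x) + (g x - g' x)) = (\<lambda>x. f x + g x - (f' x + g' x))" by auto
  ultimately have "T (\<lambda>x. f x + g x - (f' x + g' x)) < e" using f' g' by simp
  moreover have "continuous_on UNIV (\<lambda>x. f' x + g' x)" using f' g' by (intro continuous_intros)
  ultimately show "\<exists>h B. continuous_on UNIV h \<and> bounded_meas B h \<and> T (\<lambda>x. f x + g x - h x) < e"
    using bounded_meas_add[OF f'(2) g'(2)] by blast
qed

private lemma app_cont: assumes "continuous_on UNIV f" "bounded_meas B f" shows "app f"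
  unfolding app_def using assms by (auto intro!: exI[of _ f] exI[of _ B] simp: T_def)

private lemma app_cmult: assumes f: "app f" shows "app (\<lambda>x. c * f x)"
proof (cases "c = 0")
  case True
  have "bounded_meas 0 (\<lambda>x::'b. 0)" by (simp add: bounded_meas_def)
  then show ?thesis using True by (auto intro: app_cont[of "\<lambda>_. 0" 0])
next
  case False
  show ?thesis
    unfolding app_def
  proof (intro conjI allI impI)
    show "\<exists>B. bounded_meas B (\<lambda>x. c * f x)" using f app_bounded bounded_meas_cmult by blast
    fix e :: real assume "e > 0"
    then have "e / \<bar>c\<bar> > 0" using False by simp
    then obtain f' A' where f': "continuous_on UNIV f'" "bounded_meas A' f'" "T (\<lambda>x. f x - f' x) < e / \<bar>c\<bar>"
      using f unfolding app_def by blast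
    have "T (\<lambda>x. c * f x - c * f' x) = \<bar>c\<bar> * T (\<lambda>x. f x - f' x)"
      unfolding T_cmult[symmetric] by (simp add: right_diff_distrib)
    also have "\<dots> < e" using f'(3) False by (simp add: field_simps)
    finally have "T (\<lambda>x. c * f x - c * f' x) < e" .
    moreover have "continuous_on UNIV (\<lambda>x. c * f' x)" using f' by (intro continuous_intros)
    ultimately show "\<exists>h B. continuous_on UNIV h \<and> bounded_meas B h \<and> T (\<lambda>x. c * f x - h x) < e"
      using bounded_meas_cmult[OF f'(2)] by blast
  qed
qed

private lemma app_sum: "finite J \<Longrightarrow> (\<And>j. j \<in> J \<Longrightarrow> app (f j)) \<Longrightarrow> app (\<lambda>x. \<Sum>j\<in>J. f j x)"
proof (induction J rule: finite_induct)
  case empty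
  have "bounded_meas 0 (\<lambda>x::'b. 0)" by (simp add: bounded_meas_def)
  then show ?case by (auto intro: app_cont[of "\<lambda>_. 0" 0])
qed (auto intro: app_add)

private lemma app_lim:
  assumes h: "\<And>n. app (h n)" and f: "bounded_meas B f" and lim: "(\<lambda>n. T (\<lambda>x. f x - h n x)) \<longlonglongrightarrow> 0"
  shows "app f"
  unfolding app_def
proof (intro conjI allI impI)
  show "\<exists>B. bounded_meas B f" using f by blast
  fix e :: real assume e: "e > 0"
  then have "\<forall>\<^sub>F n in sequentially. T (\<lambda>x. f x - h n x) < e / 2" by (intro order_tendstoD(2)[OF lim]) simp
  then obtain n where n: "T (\<lambda>x. f x - h n x) < e / 2" by (auto simp: eventually_sequentially)
  from e have "e / 2 > 0" by simp
  then obtain g A where g: "continuous_on UNIV g" "bounded_meas A g" "T (\<lambda>x. h n x - g x) < e / 2"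
    using h[of n] unfolding app_def by blast
  obtain B' where B': "bounded_meas B' (h n)" using h app_bounded by blast
  have "T (\<lambda>x. (f x - h n x) + (h n x - g x)) \<le> T (\<lambda>x. f x - h n x) + T (\<lambda>x. h n x - g x)"
    by (rule T_triangle[OF bounded_meas_diff[OF f B'] bounded_meas_diff[OF B' g(2)]])
  then have "T (\<lambda>x. f x - g x) < e" using n g by simp
  then show "\<exists>g B. continuous_on UNIV g \<and> bounded_meas B g \<and> T (\<lambda>x. f x - g x) < e" using g by blast
qed

private lemma bounded_meas_indicator: "A \<in> sets borel \<Longrightarrow> bounded_meas 1 (indicator A :: 'b \<Rightarrow> real)"
  by (auto simp: bounded_meas_def indicator_def)

text \<open>The indicator of a closed set is the pointwise limit of piecewise linear functions of
  the distance to it.\<close>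

private lemma app_closed: assumes A: "closed A" shows "app (indicator A)"
proof (cases "A = {}")
  \<comment> \<open>\<open>infdist x {}\<close> is 0 by convention, so the functions
    \<open>h\<close> used below would be constantly 1 for the empty set.\<close>
  case True
  have "bounded_meas 0 (\<lambda>x::'b. 0)" by (simp add: bounded_meas_def)
  then have "app (\<lambda>_. 0)" by (intro app_cont) auto
  moreover have "(indicator A :: 'b \<Rightarrow> real) = (\<lambda>_. 0)" using True by (simp add: fun_eq_iff)
  ultimately show ?thesis by (simp only:)
next
  case False
  define h where "h n x = max 0 (1 - real n * infdist x A)" for n and x :: 'b
  have hc: "continuous_on UNIV (h n)" for n unfolding h_def by (intro continuous_intros)
  have hb: "bounded_meas 1 (h n)" for n
    using borel_measurable_continuous_onI[OF hc] infdist_nonneg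
    by (auto simp: bounded_meas_def h_def abs_if max_def intro!: mult_nonneg_nonneg)
  have Ab: "A \<in> sets borel" using A by simp
  have "(\<lambda>n. T (\<lambda>x. indicator A x - h n x)) \<longlonglongrightarrow> 0"
  proof (rule T_lim[OF bounded_meas_diff[OF bounded_meas_indicator[OF Ab] hb]])
    fix x
    show "(\<lambda>n. indicator A x - h n x) \<longlonglongrightarrow> 0"
    proof (cases "x \<in> A")
      case True then show ?thesis by (simp add: h_def)
    next
      case False
      then have "infdist x A > 0" using A \<open>A \<noteq> {}\<close> in_closed_iff_infdist_zero infdist_nonneg by (metis less_eq_real_def)
      then obtain n0 where n0: "1 / infdist x A < real n0" using reals_Archimedean2 by blast
      have "indicator A x - h n x = 0" if "n \<ge> n0" for n
      proof -
        have "1 / infdist x A < real n" using n0 that by linarith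
        then have "1 < real n * infdist x A" using \<open>infdist x A > 0\<close> by (simp add: field_simps)
        then show ?thesis using False by (simp add: h_def)
      qed
      then show ?thesis by (intro tendsto_eventually) (auto simp: eventually_sequentially)
    qed
  qed
  then show ?thesis by (rule app_lim[OF app_cont[OF hc hb] bounded_meas_indicator[OF Ab]])
qed

text \<open>Closed sets are stable under intersection and generate the Borel sets, so by Dynkin's
  theorem only complements and countable disjoint unions have to be treated.\<close>

private lemma app_indicator: assumes A: "A \<in> sets borel" shows "app (indicator A)"
proof -
  have "Int_stable (Collect closed :: 'b set set)" by (auto simp: Int_stable_def)
  moreover have "(Collect closed :: 'b set set) \<subseteq> Pow UNIV" by simp
  moreover have "A \<in> sigma_sets UNIV (Collect closed)" using A by (simp add: borel_eq_closed)
  ultimately show ?thesis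
  proof (rule sigma_sets_induct_disjoint[where P = "\<lambda>A. app (indicator A)"])
    show "app (indicator A)" if "A \<in> Collect closed" for A using that by (simp add: app_closed)
  next
    show "app (indicator {})" by (rule app_closed) simp
  next
    fix A assume compl: "app (indicator A)"
    have "app (\<lambda>x. 1 + (-1) * indicator A x)"
      by (intro app_add app_cmult compl app_cont[of "\<lambda>_. 1" 1]) (auto simp: bounded_meas_def)
    moreover have "(\<lambda>x. 1 + (-1) * indicator A x) = (indicator (UNIV - A) :: 'b \<Rightarrow> real)"
      by (auto simp: fun_eq_iff indicator_def)
    ultimately show "app (indicator (UNIV - A))" by (simp only:)
  next
    fix A :: "nat \<Rightarrow> 'b set"
    assume union: "disjoint_family A" "range A \<subseteq> sigma_sets UNIV (Collect closed)" "\<And>i. app (indicator (A i))"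
    have Ab: "A i \<in> sets borel" for i using union(2) by (auto simp: borel_eq_closed)
    have Ub: "(\<Union>i<n. A i) \<in> sets borel" "(\<Union>i. A i) \<in> sets borel" for n using Ab by auto
    have eq: "indicator (\<Union>i<n. A i) = (\<lambda>x. \<Sum>i<n. indicator (A i) x :: real)" for n
      using union(1) by (intro ext) (auto intro!: indicator_UN_disjoint simp: disjoint_family_on_def)
    have a: "app (indicator (\<Union>i<n. A i))" for n unfolding eq by (intro app_sum union) auto
    have "(\<lambda>n. T (\<lambda>x. indicator (\<Union>i. A i) x - indicator (\<Union>i<n. A i) x)) \<longlonglongrightarrow> 0"
    proof (rule T_lim[OF bounded_meas_diff[OF bounded_meas_indicator[OF Ub(2)] bounded_meas_indicator[OF Ub(1)]]])
      fix x
      have "(\<lambda>n. indicator (\<Union>i<n. A i) x :: real) \<longlonglongrightarrow> indicator (\<Union>i. A i) x" by (rule LIMSEQ_indicator_UN)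
      from tendsto_diff[OF tendsto_const this, of "indicator (\<Union>i. A i) x"]
      show "(\<lambda>n. indicator (\<Union>i. A i) x - indicator (\<Union>i<n. A i) x :: real) \<longlonglongrightarrow> 0" by simp
    qed
    then show "app (indicator (\<Union>i. A i))" by (rule app_lim[OF a bounded_meas_indicator[OF Ub(2)]])
  qed
qed

private lemma app_borel: assumes f: "bounded_meas B f" shows "app f"
proof -
  have fm [measurable]: "f \<in> borel_measurable borel" and fB: "\<And>x. \<bar>f x\<bar> \<le> B" using f by (auto simp: bounded_meas_def)
  define J where "J n = {- \<lceil>real (Suc n) * B\<rceil> - 1..\<lceil>real (Suc n) * B\<rceil> + 1}" for n
  define A where "A n j = {x. \<lfloor>real (Suc n) * f x\<rfloor> = j}" for n j
  define h where "h n x = (\<Sum>j\<in>J n. (of_int j / real (Suc n)) * indicator (A n j) x)" for n x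
  have Ab: "A n j \<in> sets borel" for n j unfolding A_def by measurable
  have a: "app (h n)" for n unfolding h_def using Ab by (intro app_sum app_cmult app_indicator) (auto simp: J_def)
  have he: "h n x = of_int \<lfloor>real (Suc n) * f x\<rfloor> / real (Suc n)" for n x
  proof -
    have "\<bar>real (Suc n) * f x\<bar> \<le> real (Suc n) * B" unfolding abs_mult using fB by (intro mult_mono) auto
    moreover have "\<lfloor>y\<rfloor> \<in> {- \<lceil>c\<rceil> - 1..\<lceil>c\<rceil> + 1}" if "\<bar>y\<bar> \<le> c" for y c :: real
      using that by (simp add: abs_le_iff) linarith
    ultimately have "\<lfloor>real (Suc n) * f x\<rfloor> \<in> J n" unfolding J_def by blast
    then have "h n x = (\<Sum>j\<in>{\<lfloor>real (Suc n) * f x\<rfloor>}. (of_int j / real (Suc n)) * indicator (A n j) x)"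
      unfolding h_def by (intro sum.mono_neutral_right) (auto simp: J_def A_def indicator_def)
    then show ?thesis by (simp add: A_def)
  qed
  have d: "\<bar>f x - h n x\<bar> \<le> 1 / real (Suc n)" for n x
  proof -
    have "f x - h n x = (real (Suc n) * f x - of_int \<lfloor>real (Suc n) * f x\<rfloor>) / real (Suc n)"
      unfolding he by (simp add: field_simps)
    moreover have "\<bar>real (Suc n) * f x - of_int \<lfloor>real (Suc n) * f x\<rfloor>\<bar> \<le> 1" by linarith
    ultimately show ?thesis by (simp add: abs_div divide_right_mono)
  qed
  have hm: "h n \<in> borel_measurable borel" for n using app_bounded[OF a[of n]] by (auto simp: bounded_meas_def)
  have b: "bounded_meas 1 (\<lambda>x. f x - h n x)" for n
    unfolding bounded_meas_def
  proof (intro conjI allI)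
    show "(\<lambda>x. f x - h n x) \<in> borel_measurable borel" using hm by measurable
    show "\<bar>f x - h n x\<bar> \<le> 1" for x using d[of x n] by (rule order_trans) simp
  qed
  have "(\<lambda>n. T (\<lambda>x. f x - h n x)) \<longlonglongrightarrow> 0"
  proof (rule T_lim[OF b])
    fix x
    have "\<forall>\<^sub>F n in sequentially. norm (f x - h n x) \<le> 1 / real (Suc n)" using d by simp
    then show "(\<lambda>n. f x - h n x) \<longlonglongrightarrow> 0" by (rule Lim_null_comparison) (rule LIMSEQ_Suc[OF lim_1_over_n])
  qed
  then show ?thesis by (rule app_lim[OF a f])
qed

text \<open>Cutting the approximating function off at the level \<open>B\<close> does not increase
  its distance to f, and lets the hypothesis apply with the same \<open>B\<close>.\<close>

theorem borel_functional_bound: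
  assumes cont: "\<And>g. continuous_on UNIV g \<Longrightarrow> bounded_meas B g \<Longrightarrow> \<bar>\<Sum>i\<in>I. c i * (\<integral>x. g x \<partial>N i)\<bar> \<le> A"
    and f: "bounded_meas B f"
  shows "\<bar>\<Sum>i\<in>I. c i * (\<integral>x. f x \<partial>N i)\<bar> \<le> A"
proof (rule field_le_epsilon)
  fix e :: real assume e: "e > 0"
  define K where "K = 1 + (\<Sum>i\<in>I. \<bar>c i\<bar>)"
  have K: "K > 0" "\<And>i. i \<in> I \<Longrightarrow> \<bar>c i\<bar> \<le> K"
  proof -
    show "K > 0" by (auto simp: K_def intro!: add_pos_nonneg sum_nonneg)
    fix i assume "i \<in> I"
    then have "\<bar>c i\<bar> \<le> (\<Sum>i\<in>I. \<bar>c i\<bar>)" using I by (intro member_le_sum) auto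
    then show "\<bar>c i\<bar> \<le> K" by (simp add: K_def)
  qed
  from e K have "e / K > 0" by simp
  then obtain g0 A0 where g0: "continuous_on UNIV g0" "bounded_meas A0 g0" "T (\<lambda>x. f x - g0 x) < e / K"
    using app_borel[OF f] unfolding app_def by blast
  define g where "g x = max (- B) (min B (g0 x))" for x
  have B: "B \<ge> 0" using f by (rule bounded_meas_nonneg)
  have gc: "continuous_on UNIV g" unfolding g_def using g0 by (intro continuous_intros)
  have gB: "bounded_meas B g"
    using borel_measurable_continuous_onI[OF gc] B by (auto simp: bounded_meas_def g_def)
  have fB: "\<bar>f x\<bar> \<le> B" for x using f by (simp add: bounded_meas_def)
  have "\<bar>f x - g x\<bar> \<le> \<bar>f x - g0 x\<bar>" for x using fB[of x] unfolding g_def by (auto simp: max_def min_def)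
  then have Tg: "T (\<lambda>x. f x - g x) < e / K"
    using T_mono[OF bounded_meas_diff[OF f gB] bounded_meas_diff[OF f g0(2)]] g0(3) by force
  have "\<bar>(\<Sum>i\<in>I. c i * (\<integral>x. f x \<partial>N i)) - (\<Sum>i\<in>I. c i * (\<integral>x. g x \<partial>N i))\<bar>
      = \<bar>\<Sum>i\<in>I. c i * ((\<integral>x. f x \<partial>N i) - (\<integral>x. g x \<partial>N i))\<bar>"
    by (simp add: sum_subtractf right_diff_distrib)
  also have "\<dots> \<le> (\<Sum>i\<in>I. \<bar>c i * ((\<integral>x. f x \<partial>N i) - (\<integral>x. g x \<partial>N i))\<bar>)" by (rule sum_abs)
  also have "\<dots> \<le> (\<Sum>i\<in>I. K * (\<integral>x. \<bar>f x - g x\<bar> \<partial>N i))"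
  proof (rule sum_mono)
    fix i assume i: "i \<in> I"
    have "(\<integral>x. f x \<partial>N i) - (\<integral>x. g x \<partial>N i) = (\<integral>x. f x - g x \<partial>N i)"
      using int[OF i f] int[OF i gB] by simp
    then have "\<bar>(\<integral>x. f x \<partial>N i) - (\<integral>x. g x \<partial>N i)\<bar> \<le> (\<integral>x. \<bar>f x - g x\<bar> \<partial>N i)"
      by (simp add: integral_abs_bound)
    then show "\<bar>c i * ((\<integral>x. f x \<partial>N i) - (\<integral>x. g x \<partial>N i))\<bar> \<le> K * (\<integral>x. \<bar>f x - g x\<bar> \<partial>N i)"
      unfolding abs_mult using K i by (intro mult_mono) auto
  qed
  also have "\<dots> = K * T (\<lambda>x. f x - g x)" by (simp add: T_def sum_distrib_left)
  also have "\<dots> \<le> e" using Tg K by (simp add: field_simps)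
  finally show "\<bar>\<Sum>i\<in>I. c i * (\<integral>x. f x \<partial>N i)\<bar> \<le> A + e" using cont[OF gc gB] by linarith
qed

end

section \<open>The density of the gradient\<close>

text \<open>The mixture of all \<open>N n\<close> with geometric weights: every weight is positive,
  so a null set of the mixture is null for each \<open>N n\<close>, and Radon-Nikodym
  applies.\<close>

lemma common_dominating_measure:
  fixes N :: "nat \<Rightarrow> 'b::topological_space measure"
  assumes N: "\<And>n. prob_space (N n)" and sN: "\<And>n. sets (N n) = sets borel"
  obtains \<rho> p where "prob_space \<rho>" "sets \<rho> = sets borel"
    "\<And>n. p n \<in> borel_measurable borel" "\<And>n x. 0 \<le> p n x" "\<And>n. N n = density \<rho> (\<lambda>x. ennreal (p n x))"
proof -
  define \<rho> where "\<rho> = measure_pmf (geometric_pmf (1/2)) \<bind> N"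
  have meas: "N \<in> measurable (measure_pmf (geometric_pmf (1/2))) (subprob_algebra borel)"
    using prob_space_imp_subprob_space[OF N] sN by (simp add: space_subprob_algebra)
  have \<rho>: "prob_space \<rho>" unfolding \<rho>_def
    by (rule prob_space.prob_space_bind[OF measure_pmf.prob_space_axioms _ meas]) (simp add: N)
  have s\<rho>: "sets \<rho> = sets borel" unfolding \<rho>_def by (rule sets_bind) (auto simp: sN)
  have ac: "absolutely_continuous \<rho> (N n)" for n
    unfolding absolutely_continuous_def
  proof
    fix A assume "A \<in> null_sets \<rho>"
    then have A: "A \<in> sets borel" "emeasure \<rho> A = 0" using s\<rho> by auto
    have "emeasure \<rho> A = (\<integral>\<^sup>+m. emeasure (N m) A \<partial>measure_pmf (geometric_pmf (1/2)))"
      unfolding \<rho>_def by (rule emeasure_bind[OF _ meas A(1)]) simp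
    then have "AE m in measure_pmf (geometric_pmf (1/2)). emeasure (N m) A = 0"
      using A(2) by (simp add: nn_integral_0_iff_AE)
    then have "emeasure (N n) A = 0" by (simp add: AE_measure_pmf_iff set_pmf_geometric)
    then show "A \<in> null_sets (N n)" using A(1) sN[of n] by auto
  qed
  interpret \<rho>: prob_space \<rho> by (rule \<rho>)
  have "\<exists>p. p \<in> borel_measurable borel \<and> (\<forall>x. 0 \<le> p x) \<and> N n = density \<rho> (\<lambda>x. ennreal (p x))" for n
  proof -
    interpret N: prob_space "N n" by (rule N)
    obtain D where D: "D \<in> borel_measurable \<rho>" "AE x in \<rho>. RN_deriv \<rho> (N n) x = ennreal (D x)" "\<And>x. 0 \<le> D x"
      by (rule \<rho>.real_RN_deriv[OF N.finite_measure_axioms ac[of n]]) (use sN s\<rho> in auto)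
    have "N n = density \<rho> (RN_deriv \<rho> (N n))" using \<rho>.density_RN_deriv[OF ac[of n]] sN s\<rho> by simp
    also have "\<dots> = density \<rho> (\<lambda>x. ennreal (D x))" using D by (intro density_cong) auto
    finally show ?thesis using D s\<rho> by (intro exI[of _ D]) (auto cong: measurable_cong_sets)
  qed
  then obtain p where "\<And>n. p n \<in> borel_measurable borel \<and> (\<forall>x. 0 \<le> p n x) \<and> N n = density \<rho> (\<lambda>x. ennreal (p n x))"
    by metis
  then show ?thesis using that \<rho> s\<rho> by blast
qed

lemma AE_summable_if_summable_integral:
  fixes d :: "nat \<Rightarrow> 'a \<Rightarrow> real"
  assumes d: "\<And>n. integrable M (d n)" and s: "summable (\<lambda>n. \<integral>x. \<bar>d n x\<bar> \<partial>M)"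
  shows "AE x in M. summable (\<lambda>n. \<bar>d n x\<bar>)"
proof -
  have [measurable]: "d n \<in> borel_measurable M" for n using d by auto
  have "(\<integral>\<^sup>+x. (\<Sum>n. ennreal \<bar>d n x\<bar>) \<partial>M) = (\<Sum>n. \<integral>\<^sup>+x. ennreal \<bar>d n x\<bar> \<partial>M)"
    by (rule nn_integral_suminf) measurable
  also have "\<dots> = (\<Sum>n. ennreal (\<integral>x. \<bar>d n x\<bar> \<partial>M))"
    using d by (intro suminf_cong nn_integral_eq_integral) auto
  also have "\<dots> \<noteq> \<infinity>" using s by (simp add: suminf_ennreal2)
  finally have "AE x in M. (\<Sum>n. ennreal \<bar>d n x\<bar>) \<noteq> \<infinity>" by (intro nn_integral_PInf_AE) auto
  then show ?thesis
  proof eventually_elim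
    case (elim x)
    then show ?case by (intro summable_suminf_not_top) auto
  qed
qed

text \<open>Here \<open>\<nu> y\<close> stands for the law of the solution at a fixed time with
  starting point y. Both bounds are proportional to the bound \<open>B\<close> of the test function,
  so difference quotients converge uniformly over all test functions with a common bound, that is,
  in total variation.\<close>

context
  fixes \<nu> :: "'b::euclidean_space \<Rightarrow> 'b measure" and x :: 'b and \<Lambda> K \<gamma> :: real
  assumes prob: "\<And>y. prob_space (\<nu> y)" and s\<nu>: "\<And>y. sets (\<nu> y) = sets borel"
    and lipP: "\<And>B f h. bounded_meas B f \<Longrightarrow> \<bar>(\<integral>z. f z \<partial>\<nu> (x + h)) - (\<integral>z. f z \<partial>\<nu> x)\<bar> \<le> \<Lambda> * B * norm h"
    and sd: "\<And>B f h k. bounded_meas B f \<Longrightarrow>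
      \<bar>(\<integral>z. f z \<partial>\<nu> (x + h + k)) - (\<integral>z. f z \<partial>\<nu> (x + h)) - (\<integral>z. f z \<partial>\<nu> (x + k)) + (\<integral>z. f z \<partial>\<nu> x)\<bar>
        \<le> K * B * (norm h + norm k) powr (1 + \<gamma>)"
    and \<gamma>: "\<gamma> > 0" and K: "K \<ge> 0"
begin

private definition "\<theta> = (2::real) powr - \<gamma>"
private definition "K' = K / (1 - \<theta>)"

private lemma \<theta>: "0 < \<theta>" "\<theta> < 1"
  using \<gamma> powr_less_mono[of "-\<gamma>" 0 2] by (auto simp: \<theta>_def)

private lemma K': "K' \<ge> 0" using K \<theta> by (simp add: K'_def)

private lemma int_\<nu>: "bounded_meas B f \<Longrightarrow> integrable (\<nu> y) f"
proof -
  assume f: "bounded_meas B f"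
  interpret prob_space "\<nu> y" by (rule prob)
  show ?thesis
    by (rule integrable_const_bound[where B = B]) (use f s\<nu>[of y] in \<open>auto simp: bounded_meas_def cong: measurable_cong_sets\<close>)
qed

private lemma derivative:
  assumes f: "bounded_meas B f"
  obtains D where "bounded_linear D" "\<And>h. \<bar>D h\<bar> \<le> \<Lambda> * B * norm h"
    "\<And>h. \<bar>(\<integral>z. f z \<partial>\<nu> (x + h)) - (\<integral>z. f z \<partial>\<nu> x) - D h\<bar> \<le> K' * B * norm h powr (1 + \<gamma>)"
proof -
  have B: "B \<ge> 0" using f by (rule bounded_meas_nonneg)
  obtain D where D: "bounded_linear D" "\<And>h. norm (D h) \<le> \<Lambda> * B * norm h"
    "\<And>h. norm ((\<integral>z. f z \<partial>\<nu> (x + h)) - (\<integral>z. f z \<partial>\<nu> (x + 0)) - D h) \<le> K * B / (1 - 2 powr - \<gamma>) * norm h powr (1 + \<gamma>)"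
    by (rule approx_linear[OF \<gamma>, where u = "\<lambda>h. \<integral>z. f z \<partial>\<nu> (x + h)" and A = "K * B" and L = "\<Lambda> * B"])
       (use K B sd[OF f] lipP[OF f] in \<open>auto simp: add.assoc\<close>)
  show ?thesis
    by (rule that[OF D(1)]) (use D(2,3) in \<open>auto simp: K'_def \<theta>_def\<close>)
qed

private lemma derivative':
  assumes f: "bounded_meas B f"
  obtains D where "bounded_linear D"
    "\<And>h. \<bar>(\<integral>z. f z \<partial>\<nu> (x + h)) - (\<integral>z. f z \<partial>\<nu> x) - D h\<bar> \<le> K' * B * norm h powr (1 + \<gamma>)"
proof (rule derivative[OF f])
  fix D assume "bounded_linear D"
    "\<And>h. \<bar>(\<integral>z. f z \<partial>\<nu> (x + h)) - (\<integral>z. f z \<partial>\<nu> x) - D h\<bar> \<le> K' * B * norm h powr (1 + \<gamma>)"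
  then show thesis by (rule that)
qed

private definition "q i n f = 2 ^ n * ((\<integral>z. f z \<partial>\<nu> (x + (1 / 2 ^ n) *\<^sub>R i)) - (\<integral>z. f z \<partial>\<nu> x))" for i :: 'b and n :: nat and f :: "'b \<Rightarrow> real"

private lemma q_approx:
  assumes i: "i \<in> Basis" and D: "bounded_linear D"
    "\<And>h. \<bar>(\<integral>z. f z \<partial>\<nu> (x + h)) - (\<integral>z. f z \<partial>\<nu> x) - D h\<bar> \<le> K' * B * norm h powr (1 + \<gamma>)"
  shows "\<bar>q i n f - D i\<bar> \<le> K' * B * \<theta> ^ n"
proof -
  interpret D: bounded_linear D by (rule D)
  let ?h = "(1 / 2 ^ n) *\<^sub>R i"
  have "q i n f - D i = 2 ^ n * ((\<integral>z. f z \<partial>\<nu> (x + ?h)) - (\<integral>z. f z \<partial>\<nu> x) - D ?h)"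
    by (simp add: q_def D.scaleR field_simps)
  then have "\<bar>q i n f - D i\<bar> \<le> 2 ^ n * (K' * B * norm ?h powr (1 + \<gamma>))"
    using D(2)[of ?h] by (simp add: abs_mult)
  also have "norm ?h = 2 powr - real n" using i by (simp add: powr_minus powr_realpow field_simps)
  also have "2 ^ n * (K' * B * (2 powr - real n) powr (1 + \<gamma>)) = K' * B * (2 ^ n * (2 powr - real n) powr (1 + \<gamma>))" by simp
  also have "2 ^ n * (2 powr - real n) powr (1 + \<gamma>) = \<theta> ^ n"
    unfolding \<theta>_def by (simp add: powr_powr powr_realpow[symmetric] powr_power powr_add[symmetric] algebra_simps)
  finally show ?thesis .
qed

private lemma q_lim:
  assumes i: "i \<in> Basis" and D: "bounded_linear D"
    "\<And>h. \<bar>(\<integral>z. f z \<partial>\<nu> (x + h)) - (\<integral>z. f z \<partial>\<nu> x) - D h\<bar> \<le> K' * B * norm h powr (1 + \<gamma>)"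
  shows "(\<lambda>n. q i n f) \<longlonglongrightarrow> D i"
proof -
  have "\<forall>\<^sub>F n in sequentially. norm (q i n f - D i) \<le> K' * B * \<theta> ^ n" using q_approx[OF assms] by simp
  moreover have "(\<lambda>n. K' * B * \<theta> ^ n) \<longlonglongrightarrow> 0" using \<theta> by (intro tendsto_mult_right_zero LIMSEQ_power_zero) auto
  ultimately have "(\<lambda>n. q i n f - D i) \<longlonglongrightarrow> 0" by (rule Lim_null_comparison)
  then show ?thesis by (rule LIM_zero_cancel)
qed

text \<open>The dyadic difference quotients of \<open>\<nu>\<close> are a Cauchy sequence in total variation. Their densities with
  respect to a common dominating measure therefore converge in \<open>L\<^sup>1\<close>, and the limit is absolutely continuous
  with respect to \<open>\<nu> x\<close>: if \<open>f \<ge> 0\<close> vanishes \<open>\<nu> x\<close>-almost everywhere, then \<open>y \<mapsto> \<integral> f d(\<nu> y)\<close> has its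
  minimum at \<open>x\<close>, so its derivative there is \<open>0\<close>.\<close>

private lemma density_component:
  assumes i: "i \<in> Basis"
  obtains y where "y \<in> borel_measurable borel" "integrable (\<nu> x) y" "(\<integral>z. \<bar>y z\<bar> \<partial>\<nu> x) \<le> \<Lambda>"
    "\<And>B f. bounded_meas B f \<Longrightarrow> (\<lambda>n. q i n f) \<longlonglongrightarrow> (\<integral>z. f z * y z \<partial>\<nu> x)"
proof -
  \<comment> \<open>Index 0 is the law at \<open>x\<close>, and index n + 1 the law at
    \<open>x\<close> shifted by 2 powr (-n) along \<open>i\<close>; the densities \<open>p\<close>
    keep this offset.\<close>
  define N where "N n = (case n of 0 \<Rightarrow> \<nu> x | Suc n \<Rightarrow> \<nu> (x + (1 / 2 ^ n) *\<^sub>R i))" for n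
  obtain \<rho> p where \<rho>: "prob_space \<rho>" and s\<rho> [measurable_cong]: "sets \<rho> = sets borel"
    and pm [measurable]: "\<And>n. p n \<in> borel_measurable borel" and p0: "\<And>n x. 0 \<le> p n x"
    and pN: "\<And>n. N n = density \<rho> (\<lambda>x. ennreal (p n x))"
    by (rule common_dominating_measure[of N]) (auto simp: N_def prob s\<nu> split: nat.split)
  interpret \<rho>: prob_space \<rho> by (rule \<rho>)
  have N0: "\<nu> x = density \<rho> (p 0)" and NS: "\<nu> (x + (1 / 2 ^ n) *\<^sub>R i) = density \<rho> (p (Suc n))" for n
    using pN[of 0] pN[of "Suc n"] by (auto simp: N_def)
  have ip: "integrable \<rho> (\<lambda>z. p n z * f z)" if f: "bounded_meas B f" for n B f
  proof -
    have fm: "f \<in> borel_measurable \<rho>" using f by (simp add: bounded_meas_def measurable_cong_sets[OF s\<rho> refl])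
    have "integrable (N n) f" using int_\<nu>[OF f] by (auto simp: N_def split: nat.split)
    then have "integrable (density \<rho> (p n)) f" by (simp add: pN)
    then show ?thesis using p0 by (subst (asm) integrable_density[OF fm]) auto
  qed
  have ifp: "(\<integral>z. f z \<partial>density \<rho> (p n)) = (\<integral>z. p n z * f z \<partial>\<rho>)" if f: "bounded_meas B f" for n B f
    using f p0 by (subst integral_density) (auto simp: bounded_meas_def measurable_cong_sets[OF s\<rho> refl])
  \<comment> \<open>The signed density of the n-th difference quotient; \<open>d\<close> will be its
    increments.\<close>
  define r where "r n z = 2 ^ n * (p (Suc n) z - p 0 z)" for n :: nat and z
  define d where "d n z = r (Suc n) z - r n z" for n :: nat and z
  have [measurable]: "r n \<in> borel_measurable borel" "d n \<in> borel_measurable borel" for n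
    unfolding r_def d_def by measurable
  have ir: "integrable \<rho> (\<lambda>z. f z * r n z)" "(\<integral>z. f z * r n z \<partial>\<rho>) = q i n f" if f: "bounded_meas B f" for n B f
  proof -
    have eq: "(\<lambda>z. f z * r n z) = (\<lambda>z. 2 ^ n * (p (Suc n) z * f z - p 0 z * f z))"
      by (simp add: r_def algebra_simps)
    show "integrable \<rho> (\<lambda>z. f z * r n z)" unfolding eq
      by (intro integrable_mult_right Bochner_Integration.integrable_diff ip[OF f])
    show "(\<integral>z. f z * r n z \<partial>\<rho>) = q i n f"
      unfolding eq using ip[OF f, of "Suc n"] ip[OF f, of 0] by (simp add: q_def NS N0 ifp[OF f])
  qed
  have id: "integrable \<rho> (\<lambda>z. f z * d n z)" "(\<integral>z. f z * d n z \<partial>\<rho>) = q i (Suc n) f - q i n f" if f: "bounded_meas B f" for n B f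
    using ir[OF f, of "Suc n"] ir[OF f, of n] by (simp_all add: d_def right_diff_distrib)
  have one: "bounded_meas 1 (\<lambda>_. 1 :: real)" by (simp add: bounded_meas_def)
  have sgn_bm: "bounded_meas 1 (\<lambda>z. sgn (g z))" if "g \<in> borel_measurable borel" for g :: "'b \<Rightarrow> real"
    using that by (auto simp: bounded_meas_def abs_sgn_eq)
  have id1: "integrable \<rho> (d n)" "integrable \<rho> (r n)" for n using id(1)[OF one, of n] ir(1)[OF one, of n] by simp_all
  have dn: "(\<integral>z. \<bar>d n z\<bar> \<partial>\<rho>) \<le> 2 * K' * \<theta> ^ n" for n
  proof -
    \<comment> \<open>Tested with its own sign, \<open>d n\<close> yields its
      \<open>L\<^sup>1\<close> norm as the difference of two quotients of one bounded function, and
      both are close to the same derivative. That this function depends on n does no harm, since the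
      rate depends on its bound only.\<close>
    have sb: "bounded_meas 1 (\<lambda>z. sgn (d n z))" by (intro sgn_bm) measurable
    obtain D where D: "bounded_linear D"
      "\<And>h. \<bar>(\<integral>z. sgn (d n z) \<partial>\<nu> (x + h)) - (\<integral>z. sgn (d n z) \<partial>\<nu> x) - D h\<bar> \<le> K' * 1 * norm h powr (1 + \<gamma>)"
      by (rule derivative'[OF sb]) (rule that; blast)
    have "(\<integral>z. \<bar>d n z\<bar> \<partial>\<rho>) = (\<integral>z. sgn (d n z) * d n z \<partial>\<rho>)" by (simp add: sgn_mult_self_eq[symmetric] abs_sgn mult.commute)
    also have "\<dots> = q i (Suc n) (\<lambda>z. sgn (d n z)) - q i n (\<lambda>z. sgn (d n z))" by (rule id(2)[OF sb])
    also have "\<dots> \<le> K' * 1 * \<theta> ^ Suc n + K' * 1 * \<theta> ^ n"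
      using q_approx[OF i D, of "Suc n"] q_approx[OF i D, of n] by linarith
    also have "\<dots> \<le> 2 * K' * \<theta> ^ n"
      using mult_left_mono[of "\<theta> ^ Suc n" "\<theta> ^ n" K'] K' \<theta> by (simp add: mult_left_le_one_le)
    finally show ?thesis .
  qed
  have sum_d: "summable (\<lambda>n. \<integral>z. \<bar>d n z\<bar> \<partial>\<rho>)"
    by (rule summable_comparison_test'[of "\<lambda>n. 2 * K' * \<theta> ^ n" 0])
       (use dn \<theta> in \<open>auto intro!: summable_mult summable_geometric\<close>)
  have ae: "AE z in \<rho>. summable (\<lambda>n. \<bar>d n z\<bar>)" by (rule AE_summable_if_summable_integral[OF id1(1) sum_d])
  define R where "R z = r 0 z + (\<Sum>n. d n z)" for z
  have Rm [measurable]: "R \<in> borel_measurable borel" unfolding R_def by measurable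
  have fR: "integrable \<rho> (\<lambda>z. f z * R z)" "(\<lambda>n. q i n f) \<longlonglongrightarrow> (\<integral>z. f z * R z \<partial>\<rho>)" if f: "bounded_meas B f" for f B
  proof -
    have fB: "\<bar>f z\<bar> \<le> B" for z using f by (simp add: bounded_meas_def)
    have [measurable]: "f \<in> borel_measurable borel" using f by (simp add: bounded_meas_def)
    have B: "B \<ge> 0" using f by (rule bounded_meas_nonneg)
    have 1: "AE z in \<rho>. summable (\<lambda>n. norm (f z * d n z))"
      using ae by eventually_elim (simp add: abs_mult summable_mult)
    have "(\<integral>z. norm (f z * d n z) \<partial>\<rho>) \<le> B * (\<integral>z. \<bar>d n z\<bar> \<partial>\<rho>)" for n
    proof -
      have "(\<integral>z. norm (f z * d n z) \<partial>\<rho>) \<le> (\<integral>z. B * \<bar>d n z\<bar> \<partial>\<rho>)"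
      proof (rule integral_mono)
        show "integrable \<rho> (\<lambda>z. norm (f z * d n z))" using id(1)[OF f] by (rule integrable_norm)
        show "integrable \<rho> (\<lambda>z. B * \<bar>d n z\<bar>)" using id1(1) by simp
        show "norm (f z * d n z) \<le> B * \<bar>d n z\<bar>" for z
          unfolding real_norm_def abs_mult by (intro mult_right_mono fB) simp
      qed
      then show ?thesis by simp
    qed
    then have 2: "summable (\<lambda>n. \<integral>z. norm (f z * d n z) \<partial>\<rho>)"
      by (intro summable_comparison_test'[OF summable_mult[OF sum_d, of B], of 0]) auto
    note s = integrable_suminf[OF id(1)[OF f] 1 2] sums_integral[OF id(1)[OF f] 1 2]
    have eq: "AE z in \<rho>. f z * r 0 z + (\<Sum>n. f z * d n z) = f z * R z"
      using ae
    proof eventually_elim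
      case (elim z)
      then have "summable (\<lambda>n. d n z)" by (rule summable_rabs_cancel)
      then show ?case by (simp add: R_def distrib_left suminf_mult)
    qed
    have i: "integrable \<rho> (\<lambda>z. f z * r 0 z + (\<Sum>n. f z * d n z))"
      by (intro Bochner_Integration.integrable_add s ir(1)[OF f])
    show "integrable \<rho> (\<lambda>z. f z * R z)"
      by (rule Bochner_Integration.integrable_cong_AE_imp[OF i _ ]) (use eq in auto)
    have "(\<lambda>n. (\<Sum>k<n. q i (Suc k) f - q i k f)) \<longlonglongrightarrow> (\<integral>z. (\<Sum>n. f z * d n z) \<partial>\<rho>)"
      using s(2) unfolding id(2)[OF f] sums_def .
    moreover have "(\<Sum>k<n. q i (Suc k) f - q i k f) = q i n f - q i 0 f" for n
      by (rule sum_lessThan_telescope)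
    ultimately have "(\<lambda>n. q i 0 f + (q i n f - q i 0 f)) \<longlonglongrightarrow> q i 0 f + (\<integral>z. (\<Sum>n. f z * d n z) \<partial>\<rho>)"
      by (intro tendsto_add tendsto_const) simp
    also have "q i 0 f + (\<integral>z. (\<Sum>n. f z * d n z) \<partial>\<rho>) = (\<integral>z. f z * r 0 z + (\<Sum>n. f z * d n z) \<partial>\<rho>)"
      using s(1) ir[OF f, of 0] by simp
    also have "\<dots> = (\<integral>z. f z * R z \<partial>\<rho>)" using eq by (intro integral_cong_AE) auto
    finally show "(\<lambda>n. q i n f) \<longlonglongrightarrow> (\<integral>z. f z * R z \<partial>\<rho>)" by simp
  qed
  have iR: "integrable \<rho> R" using fR(1)[OF one] by simp
  have D_eq: "D i = (\<integral>z. f z * R z \<partial>\<rho>)" if f: "bounded_meas B f" and D: "bounded_linear D"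
    "\<And>h. \<bar>(\<integral>z. f z \<partial>\<nu> (x + h)) - (\<integral>z. f z \<partial>\<nu> x) - D h\<bar> \<le> K' * B * norm h powr (1 + \<gamma>)" for D f B
    using LIMSEQ_unique[OF q_lim[OF i D] fR(2)[OF f]] .
  have nul: "(\<integral>z. f z * R z \<partial>\<rho>) = 0"
    if f: "bounded_meas 1 f" "\<And>z. f z \<ge> 0" "\<And>z. p 0 z \<noteq> 0 \<Longrightarrow> f z = 0" for f
  proof -
    obtain D where D: "bounded_linear D"
      "\<And>h. \<bar>(\<integral>z. f z \<partial>\<nu> (x + h)) - (\<integral>z. f z \<partial>\<nu> x) - D h\<bar> \<le> K' * 1 * norm h powr (1 + \<gamma>)"
      by (rule derivative'[OF f(1)]) (rule that; blast)
    interpret D: bounded_linear D by (rule D)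
    have "(\<lambda>z. p 0 z * f z) = (\<lambda>_. 0)" using f(3) by (auto simp: fun_eq_iff)
    then have z: "(\<integral>z. f z \<partial>\<nu> x) = 0" unfolding N0 ifp[OF f(1)] by simp
    have ge: "(\<integral>z. f z \<partial>\<nu> (x + h)) \<ge> 0" for h using f(2) by (intro integral_nonneg_AE) auto
    have le: "- D h \<le> K' * norm h powr (1 + \<gamma>)" for h using D(2)[of h] ge[of h] z by linarith
    have lim: "(\<lambda>n. K' * \<theta> ^ n) \<longlonglongrightarrow> 0" using \<theta> by (intro tendsto_mult_right_zero LIMSEQ_power_zero) auto
    have bound: "- D h \<le> K' * \<theta> ^ n" if "norm h = 1" for h n
    proof -
      have "- D ((1 / 2 ^ n) *\<^sub>R h) \<le> K' * (2 powr - real n) powr (1 + \<gamma>)"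
        using le[of "(1 / 2 ^ n) *\<^sub>R h"] that by (simp add: powr_minus powr_realpow divide_inverse)
      then have "2 ^ n * (- D ((1 / 2 ^ n) *\<^sub>R h)) \<le> 2 ^ n * (K' * (2 powr - real n) powr (1 + \<gamma>))"
        by (intro mult_left_mono) auto
      moreover have "2 ^ n * (2 powr - real n) powr (1 + \<gamma>) = \<theta> ^ n"
        unfolding \<theta>_def by (simp add: powr_powr powr_realpow[symmetric] powr_power powr_add[symmetric] algebra_simps)
      ultimately show ?thesis by (simp add: D.scaleR mult.left_commute)
    qed
    have "- D h \<le> 0" if "norm h = 1" for h
      by (rule LIMSEQ_le_const[OF lim]) (use bound[OF that] in auto)
    from this[of i] this[of "- i"] have "D i = 0" using i by (simp add: D.neg)
    then show ?thesis using D_eq[OF f(1) D] by simp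
  qed
  have R0: "AE z in \<rho>. p 0 z = 0 \<longrightarrow> R z = 0"
  proof -
    \<comment> \<open>For c = 1 and c = -1 this selects the positive and the negative part of
      \<open>R\<close> on the zero set of \<open>p 0\<close>; both integrals vanish by
      \<open>nul\<close>.\<close>
    define f where "f c z = (if p 0 z = 0 \<and> c * R z > 0 then 1 else 0 :: real)" for c z
    have fm: "f c \<in> borel_measurable borel" for c unfolding f_def by measurable
    have f: "bounded_meas 1 (f c)" for c
      unfolding bounded_meas_def using fm[of c] by (simp add: f_def)
    have "(\<integral>z. f c z * R z \<partial>\<rho>) = 0" for c
      by (rule nul[OF f]) (auto simp: f_def)
    then have "(\<integral>z. f 1 z * R z - f (-1) z * R z \<partial>\<rho>) = 0" using fR(1)[OF f[of 1]] fR(1)[OF f[of "-1"]] by simp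
    moreover have "f 1 z * R z - f (-1) z * R z = (if p 0 z = 0 then \<bar>R z\<bar> else 0)" for z by (auto simp: f_def)
    ultimately have "(\<integral>z. (if p 0 z = 0 then \<bar>R z\<bar> else 0) \<partial>\<rho>) = 0" by simp
    moreover have "integrable \<rho> (\<lambda>z. if p 0 z = 0 then \<bar>R z\<bar> else 0)"
      by (rule Bochner_Integration.integrable_bound[OF iR]) auto
    ultimately have "AE z in \<rho>. (if p 0 z = 0 then \<bar>R z\<bar> else 0) = 0"
      by (subst (asm) integral_nonneg_eq_0_iff_AE) auto
    then show ?thesis by eventually_elim auto
  qed
  \<comment> \<open>Where \<open>p 0\<close> vanishes the quotient is 0 by convention, in agreement
    with \<open>R0\<close>.\<close>
  define y where "y z = R z / p 0 z" for z
  have ym [measurable]: "y \<in> borel_measurable borel" unfolding y_def by measurable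
  have py: "AE z in \<rho>. p 0 z * (f z * y z) = f z * R z" for f :: "'b \<Rightarrow> real"
    using R0 by eventually_elim (auto simp: y_def)
  have iy: "(\<integral>z. f z * y z \<partial>\<nu> x) = (\<integral>z. f z * R z \<partial>\<rho>)" if f: "bounded_meas B f" for f B
  proof -
    have [measurable]: "f \<in> borel_measurable borel" using f by (simp add: bounded_meas_def)
    have "(\<integral>z. f z * y z \<partial>\<nu> x) = (\<integral>z. p 0 z * (f z * y z) \<partial>\<rho>)"
      unfolding N0 using p0 by (subst integral_density) auto
    also have "\<dots> = (\<integral>z. f z * R z \<partial>\<rho>)" by (intro integral_cong_AE py) measurable
    finally show ?thesis .
  qed
  show ?thesis
  proof (rule that[OF ym])
    have "integrable \<rho> (\<lambda>z. p 0 z * (1 * y z))"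
      by (rule Bochner_Integration.integrable_cong_AE_imp[OF fR(1)[OF one]]) (use py[of "\<lambda>_. 1"] in auto)
    then show "integrable (\<nu> x) y" unfolding N0 using p0 by (subst integrable_density) auto
    \<comment> \<open>Duality again: the \<open>L\<^sup>1\<close> norm of \<open>y\<close> is the
      derivative in direction \<open>i\<close> for a test function bounded by 1.\<close>
    have sb: "bounded_meas 1 (\<lambda>z. sgn (y z))" by (intro sgn_bm) measurable
    obtain D where D: "bounded_linear D" "\<And>h. \<bar>D h\<bar> \<le> \<Lambda> * 1 * norm h"
      "\<And>h. \<bar>(\<integral>z. sgn (y z) \<partial>\<nu> (x + h)) - (\<integral>z. sgn (y z) \<partial>\<nu> x) - D h\<bar> \<le> K' * 1 * norm h powr (1 + \<gamma>)"
      by (rule derivative[OF sb]) (rule that; blast)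
    have "(\<integral>z. \<bar>y z\<bar> \<partial>\<nu> x) = (\<integral>z. sgn (y z) * y z \<partial>\<nu> x)" by (simp add: abs_sgn mult.commute)
    also have "\<dots> = D i" by (simp add: iy[OF sb] D_eq[OF sb D(1,3)])
    also have "\<dots> \<le> \<Lambda>" using D(2)[of i] i by simp
    finally show "(\<integral>z. \<bar>y z\<bar> \<partial>\<nu> x) \<le> \<Lambda>" .
    show "(\<lambda>n. q i n f) \<longlonglongrightarrow> (\<integral>z. f z * y z \<partial>\<nu> x)" if "bounded_meas B f" for B f
      unfolding iy[OF that] by (rule fR(2)[OF that])
  qed
qed

text \<open>\<open>derivative\<close> already gives a total derivative for each test function, with
  remainder of order norm h powr (1 + \<gamma>). It remains to assemble the coordinate densities
  into one vector independent of f; summing their norms produces the factor DIM('b).\<close>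

theorem gradient_density:
  obtains y where "y \<in> borel_measurable borel" "integrable (\<nu> x) y" "(\<integral>z. norm (y z) \<partial>\<nu> x) \<le> DIM('b) * \<Lambda>"
    "\<And>B f. bounded_meas B f \<Longrightarrow> GDERIV (\<lambda>x. \<integral>z. f z \<partial>\<nu> x) x :> (\<integral>z. f z *\<^sub>R y z \<partial>\<nu> x)"
proof -
  note s\<nu> [measurable_cong]
  have "\<forall>i\<in>Basis. \<exists>y. y \<in> borel_measurable borel \<and> integrable (\<nu> x) y \<and> (\<integral>z. \<bar>y z\<bar> \<partial>\<nu> x) \<le> \<Lambda> \<and>
    (\<forall>B f. bounded_meas B f \<longrightarrow> (\<lambda>n. q i n f) \<longlonglongrightarrow> (\<integral>z. f z * y z \<partial>\<nu> x))"
    by (metis density_component)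
  from bchoice[OF this] obtain Y where Y': "\<forall>i\<in>Basis. Y i \<in> borel_measurable borel \<and> integrable (\<nu> x) (Y i) \<and>
    (\<integral>z. \<bar>Y i z\<bar> \<partial>\<nu> x) \<le> \<Lambda> \<and> (\<forall>B f. bounded_meas B f \<longrightarrow> (\<lambda>n. q i n f) \<longlonglongrightarrow> (\<integral>z. f z * Y i z \<partial>\<nu> x))" ..
  have Y: "\<And>i. i \<in> Basis \<Longrightarrow> Y i \<in> borel_measurable borel" "\<And>i. i \<in> Basis \<Longrightarrow> integrable (\<nu> x) (Y i)"
    "\<And>i. i \<in> Basis \<Longrightarrow> (\<integral>z. \<bar>Y i z\<bar> \<partial>\<nu> x) \<le> \<Lambda>"
    "\<And>i B f. i \<in> Basis \<Longrightarrow> bounded_meas B f \<Longrightarrow> (\<lambda>n. q i n f) \<longlonglongrightarrow> (\<integral>z. f z * Y i z \<partial>\<nu> x)"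
    using Y' by blast+
  define y where "y z = (\<Sum>i\<in>Basis. Y i z *\<^sub>R i)" for z
  have ym [measurable]: "y \<in> borel_measurable borel"
    unfolding y_def using Y(1) by (intro borel_measurable_sum borel_measurable_scaleR) auto
  have iy: "integrable (\<nu> x) y" unfolding y_def by (intro Bochner_Integration.integrable_sum integrable_scaleR_left Y)
  have yi: "y z \<bullet> i = Y i z" if "i \<in> Basis" for i z using that by (simp add: y_def)
  show ?thesis
  proof (rule that[OF ym iy])
    have "(\<integral>z. norm (y z) \<partial>\<nu> x) \<le> (\<integral>z. (\<Sum>i\<in>Basis. \<bar>Y i z\<bar>) \<partial>\<nu> x)"
    proof (rule integral_mono)
      show "integrable (\<nu> x) (\<lambda>z. norm (y z))" using iy by simp
      show "integrable (\<nu> x) (\<lambda>z. \<Sum>i\<in>Basis. \<bar>Y i z\<bar>)" using Y(2) by simp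
      show "norm (y z) \<le> (\<Sum>i\<in>Basis. \<bar>Y i z\<bar>)" for z
        using norm_le_l1[of "y z"] by (simp add: yi cong: sum.cong)
    qed
    also have "\<dots> = (\<Sum>i\<in>Basis. \<integral>z. \<bar>Y i z\<bar> \<partial>\<nu> x)" using Y(2) by (subst Bochner_Integration.integral_sum) auto
    also have "\<dots> \<le> (\<Sum>i\<in>(Basis::'b set). \<Lambda>)" by (intro sum_mono Y)
    finally show "(\<integral>z. norm (y z) \<partial>\<nu> x) \<le> DIM('b) * \<Lambda>" by simp
  next
    fix B and f :: "'b \<Rightarrow> real" assume f: "bounded_meas B f"
    have fB: "\<bar>f z\<bar> \<le> B" for z using f by (simp add: bounded_meas_def)
    have [measurable]: "f \<in> borel_measurable borel" using f by (simp add: bounded_meas_def)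
    have B: "B \<ge> 0" using f by (rule bounded_meas_nonneg)
    obtain D where D: "bounded_linear D"
      "\<And>h. \<bar>(\<integral>z. f z \<partial>\<nu> (x + h)) - (\<integral>z. f z \<partial>\<nu> x) - D h\<bar> \<le> K' * B * norm h powr (1 + \<gamma>)"
      by (rule derivative'[OF f]) (rule that; blast)
    interpret D: bounded_linear D by (rule D)
    have int: "integrable (\<nu> x) (\<lambda>z. f z *\<^sub>R y z)"
    proof (rule Bochner_Integration.integrable_bound[of _ "\<lambda>z. B * norm (y z)"])
      show "integrable (\<nu> x) (\<lambda>z. B * norm (y z))" using iy by simp
      show "AE z in \<nu> x. norm (f z *\<^sub>R y z) \<le> norm (B * norm (y z))"
        using fB B by (auto intro!: mult_right_mono)
    qed measurable
    have Dh: "D h = h \<bullet> (\<integral>z. f z *\<^sub>R y z \<partial>\<nu> x)" for h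
    proof -
      have Di: "D i = i \<bullet> (\<integral>z. f z *\<^sub>R y z \<partial>\<nu> x)" if i: "i \<in> Basis" for i
      proof -
        have "D i = (\<integral>z. f z * Y i z \<partial>\<nu> x)" by (rule LIMSEQ_unique[OF q_lim[OF i D] Y(4)[OF i f]])
        also have "\<dots> = (\<integral>z. i \<bullet> (f z *\<^sub>R y z) \<partial>\<nu> x)" by (simp add: yi[OF i, symmetric] inner_commute)
        also have "\<dots> = i \<bullet> (\<integral>z. f z *\<^sub>R y z \<partial>\<nu> x)" by (rule integral_inner_right) (rule int)
        finally show ?thesis .
      qed
      have "D h = D (\<Sum>i\<in>Basis. (h \<bullet> i) *\<^sub>R i)" by (simp add: euclidean_representation)
      also have "\<dots> = (\<Sum>i\<in>Basis. (h \<bullet> i) * (i \<bullet> (\<integral>z. f z *\<^sub>R y z \<partial>\<nu> x)))" by (simp add: D.sum D.scaleR Di)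
      also have "\<dots> = h \<bullet> (\<integral>z. f z *\<^sub>R y z \<partial>\<nu> x)"
        by (subst (3) euclidean_inner) (simp add: inner_commute)
      finally show ?thesis .
    qed
    have "((\<lambda>h. ((\<integral>z. f z \<partial>\<nu> (x + h)) - (\<integral>z. f z \<partial>\<nu> x) - D h) /\<^sub>R norm h) \<longlongrightarrow> 0) (at 0)"
    proof (rule Lim_null_comparison)
      show "\<forall>\<^sub>F h in at 0. norm (((\<integral>z. f z \<partial>\<nu> (x + h)) - (\<integral>z. f z \<partial>\<nu> x) - D h) /\<^sub>R norm h) \<le> K' * B * norm h powr \<gamma>"
        unfolding eventually_at
      proof (intro exI[of _ 1] conjI ballI impI)
        fix h :: 'b assume "h \<noteq> 0 \<and> dist h 0 < 1"
        then have h: "norm h > 0" by simp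
        have "norm h powr (1 + \<gamma>) = norm h * norm h powr \<gamma>" using h by (simp add: powr_add)
        then have "\<bar>(\<integral>z. f z \<partial>\<nu> (x + h)) - (\<integral>z. f z \<partial>\<nu> x) - D h\<bar> \<le> norm h * (K' * B * norm h powr \<gamma>)"
          using D(2)[of h] by (simp add: mult_ac)
        then show "norm (((\<integral>z. f z \<partial>\<nu> (x + h)) - (\<integral>z. f z \<partial>\<nu> x) - D h) /\<^sub>R norm h) \<le> K' * B * norm h powr \<gamma>"
          using h by (simp add: abs_mult divide_inverse[symmetric] field_simps)
      qed simp
      have "((\<lambda>h::'b. norm h powr \<gamma>) \<longlongrightarrow> norm (0::'b) powr \<gamma>) (at 0)"
        using \<gamma> by (intro tendsto_powr' tendsto_norm tendsto_ident_at tendsto_const) auto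
      then show "((\<lambda>h::'b. K' * B * norm h powr \<gamma>) \<longlongrightarrow> 0) (at 0)"
        using tendsto_mult_right_zero by force
    qed
    from tendsto_norm_zero[OF this] have "((\<lambda>x. \<integral>z. f z \<partial>\<nu> x) has_derivative D) (at x)"
      using D(1) by (simp add: has_derivative_at abs_mult divide_inverse mult.commute)
    then show "GDERIV (\<lambda>x. \<integral>z. f z \<partial>\<nu> x) x :> (\<integral>z. f z *\<^sub>R y z \<partial>\<nu> x)"
      unfolding gderiv_def Dh[abs_def] by simp
  qed
qed

end

section \<open>The characteristic exponent of a stable process\<close>

text \<open>Cauchy's equation on an interval. Boundedness forces f to be small near 0, because n + 1
  times f s is f at (n + 1) s and stays bounded. Hence f t is determined up to an error of order 1/n
  by the multiple of T / (n + 1) just below t.\<close>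

lemma additive_bounded_linear:
  fixes f :: "real \<Rightarrow> 'c::real_normed_vector"
  assumes add: "\<And>s t. 0 \<le> s \<Longrightarrow> 0 \<le> t \<Longrightarrow> s + t \<le> T \<Longrightarrow> f (s + t) = f s + f t"
    and bd: "\<And>t. 0 \<le> t \<Longrightarrow> t \<le> T \<Longrightarrow> norm (f t) \<le> C" and T: "T > 0" and t: "0 \<le> t" "t \<le> T"
  shows "f t = (t / T) *\<^sub>R f T"
proof -
  have mult: "f (real n * s) = real n *\<^sub>R f s" if "0 \<le> s" "real n * s \<le> T" for n s
    using that
  proof (induction n)
    case 0
    show ?case using add[of 0 0] T by simp
  next
    case (Suc n)
    have le: "real n * s + s \<le> T" using Suc.prems by (simp add: algebra_simps)
    have "f (real n * s + s) = f (real n * s) + f s" using le Suc.prems by (intro add) auto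
    then show ?case using Suc le by (simp add: algebra_simps)
  qed
  have C: "C \<ge> 0" using bd[of 0] T norm_ge_zero[of "f 0"] by linarith
  have small: "norm (f s) \<le> C / real (Suc n)" if s: "0 \<le> s" "real (Suc n) * s \<le> T" for n s
  proof -
    have "real (Suc n) * norm (f s) = norm (f (real (Suc n) * s))" using mult[of s "Suc n"] s by simp
    also have "\<dots> \<le> C" using s by (intro bd) auto
    finally show ?thesis by (simp add: field_simps)
  qed
  have "norm (f t - (t / T) *\<^sub>R f T) \<le> (C + norm (f T)) * (1 / real (Suc n))" for n
  proof -
    define N where "N = real (Suc n)"
    define m where "m = nat \<lfloor>N * t / T\<rfloor>"
    have N: "N > 0" by (simp add: N_def)
    have "0 \<le> \<lfloor>N * t / T\<rfloor>" using t T N by simp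
    then have m: "real m \<le> N * t / T" "N * t / T < real m + 1" by (simp_all add: m_def)
    define s where "s = t - real m * (T / N)"
    have s0: "0 \<le> s" using m(1) T N by (simp add: s_def field_simps)
    have s1: "N * s \<le> T"
    proof -
      have "N * s = T * (N * t / T - real m)" using T N by (simp add: s_def field_simps)
      also have "\<dots> \<le> T * 1" using m T by (intro mult_left_mono) auto
      finally show ?thesis by simp
    qed
    have ts: "t = real m * (T / N) + s" by (simp add: s_def)
    have mT: "real m * (T / N) \<le> T" using s0 t ts by linarith
    have "f T = f (real (Suc n) * (T / N))" by (simp add: N_def)
    also have "\<dots> = real (Suc n) *\<^sub>R f (T / N)" using T N by (intro mult) (auto simp: N_def)
    finally have fTN: "f (T / N) = (1 / N) *\<^sub>R f T" by (simp add: N_def del: of_nat_Suc)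
    have "f t = f (real m * (T / N)) + f s"
      using s0 T N t ts by (subst ts, intro add) auto
    also have "f (real m * (T / N)) = (real m / N) *\<^sub>R f T"
      using mT T N by (subst mult) (auto simp: fTN)
    finally have "f t - (t / T) *\<^sub>R f T = f s - (t / T - real m / N) *\<^sub>R f T"
      by (simp add: scaleR_left_diff_distrib)
    then have "norm (f t - (t / T) *\<^sub>R f T) \<le> norm (f s) + \<bar>t / T - real m / N\<bar> * norm (f T)"
      using norm_triangle_ineq4[of "f s" "(t / T - real m / N) *\<^sub>R f T"] by simp
    moreover have "norm (f s) \<le> C / N" using small[OF s0, of n] s1 by (simp add: N_def)
    moreover have "\<bar>t / T - real m / N\<bar> \<le> 1 / N"
    proof -
      have "t / T - real m / N = (N * t / T - real m) / N" using N by (simp add: field_simps)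
      moreover have "\<bar>N * t / T - real m\<bar> \<le> 1" using m by linarith
      ultimately show ?thesis using N by (simp add: abs_div divide_right_mono)
    qed
    then have "\<bar>t / T - real m / N\<bar> * norm (f T) \<le> 1 / N * norm (f T)" by (rule mult_right_mono) simp
    ultimately show ?thesis by (simp add: N_def add_divide_distrib)
  qed
  then have ev: "\<forall>n\<ge>0. norm (f t - (t / T) *\<^sub>R f T) \<le> (C + norm (f T)) * (1 / real (Suc n))" by simp
  have lim: "(\<lambda>n. (C + norm (f T)) * (1 / real (Suc n))) \<longlonglongrightarrow> (C + norm (f T)) * 0"
    by (intro tendsto_mult_left LIMSEQ_Suc[OF lim_1_over_n])
  have "norm (f t - (t / T) *\<^sub>R f T) \<le> (C + norm (f T)) * 0"
    by (rule LIMSEQ_le_const[OF lim]) (use ev in blast)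
  then show ?thesis by simp
qed

text \<open>Values within 1/2 of 1 lie in the right half plane, so two principal logarithms add up
  without crossing the branch cut, and \<open>Ln (a t)\<close> solves Cauchy's equation on
  [0, \<delta>]. Larger times are reached by powers.\<close>

lemma multiplicative_exp:
  fixes a :: "real \<Rightarrow> complex"
  assumes mult: "\<And>s t. 0 \<le> s \<Longrightarrow> 0 \<le> t \<Longrightarrow> a (s + t) = a s * a t"
    and \<delta>: "\<delta> > 0" "\<And>t. 0 \<le> t \<Longrightarrow> t \<le> \<delta> \<Longrightarrow> norm (a t - 1) \<le> 1/2" and t: "t \<ge> 0"
  shows "a t = exp (of_real t * (Ln (a \<delta>) / of_real \<delta>))"
proof -
  have Re: "Re (a t) > 0" if "0 \<le> t" "t \<le> \<delta>" for t
    using \<delta>(2)[OF that] abs_Re_le_cmod[of "a t - 1"] by simp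
  have nz: "a t \<noteq> 0" if "0 \<le> t" "t \<le> \<delta>" for t using Re[OF that] by auto
  have Im: "\<bar>Im (Ln (a t))\<bar> < pi / 2" if "0 \<le> t" "t \<le> \<delta>" for t
    by (rule Re_Ln_pos_lt_imp[OF Re[OF that]])
  have lin: "Ln (a s) = (s / \<delta>) *\<^sub>R Ln (a \<delta>)" if s: "0 \<le> s" "s \<le> \<delta>" for s
  proof (rule additive_bounded_linear[where C = "2 + pi / 2"])
    fix s t :: real assume st: "0 \<le> s" "0 \<le> t" "s + t \<le> \<delta>"
    have "a (s + t) = exp (Ln (a s) + Ln (a t))"
      using st nz[of s] nz[of t] by (simp add: mult exp_add)
    moreover have "Ln (exp (Ln (a s) + Ln (a t))) = Ln (a s) + Ln (a t)"
      using Im[of s] Im[of t] st by (intro Ln_exp) auto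
    ultimately show "Ln (a (s + t)) = Ln (a s) + Ln (a t)" by simp
  next
    fix t :: real assume t: "0 \<le> t" "t \<le> \<delta>"
    have n: "1/2 \<le> norm (a t)" "norm (a t) \<le> 3/2"
      using \<delta>(2)[OF t] norm_triangle_ineq2[of 1 "a t"] norm_triangle_ineq2[of "a t" 1]
      by (auto simp: norm_minus_commute)
    have "ln (norm (a t)) \<le> norm (a t) - 1" using n by (intro ln_le_minus_one) auto
    moreover have "ln (1 / norm (a t)) \<le> 1 / norm (a t) - 1" using n by (intro ln_le_minus_one) auto
    moreover have "1 / norm (a t) \<le> 2"
    proof -
      have pos: "norm (a t) > 0" using n by linarith
      show ?thesis unfolding pos_divide_le_eq[OF pos] using n by linarith
    qed
    moreover have "ln (1 / norm (a t)) = - ln (norm (a t))" using n by (simp add: ln_div)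
    ultimately have "\<bar>ln (norm (a t))\<bar> \<le> 2" using n by linarith
    then have "\<bar>Re (Ln (a t))\<bar> \<le> 2" using nz[OF t] by simp
    then show "norm (Ln (a t)) \<le> 2 + pi / 2"
      using Im[OF t] cmod_le[of "Ln (a t)"] by linarith
  qed (use s \<delta> in auto)
  have small: "a s = exp (of_real s * (Ln (a \<delta>) / of_real \<delta>))" if s: "0 \<le> s" "s \<le> \<delta>" for s
  proof -
    have "a s = exp (Ln (a s))" using nz[OF s] by simp
    then show ?thesis unfolding lin[OF s] by (simp add: scaleR_conv_of_real)
  qed
  obtain n where n: "t / \<delta> < real n" using reals_Archimedean2 by blast
  then have n0: "n > 0" using t \<delta> by (metis divide_nonneg_pos less_le_not_le not_gr_zero of_nat_0)
  have pow: "a (real k * s) = a s ^ k" if "0 \<le> s" "k > 0" for k s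
    using that(2)
  proof (induction k rule: nat_induct_non_zero)
    case (Suc k)
    have "a (s + real k * s) = a s * a (real k * s)" using that by (intro mult) auto
    then show ?case using Suc by (simp add: algebra_simps)
  qed simp
  have tn: "0 \<le> t / n" "t / n \<le> \<delta>" using t n n0 \<delta> by (auto simp: field_simps)
  have "a t = a (t / n) ^ n" using pow[OF tn(1) n0] n0 by simp
  also have "\<dots> = exp (of_nat n * (of_real (t / n) * (Ln (a \<delta>) / of_real \<delta>)))"
    by (simp only: small[OF tn] exp_of_nat_mult)
  also have "of_nat n * (of_real (t / n) * (Ln (a \<delta>) / of_real \<delta>)) = of_real t * (Ln (a \<delta>) / of_real \<delta>)"
    using n0 by simp
  finally show ?thesis .
qed

lemma exp_eq_one_small:
  fixes z :: complex
  assumes "norm z \<le> 1" "exp z = 1"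
  shows "z = 0"
proof -
  obtain n :: int where n: "Re z = 0" "Im z = of_int (2 * n) * pi"
    using assms(2) unfolding exp_eq_1 by blast
  have "\<bar>of_int (2 * n) * pi\<bar> \<le> 1" using abs_Im_le_cmod[of z] assms(1) n by linarith
  then have e: "\<bar>of_int n\<bar> * pi \<le> 1 / 2" by (simp add: abs_mult)
  have "n = 0"
  proof (rule ccontr)
    assume "n \<noteq> 0"
    then have "1 \<le> \<bar>of_int n :: real\<bar>" by linarith
    then have "1 * pi \<le> \<bar>of_int n\<bar> * pi" by (rule mult_right_mono) simp
    then show False using e pi_gt3 by linarith
  qed
  then show ?thesis using n by (simp add: complex_eq_iff)
qed

text \<open>The time is chosen so that t (p - q) has modulus 1, while a nonzero solution of exp z =
  1 has modulus at least 2 pi.\<close>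

lemma exp_of_real_mult_unique:
  fixes p q :: complex
  assumes "\<And>t. t > 0 \<Longrightarrow> exp (of_real t * p) = exp (of_real t * q)"
  shows "p = q"
proof (rule ccontr)
  assume "p \<noteq> q"
  define c where "c = p - q"
  have c: "norm c > 0" using \<open>p \<noteq> q\<close> by (simp add: c_def)
  define t where "t = 1 / norm c"
  have t: "t > 0" using c by (simp add: t_def)
  have "norm (of_real t * c) = 1" unfolding norm_mult norm_of_real t_def using c by simp
  moreover have "exp (of_real t * c) = 1" using assms[OF t] by (simp add: c_def right_diff_distrib exp_diff)
  ultimately have "of_real t * c = 0" by (intro exp_eq_one_small) auto
  then show False using c t by simp
qed

text \<open>The witnesses are the increments over [0, s] and [s, s + t]. The value at time 0 stays
  subtracted, since it is 0 only almost surely; stationarity from time 0 still gives the right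
  laws.\<close>

lemma levy_convolution:
  fixes Z :: "real \<Rightarrow> 'a \<Rightarrow> 'b::euclidean_space"
  assumes M: "prob_space M" and Z: "levy_process M Z" and st: "s \<ge> 0" "t \<ge> 0"
  obtains A B where "prob_space.indep_var M borel A borel B"
    "distr M borel A = distr M borel (Z s)" "distr M borel B = distr M borel (Z t)"
    "distr M borel (\<lambda>\<omega>. A \<omega> + B \<omega>) = distr M borel (Z (s + t))"
proof -
  interpret prob_space M by (rule M)
  \<comment> \<open>The definition of a Levy process speaks of sequences of times; from index 2 on
    this one is constant.\<close>
  define u where "u i = (case i of 0 \<Rightarrow> 0 | Suc 0 \<Rightarrow> s | _ \<Rightarrow> s + t)" for i :: nat
  have ind: "\<forall>n (s :: nat \<Rightarrow> real). 0 \<le> s 0 \<and> (\<forall>i<n. s i \<le> s (Suc i)) \<longrightarrow>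
        indep_vars (\<lambda>_. borel) (\<lambda>i \<omega>. Z (s (Suc i)) \<omega> - Z (s i) \<omega>) {..<n}"
    and stat: "\<forall>s\<ge>0. \<forall>h\<ge>0. distr M borel (\<lambda>\<omega>. Z (s + h) \<omega> - Z s \<omega>) = distr M borel (Z h)"
    using Z unfolding levy_process_def by blast+
  have "indep_vars (\<lambda>_. borel) (\<lambda>i \<omega>. Z (u (Suc i)) \<omega> - Z (u i) \<omega>) {..<2}"
    using ind[rule_format, of u 2] st by (simp add: u_def numeral_2_eq_2 less_Suc_eq split: nat.split)
  then have "indep_var borel ((\<lambda>v. v 0) \<circ> (\<lambda>\<omega>. restrict (\<lambda>i. Z (u (Suc i)) \<omega> - Z (u i) \<omega>) {0}))
      borel ((\<lambda>v. v 1) \<circ> (\<lambda>\<omega>. restrict (\<lambda>i. Z (u (Suc i)) \<omega> - Z (u i) \<omega>) {1}))"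
    by (intro indep_var_compose[OF indep_var_restrict] measurable_component_singleton) auto
  moreover have "(\<lambda>v. v 0) \<circ> (\<lambda>\<omega>. restrict (\<lambda>i. Z (u (Suc i)) \<omega> - Z (u i) \<omega>) {0}) = (\<lambda>\<omega>. Z s \<omega> - Z 0 \<omega>)"
    by (simp add: fun_eq_iff u_def)
  moreover have "(\<lambda>v. v 1) \<circ> (\<lambda>\<omega>. restrict (\<lambda>i. Z (u (Suc i)) \<omega> - Z (u i) \<omega>) {1}) = (\<lambda>\<omega>. Z (s + t) \<omega> - Z s \<omega>)"
    by (simp add: fun_eq_iff u_def)
  ultimately have iv: "indep_var borel (\<lambda>\<omega>. Z s \<omega> - Z 0 \<omega>) borel (\<lambda>\<omega>. Z (s + t) \<omega> - Z s \<omega>)" by simp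
  show ?thesis
    by (rule that[OF iv]) (use stat[rule_format, of 0 s] stat[rule_format, of s t] stat[rule_format, of 0 "s + t"] st in auto)
qed

lemma norm_iexp_diff_one_le: "norm (iexp x - 1) \<le> min 2 \<bar>x\<bar>"
proof -
  have "norm (iexp x - (\<Sum>k\<le>0. (\<i> * x) ^ k / fact k)) \<le> \<bar>x\<bar> ^ Suc 0 / fact (Suc 0)" by (rule iexp_approx1)
  moreover have "norm (iexp x - 1) \<le> norm (iexp x) + norm (1::complex)" by (rule norm_triangle_ineq4)
  ultimately show ?thesis by simp
qed

text \<open>If the mean c of \<open>iexp (u * x)\<close> has modulus 1, the mean square distance of
  \<open>iexp (u * x)\<close> from c is 2 - 2 |c|^2 = 0. Thus almost every x is determined modulo 2
  pi / u, simultaneously for all u = 1 / (n + 1), and small u leave no ambiguity.\<close>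

lemma (in real_distribution) unit_char_imp_return:
  assumes "\<And>u. u > 0 \<Longrightarrow> norm (char M u) = 1"
  shows "\<exists>c. M = return borel c"
proof -
  have ae: "AE x in M. iexp (u * x) = char M u" if u: "u > 0" for u
  proof -
    define c where "c = char M u"
    have c1: "norm c = 1" using assms[OF u] by (simp add: c_def)
    have [measurable]: "(\<lambda>x. iexp (u * x)) \<in> borel_measurable M" by measurable
    have i: "integrable M (\<lambda>x. iexp (u * x))" by (rule integrable_const_bound[where B = 1]) auto
    have eq: "(norm (iexp (u * x) - c))\<^sup>2 = 2 - 2 * Re (cnj c * iexp (u * x))" for x
    proof -
      have "(norm (iexp (u * x) - c))\<^sup>2 = (norm (iexp (u * x)))\<^sup>2 + (norm c)\<^sup>2 - 2 * Re (cnj c * iexp (u * x))"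
        unfolding cmod_power2 by (simp add: power2_eq_square algebra_simps)
      then show ?thesis by (simp add: c1)
    qed
    define g where "g x = Re (cnj c * iexp (u * x))" for x
    have ci: "integrable M (\<lambda>x. cnj c * iexp (u * x))" using i by (rule integrable_mult_right)
    then have ig: "integrable M g" unfolding g_def by (rule integrable_Re)
    have "(\<integral>x. g x \<partial>M) = Re (\<integral>x. cnj c * iexp (u * x) \<partial>M)"
      unfolding g_def by (rule integral_Re[OF ci])
    also have "\<dots> = Re (cnj c * c)" by (simp add: c_def char_def)
    also have "\<dots> = 1" using c1 complex_norm_square[of c] by (simp add: mult.commute)
    finally have "(\<integral>x. 2 - 2 * g x \<partial>M) = 0"
      using ig prob_space by (subst Bochner_Integration.integral_diff) auto
    moreover have eq': "(norm (iexp (u * x) - c))\<^sup>2 = 2 - 2 * g x" for x unfolding eq g_def ..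
    moreover have "integrable M (\<lambda>x. 2 - 2 * g x)" using ig by simp
    moreover have "2 - 2 * g x \<ge> 0" for x using eq'[of x] by (metis zero_le_power2)
    ultimately have "AE x in M. 2 - 2 * g x = 0"
      by (subst (asm) integral_nonneg_eq_0_iff_AE) auto
    then have "AE x in M. (norm (iexp (u * x) - c))\<^sup>2 = 0" unfolding eq' .
    then show ?thesis by eventually_elim (simp add: c_def)
  qed
  have "AE x in M. \<forall>n. iexp (1 / real (Suc n) * x) = char M (1 / real (Suc n))"
    unfolding AE_all_countable by (intro allI ae) simp
  \<comment> \<open>A property that holds almost surely holds at some point c; this is the candidate
    for the atom.\<close>
  then have "\<exists>c. \<forall>n. iexp (1 / real (Suc n) * c) = char M (1 / real (Suc n))"
  proof (rule contrapos_pp)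
    assume "\<nexists>c. \<forall>n. iexp (1 / real (Suc n) * c) = char M (1 / real (Suc n))"
    then have "\<not> (\<forall>n. iexp (1 / real (Suc n) * x) = char M (1 / real (Suc n)))" for x by blast
    then show "\<not> (AE x in M. \<forall>n. iexp (1 / real (Suc n) * x) = char M (1 / real (Suc n)))"
      by (simp only: AE_const not_False_eq_True)
  qed
  then obtain c where c: "\<And>n. iexp (1 / real (Suc n) * c) = char M (1 / real (Suc n))" by blast
  have "AE x in M. x = c"
    using \<open>AE x in M. \<forall>n. iexp (1 / real (Suc n) * x) = char M (1 / real (Suc n))\<close>
  proof eventually_elim
    case (elim x)
    obtain n where n: "\<bar>x - c\<bar> < real n" using reals_Archimedean2 by blast
    define y where "y = 1 / real (Suc n) * (x - c)"
    have "iexp y = iexp (1 / real (Suc n) * x) / iexp (1 / real (Suc n) * c)"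
      by (simp add: y_def exp_diff[symmetric] right_diff_distrib diff_divide_distrib)
    also have "iexp (1 / real (Suc n) * x) = iexp (1 / real (Suc n) * c)" using elim c by simp
    finally have "iexp y = 1" by simp
    moreover have "\<bar>y\<bar> \<le> 1" using n by (simp add: y_def abs_mult field_simps)
    ultimately have "\<i> * of_real y = 0" by (intro exp_eq_one_small) (auto simp: norm_mult)
    then have "y = 0" by simp
    then show ?case by (simp add: y_def)
  qed
  then have "M = return M c" by (rule AE_eq_constD)
  moreover have "return M c = return borel c" by (rule return_cong) simp
  ultimately show ?thesis by metis
qed

section \<open>The exponent of a one-dimensional stable process\<close>

context
  fixes M :: "'a measure" and \<zeta> :: "real \<Rightarrow> 'a \<Rightarrow> real" and \<alpha> :: real
  assumes M: "prob_space M" and \<alpha>: "0 < \<alpha>" "\<alpha> < 2" and stable: "stable_process \<alpha> M \<zeta>"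
begin

interpretation prob_space M by (rule M)

private lemma levy: "levy_process M \<zeta>" using stable by (simp add: stable_process_def)

private lemma rv: "t \<ge> 0 \<Longrightarrow> \<zeta> t \<in> borel_measurable M" using levy by (simp add: levy_process_def)

private definition "\<phi> t = char (distr M borel (\<zeta> t))"

private lemma real_dist: "t \<ge> 0 \<Longrightarrow> real_distribution (distr M borel (\<zeta> t))"
  by (rule real_distribution_distr) (rule rv)

private lemma \<phi>_mult: assumes "s \<ge> 0" "t \<ge> 0" shows "\<phi> (s + t) u = \<phi> s u * \<phi> t u"
proof -
  obtain A B where AB: "indep_var borel A borel B"
    "distr M borel A = distr M borel (\<zeta> s)" "distr M borel B = distr M borel (\<zeta> t)"
    "distr M borel (\<lambda>\<omega>. A \<omega> + B \<omega>) = distr M borel (\<zeta> (s + t))"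
    by (rule levy_convolution[OF M levy assms])
  show ?thesis unfolding \<phi>_def AB(2-4)[symmetric] by (rule char_distr_add[OF AB(1)])
qed

text \<open>Right continuity of the paths at 0 with dominated convergence. The majorant with
  \<open>R\<close> is uniform over bounded u; this uniformity later makes the exponent
  continuous.\<close>

private lemma \<phi>_near_one: assumes R: "R \<ge> 0"
  shows "\<exists>\<delta>>0. \<forall>t u. 0 \<le> t \<longrightarrow> t \<le> \<delta> \<longrightarrow> \<bar>u\<bar> \<le> R \<longrightarrow> norm (\<phi> t u - 1) \<le> 1/2"
proof (rule ccontr)
  assume "\<not> ?thesis"
  then have "\<forall>n. \<exists>t u. 0 \<le> t \<and> t \<le> 1 / real (Suc n) \<and> \<bar>u\<bar> \<le> R \<and> \<not> norm (\<phi> t u - 1) \<le> 1/2"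
    by (metis zero_less_divide_1_iff of_nat_0_less_iff zero_less_Suc)
  then obtain t u where tu: "\<And>n. 0 \<le> t n" "\<And>n. t n \<le> 1 / real (Suc n)" "\<And>n. \<bar>u n\<bar> \<le> R"
    "\<And>n. \<not> norm (\<phi> (t n) (u n) - 1) \<le> 1/2"
    by metis
  note [measurable] = rv[OF tu(1)]
  have t0: "t \<longlonglongrightarrow> 0"
    by (rule tendsto_sandwich[OF _ _ tendsto_const LIMSEQ_Suc[OF lim_1_over_n]]) (use tu in auto)
  have le: "norm (\<phi> (t n) (u n) - 1) \<le> (\<integral>\<omega>. min 2 (R * \<bar>\<zeta> (t n) \<omega>\<bar>) \<partial>M)" for n
  proof -
    have "integrable M (\<lambda>\<omega>. iexp (u n * \<zeta> (t n) \<omega>))" by (rule integrable_const_bound[where B = 1]) auto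
    then have "\<phi> (t n) (u n) - 1 = (\<integral>\<omega>. iexp (u n * \<zeta> (t n) \<omega>) - 1 \<partial>M)"
      by (simp add: \<phi>_def char_def integral_distr prob_space)
    also have "norm \<dots> \<le> (\<integral>\<omega>. norm (iexp (u n * \<zeta> (t n) \<omega>) - 1) \<partial>M)" by (rule integral_norm_bound)
    also have "\<dots> \<le> (\<integral>\<omega>. min 2 (R * \<bar>\<zeta> (t n) \<omega>\<bar>) \<partial>M)"
    proof (rule integral_mono)
      show "norm (iexp (u n * \<zeta> (t n) \<omega>) - 1) \<le> min 2 (R * \<bar>\<zeta> (t n) \<omega>\<bar>)" for \<omega>
      proof -
        have "\<bar>u n * \<zeta> (t n) \<omega>\<bar> \<le> R * \<bar>\<zeta> (t n) \<omega>\<bar>" unfolding abs_mult using tu(3) by (intro mult_right_mono) auto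
        then show ?thesis using norm_iexp_diff_one_le[of "u n * \<zeta> (t n) \<omega>"] by linarith
      qed
      then show "integrable M (\<lambda>\<omega>. norm (iexp (u n * \<zeta> (t n) \<omega>) - 1))"
        by (intro integrable_const_bound[where B = 2]) auto
      show "integrable M (\<lambda>\<omega>. min 2 (R * \<bar>\<zeta> (t n) \<omega>\<bar>))"
        using R by (intro integrable_const_bound[where B = 2]) auto
    qed
    finally show ?thesis .
  qed
  have "(\<lambda>n. \<integral>\<omega>. min 2 (R * \<bar>\<zeta> (t n) \<omega>\<bar>) \<partial>M) \<longlonglongrightarrow> (\<integral>\<omega>. min 2 (R * \<bar>0\<bar>) \<partial>M)"
  proof (rule integral_dominated_convergence[where w = "\<lambda>_. 2"])
    have "AE \<omega> in M. \<zeta> 0 \<omega> = 0" "AE \<omega> in M. cadlag (\<lambda>t. \<zeta> t \<omega>)" using levy by (auto simp: levy_process_def)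
    then show "AE \<omega> in M. (\<lambda>n. min 2 (R * \<bar>\<zeta> (t n) \<omega>\<bar>)) \<longlonglongrightarrow> min 2 (R * \<bar>0\<bar>)"
    proof eventually_elim
      case (elim \<omega>)
      have "((\<lambda>t. \<zeta> t \<omega>) \<longlongrightarrow> \<zeta> 0 \<omega>) (at_right 0)" using elim(2) by (simp add: cadlag_def)
      moreover have "{0..} - {0} = {0<..} - {0::real}" by auto
      then have eq: "at 0 within {0..} = at_right (0::real)" by (simp only: at_within_def)
      ultimately have "continuous (at 0 within {0..}) (\<lambda>t. \<zeta> t \<omega>)"
        unfolding continuous_within unfolding eq by simp
      then have "(\<lambda>n. \<zeta> (t n) \<omega>) \<longlonglongrightarrow> \<zeta> 0 \<omega>"
        by (rule continuous_within_tendsto_compose) (use t0 tu in auto)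
      then show ?case unfolding elim(1) by (intro tendsto_intros)
    qed
    show "AE \<omega> in M. norm (min 2 (R * \<bar>\<zeta> (t n) \<omega>\<bar>)) \<le> 2" for n using R by auto
  qed auto
  then have "(\<lambda>n. \<integral>\<omega>. min 2 (R * \<bar>\<zeta> (t n) \<omega>\<bar>) \<partial>M) \<longlonglongrightarrow> 0" by simp
  then have "\<forall>\<^sub>F n in sequentially. (\<integral>\<omega>. min 2 (R * \<bar>\<zeta> (t n) \<omega>\<bar>) \<partial>M) < 1/2" by (rule order_tendstoD) simp
  then obtain n where "(\<integral>\<omega>. min 2 (R * \<bar>\<zeta> (t n) \<omega>\<bar>) \<partial>M) < 1/2" by (auto simp: eventually_sequentially)
  with le[of n] tu(4)[of n] show False by simp
qed

text \<open>The characteristic exponent. The choice is determined because the exponent is unique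
  (\<open>exp_of_real_mult_unique\<close>); \<open>local_exponent\<close> expresses it, for all u in
  a bounded set, by the principal logarithm at one common small time.\<close>

private definition "\<psi> u = (SOME p. \<forall>t\<ge>0. \<phi> t u = exp (of_real t * p))"

private lemma local_exponent: assumes R: "R \<ge> 0"
  shows "\<exists>\<delta>>0. \<forall>u. \<bar>u\<bar> \<le> R \<longrightarrow> \<psi> u = Ln (\<phi> \<delta> u) / of_real \<delta> \<and> Re (\<phi> \<delta> u) > 0 \<and> (\<forall>t\<ge>0. \<phi> t u = exp (of_real t * \<psi> u))"
proof -
  obtain \<delta> where \<delta>: "\<delta> > 0" "\<And>t u. 0 \<le> t \<Longrightarrow> t \<le> \<delta> \<Longrightarrow> \<bar>u\<bar> \<le> R \<Longrightarrow> norm (\<phi> t u - 1) \<le> 1/2"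
    using \<phi>_near_one[OF R] by blast
  have "\<psi> u = Ln (\<phi> \<delta> u) / of_real \<delta> \<and> Re (\<phi> \<delta> u) > 0 \<and> (\<forall>t\<ge>0. \<phi> t u = exp (of_real t * \<psi> u))" if u: "\<bar>u\<bar> \<le> R" for u
  proof -
    have e: "\<forall>t\<ge>0. \<phi> t u = exp (of_real t * (Ln (\<phi> \<delta> u) / of_real \<delta>))"
      using multiplicative_exp[of "\<lambda>t. \<phi> t u", OF \<phi>_mult \<delta>(1)] \<delta>(2)[OF _ _ u] by blast
    then have p: "\<forall>t\<ge>0. \<phi> t u = exp (of_real t * \<psi> u)"
      unfolding \<psi>_def by (rule someI[of "\<lambda>p. \<forall>t\<ge>0. \<phi> t u = exp (of_real t * p)"])
    have "\<psi> u = Ln (\<phi> \<delta> u) / of_real \<delta>"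
      by (rule exp_of_real_mult_unique) (use e p in \<open>metis less_imp_le\<close>)
    moreover have "Re (\<phi> \<delta> u) > 0" using \<delta>(2)[of \<delta> u] \<delta>(1) u abs_Re_le_cmod[of "\<phi> \<delta> u - 1"] by simp
    ultimately show ?thesis using p by blast
  qed
  then show ?thesis using \<delta>(1) by blast
qed

private lemma \<phi>_eq: "t \<ge> 0 \<Longrightarrow> \<phi> t u = exp (of_real t * \<psi> u)"
  using local_exponent[of "\<bar>u\<bar>"] by auto

private lemma \<psi>_cont: "isCont \<psi> u"
proof -
  obtain \<delta> where \<delta>: "\<delta> > 0" "\<And>v. \<bar>v\<bar> \<le> \<bar>u\<bar> + 1 \<Longrightarrow> \<psi> v = Ln (\<phi> \<delta> v) / of_real \<delta> \<and> Re (\<phi> \<delta> v) > 0"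
    using local_exponent[of "\<bar>u\<bar> + 1"] by auto
  have "isCont (\<phi> \<delta>) u" unfolding \<phi>_def using \<delta>(1) by (intro real_distribution.isCont_char real_dist) simp
  moreover have "\<phi> \<delta> u \<notin> \<real>\<^sub>\<le>\<^sub>0" using \<delta>(2)[of u] by (auto simp: complex_nonpos_Reals_iff)
  ultimately have "isCont (\<lambda>v. Ln (\<phi> \<delta> v) / of_real \<delta>) u" using \<delta>(1) by (intro continuous_intros) auto
  moreover have ev: "\<forall>\<^sub>F v in nhds u. \<psi> v = Ln (\<phi> \<delta> v) / of_real \<delta>"
    unfolding eventually_nhds_metric by (intro exI[of _ 1]) (use \<delta>(2) in \<open>auto simp: dist_real_def\<close>)
  ultimately show ?thesis using isCont_cong[OF ev] by simp
qed

private lemma \<psi>_cont_on: "continuous_on S \<psi>"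
  using \<psi>_cont by (simp add: continuous_at_imp_continuous_on)

private lemma \<psi>_Re: "Re (\<psi> u) \<le> 0"
proof -
  have "norm (\<phi> 1 u) \<le> 1" unfolding \<phi>_def by (intro real_distribution.cmod_char_le_1 real_dist) simp
  then show ?thesis by (simp add: \<phi>_eq norm_exp_eq_Re)
qed

private lemma stable_char:
  assumes t: "t > 0" and AB: "A > 0" "B > 0"
  shows "\<exists>D. \<forall>u. \<phi> t (A * u) * \<phi> t (B * u) = \<phi> t ((A powr \<alpha> + B powr \<alpha>) powr (1/\<alpha>) * u) * iexp (D * u)"
proof -
  define \<mu> where "\<mu> = distr M borel (\<zeta> t)"
  interpret \<mu>: real_distribution \<mu> unfolding \<mu>_def using t by (intro real_dist) simp
  interpret P: pair_prob_space \<mu> \<mu> ..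
  define C where "C = (A powr \<alpha> + B powr \<alpha>) powr (1/\<alpha>)"
  obtain D where D: "distr (\<mu> \<Otimes>\<^sub>M \<mu>) borel (\<lambda>(x, y). A * x + B * y) = distr \<mu> borel (\<lambda>x. C * x + D)"
    using stable t AB unfolding stable_process_def stable_law_def \<mu>_def C_def by blast
  have \<phi>: "\<phi> t v = (\<integral>x. iexp (v * x) \<partial>\<mu>)" for v by (simp add: \<phi>_def \<mu>_def char_def)
  show ?thesis
  proof (intro exI allI)
    fix u
    have i: "integrable (\<mu> \<Otimes>\<^sub>M \<mu>) (\<lambda>p. iexp (u * A * fst p) * iexp (u * B * snd p))"
      by (rule P.integrable_const_bound[where B = 1]) (auto simp: norm_mult)
    have "char (distr (\<mu> \<Otimes>\<^sub>M \<mu>) borel (\<lambda>(x, y). A * x + B * y)) u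
        = (\<integral>p. iexp (u * A * fst p) * iexp (u * B * snd p) \<partial>(\<mu> \<Otimes>\<^sub>M \<mu>))"
      unfolding char_def by (subst integral_distr) (auto simp: case_prod_beta exp_add[symmetric] algebra_simps)
    also have "\<dots> = (\<integral>x. \<integral>y. iexp (u * A * x) * iexp (u * B * y) \<partial>\<mu> \<partial>\<mu>)"
      using P.integral_fst'[OF i] by simp
    also have "\<dots> = \<phi> t (A * u) * \<phi> t (B * u)" by (simp add: \<phi> mult_ac)
    finally have l: "char (distr (\<mu> \<Otimes>\<^sub>M \<mu>) borel (\<lambda>(x, y). A * x + B * y)) u = \<phi> t (A * u) * \<phi> t (B * u)" .
    have "char (distr \<mu> borel (\<lambda>x. C * x + D)) u = (\<integral>x. iexp (C * u * x) * iexp (D * u) \<partial>\<mu>)"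
      unfolding char_def by (subst integral_distr) (auto simp: exp_add[symmetric] algebra_simps)
    also have "\<dots> = \<phi> t (C * u) * iexp (D * u)" by (simp add: \<phi>)
    finally show "\<phi> t (A * u) * \<phi> t (B * u) = \<phi> t ((A powr \<alpha> + B powr \<alpha>) powr (1/\<alpha>) * u) * iexp (D * u)"
      using l unfolding D C_def by simp
  qed
qed

private definition "\<omega> A B u = \<psi> (A * u) + \<psi> (B * u) - \<psi> ((A powr \<alpha> + B powr \<alpha>) powr (1/\<alpha>) * u)"

text \<open>The defect \<open>\<omega>\<close> of the scaling relation is the exponent of the deterministic shift in the stability
  relation, hence linear in \<open>u\<close>.\<close>

private lemma \<omega>:
  assumes AB: "A > 0" "B > 0"
  shows "Re (\<omega> A B u) = 0" and "u \<ge> 0 \<Longrightarrow> \<omega> A B u = of_real u * \<omega> A B 1"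
proof -
  have e: "\<exists>D. \<forall>u. exp (of_real t * \<omega> A B u) = iexp (D * u)" if t: "t > 0" for t
  proof -
    obtain D where D: "\<And>u. \<phi> t (A * u) * \<phi> t (B * u) = \<phi> t ((A powr \<alpha> + B powr \<alpha>) powr (1/\<alpha>) * u) * iexp (D * u)"
      using stable_char[OF t AB] by blast
    have "exp (of_real t * \<omega> A B u) = iexp (D * u)" for u
      using D[of u] t by (simp add: \<phi>_eq \<omega>_def distrib_left right_diff_distrib exp_diff exp_add)
    then show ?thesis by blast
  qed
  show "Re (\<omega> A B u) = 0"
  proof -
    obtain D where "exp (of_real 1 * \<omega> A B u) = iexp (D * u)" using e[of 1] by auto
    then have "norm (exp (of_real 1 * \<omega> A B u)) = norm (iexp (D * u))" by (simp only:)
    then show ?thesis by (simp add: norm_exp_eq_Re)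
  qed
  have add: "\<omega> A B (u + v) = \<omega> A B u + \<omega> A B v" for u v
  proof (rule exp_of_real_mult_unique)
    fix t :: real assume "t > 0"
    then obtain D where D: "\<And>u. exp (of_real t * \<omega> A B u) = iexp (D * u)" using e by blast
    have "exp (of_real t * (\<omega> A B u + \<omega> A B v)) = iexp (D * u) * iexp (D * v)"
      by (simp only: distrib_left exp_add D)
    also have "\<dots> = iexp (D * (u + v))" by (simp add: exp_add[symmetric] distrib_left)
    finally show "exp (of_real t * \<omega> A B (u + v)) = exp (of_real t * (\<omega> A B u + \<omega> A B v))" by (simp only: D)
  qed
  assume u: "u \<ge> 0"
  have cont: "continuous_on {0..max 1 u} (\<omega> A B)"
    unfolding \<omega>_def by (intro continuous_intros continuous_on_compose2[OF \<psi>_cont_on[of UNIV]]) auto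
  then have "bounded (\<omega> A B ` {0..max 1 u})" by (intro compact_imp_bounded compact_continuous_image) auto
  then obtain K where K: "\<And>v. v \<in> {0..max 1 u} \<Longrightarrow> norm (\<omega> A B v) \<le> K" unfolding bounded_iff by blast
  have lin: "\<omega> A B v = (v / max 1 u) *\<^sub>R \<omega> A B (max 1 u)" if "0 \<le> v" "v \<le> max 1 u" for v
    by (rule additive_bounded_linear[where C = K]) (use that add K in auto)
  have "\<omega> A B u = (u / max 1 u) *\<^sub>R \<omega> A B (max 1 u)" by (rule lin) (use u in auto)
  also have "\<dots> = u *\<^sub>R ((1 / max 1 u) *\<^sub>R \<omega> A B (max 1 u))" by simp
  also have "(1 / max 1 u) *\<^sub>R \<omega> A B (max 1 u) = \<omega> A B 1" by (rule lin[symmetric]) auto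
  finally show "\<omega> A B u = of_real u * \<omega> A B 1" by (simp add: scaleR_conv_of_real)
qed

private lemma \<psi>_zero: "\<psi> 0 = 0"
proof (rule exp_of_real_mult_unique)
  fix t :: real assume t: "t > 0"
  have "\<phi> t 0 = 1" unfolding \<phi>_def using t by (intro real_distribution.char_zero real_dist) simp
  then show "exp (of_real t * \<psi> 0) = exp (of_real t * 0)" using t by (simp add: \<phi>_eq)
qed

text \<open>Linearity of \<open>\<omega>\<close> makes \<open>\<psi> (s u) - u \<psi> s\<close> additive in \<open>s powr \<alpha>\<close>. Exchanging the roles of
  \<open>s\<close> and \<open>u\<close> in the resulting identity determines \<open>\<psi>\<close> up to three constants.\<close>

private lemma scaling:
  assumes u: "u > 0" and s: "s > 0"
  shows "\<psi> (s * u) - of_real u * \<psi> s = of_real (s powr \<alpha>) * (\<psi> u - of_real u * \<psi> 1)"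
proof -
  \<comment> \<open>In the variable a = s powr \<alpha> the linearity of the defect
    \<open>\<omega>\<close> in u becomes additivity of \<open>k\<close>.\<close>
  define k where "k a = \<psi> (a powr (1/\<alpha>) * u) - of_real u * \<psi> (a powr (1/\<alpha>))" for a
  have add: "k (a + b) = k a + k b" if ab: "a \<ge> 0" "b \<ge> 0" for a b
  proof (cases "a = 0 \<or> b = 0")
    case True then show ?thesis by (auto simp: k_def \<psi>_zero)
  next
    case False
    then have ab: "a > 0" "b > 0" using ab by auto
    have p: "(a powr (1/\<alpha>)) powr \<alpha> = a" "(b powr (1/\<alpha>)) powr \<alpha> = b" using ab \<alpha> by (auto simp: powr_powr)
    have "\<omega> (a powr (1/\<alpha>)) (b powr (1/\<alpha>)) u = of_real u * \<omega> (a powr (1/\<alpha>)) (b powr (1/\<alpha>)) 1"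
      using ab u by (intro \<omega>(2)) auto
    then show ?thesis unfolding \<omega>_def p k_def by (simp add: algebra_simps)
  qed
  define T where "T = max 1 (s powr \<alpha>)"
  have "continuous_on {0..T} k"
    unfolding k_def using \<alpha>
    by (intro continuous_intros continuous_on_compose2[OF \<psi>_cont_on[of UNIV]] continuous_on_powr') auto
  then have "bounded (k ` {0..T})" by (intro compact_imp_bounded compact_continuous_image) auto
  then obtain K where K: "\<And>v. v \<in> {0..T} \<Longrightarrow> norm (k v) \<le> K" unfolding bounded_iff by blast
  have lin: "k v = (v / T) *\<^sub>R k T" if "0 \<le> v" "v \<le> T" for v
    by (rule additive_bounded_linear[where C = K]) (use that add K in \<open>auto simp: T_def\<close>)
  have "k (s powr \<alpha>) = ((s powr \<alpha>) / T) *\<^sub>R k T" by (rule lin) (auto simp: T_def)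
  also have "\<dots> = (s powr \<alpha>) *\<^sub>R ((1 / T) *\<^sub>R k T)" by simp
  also have "(1 / T) *\<^sub>R k T = k 1" by (rule lin[symmetric]) (auto simp: T_def)
  finally have "k (s powr \<alpha>) = of_real (s powr \<alpha>) * k 1" by (simp add: scaleR_conv_of_real)
  then show ?thesis using s \<alpha> by (simp add: k_def powr_powr)
qed

private lemma Re_double: "Re (\<psi> (2 powr (1/\<alpha>) * u)) = 2 * Re (\<psi> u)"
  using \<omega>(1)[of 1 1 u] by (simp add: \<omega>_def)

text \<open>For \<alpha> \<noteq> 1 the identity \<open>scaling\<close>, used for (2, u) and for (u,
  2), gives two linear equations for \<psi> u and \<psi> (2 u) with determinant 2 - 2 powr \<alpha>
  up to sign. For \<alpha> = 1 the determinant vanishes; then \<psi> u / u is, up to a constant,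
  additive in ln u, which produces the term u ln u. In both cases the doubling relation for the real
  part makes the coefficient of the extra term imaginary.\<close>

private lemma exponent_form:
  obtains w a p where "Re a = 0" "Re p = 0" "\<alpha> \<noteq> 1 \<longrightarrow> a = 0"
    "\<And>u. u > 0 \<Longrightarrow> \<psi> u = w * of_real (u powr \<alpha>) + a * of_real (u * ln u) + p * of_real u"
proof (cases "\<alpha> = 1")
  case False
  define e where "e = complex_of_real (2 - 2 powr \<alpha>)"
  have "2 powr \<alpha> \<noteq> (2 powr 1 :: real)" using False by (subst powr_inj) auto
  then have e: "e \<noteq> 0" unfolding e_def of_real_eq_0_iff by simp
  define w where "w = (2 * \<psi> 1 - \<psi> 2) / e"
  define p where "p = (\<psi> 2 - of_real (2 powr \<alpha>) * \<psi> 1) / e"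
  have form: "\<psi> u = w * of_real (u powr \<alpha>) + p * of_real u" if u: "u > 0" for u
  proof -
    have "\<psi> (2 * u) - of_real u * \<psi> 2 = of_real (2 powr \<alpha>) * (\<psi> u - of_real u * \<psi> 1)"
      by (rule scaling[OF u]) simp
    moreover have "\<psi> (2 * u) - 2 * \<psi> u = of_real (u powr \<alpha>) * (\<psi> 2 - 2 * \<psi> 1)"
      using scaling[of 2 u] u by (simp add: mult.commute)
    ultimately have "e * \<psi> u = (2 * \<psi> 1 - \<psi> 2) * of_real (u powr \<alpha>) + (\<psi> 2 - of_real (2 powr \<alpha>) * \<psi> 1) * of_real u"
      unfolding e_def of_real_diff by (simp add: algebra_simps) algebra
    then have "\<psi> u = ((2 * \<psi> 1 - \<psi> 2) * of_real (u powr \<alpha>) + (\<psi> 2 - of_real (2 powr \<alpha>) * \<psi> 1) * of_real u) / e"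
      using e by (simp add: field_simps)
    then show ?thesis by (simp add: w_def p_def add_divide_distrib)
  qed
  have "Re p = 0"
  proof -
    have a: "(2 powr (1/\<alpha>)) powr \<alpha> = (2::real)" using \<alpha> by (simp add: powr_powr)
    have "Re w * 2 + Re p * 2 powr (1/\<alpha>) = 2 * (Re w + Re p)"
      using Re_double[of 1] form[of "2 powr (1/\<alpha>)"] form[of 1] by (simp add: a)
    then have "Re p * (2 powr (1/\<alpha>) - 2) = 0" by (simp add: algebra_simps)
    moreover have "2 powr (1/\<alpha>) \<noteq> (2 powr 1 :: real)" using False \<alpha> by (subst powr_inj) auto
    ultimately show ?thesis by simp
  qed
  then show ?thesis by (intro that[of 0 p w]) (use False form in auto)
next
  case True
  define n where "n x = \<psi> (exp x) / of_real (exp x) - \<psi> 1" for x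
  have add: "n (x + y) = n x + n y" for x y
  proof -
    have "\<psi> (exp x * exp y) - of_real (exp y) * \<psi> (exp x) = of_real (exp x) * (\<psi> (exp y) - of_real (exp y) * \<psi> 1)"
      using scaling[of "exp y" "exp x"] True by simp
    then show ?thesis by (simp add: n_def exp_add field_simps)
  qed
  have lin: "n x = of_real x * n 1" if x: "x \<ge> 0" for x
  proof -
    have "continuous_on {0..max 1 x} n"
      unfolding n_def by (intro continuous_intros continuous_on_compose2[OF \<psi>_cont_on[of UNIV]]) auto
    then have "bounded (n ` {0..max 1 x})" by (intro compact_imp_bounded compact_continuous_image) auto
    then obtain K where K: "\<And>v. v \<in> {0..max 1 x} \<Longrightarrow> norm (n v) \<le> K" unfolding bounded_iff by blast
    have lin: "n v = (v / max 1 x) *\<^sub>R n (max 1 x)" if "0 \<le> v" "v \<le> max 1 x" for v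
      by (rule additive_bounded_linear[where C = K]) (use that add K in auto)
    have "n x = (x / max 1 x) *\<^sub>R n (max 1 x)" by (rule lin) (use x in auto)
    also have "\<dots> = x *\<^sub>R ((1 / max 1 x) *\<^sub>R n (max 1 x))" by simp
    also have "(1 / max 1 x) *\<^sub>R n (max 1 x) = n 1" by (rule lin[symmetric]) auto
    finally show ?thesis by (simp add: scaleR_conv_of_real)
  qed
  have lin': "n x = of_real x * n 1" for x
  proof (cases "x \<ge> 0")
    case False
    have "n 0 = 0" using add[of 0 0] by simp
    then have "n x = - n (- x)" using add[of x "-x"] by (simp add: eq_neg_iff_add_eq_0)
    then show ?thesis using lin[of "-x"] False by simp
  qed (rule lin)
  define w a where "w = \<psi> 1" and "a = n 1"
  have form: "\<psi> u = w * of_real u + a * of_real (u * ln u)" if u: "u > 0" for u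
  proof -
    have "\<psi> u / of_real u - w = of_real (ln u) * a"
      using lin'[of "ln u"] u by (simp add: n_def w_def a_def)
    then show ?thesis using u by (simp add: field_simps)
  qed
  have "Re a = 0"
  proof -
    have "Re w * 2 + Re a * (2 * ln 2) = 2 * Re w"
      using Re_double[of 1] True form[of 2] form[of 1] by simp
    then show ?thesis by simp
  qed
  then show ?thesis by (intro that[of a 0 w]) (use True form in auto)
qed

text \<open>If the real part of w were 0, the characteristic function at time 1 would have modulus 1
  everywhere and the law would be a point mass, which \<open>stable_law\<close> excludes. This
  strict sign is the source of all smoothing.\<close>

theorem stable_process_exponent:
  obtains w a :: complex and p :: real where "Re w < 0" "Re a = 0" "\<alpha> \<noteq> 1 \<longrightarrow> a = 0"
    "\<And>t u. t \<ge> 0 \<Longrightarrow> u > 0 \<Longrightarrow> char (distr M borel (\<zeta> t)) u =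
        exp (of_real t * (w * of_real (u powr \<alpha>) + a * of_real (u * ln u))) * iexp (u * (t * p))"
proof -
  obtain w a p where wap: "Re a = 0" "Re p = 0" "\<alpha> \<noteq> 1 \<longrightarrow> a = 0"
    "\<And>u. u > 0 \<Longrightarrow> \<psi> u = w * of_real (u powr \<alpha>) + a * of_real (u * ln u) + p * of_real u"
    by (rule exponent_form) (rule that; blast)
  have Re\<psi>: "Re (\<psi> u) = Re w * u powr \<alpha>" if "u > 0" for u
    using wap(4)[OF that] wap(1,2) by simp
  have "Re w < 0"
  proof (rule ccontr)
    assume "\<not> Re w < 0"
    then have w0: "Re w = 0" using \<psi>_Re[of 1] Re\<psi>[of 1] by simp
    have "\<exists>c. distr M borel (\<zeta> 1) = return borel c"
    proof (rule real_distribution.unit_char_imp_return[OF real_dist])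
      fix u :: real assume "u > 0"
      then show "norm (char (distr M borel (\<zeta> 1)) u) = 1"
        using \<phi>_eq[of 1 u] Re\<psi>[of u] w0 by (simp add: \<phi>_def norm_exp_eq_Re)
    qed simp
    then show False using stable unfolding stable_process_def stable_law_def by (meson zero_less_one)
  qed
  moreover obtain r where r: "p = \<i> * of_real r"
    using wap(2) by (intro that[of "Im p"]) (simp add: complex_eq_iff)
  have "char (distr M borel (\<zeta> t)) u =
        exp (of_real t * (w * of_real (u powr \<alpha>) + a * of_real (u * ln u))) * iexp (u * (t * r))"
    if "t \<ge> 0" "u > 0" for t u
    using \<phi>_eq[OF that(1), of u] wap(4)[OF that(2)]
    by (simp add: \<phi>_def exp_add[symmetric] distrib_left mult_ac add_ac r)
  ultimately show ?thesis by (intro that[of w a r]) (use wap in auto)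
qed

end

section \<open>Smoothness of stable laws\<close>

text \<open>For n \<alpha> \<ge> m the power is at most the n-th power of u powr \<alpha>, and the
  inequality exp y \<ge> (y / n)^n bounds the latter by the exponential.\<close>

lemma power_times_exp_powr_bounded:
  fixes c \<alpha> :: real
  assumes c: "c > 0" and \<alpha>: "\<alpha> > 0"
  obtains K where "K > 0" "\<And>u. u \<ge> 1 \<Longrightarrow> u ^ m * exp (- c * u powr \<alpha>) \<le> K"
proof -
  obtain n where n: "real m / \<alpha> < real n" using reals_Archimedean2 by blast
  have n0: "n > 0"
  proof (rule ccontr)
    assume "\<not> n > 0"
    moreover have "real m / \<alpha> \<ge> 0" using \<alpha> by simp
    ultimately show False using n by simp
  qed
  have "u ^ m * exp (- c * u powr \<alpha>) \<le> (real n / c) ^ n" if u: "u \<ge> 1" for u :: real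
  proof -
    have "real m \<le> \<alpha> * real n" using n \<alpha> by (simp add: field_simps)
    then have "u powr real m \<le> u powr (\<alpha> * real n)" using u by (intro powr_mono) auto
    then have 1: "u ^ m \<le> (u powr \<alpha>) ^ n" using u by (simp add: powr_realpow[symmetric] powr_powr)
    have "(c * u powr \<alpha> / real n) ^ n \<le> exp (c * u powr \<alpha> / real n) ^ n"
      using c by (intro power_mono order_trans[OF _ exp_ge_add_one_self]) auto
    also have "\<dots> = exp (c * u powr \<alpha>)" using n0 by (simp add: exp_of_nat_mult[symmetric])
    finally have "(real n / c) ^ n * (c * u powr \<alpha> / real n) ^ n \<le> (real n / c) ^ n * exp (c * u powr \<alpha>)"
      using c by (intro mult_left_mono) auto
    then have 2: "(u powr \<alpha>) ^ n \<le> (real n / c) ^ n * exp (c * u powr \<alpha>)"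
      using c n0 by (simp add: power_mult_distrib[symmetric])
    have "u ^ m * exp (- c * u powr \<alpha>) \<le> (real n / c) ^ n * exp (c * u powr \<alpha>) * exp (- c * u powr \<alpha>)"
      using 1 2 by (intro mult_right_mono) auto
    also have "\<dots> = (real n / c) ^ n" by (simp add: exp_minus)
    finally show ?thesis .
  qed
  then show ?thesis using that[of "(real n / c) ^ n"] c n0 by simp
qed

text \<open>The shape of the majorant of \<open>g''\<close> below: an integrable singularity at 0
  and quadratic decay at infinity.\<close>

lemma integrable_powr_split:
  fixes \<beta> :: real
  assumes \<beta>: "\<beta> > 0"
  shows "integrable lborel (\<lambda>u. indicator {0<..<1} u * u powr (\<beta> - 1) + indicator {1<..} u / u\<^sup>2 :: real)"
proof (intro Bochner_Integration.integrable_add)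
  have "set_integrable lborel (einterval 0 1) (\<lambda>u. u powr (\<beta> - 1))"
  proof (rule interval_integral_FTC_nonneg(1)[where F = "\<lambda>u. u powr \<beta> / \<beta>" and A = 0 and B = "1 / \<beta>"])
    show "((\<lambda>u. u powr \<beta> / \<beta>) has_real_derivative x powr (\<beta> - 1)) (at x)" if "0 < ereal x" "ereal x < 1" for x
      using that \<beta> by (auto intro!: derivative_eq_intros)
    show "isCont (\<lambda>u. u powr (\<beta> - 1)) x" if "0 < ereal x" "ereal x < 1" for x
      using that by (intro continuous_intros) auto
    have "((\<lambda>u. u powr \<beta> / \<beta>) \<longlongrightarrow> 0 / \<beta>) (at_right 0)"
      using \<beta> by (intro tendsto_divide tendsto_const tendsto_zero_powrI[where b = \<beta>] tendsto_ident_at)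
         (auto simp: eventually_at_right_less intro!: eventually_at_rightI[of 0 1])
    then show "(((\<lambda>u. u powr \<beta> / \<beta>) \<circ> real_of_ereal) \<longlongrightarrow> 0) (at_right 0)"
      unfolding zero_ereal_def ereal_tendsto_simps by simp
    have "((\<lambda>u. u powr \<beta> / \<beta>) \<longlongrightarrow> 1 powr \<beta> / \<beta>) (at_left 1)"
      using \<beta> by (intro tendsto_intros) auto
    then show "(((\<lambda>u. u powr \<beta> / \<beta>) \<circ> real_of_ereal) \<longlongrightarrow> 1 / \<beta>) (at_left 1)"
      unfolding one_ereal_def ereal_tendsto_simps by simp
  qed auto
  then have "set_integrable lborel {0<..<1} (\<lambda>u. u powr (\<beta> - 1))"
    unfolding zero_ereal_def one_ereal_def einterval_eq .
  then show "integrable lborel (\<lambda>u. indicator {0<..<1} u * u powr (\<beta> - 1) :: real)"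
    by (simp add: set_integrable_def)
  have "set_integrable lborel (einterval 1 \<infinity>) (\<lambda>u. 1 / u\<^sup>2 :: real)"
  proof (rule interval_integral_FTC_nonneg(1)[where F = "\<lambda>u. - (1 / u)" and A = "-1" and B = 0])
    show "((\<lambda>u. - (1 / u)) has_real_derivative 1 / x\<^sup>2) (at x)" if "1 < ereal x" "ereal x < \<infinity>" for x
      using that by (auto intro!: derivative_eq_intros simp: power2_eq_square)
    show "isCont (\<lambda>u. 1 / u\<^sup>2) x" if "1 < ereal x" "ereal x < \<infinity>" for x :: real
      using that by (intro continuous_intros) auto
    have "((\<lambda>u::real. - (1 / u)) \<longlongrightarrow> - (1 / 1)) (at_right 1)" by (intro tendsto_intros) auto
    then show "(((\<lambda>u::real. - (1 / u)) \<circ> real_of_ereal) \<longlongrightarrow> -1) (at_right 1)"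
      unfolding one_ereal_def ereal_tendsto_simps by simp
    have "((\<lambda>u::real. - (1 / u)) \<longlongrightarrow> 0) at_top"
      using tendsto_minus[OF tendsto_divide_0[OF tendsto_const filterlim_at_top_imp_at_infinity[OF filterlim_ident]], of "1::real"]
      by simp
    then show "(((\<lambda>u::real. - (1 / u)) \<circ> real_of_ereal) \<longlongrightarrow> 0) (at_left \<infinity>)"
      unfolding ereal_tendsto_simps .
  qed auto
  then have "set_integrable lborel {1<..} (\<lambda>u. 1 / u\<^sup>2 :: real)"
    unfolding one_ereal_def einterval_eq .
  then show "integrable lborel (\<lambda>u. indicator {1<..} u / u\<^sup>2 :: real)"
    by (simp add: set_integrable_def)
qed

text \<open>Integration by parts twice against \<open>exp (- \<i> x u)\<close>: the function
  \<open>exp (- \<i> x u) * (\<i> / x * g u + g' u / x\<^sup>2)\<close> has derivative \<open>exp (- \<i> x u) * (g u + g'' u / x\<^sup>2)\<close>.\<close>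

lemma half_line_fourier_bound:
  fixes g g' g'' :: "real \<Rightarrow> complex"
  assumes g: "\<And>u. u > 0 \<Longrightarrow> (g has_vector_derivative g' u) (at u)"
    and g': "\<And>u. u > 0 \<Longrightarrow> (g' has_vector_derivative g'' u) (at u)"
    and g'': "\<And>u. u > 0 \<Longrightarrow> isCont g'' u"
    and ig: "set_integrable lborel {0<..} g" and ig'': "set_integrable lborel {0<..} g''"
    and lim0: "(g \<longlongrightarrow> 0) (at_right 0)" "(g' \<longlongrightarrow> l) (at_right 0)"
    and lim: "(g \<longlongrightarrow> 0) at_top" "(g' \<longlongrightarrow> 0) at_top" and x: "x \<noteq> 0"
  shows "norm (\<integral>u\<in>{0<..}. iexp (- (x * u)) * g u \<partial>lborel)
    \<le> (norm l + (\<integral>u\<in>{0<..}. norm (g'' u) \<partial>lborel)) / x\<^sup>2"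
proof -
  define F where "F u = iexp (- (x * u)) * (\<i> / of_real x * g u + g' u / of_real (x\<^sup>2))" for u
  define f where "f u = iexp (- (x * u)) * g u + iexp (- (x * u)) * g'' u / of_real (x\<^sup>2)" for u
  have si: "set_integrable lborel {0<..} (\<lambda>u. iexp (- (x * u)) * h u)" if h: "set_integrable lborel {0<..} h" for h :: "real \<Rightarrow> complex"
  proof -
    have "integrable lborel (\<lambda>u. iexp (- (x * u)) * (indicator {0<..} u *\<^sub>R h u))"
    proof (rule Bochner_Integration.integrable_bound[OF h[unfolded set_integrable_def]])
      have [measurable]: "(\<lambda>u. indicator {0<..} u *\<^sub>R h u) \<in> borel_measurable lborel"
        using h unfolding set_integrable_def by (rule borel_measurable_integrable)
      show "(\<lambda>u. iexp (- (x * u)) * (indicator {0<..} u *\<^sub>R h u)) \<in> borel_measurable lborel" by measurable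
      show "AE u in lborel. norm (iexp (- (x * u)) * (indicator {0<..} u *\<^sub>R h u)) \<le> norm (indicator {0<..} u *\<^sub>R h u)"
        unfolding norm_mult by simp
    qed
    then show ?thesis unfolding set_integrable_def by (simp add: mult_ac scaleR_conv_of_real)
  qed
  have dg: "isCont g u" "isCont g' u" if "u > 0" for u
    using g[OF that] g'[OF that] has_vector_derivative_continuous by blast+
  have i1: "set_integrable lborel {0<..} (\<lambda>u. iexp (- (x * u)) * g u)" by (rule si[OF ig])
  have i2: "set_integrable lborel {0<..} (\<lambda>u. iexp (- (x * u)) * g'' u)" by (rule si[OF ig''])
  have i2': "set_integrable lborel {0<..} (\<lambda>u. iexp (- (x * u)) * g'' u / of_real (x\<^sup>2))"
    using i2 by (rule set_integrable_divide) 
  have bnd0: "((\<lambda>u. iexp (- (x * u)) * h u) \<longlongrightarrow> 0) G" if "(h \<longlongrightarrow> 0) G" for h :: "real \<Rightarrow> complex" and G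
  proof (rule Lim_null_comparison)
    show "\<forall>\<^sub>F u in G. norm (iexp (- (x * u)) * h u) \<le> norm (h u)" by (simp add: norm_mult)
    show "((\<lambda>u. norm (h u)) \<longlongrightarrow> 0) G" by (rule tendsto_norm_zero[OF that])
  qed
  \<comment> \<open>Only the lower boundary term survives: there \<open>g\<close> tends to 0 and
    \<open>g'\<close> to \<open>l\<close>, while both vanish at infinity.\<close>
  have "(LBINT u=0..\<infinity>. f u) = 0 - l / of_real (x\<^sup>2)"
  proof (rule interval_integral_FTC_integrable[where F = F])
    show "(F has_vector_derivative f u) (at u)" if "0 < ereal u" "ereal u < \<infinity>" for u
    proof -
      have u: "u > 0" using that by simp
      have e: "((\<lambda>u. iexp (- (x * u))) has_vector_derivative (- \<i> * of_real x) * iexp (- (x * u))) (at u)"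
      proof -
        have "((exp \<circ> (\<lambda>u. \<i> * of_real (- (x * u)))) has_vector_derivative (\<i> * of_real (- x)) * exp (\<i> * of_real (- (x * u)))) (at u)"
          by (rule field_vector_diff_chain_at) (auto intro!: derivative_eq_intros)
        then show ?thesis by (simp add: comp_def)
      qed
      have "(F has_vector_derivative
         (iexp (- (x * u)) * (\<i> / of_real x * g' u + g'' u / of_real (x\<^sup>2))
          + ((- \<i> * of_real x) * iexp (- (x * u))) * (\<i> / of_real x * g u + g' u / of_real (x\<^sup>2)))) (at u)"
        unfolding F_def
        by (rule has_vector_derivative_mult[OF e])
           (intro has_vector_derivative_add has_vector_derivative_mult_right has_vector_derivative_divide g g' u)
      moreover have "iexp (- (x * u)) * (\<i> / of_real x * g' u + g'' u / of_real (x\<^sup>2))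
          + ((- \<i> * of_real x) * iexp (- (x * u))) * (\<i> / of_real x * g u + g' u / of_real (x\<^sup>2)) = f u"
        using x by (simp add: f_def field_simps power2_eq_square)
      ultimately show ?thesis by simp
    qed
    show "isCont f u" if "0 < ereal u" "ereal u < \<infinity>" for u
      unfolding f_def using that x by (intro continuous_intros dg g'') auto
    show "set_integrable lborel (einterval 0 \<infinity>) f"
      unfolding zero_ereal_def einterval_eq f_def by (intro set_integral_add i1 i2')
    have "((\<lambda>u. iexp (- (x * u)) * (\<i> / of_real x * g u + g' u / of_real (x\<^sup>2))) \<longlongrightarrow> iexp (- (x * 0)) * (\<i> / of_real x * 0 + l / of_real (x\<^sup>2))) (at_right 0)"
      using x by (intro tendsto_intros lim0) auto
    then show "((F \<circ> real_of_ereal) \<longlongrightarrow> l / of_real (x\<^sup>2)) (at_right 0)"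
      unfolding zero_ereal_def ereal_tendsto_simps F_def by simp
    have "((\<lambda>u. \<i> / of_real x * g u + g' u / of_real (x\<^sup>2)) \<longlongrightarrow> \<i> / of_real x * 0 + 0 / of_real (x\<^sup>2)) at_top"
      using x by (intro tendsto_intros lim) auto
    then have "((\<lambda>u. \<i> / of_real x * g u + g' u / of_real (x\<^sup>2)) \<longlongrightarrow> 0) at_top" by simp
    from bnd0[OF this] show "((F \<circ> real_of_ereal) \<longlongrightarrow> 0) (at_left \<infinity>)"
      unfolding ereal_tendsto_simps F_def .
  qed simp
  then have "(\<integral>u\<in>{0<..}. f u \<partial>lborel) = - l / of_real (x\<^sup>2)"
    unfolding interval_lebesgue_integral_def zero_ereal_def einterval_eq by simp
  then have eq: "(\<integral>u\<in>{0<..}. iexp (- (x * u)) * g u \<partial>lborel) = - l / of_real (x\<^sup>2) - (\<integral>u\<in>{0<..}. iexp (- (x * u)) * g'' u \<partial>lborel) / of_real (x\<^sup>2)"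
    unfolding f_def using i1 i2' by (simp add: set_integral_add(2) algebra_simps)
  have "norm (\<integral>u\<in>{0<..}. iexp (- (x * u)) * g'' u \<partial>lborel) \<le> (\<integral>u\<in>{0<..}. norm (iexp (- (x * u)) * g'' u) \<partial>lborel)"
    unfolding set_lebesgue_integral_def by (rule order_trans[OF integral_norm_bound]) simp
  also have "\<dots> = (\<integral>u\<in>{0<..}. norm (g'' u) \<partial>lborel)" by (simp add: norm_mult)
  finally have n: "norm (\<integral>u\<in>{0<..}. iexp (- (x * u)) * g'' u \<partial>lborel) \<le> (\<integral>u\<in>{0<..}. norm (g'' u) \<partial>lborel)" .
  have "norm (\<integral>u\<in>{0<..}. iexp (- (x * u)) * g u \<partial>lborel)
      \<le> norm (- l / of_real (x\<^sup>2)) + norm ((\<integral>u\<in>{0<..}. iexp (- (x * u)) * g'' u \<partial>lborel) / of_real (x\<^sup>2))"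
    unfolding eq by (rule norm_triangle_ineq4)
  also have "\<dots> = (norm l + norm (\<integral>u\<in>{0<..}. iexp (- (x * u)) * g'' u \<partial>lborel)) / x\<^sup>2"
    by (simp add: norm_divide add_divide_distrib norm_power)
  also have "\<dots> \<le> (norm l + (\<integral>u\<in>{0<..}. norm (g'' u) \<partial>lborel)) / x\<^sup>2"
    using n by (intro divide_right_mono add_left_mono) auto
  finally show ?thesis .
qed

section \<open>Half-line Fourier decay of the stable symbol\<close>

lemma abs_ln_le: "\<bar>ln u\<bar> \<le> 2 * u powr (-1/2)" if "0 < u" "u \<le> 1" for u :: real
proof -
  have "ln (1 / u) \<le> (1 / u) powr (1/2) / (1/2)" using that by (intro ln_powr_bound) auto
  moreover have "(1 / u) powr (1/2) = u powr (-1/2)" using that by (simp add: powr_divide powr_minus_divide)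
  ultimately show ?thesis using that by (simp add: ln_div)
qed

text \<open>\<open>\<eta>\<close> is the exponent at time 1 on u > 0 after removal of the drift, and
  \<open>\<kappa>\<close> is u times its derivative written out. Differentiating through
  \<open>\<kappa>\<close> avoids the second derivative of \<open>\<eta>\<close>, whose terms of
  order u powr (\<alpha> - 2) and 1/u may fail to be integrable at 0. The exponent
  \<open>\<beta>\<close> is small enough to dominate the logarithm as well.\<close>

locale stable_exponent =
  fixes w a :: complex and \<alpha> :: real
  assumes w: "Re w < 0" and a: "Re a = 0" and \<alpha>: "0 < \<alpha>" "\<alpha> < 2"
begin

definition \<eta> :: "real \<Rightarrow> complex" where "\<eta> u = (u powr \<alpha>) *\<^sub>R w + (u * ln u) *\<^sub>R a"
definition \<eta>' :: "real \<Rightarrow> complex" where "\<eta>' u = (\<alpha> * u powr (\<alpha> - 1)) *\<^sub>R w + (ln u + 1) *\<^sub>R a"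
definition \<kappa> :: "real \<Rightarrow> complex" where "\<kappa> u = (\<alpha> * u powr \<alpha>) *\<^sub>R w + (u * ln u + u) *\<^sub>R a"
definition \<kappa>' :: "real \<Rightarrow> complex" where "\<kappa>' u = (\<alpha>\<^sup>2 * u powr (\<alpha> - 1)) *\<^sub>R w + (ln u + 2) *\<^sub>R a"
definition c :: real where "c = - Re w"
definition K :: real where "K = 2 * norm w + 3 * norm a"
definition \<beta> :: real where "\<beta> = min \<alpha> (1/2)"

text \<open>Up to a constant, the Fourier transform of the derivative of the density on the positive
  half line. That \<open>g\<close> tends to 0 and \<open>g'\<close> to 1 at 0, with
  \<open>g''\<close> integrable, is why this derivative decays like 1/x^2.\<close>

definition g :: "real \<Rightarrow> complex" where "g u = u *\<^sub>R exp (\<eta> u)"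
definition g' :: "real \<Rightarrow> complex" where "g' u = (1 + \<kappa> u) * exp (\<eta> u)"
definition g'' :: "real \<Rightarrow> complex" where "g'' u = (\<kappa>' u + (1 + \<kappa> u) * \<eta>' u) * exp (\<eta> u)"

lemma c: "c > 0" using w by (simp add: c_def)
lemma K: "K \<ge> 0" by (simp add: K_def)
lemma \<beta>: "0 < \<beta>" "\<beta> \<le> \<alpha>" "\<beta> \<le> 1/2" using \<alpha> by (auto simp: \<beta>_def)

lemma norm_exp_\<eta>: "norm (exp (\<eta> u)) = exp (- c * u powr \<alpha>)"
  by (simp add: norm_exp_eq_Re \<eta>_def a c_def mult.commute)

lemma norm_g: "u \<ge> 0 \<Longrightarrow> norm (g u) = u * exp (- c * u powr \<alpha>)"
  unfolding g_def norm_scaleR norm_exp_\<eta> by simp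

lemma \<kappa>_eq: "u > 0 \<Longrightarrow> \<kappa> u = u *\<^sub>R \<eta>' u"
  by (simp add: \<kappa>_def \<eta>'_def powr_diff field_simps scaleR_add_right)

lemma \<eta>_deriv: "u > 0 \<Longrightarrow> (\<eta> has_vector_derivative \<eta>' u) (at u)"
  unfolding \<eta>_def[abs_def] \<eta>'_def
  by (auto intro!: derivative_eq_intros simp: field_simps)

lemma \<kappa>_deriv: "u > 0 \<Longrightarrow> (\<kappa> has_vector_derivative \<kappa>' u) (at u)"
  unfolding \<kappa>_def[abs_def] \<kappa>'_def
  by (auto intro!: derivative_eq_intros simp: field_simps power2_eq_square scaleR_conv_of_real)

lemma exp_\<eta>_deriv: "u > 0 \<Longrightarrow> ((\<lambda>u. exp (\<eta> u)) has_vector_derivative \<eta>' u * exp (\<eta> u)) (at u)"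
  using field_vector_diff_chain_at[OF \<eta>_deriv DERIV_exp] by (simp add: comp_def)

lemma g_deriv: "u > 0 \<Longrightarrow> (g has_vector_derivative g' u) (at u)"
  unfolding g_def[abs_def] g'_def
  by (rule has_vector_derivative_eq_rhs[OF has_vector_derivative_scaleR[OF DERIV_ident exp_\<eta>_deriv]])
     (auto simp: \<kappa>_eq algebra_simps)

lemma g'_deriv: "u > 0 \<Longrightarrow> (g' has_vector_derivative g'' u) (at u)"
  unfolding g'_def[abs_def] g''_def
  by (rule has_vector_derivative_eq_rhs[OF has_vector_derivative_mult[OF has_vector_derivative_add[OF has_vector_derivative_const \<kappa>_deriv] exp_\<eta>_deriv]])
     (auto simp: algebra_simps)

lemma g''_cont: "u > 0 \<Longrightarrow> isCont g'' u"
  unfolding g''_def[abs_def] \<kappa>'_def \<eta>'_def \<kappa>_def \<eta>_def by (intro continuous_intros) auto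

text \<open>On this range the logarithm is at most 2 u powr (\<beta> - 1); together with \<alpha> <
  2 this gives the coefficients 2 and 3 in \<open>K\<close>.\<close>

lemma symbol_bounds_near_0:
  assumes u: "0 < u" "u \<le> 1"
  shows "norm (\<kappa> u) \<le> K * u powr \<beta>" "norm (\<eta>' u) \<le> K * u powr (\<beta> - 1)" "norm (\<kappa>' u) \<le> 2 * K * u powr (\<beta> - 1)"
proof -
  have p1: "u powr (\<alpha> - 1) \<le> u powr (\<beta> - 1)" using u \<beta> by (intro powr_mono') auto
  have p2: "1 \<le> u powr (\<beta> - 1)" using u \<beta> powr_mono'[of "\<beta> - 1" 0 u] by simp
  have "u powr (-1/2) \<le> u powr (\<beta> - 1)" using u \<beta> by (intro powr_mono') auto
  then have p3: "\<bar>ln u\<bar> \<le> 2 * u powr (\<beta> - 1)" using abs_ln_le[OF u] by linarith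
  have "norm (\<eta>' u) \<le> \<alpha> * u powr (\<alpha> - 1) * norm w + \<bar>ln u + 1\<bar> * norm a"
    unfolding \<eta>'_def using norm_triangle_ineq[of "(\<alpha> * u powr (\<alpha> - 1)) *\<^sub>R w" "(ln u + 1) *\<^sub>R a"] \<alpha> by simp
  also have "\<dots> \<le> 2 * u powr (\<beta> - 1) * norm w + 3 * u powr (\<beta> - 1) * norm a"
    using \<alpha> p1 p2 p3 by (intro add_mono mult_right_mono mult_mono) auto
  also have "\<dots> = K * u powr (\<beta> - 1)" by (simp add: K_def algebra_simps)
  finally show e: "norm (\<eta>' u) \<le> K * u powr (\<beta> - 1)" .
  have "norm (\<kappa> u) = u * norm (\<eta>' u)" using u by (simp add: \<kappa>_eq)
  also have "\<dots> \<le> u * (K * u powr (\<beta> - 1))" using u e by (intro mult_left_mono) auto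
  also have "\<dots> = K * u powr \<beta>" using u powr_add[of u 1 "\<beta> - 1"] by simp
  finally show "norm (\<kappa> u) \<le> K * u powr \<beta>" .
  have "norm (\<kappa>' u) \<le> \<alpha>\<^sup>2 * u powr (\<alpha> - 1) * norm w + \<bar>ln u + 2\<bar> * norm a"
    unfolding \<kappa>'_def using norm_triangle_ineq[of "(\<alpha>\<^sup>2 * u powr (\<alpha> - 1)) *\<^sub>R w" "(ln u + 2) *\<^sub>R a"] by simp
  also have "\<dots> \<le> 4 * u powr (\<beta> - 1) * norm w + 4 * u powr (\<beta> - 1) * norm a"
    using \<alpha> p1 p2 p3 power_mono[of \<alpha> 2 2] by (intro add_mono mult_right_mono mult_mono) auto
  also have "\<dots> \<le> 2 * K * u powr (\<beta> - 1)" by (simp add: K_def algebra_simps)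
  finally show "norm (\<kappa>' u) \<le> 2 * K * u powr (\<beta> - 1)" .
qed

lemma symbol_bounds_at_top:
  assumes u: "1 \<le> u"
  shows "norm (\<kappa> u) \<le> K * u\<^sup>2" "norm (\<eta>' u) \<le> K * u" "norm (\<kappa>' u) \<le> 2 * K * u"
proof -
  have p1: "u powr (\<alpha> - 1) \<le> u" using u \<alpha> powr_mono[of "\<alpha> - 1" 1 u] by simp
  have p3: "\<bar>ln u\<bar> \<le> u" using u ln_le_minus_one[of u] by simp
  have "norm (\<eta>' u) \<le> \<alpha> * u powr (\<alpha> - 1) * norm w + \<bar>ln u + 1\<bar> * norm a"
    unfolding \<eta>'_def using norm_triangle_ineq[of "(\<alpha> * u powr (\<alpha> - 1)) *\<^sub>R w" "(ln u + 1) *\<^sub>R a"] \<alpha> by simp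
  also have "\<dots> \<le> 2 * u * norm w + 3 * u * norm a"
    using \<alpha> p1 p3 u by (intro add_mono mult_right_mono mult_mono) auto
  also have "\<dots> = K * u" by (simp add: K_def algebra_simps)
  finally show e: "norm (\<eta>' u) \<le> K * u" .
  have "norm (\<kappa> u) = u * norm (\<eta>' u)" using u by (simp add: \<kappa>_eq)
  also have "\<dots> \<le> u * (K * u)" using u e by (intro mult_left_mono) auto
  finally show "norm (\<kappa> u) \<le> K * u\<^sup>2" by (simp add: power2_eq_square mult_ac)
  have "norm (\<kappa>' u) \<le> \<alpha>\<^sup>2 * u powr (\<alpha> - 1) * norm w + \<bar>ln u + 2\<bar> * norm a"
    unfolding \<kappa>'_def using norm_triangle_ineq[of "(\<alpha>\<^sup>2 * u powr (\<alpha> - 1)) *\<^sub>R w" "(ln u + 2) *\<^sub>R a"] by simp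
  also have "\<dots> \<le> 4 * u * norm w + 4 * u * norm a"
    using \<alpha> p1 p3 u power_mono[of \<alpha> 2 2] by (intro add_mono mult_right_mono mult_mono) auto
  also have "\<dots> \<le> 2 * K * u" using u by (simp add: K_def algebra_simps)
  finally show "norm (\<kappa>' u) \<le> 2 * K * u" .
qed

text \<open>The factor in front of the exponential in \<open>g''\<close> grows at most like u^3; two
  further powers buy the decay u^(-2).\<close>

lemma power5_exp_bounded:
  obtains K3 where "K3 > 0" "\<And>u. u \<ge> 1 \<Longrightarrow> u ^ 5 * exp (- c * u powr \<alpha>) \<le> K3"
  using power_times_exp_powr_bounded[OF c \<alpha>(1), where m = 5] by blast

text \<open>The point 1 lies in neither interval of the majorant; it is a null set for the
  integral.\<close>

lemma g''_bound:
  obtains B where "\<And>u. u > 0 \<Longrightarrow> u \<noteq> 1 \<Longrightarrow> norm (g'' u) \<le> B * (indicator {0<..<1} u * u powr (\<beta> - 1) + indicator {1<..} u / u\<^sup>2)"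
proof -
  obtain K3 where K3: "K3 > 0" "\<And>u. u \<ge> 1 \<Longrightarrow> u ^ 5 * exp (- c * u powr \<alpha>) \<le> K3" by (rule power5_exp_bounded) (rule that; blast)
  define B where "B = (2 * K + (1 + K) * K) * (1 + K3)"
  have B0: "2 * K + (1 + K) * K \<ge> 0" using K by simp
  have tri: "norm (g'' u) \<le> (norm (\<kappa>' u) + (1 + norm (\<kappa> u)) * norm (\<eta>' u)) * exp (- c * u powr \<alpha>)" for u
    unfolding g''_def norm_mult norm_exp_\<eta>
    by (intro mult_right_mono order_trans[OF norm_triangle_ineq] add_left_mono)
       (auto simp: norm_mult intro!: mult_right_mono order_trans[OF norm_triangle_ineq])
  have "norm (g'' u) \<le> B * (indicator {0<..<1} u * u powr (\<beta> - 1) + indicator {1<..} u / u\<^sup>2)" if u: "u > 0" "u \<noteq> 1" for u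
  proof (cases "u < 1")
    case True
    have ub: "u powr \<beta> \<le> 1" using u True \<beta> by (simp add: powr_le1)
    have e1: "exp (- c * u powr \<alpha>) \<le> 1" using c by simp
    have "norm (\<kappa>' u) + (1 + norm (\<kappa> u)) * norm (\<eta>' u) \<le> 2 * K * u powr (\<beta> - 1) + (1 + K) * (K * u powr (\<beta> - 1))"
    proof (intro add_mono mult_mono)
      show "norm (\<kappa> u) \<le> K" using symbol_bounds_near_0(1)[of u] u True mult_left_mono[OF ub K] by simp
    qed (use symbol_bounds_near_0[of u] u True K in auto)
    also have "\<dots> = (2 * K + (1 + K) * K) * u powr (\<beta> - 1)" by (simp add: algebra_simps)
    finally have "norm (g'' u) \<le> (2 * K + (1 + K) * K) * u powr (\<beta> - 1) * 1"
      using tri[of u] e1 K by (meson order_trans mult_mono exp_ge_zero mult_nonneg_nonneg norm_ge_zero powr_ge_zero B0 mult_left_le)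
    also have "\<dots> \<le> B * u powr (\<beta> - 1)" unfolding B_def
      using mult_left_mono[of 1 "1 + K3" "2 * K + (1 + K) * K"] B0 K3(1) by (simp add: mult_right_mono)
    finally show ?thesis using True u by (simp add: indicator_def)
  next
    case False
    then have u1: "u > 1" using u by simp
    have pw: "u \<le> u ^ 3" "1 \<le> u\<^sup>2" using u1 power_increasing[of 1 3 u] by auto
    have "norm (\<kappa>' u) + (1 + norm (\<kappa> u)) * norm (\<eta>' u) \<le> 2 * K * u + (1 + K * u\<^sup>2) * (K * u)"
      using symbol_bounds_at_top[of u] u1 K by (intro add_mono mult_mono) auto
    also have "\<dots> \<le> 2 * K * u ^ 3 + ((1 + K) * u\<^sup>2) * (K * u)"
      using pw u1 K by (intro add_mono mult_left_mono mult_right_mono) (auto simp: algebra_simps)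
    also have "\<dots> = (2 * K + (1 + K) * K) * u ^ 3" by (simp add: algebra_simps power2_eq_square power3_eq_cube)
    finally have "norm (g'' u) \<le> (2 * K + (1 + K) * K) * u ^ 3 * exp (- c * u powr \<alpha>)"
      using tri[of u] by (meson order_trans mult_right_mono exp_ge_zero)
    also have "\<dots> \<le> (2 * K + (1 + K) * K) * (K3 / u\<^sup>2)"
    proof -
      have "u ^ 3 * exp (- c * u powr \<alpha>) = u ^ 5 * exp (- c * u powr \<alpha>) / u\<^sup>2"
        using u1 by (simp add: field_simps power_add[symmetric])
      also have "\<dots> \<le> K3 / u\<^sup>2" using K3(2)[of u] u1 by (intro divide_right_mono) auto
      finally show ?thesis unfolding mult.assoc using B0 by (intro mult_left_mono) auto
    qed
    also have "\<dots> \<le> B * (1 / u\<^sup>2)" unfolding B_def mult.assoc using B0 K3 by (intro mult_left_mono) (auto intro!: divide_right_mono)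
    finally show ?thesis using u1 by (simp add: indicator_def)
  qed
  then show ?thesis using that by blast
qed

lemma g''_integrable: "set_integrable lborel {0<..} g''"
proof -
  obtain B where B: "\<And>u. u > 0 \<Longrightarrow> u \<noteq> 1 \<Longrightarrow> norm (g'' u) \<le> B * (indicator {0<..<1} u * u powr (\<beta> - 1) + indicator {1<..} u / u\<^sup>2)"
    by (rule g''_bound) (rule that; blast)
  show ?thesis
    unfolding set_integrable_def
  proof (rule Bochner_Integration.integrable_bound)
    show "integrable lborel (\<lambda>u. B * (indicator {0<..<1} u * u powr (\<beta> - 1) + indicator {1<..} u / u\<^sup>2))"
      by (intro integrable_mult_right integrable_powr_split \<beta>)
    show "(\<lambda>u. indicator {0<..} u *\<^sub>R g'' u) \<in> borel_measurable lborel"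
      unfolding g''_def \<kappa>'_def \<eta>'_def \<kappa>_def \<eta>_def by measurable
    have "AE u in lborel. u \<noteq> (1::real)" by (rule AE_lborel_singleton)
    then show "AE u in lborel. norm (indicator {0<..} u *\<^sub>R g'' u) \<le> norm (B * (indicator {0<..<1} u * u powr (\<beta> - 1) + indicator {1<..} u / u\<^sup>2))"
    proof eventually_elim
      case (elim u)
      then show ?case using B[of u] abs_ge_self[of "B * (indicator {0<..<1} u * u powr (\<beta> - 1) + indicator {1<..} u / u\<^sup>2)"]
        by (cases "u > 0") (auto intro: order_trans simp del: abs_ge_self)
    qed
  qed
qed

lemma weighted_bound:
  obtains B where "B > 0" "\<And>u k. u \<ge> 0 \<Longrightarrow> k \<le> 3 \<Longrightarrow> u ^ k * exp (- c * u powr \<alpha>) \<le> B * inverse (1 + u\<^sup>2)"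
proof -
  obtain K3 where K3: "K3 > 0" "\<And>u. u \<ge> 1 \<Longrightarrow> u ^ 5 * exp (- c * u powr \<alpha>) \<le> K3" by (rule power5_exp_bounded) (rule that; blast)
  have "u ^ k * exp (- c * u powr \<alpha>) \<le> 2 * (1 + K3) * inverse (1 + u\<^sup>2)" if u: "u \<ge> 0" and k: "k \<le> 3" for u k
  proof (cases "u \<le> 1")
    case True
    have "u ^ k * exp (- c * u powr \<alpha>) \<le> 1 * 1" using u True c by (intro mult_mono) (auto simp: power_le_one)
    also have "\<dots> \<le> 2 * inverse (1 + u\<^sup>2)" using u True power_le_one[of u 2] by (simp add: field_simps add_pos_nonneg)
    also have "\<dots> \<le> 2 * (1 + K3) * inverse (1 + u\<^sup>2)" using K3 by (intro mult_right_mono) auto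
    finally show ?thesis .
  next
    case False
    then have u1: "u > 1" by simp
    have "u ^ k * exp (- c * u powr \<alpha>) \<le> u ^ 3 * exp (- c * u powr \<alpha>)" using u1 k by (intro mult_right_mono power_increasing) auto
    also have "\<dots> = u ^ 5 * exp (- c * u powr \<alpha>) / u\<^sup>2" using u1 by (simp add: field_simps power_add[symmetric])
    also have "\<dots> \<le> K3 / u\<^sup>2" using K3(2)[of u] u1 by (intro divide_right_mono) auto
    also have "\<dots> \<le> (2 * K3) / (1 + u\<^sup>2)"
    proof -
      have "1 + u\<^sup>2 \<le> 2 * u\<^sup>2" using u1 one_le_power[of u 2] by simp
      then have "K3 * (1 + u\<^sup>2) \<le> K3 * (2 * u\<^sup>2)" using K3 by (intro mult_left_mono) auto
      then show ?thesis using u1 by (simp add: field_simps add_pos_pos)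
    qed
    also have "\<dots> \<le> 2 * (1 + K3) * inverse (1 + u\<^sup>2)" by (simp add: divide_inverse mult_right_mono)
    finally show ?thesis .
  qed
  then show ?thesis using that[of "2 * (1 + K3)"] K3 by auto
qed

lemma integrable_inverse_square: "integrable lborel (\<lambda>x::real. inverse (1 + x\<^sup>2))"
  using integrable_inverse_1_plus_square by (simp add: set_integrable_def einterval_def)

lemma g_integrable: "set_integrable lborel {0<..} g"
proof -
  obtain B where B: "B > 0" "\<And>u k. u \<ge> 0 \<Longrightarrow> k \<le> 3 \<Longrightarrow> u ^ k * exp (- c * u powr \<alpha>) \<le> B * inverse (1 + u\<^sup>2)"
    by (rule weighted_bound) (rule that; blast)
  show ?thesis
    unfolding set_integrable_def
  proof (rule Bochner_Integration.integrable_bound)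
    show "integrable lborel (\<lambda>u. B * inverse (1 + u\<^sup>2))" by (intro integrable_mult_right integrable_inverse_square)
    show "(\<lambda>u. indicator {0<..} u *\<^sub>R g u) \<in> borel_measurable lborel" unfolding g_def \<eta>_def by measurable
    show "AE u in lborel. norm (indicator {0<..} u *\<^sub>R g u) \<le> norm (B * inverse (1 + u\<^sup>2))"
    proof (rule AE_I2)
      fix u :: real
      show "norm (indicator {0<..} u *\<^sub>R g u) \<le> norm (B * inverse (1 + u\<^sup>2))"
        using B(2)[of u 1] B(1) by (auto simp: indicator_def norm_g)
    qed
  qed
qed

lemma g_tendsto_at_top:
  shows "(g \<longlongrightarrow> 0) at_top" "(g' \<longlongrightarrow> 0) at_top"
proof -
  obtain K3 where K3: "K3 > 0" "\<And>u. u \<ge> 1 \<Longrightarrow> u ^ 5 * exp (- c * u powr \<alpha>) \<le> K3" by (rule power5_exp_bounded) (rule that; blast)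
  have e: "u\<^sup>2 * exp (- c * u powr \<alpha>) \<le> K3 / u" if u: "u \<ge> 1" for u
  proof -
    have "u ^ 3 * exp (- c * u powr \<alpha>) \<le> u ^ 5 * exp (- c * u powr \<alpha>)" using u by (intro mult_right_mono power_increasing) auto
    then have "u ^ 3 * exp (- c * u powr \<alpha>) \<le> K3" using K3(2)[OF u] by linarith
    moreover have "u\<^sup>2 * exp (- c * u powr \<alpha>) = u ^ 3 * exp (- c * u powr \<alpha>) / u"
      using u by (simp add: power2_eq_square power3_eq_cube)
    ultimately show ?thesis using u by (simp only:) (intro divide_right_mono; simp)
  qed
  have lim: "((\<lambda>u::real. C * (K3 / u)) \<longlongrightarrow> 0) at_top" for C
    by (intro tendsto_mult_right_zero tendsto_divide_0[OF tendsto_const] filterlim_at_top_imp_at_infinity filterlim_ident)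
  show "(g \<longlongrightarrow> 0) at_top"
  proof (rule Lim_null_comparison[OF _ lim[of 1]])
    show "\<forall>\<^sub>F u in at_top. norm (g u) \<le> 1 * (K3 / u)"
      using eventually_ge_at_top[of 1]
    proof eventually_elim
      case (elim u)
      have "u * exp (- c * u powr \<alpha>) \<le> u\<^sup>2 * exp (- c * u powr \<alpha>)"
        using elim by (intro mult_right_mono) (auto simp: power2_eq_square)
      then show ?case using e[OF elim] norm_g[of u] elim by linarith
    qed
  qed
  show "(g' \<longlongrightarrow> 0) at_top"
  proof (rule Lim_null_comparison[OF _ lim[of "1 + K"]])
    show "\<forall>\<^sub>F u in at_top. norm (g' u) \<le> (1 + K) * (K3 / u)"
      using eventually_ge_at_top[of 1]
    proof eventually_elim
      case (elim u)
      have "norm (1 + \<kappa> u) \<le> 1 + K * u\<^sup>2"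
        using symbol_bounds_at_top(1)[OF elim] norm_triangle_ineq[of 1 "\<kappa> u"] by simp
      also have "\<dots> \<le> (1 + K) * u\<^sup>2" using elim one_le_power[of u 2] by (simp add: algebra_simps)
      finally have "norm (g' u) \<le> (1 + K) * u\<^sup>2 * exp (- c * u powr \<alpha>)"
        unfolding g'_def norm_mult norm_exp_\<eta> by (rule mult_right_mono) simp
      also have "\<dots> \<le> (1 + K) * (K3 / u)" unfolding mult.assoc using e[OF elim] K by (intro mult_left_mono) auto
      finally show ?case .
    qed
  qed
qed

lemma g_tendsto_at_0:
  shows "(g \<longlongrightarrow> 0) (at_right 0)" "(g' \<longlongrightarrow> 1) (at_right 0)"
proof -
  have ev: "\<forall>\<^sub>F u in at_right 0. (0::real) < u \<and> u \<le> 1"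
    by (rule eventually_at_rightI[of 0 1]) auto
  have lim\<beta>: "((\<lambda>u. C * u powr \<beta>) \<longlongrightarrow> 0) (at_right 0)" for C :: real
    using \<beta> by (intro tendsto_mult_right_zero tendsto_zero_powrI[where b = \<beta>] tendsto_ident_at tendsto_const)
       (auto intro!: eventually_at_rightI[of 0 1])
  have lim\<alpha>: "((\<lambda>u. C * u powr \<alpha>) \<longlongrightarrow> 0) (at_right 0)" for C :: real
    using \<alpha> by (intro tendsto_mult_right_zero tendsto_zero_powrI[where b = \<alpha>] tendsto_ident_at tendsto_const)
       (auto intro!: eventually_at_rightI[of 0 1])
  have \<kappa>0: "(\<kappa> \<longlongrightarrow> 0) (at_right 0)"
    by (rule Lim_null_comparison[OF _ lim\<beta>[of K]]) (use ev in \<open>eventually_elim, auto intro: symbol_bounds_near_0\<close>)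
  have "((\<lambda>u. \<kappa> u - (\<alpha> * u powr \<alpha>) *\<^sub>R w - u *\<^sub>R a + (1 * u powr \<alpha>) *\<^sub>R w) \<longlongrightarrow> 0 - 0 *\<^sub>R w - 0 *\<^sub>R a + 0 *\<^sub>R w) (at_right 0)"
    by (intro tendsto_intros \<kappa>0 lim\<alpha>)
  moreover have "(\<lambda>u. \<kappa> u - (\<alpha> * u powr \<alpha>) *\<^sub>R w - u *\<^sub>R a + (1 * u powr \<alpha>) *\<^sub>R w) = \<eta>"
    by (simp add: fun_eq_iff \<kappa>_def \<eta>_def scaleR_add_left)
  ultimately have "(\<eta> \<longlongrightarrow> 0) (at_right 0)" by simp
  then have e: "((\<lambda>u. exp (\<eta> u)) \<longlongrightarrow> exp 0) (at_right 0)" by (rule tendsto_exp)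
  have "((\<lambda>u. u *\<^sub>R exp (\<eta> u)) \<longlongrightarrow> 0 *\<^sub>R exp 0) (at_right 0)" by (intro tendsto_intros e)
  then show "(g \<longlongrightarrow> 0) (at_right 0)" by (simp add: g_def[abs_def])
  have "((\<lambda>u. (1 + \<kappa> u) * exp (\<eta> u)) \<longlongrightarrow> (1 + 0) * exp 0) (at_right 0)" by (intro tendsto_intros e \<kappa>0)
  then show "(g' \<longlongrightarrow> 1) (at_right 0)" by (simp add: g'_def[abs_def])
qed

text \<open>Integration by parts gives decay like 1/x^2, and integrability of \<open>g\<close> gives
  a bound near 0; adding the two estimates yields one that is valid everywhere.\<close>

lemma fourier_decay:
  obtains A where "A > 0" "\<And>x. norm (\<integral>u\<in>{0<..}. iexp (- (x * u)) * g u \<partial>lborel) \<le> A * inverse (1 + x\<^sup>2)"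
proof -
  define A1 where "A1 = 1 + (\<integral>u\<in>{0<..}. norm (g'' u) \<partial>lborel)"
  define A2 where "A2 = (\<integral>u\<in>{0<..}. norm (g u) \<partial>lborel)"
  have A: "A1 \<ge> 0" "A2 \<ge> 0" unfolding A1_def A2_def set_lebesgue_integral_def
    by (auto intro!: add_nonneg_nonneg integral_nonneg_AE)
  have "norm (\<integral>u\<in>{0<..}. iexp (- (x * u)) * g u \<partial>lborel) \<le> (A1 + A2 + 1) * inverse (1 + x\<^sup>2)" for x
  proof -
    let ?I = "norm (\<integral>u\<in>{0<..}. iexp (- (x * u)) * g u \<partial>lborel)"
    have "?I \<le> (\<integral>u. norm (indicator {0<..} u *\<^sub>R (iexp (- (x * u)) * g u)) \<partial>lborel)"
      unfolding set_lebesgue_integral_def by (rule integral_norm_bound)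
    then have 1: "?I \<le> A2" by (simp add: A2_def set_lebesgue_integral_def norm_mult)
    have 2: "?I * x\<^sup>2 \<le> A1"
    proof (cases "x = 0")
      case False
      have "?I \<le> A1 / x\<^sup>2"
        unfolding A1_def
        using half_line_fourier_bound[OF g_deriv g'_deriv g''_cont g_integrable g''_integrable g_tendsto_at_0 g_tendsto_at_top False] by simp
      then show ?thesis using False by (simp add: field_simps)
    qed (use A in simp)
    have "?I * (1 + x\<^sup>2) \<le> A1 + A2 + 1" using 1 2 by (simp add: distrib_left)
    moreover have "1 + x\<^sup>2 > 0" by (simp add: add_pos_nonneg)
    ultimately show ?thesis by (simp add: divide_inverse[symmetric] pos_le_divide_eq)
  qed
  then show ?thesis using that[of "A1 + A2 + 1"] A by auto
qed

end

section \<open>Fourier inversion and translation of densities\<close>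

lemma fourier_derivative:
  fixes \<psi> :: "real \<Rightarrow> complex"
  assumes \<psi>: "integrable lborel \<psi>" "integrable lborel (\<lambda>u. of_real u * \<psi> u)" "integrable lborel (\<lambda>u. of_real (u\<^sup>2) * \<psi> u)"
  shows "((\<lambda>x. \<integral>u. iexp (- (x * u)) * \<psi> u \<partial>lborel) has_vector_derivative
    (\<integral>u. iexp (- (x * u)) * (- \<i> * of_real u * \<psi> u) \<partial>lborel)) (at x)"
proof -
  have int: "integrable lborel (\<lambda>u. iexp (- (x * u)) * h u)" if h: "integrable lborel h" for h :: "real \<Rightarrow> complex" and x
    by (rule Bochner_Integration.integrable_bound[OF h]) (use h in \<open>auto simp: norm_mult\<close>)
  have i1: "integrable lborel (\<lambda>u. - \<i> * of_real u * \<psi> u)"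
    using integrable_mult_right[OF \<psi>(2), of "- \<i>"] by (simp add: mult.assoc)
  define F where "F x = (\<integral>u. iexp (- (x * u)) * \<psi> u \<partial>lborel)" for x
  define D where "D = (\<integral>u. iexp (- (x * u)) * (- \<i> * of_real u * \<psi> u) \<partial>lborel)"
  define C where "C = (\<integral>u. norm (of_real (u\<^sup>2) * \<psi> u) \<partial>lborel)"
  \<comment> \<open>Differentiation under the integral with an explicit quadratic error: the
    second-order Taylor remainder of the exponential is integrated against the second moment
    \<open>C\<close>.\<close>
  have bound: "norm (F (x + h) - F x - h *\<^sub>R D) \<le> C * h\<^sup>2" for h
  proof -
    have "F (x + h) - F x - h *\<^sub>R D = (\<integral>u. iexp (- ((x + h) * u)) * \<psi> u - iexp (- (x * u)) * \<psi> u
       - h *\<^sub>R (iexp (- (x * u)) * (- \<i> * of_real u * \<psi> u)) \<partial>lborel)"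
      unfolding F_def D_def using int[OF \<psi>(1), of "x + h"] int[OF \<psi>(1), of x] int[OF i1, of x] by simp
    also have "norm \<dots> \<le> (\<integral>u. h\<^sup>2 * norm (of_real (u\<^sup>2) * \<psi> u) \<partial>lborel)"
    proof (rule order_trans[OF integral_norm_bound integral_mono[OF integrable_norm]])
      show "integrable lborel (\<lambda>u. iexp (- ((x + h) * u)) * \<psi> u - iexp (- (x * u)) * \<psi> u
         - h *\<^sub>R (iexp (- (x * u)) * (- \<i> * of_real u * \<psi> u)))"
        by (intro Bochner_Integration.integrable_diff integrable_scaleR_right int \<psi>(1) i1)
      show "integrable lborel (\<lambda>u. h\<^sup>2 * norm (of_real (u\<^sup>2) * \<psi> u))" using \<psi>(3) by simp
      fix u
      have "iexp (- ((x + h) * u)) * \<psi> u - iexp (- (x * u)) * \<psi> u - h *\<^sub>R (iexp (- (x * u)) * (- \<i> * of_real u * \<psi> u))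
        = iexp (- (x * u)) * \<psi> u * (iexp (- (h * u)) - (\<Sum>k\<le>1. (\<i> * (- (h * u))) ^ k / fact k))"
        by (simp add: distrib_right exp_diff exp_minus exp_add scaleR_conv_of_real field_simps)
      also have "norm \<dots> = norm (\<psi> u) * norm (iexp (- (h * u)) - (\<Sum>k\<le>1. (\<i> * (- (h * u))) ^ k / fact k))"
        by (simp only: norm_mult norm_exp_i_times mult_1_left)
      also have "\<dots> \<le> norm (\<psi> u) * (\<bar>- (h * u)\<bar> ^ Suc 1 / fact (Suc 1))"
        by (intro mult_left_mono iexp_approx1) simp
      also have "\<dots> \<le> h\<^sup>2 * norm (of_real (u\<^sup>2) * \<psi> u)"
        unfolding Suc_1 power2_abs by (simp add: norm_mult power_mult_distrib norm_power)
      finally show "norm (iexp (- ((x + h) * u)) * \<psi> u - iexp (- (x * u)) * \<psi> u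
         - h *\<^sub>R (iexp (- (x * u)) * (- \<i> * of_real u * \<psi> u))) \<le> h\<^sup>2 * norm (of_real (u\<^sup>2) * \<psi> u)" .
    qed
    also have "\<dots> = C * h\<^sup>2" by (simp add: C_def)
    finally show ?thesis .
  qed
  show ?thesis
    unfolding F_def[symmetric, abs_def] D_def[symmetric] has_vector_derivative_def has_derivative_at
  proof (intro conjI)
    show "bounded_linear (\<lambda>x. x *\<^sub>R D)" by (rule bounded_linear_scaleR_left)
    show "((\<lambda>h. norm (F (x + h) - F x - h *\<^sub>R D) / norm h) \<longlongrightarrow> 0) (at 0)"
    proof (rule Lim_null_comparison)
      show "\<forall>\<^sub>F h in at 0. norm (norm (F (x + h) - F x - h *\<^sub>R D) / norm h) \<le> C * \<bar>h\<bar>"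
        unfolding eventually_at
      proof (intro exI[of _ 1] conjI ballI impI)
        fix h :: real assume h: "h \<noteq> 0 \<and> dist h 0 < 1"
        have "norm (F (x + h) - F x - h *\<^sub>R D) / norm h \<le> C * h\<^sup>2 / norm h"
          by (rule divide_right_mono[OF bound]) simp
        also have "\<dots> = C * \<bar>h\<bar>" using h by (simp add: power2_eq_square abs_if)
        finally show "norm (norm (F (x + h) - F x - h *\<^sub>R D) / norm h) \<le> C * \<bar>h\<bar>" by simp
      qed simp
      show "((\<lambda>h. C * \<bar>h\<bar>) \<longlongrightarrow> 0) (at 0)" by (rule tendsto_mult_right_zero[OF tendsto_rabs_zero[OF tendsto_ident_at]])
    qed
  qed
qed

text \<open>The quotient is the integral of \<open>iexp (- (u * x))\<close> over x from a to b; for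
  u = 0 division by zero makes it 0.\<close>

lemma norm_iexp_diff_div_le: "norm ((iexp (- (u * a)) - iexp (- (u * b))) / (\<i> * of_real u)) \<le> \<bar>b - a\<bar>"
proof (cases "u = 0")
  case False
  have "iexp (- (u * a)) - iexp (- (u * b)) = iexp (- (u * a)) * (1 - iexp (u * (a - b)))"
    by (simp add: exp_diff exp_minus exp_add right_diff_distrib field_simps)
  then have "norm (iexp (- (u * a)) - iexp (- (u * b))) = norm (iexp (u * (a - b)) - 1)"
    by (simp add: norm_mult norm_minus_commute)
  also have "\<dots> \<le> \<bar>u * (a - b)\<bar>" using norm_iexp_diff_one_le[of "u * (a - b)"] by simp
  also have "\<dots> = \<bar>b - a\<bar> * \<bar>u\<bar>" by (simp add: abs_mult abs_minus_commute)
  finally show ?thesis using False unfolding norm_divide norm_mult by (simp add: pos_divide_le_eq)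
qed simp

text \<open>Levy's inversion formula is a limit of integrals over bounded intervals. As the kernel
  is bounded by |b - a| and the characteristic function is integrable, dominated convergence turns
  it into one integral.\<close>

lemma (in real_distribution) interval_measure_inversion:
  assumes ic: "integrable lborel (char M)" and ab: "a \<le> b" and nul: "measure M {a} = 0" "measure M {b} = 0"
  shows "of_real (measure M {a<..b}) = 1 / (2 * pi) * (\<integral>u. (iexp (- (u * a)) - iexp (- (u * b))) / (\<i> * u) * char M u \<partial>lborel)"
proof -
  let ?f = "\<lambda>u. (iexp (- (u * a)) - iexp (- (u * b))) / (\<i> * of_real u) * char M u"
  have fm [measurable]: "?f \<in> borel_measurable borel" by measurable
  have fb: "norm (?f u) \<le> \<bar>b - a\<bar> * norm (char M u)" for u
    unfolding norm_mult by (intro mult_right_mono norm_iexp_diff_div_le) simp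
  have "(\<lambda>n::nat. \<integral>u. indicator {- real n<..<real n} u *\<^sub>R ?f u \<partial>lborel) \<longlonglongrightarrow> (\<integral>u. ?f u \<partial>lborel)"
  proof (rule integral_dominated_convergence[where w = "\<lambda>u. \<bar>b - a\<bar> * norm (char M u)"])
    show "integrable lborel (\<lambda>u. \<bar>b - a\<bar> * norm (char M u))" using ic by simp
    show "AE u in lborel. (\<lambda>n. indicator {- real n<..<real n} u *\<^sub>R ?f u) \<longlonglongrightarrow> ?f u"
    proof (rule AE_I2)
      fix u :: real
      obtain N where N: "\<bar>u\<bar> < real N" using reals_Archimedean2 by blast
      have "indicator {- real n<..<real n} u *\<^sub>R ?f u = ?f u" if "n \<ge> N" for n
        using N that by (simp add: indicator_def abs_less_iff)
      then show "(\<lambda>n. indicator {- real n<..<real n} u *\<^sub>R ?f u) \<longlonglongrightarrow> ?f u"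
        by (intro tendsto_eventually) (auto simp: eventually_sequentially)
    qed
    show "AE u in lborel. norm (indicator {- real n<..<real n} u *\<^sub>R ?f u) \<le> \<bar>b - a\<bar> * norm (char M u)" for n
      using fb by (auto simp: indicator_def)
  qed measurable
  then have "(\<lambda>n. 1 / (2 * pi) * (\<integral>u. indicator {- real n<..<real n} u *\<^sub>R ?f u \<partial>lborel)) \<longlonglongrightarrow> 1 / (2 * pi) * (\<integral>u. ?f u \<partial>lborel)"
    by (intro tendsto_mult_left)
  moreover have "(CLBINT u=- real n..real n. ?f u) = (\<integral>u. indicator {- real n<..<real n} u *\<^sub>R ?f u \<partial>lborel)" for n
    by (simp add: interval_lebesgue_integral_def set_lebesgue_integral_def einterval_eq del: times_divide_eq_left)
  moreover have "(\<lambda>n. 1 / (2 * pi) * (CLBINT u=- real n..real n. ?f u)) \<longlonglongrightarrow> of_real (measure M {a<..b})"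
    using Levy_Inversion[OF ab nul] by simp
  ultimately show ?thesis using LIMSEQ_unique by (simp only:) 
qed

lemma char_uminus: "char M (- u) = cnj (char M u)"
proof -
  have "(\<lambda>x. iexp (- u * x)) = (\<lambda>x. cnj (iexp (u * x)))" by (simp add: fun_eq_iff exp_cnj)
  then show ?thesis unfolding char_def by (simp only: Bochner_Integration.integral_cnj)
qed

text \<open>For \<open>\<bar>h\<bar> \<le> 1\<close>, \<open>p (z - h) - p z\<close> is bounded by a multiple of \<open>\<bar>h\<bar> / (1 + z\<^sup>2)\<close>; larger \<open>h\<close> are trivial.\<close>

lemma shift_bound_of_density:
  fixes p p' :: "real \<Rightarrow> real"
  assumes p: "\<And>x. (p has_real_derivative p' x) (at x)" and A: "A \<ge> 0" "\<And>x. \<bar>p' x\<bar> \<le> A * inverse (1 + x\<^sup>2)"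
    and N: "prob_space N" "N = density lborel (\<lambda>x. ennreal (p x))" and p0: "\<And>x. p x \<ge> 0"
    and f: "bounded_meas B f"
  shows "\<bar>(\<integral>z. f (h + z) \<partial>N) - (\<integral>z. f z \<partial>N)\<bar> \<le> (2 + 3 * A * pi) * B * \<bar>h\<bar>"
proof -
  interpret prob_space N by (rule N)
  have sN [measurable_cong]: "sets N = sets borel" using N by simp
  have B: "B \<ge> 0" using f by (rule bounded_meas_nonneg)
  have fm [measurable]: "f \<in> borel_measurable borel" and fB: "\<And>x. \<bar>f x\<bar> \<le> B" using f by (auto simp: bounded_meas_def)
  have pc: "continuous_on UNIV p" using DERIV_isCont[OF p] by (intro continuous_at_imp_continuous_on) auto
  then have pm [measurable]: "p \<in> borel_measurable borel" by (rule borel_measurable_continuous_onI)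
  show ?thesis
  proof (cases "\<bar>h\<bar> \<le> 1")
    case False
    have "\<bar>expectation (\<lambda>z. f (h + z))\<bar> \<le> B" "\<bar>expectation f\<bar> \<le> B"
      by (rule abs_integral_le; use fB in simp)+
    then have "\<bar>(\<integral>z. f (h + z) \<partial>N) - (\<integral>z. f z \<partial>N)\<bar> \<le> 2 * B" by linarith
    also have "\<dots> \<le> (2 + 3 * A * pi) * B" using A B by (intro mult_right_mono) auto
    also have "\<dots> * 1 \<le> (2 + 3 * A * pi) * B * \<bar>h\<bar>" using False A B by (intro mult_left_mono) auto
    finally show ?thesis by simp
  next
    case True
    have iN: "integrable N (\<lambda>z. g z)" if "bounded_meas B g" for g
      by (rule integrable_const_bound[where B = B]) (use that in \<open>auto simp: bounded_meas_def\<close>)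
    have den: "(\<integral>z. g z \<partial>N) = (\<integral>z. p z * g z \<partial>lborel)" "integrable lborel (\<lambda>z. p z * g z)"
      if g: "bounded_meas B g" for g
    proof -
      have gm: "g \<in> borel_measurable lborel" using g by (simp add: bounded_meas_def)
      show "(\<integral>z. g z \<partial>N) = (\<integral>z. p z * g z \<partial>lborel)"
        unfolding N(2) using gm p0 by (subst integral_density) auto
      have "integrable (density lborel p) g" using iN[OF g] by (simp only: N(2)[symmetric])
      then show "integrable lborel (\<lambda>z. p z * g z)"
        using gm p0 by (subst (asm) integrable_density) auto
    qed
    have fs: "bounded_meas B (\<lambda>z. f (h + z))"
      using fB unfolding bounded_meas_def by (auto intro!: measurable_compose[OF _ fm])
    have "(\<integral>z. f (h + z) \<partial>N) = (\<integral>z. p z * f (h + z) \<partial>lborel)" by (rule den(1)[OF fs])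
    also have "\<dots> = (\<integral>z. p (- h + 1 * z) * f (h + (- h + 1 * z)) \<partial>lborel)"
      using lborel_integral_real_affine[of 1 "\<lambda>z. p z * f (h + z)" "- h"] by simp
    finally have 1: "(\<integral>z. f (h + z) \<partial>N) = (\<integral>z. p (z - h) * f z \<partial>lborel)" by (simp add: algebra_simps)
    have i1: "integrable lborel (\<lambda>z. p (z - h) * f z)"
      using lborel_integrable_real_affine[OF den(2)[OF fs], of 1 "- h"] by (simp add: algebra_simps)
    have mv: "\<bar>p (z - h) - p z\<bar> \<le> \<bar>h\<bar> * (3 * A * inverse (1 + z\<^sup>2))" for z
    proof -
      have "norm (p (z - h) - p z) \<le> (3 * A * inverse (1 + z\<^sup>2)) * norm ((z - h) - z)"
      proof (rule field_differentiable_bound[where S = "cball z 1" and f' = p'])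
        show "(p has_field_derivative p' y) (at y within cball z 1)" for y
          using p by (rule has_field_derivative_at_within)
        \<comment> \<open>Points at distance at most 1 have comparable weights, 1 + z^2 \<le> 3 (1 +
          y^2). The factor pi of the final constant is the integral of 1 / (1 + z^2).\<close>
        fix y assume "y \<in> cball z 1"
        then have "\<bar>z - y\<bar> \<le> 1" by (simp add: dist_real_def)
        then have "(z - y)\<^sup>2 \<le> 1" by (simp add: abs_square_le_1)
        moreover have "2 * y\<^sup>2 + 2 * (z - y)\<^sup>2 - z\<^sup>2 = (2 * y - z)\<^sup>2" by (simp add: power2_eq_square algebra_simps)
        then have "z\<^sup>2 \<le> 2 * y\<^sup>2 + 2 * (z - y)\<^sup>2" by (smt (verit) zero_le_power2)
        ultimately have "1 + z\<^sup>2 \<le> 3 * (1 + y\<^sup>2)" by (smt (verit) zero_le_power2)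
        then have "inverse (1 + y\<^sup>2) \<le> 3 * inverse (1 + z\<^sup>2)" by (simp add: field_simps add_pos_nonneg)
        then have "A * inverse (1 + y\<^sup>2) \<le> A * (3 * inverse (1 + z\<^sup>2))" using A by (intro mult_left_mono)
        then show "norm (p' y) \<le> 3 * A * inverse (1 + z\<^sup>2)" using A(2)[of y] by simp
      qed (use True in \<open>auto simp: dist_real_def\<close>)
      then show ?thesis by (simp add: mult_ac)
    qed
    have "\<bar>(\<integral>z. f (h + z) \<partial>N) - (\<integral>z. f z \<partial>N)\<bar> = \<bar>\<integral>z. p (z - h) * f z - p z * f z \<partial>lborel\<bar>"
      unfolding 1 den(1)[OF f] using i1 den(2)[OF f] by simp
    also have "\<dots> \<le> (\<integral>z. \<bar>p (z - h) * f z - p z * f z\<bar> \<partial>lborel)" by (rule integral_abs_bound)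
    also have "\<dots> \<le> (\<integral>z. \<bar>h\<bar> * (3 * A) * B * inverse (1 + z\<^sup>2) \<partial>lborel)"
    proof (rule integral_mono)
      show "integrable lborel (\<lambda>z. \<bar>p (z - h) * f z - p z * f z\<bar>)" using i1 den(2)[OF f] by simp
      have "integrable lborel (\<lambda>x::real. inverse (1 + x\<^sup>2))"
        using integrable_inverse_1_plus_square by (simp add: set_integrable_def einterval_def)
      then show "integrable lborel (\<lambda>z. \<bar>h\<bar> * (3 * A) * B * inverse (1 + z\<^sup>2))" by (rule integrable_mult_right)
      fix z
      have "\<bar>p (z - h) * f z - p z * f z\<bar> = \<bar>p (z - h) - p z\<bar> * \<bar>f z\<bar>"
        by (simp add: abs_mult[symmetric] left_diff_distrib)
      also have "\<dots> \<le> (\<bar>h\<bar> * (3 * A * inverse (1 + z\<^sup>2))) * B" by (intro mult_mono mv fB) (use A in auto)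
      finally show "\<bar>p (z - h) * f z - p z * f z\<bar> \<le> \<bar>h\<bar> * (3 * A) * B * inverse (1 + z\<^sup>2)" by (simp add: mult_ac)
    qed
    also have "\<dots> = \<bar>h\<bar> * (3 * A) * B * pi"
      using LBINT_inverse_1_plus_square
      by (simp add: interval_lebesgue_integral_def set_lebesgue_integral_def einterval_def)
    also have "\<dots> \<le> (2 + 3 * A * pi) * B * \<bar>h\<bar>" using B by (simp add: algebra_simps)
    finally show ?thesis .
  qed
qed

section \<open>The density of the driftless stable law at time 1\<close>

context stable_exponent begin

context
  fixes N :: "real measure"
  assumes rd: "real_distribution N" and ch: "\<And>u. u > 0 \<Longrightarrow> char N u = exp (\<eta> u)"
begin

interpretation real_distribution N by (rule rd)

private lemma norm_char: "norm (char N u) = exp (- c * \<bar>u\<bar> powr \<alpha>)"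
proof -
  consider "u > 0" | "u = 0" | "u < 0" by linarith
  then show ?thesis
  proof cases
    case 1 then show ?thesis by (simp only: ch norm_exp_\<eta> abs_of_pos)
  next
    case 2 then show ?thesis by (simp add: char_zero)
  next
    case 3
    have "char N u = cnj (char N (- u))" by (simp add: char_uminus)
    then have "norm (char N u) = norm (char N (- u))" by simp
    also have "\<dots> = exp (- c * (- u) powr \<alpha>)" using 3 by (simp only: ch norm_exp_\<eta> neg_0_less_iff_less)
    finally show ?thesis using 3 by (simp add: abs_of_neg)
  qed
qed

private lemma integrable_weighted: "k \<le> 3 \<Longrightarrow> integrable lborel (\<lambda>u. of_real (u ^ k) * char N u)"
proof -
  assume k: "k \<le> 3"
  obtain B where B: "B > 0" "\<And>u k. u \<ge> 0 \<Longrightarrow> k \<le> 3 \<Longrightarrow> u ^ k * exp (- c * u powr \<alpha>) \<le> B * inverse (1 + u\<^sup>2)"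
    by (rule weighted_bound) (rule that; blast)
  show ?thesis
  proof (rule Bochner_Integration.integrable_bound)
    show "integrable lborel (\<lambda>u. B * inverse (1 + u\<^sup>2))" by (intro integrable_mult_right integrable_inverse_square)
    show "AE u in lborel. norm (of_real (u ^ k) * char N u) \<le> norm (B * inverse (1 + u\<^sup>2))"
    proof (rule AE_I2)
      fix u :: real
      have "norm (of_real (u ^ k) * char N u) = \<bar>u\<bar> ^ k * exp (- c * \<bar>u\<bar> powr \<alpha>)"
        unfolding norm_mult norm_char by (simp add: norm_power power_abs)
      then show "norm (of_real (u ^ k) * char N u) \<le> norm (B * inverse (1 + u\<^sup>2))"
        using B(2)[OF abs_ge_zero k, of u] B(1) by simp
    qed
  qed measurable
qed

text \<open>The inversion formula for the density, and its derivative taken under the integral. Both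
  remain complex valued until \<open>p\<close> and \<open>p'\<close> take real parts.\<close>

private definition "P x = (\<integral>u. iexp (- (x * u)) * char N u \<partial>lborel) / (2 * pi)"
private definition "P' x = (\<integral>u. iexp (- (x * u)) * (- \<i> * of_real u * char N u) \<partial>lborel) / (2 * pi)"

private lemma P_deriv: "(P has_vector_derivative P' x) (at x)"
  unfolding P_def[abs_def] P'_def
  using integrable_weighted[of 0] integrable_weighted[of 1] integrable_weighted[of 2]
  by (intro has_vector_derivative_divide fourier_derivative) simp_all

text \<open>The integrand at -u is the conjugate of the integrand at u. The whole integral is thus I
  plus its conjugate, with I the half-line integral estimated in
  \<open>fourier_decay\<close>.\<close>

private lemma P'_bound: obtains A where "A > 0" "\<And>x. norm (P' x) \<le> A * inverse (1 + x\<^sup>2)"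
proof -
  obtain A where A: "A > 0" "\<And>x. norm (\<integral>u\<in>{0<..}. iexp (- (x * u)) * g u \<partial>lborel) \<le> A * inverse (1 + x\<^sup>2)"
    by (rule fourier_decay) (rule that; blast)
  have "norm (P' x) \<le> A * inverse (1 + x\<^sup>2)" for x
  proof -
    let ?h = "\<lambda>u. iexp (- (x * u)) * (- \<i> * of_real u * char N u)"
    have int: "integrable lborel ?h"
      by (rule Bochner_Integration.integrable_bound[OF integrable_weighted[of 1]]) (auto simp: norm_mult)
    have hc: "?h (- u) = cnj (?h u)" for u
      by (simp add: exp_cnj char_uminus)
    define I where "I = (\<integral>u\<in>{0<..}. ?h u \<partial>lborel)"
    have "set_integrable lborel {0<..} ?h" "set_integrable lborel {..<0} ?h"
      using int unfolding set_integrable_def by (auto intro!: integrable_mult_indicator)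
    then have "(\<integral>u\<in>{0<..} \<union> {..<0}. ?h u \<partial>lborel) = I + (\<integral>u\<in>{..<0}. ?h u \<partial>lborel)"
      unfolding I_def by (intro set_integral_Un) auto
    moreover have "(\<integral>u\<in>{..<0}. ?h u \<partial>lborel) = cnj I"
    proof -
      have "(\<integral>u\<in>{..<0}. ?h u \<partial>lborel) = (\<integral>u. indicator {..<0} (0 + (-1) * u) *\<^sub>R ?h (0 + (-1) * u) \<partial>lborel)"
        unfolding set_lebesgue_integral_def
        using lborel_integral_real_affine[of "-1" "\<lambda>u. indicator {..<0} u *\<^sub>R ?h u" 0] by simp
      also have "\<dots> = (\<integral>u. cnj (indicator {0<..} u *\<^sub>R ?h u) \<partial>lborel)"
      proof (intro Bochner_Integration.integral_cong refl)
        fix u :: real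
        have "?h (0 + (-1) * u) = cnj (?h u)" using hc[of u] by simp
        moreover have "indicator {..<0} (0 + (-1) * u) = (indicator {0<..} u :: real)" by (simp add: indicator_def)
        ultimately show "indicator {..<0} (0 + (-1) * u) *\<^sub>R ?h (0 + (-1) * u) = cnj (indicator {0<..} u *\<^sub>R ?h u)"
          by (simp only: complex_cnj_scaleR)
      qed
      also have "\<dots> = cnj I" unfolding I_def set_lebesgue_integral_def by (rule Bochner_Integration.integral_cnj)
      finally show ?thesis .
    qed
    moreover have "(\<integral>u. ?h u \<partial>lborel) = (\<integral>u\<in>{0<..} \<union> {..<0}. ?h u \<partial>lborel)"
      unfolding set_lebesgue_integral_def
    proof (rule integral_cong_AE)
      show "?h \<in> borel_measurable lborel" by measurable
      show "(\<lambda>u. indicator ({0<..} \<union> {..<0}) u *\<^sub>R ?h u) \<in> borel_measurable lborel" by measurable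
      have "AE u in lborel. u \<noteq> (0::real)" by (rule AE_lborel_singleton)
      then show "AE u in lborel. ?h u = indicator ({0<..} \<union> {..<0}) u *\<^sub>R ?h u"
        by eventually_elim (auto simp: indicator_def)
    qed
    ultimately have P'I: "P' x = (I + cnj I) / (2 * pi)" by (simp add: P'_def)
    have "I = - \<i> * (\<integral>u\<in>{0<..}. iexp (- (x * u)) * g u \<partial>lborel)"
      unfolding I_def set_lebesgue_integral_def
      by (subst integral_mult_right_zero[symmetric], intro Bochner_Integration.integral_cong refl)
         (auto simp: indicator_def g_def ch scaleR_conv_of_real)
    then have nI: "norm I \<le> A * inverse (1 + x\<^sup>2)" using A(2)[of x] by (simp add: norm_mult)
    have "norm (P' x) = norm (I + cnj I) / (2 * pi)" unfolding P'I by (simp add: norm_divide)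
    also have "\<dots> \<le> (norm I + norm (cnj I)) / (2 * pi)" by (intro divide_right_mono norm_triangle_ineq) simp
    also have "\<dots> = norm I / pi" by simp
    also have "\<dots> \<le> norm I" using pi_ge_two by (simp add: divide_le_eq mult_le_cancel_left1)
    finally show ?thesis using nI by linarith
  qed
  then show ?thesis using that A(1) by blast
qed

private lemma int_char: "integrable lborel (char N)"
  using integrable_weighted[of 0] by simp

text \<open>Inversion on an interval requires end points without mass. There are only countably many
  atoms, so x can be enclosed between such end points within \<epsilon>, and the inversion formula
  bounds the mass of the interval by a multiple of \<epsilon>.\<close>

private lemma atomless: "measure N {x} = 0"
proof -
  define C where "C = (\<integral>u. norm (char N u) \<partial>lborel) / pi"
  have C: "C \<ge> 0" by (simp add: C_def)
  have "measure N {x} \<le> 0 + e" if e: "e > 0" for e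
  proof -
    define \<epsilon> where "\<epsilon> = e / (C + 1)"
    have \<epsilon>: "\<epsilon> > 0" "C * \<epsilon> \<le> e" using e C by (auto simp: \<epsilon>_def field_simps)
    have "\<exists>y\<in>{l<..<u}. measure N {y} = 0" if "l < u" for l u :: real
    proof (rule ccontr)
      assume "\<not> ?thesis"
      then have "{l<..<u} \<subseteq> {y. measure N {y} > 0}" by (auto simp: less_le measure_nonneg)
      then have "countable {l<..<u}" using countable_atoms countable_subset by blast
      then show False using uncountable_open_interval that by blast
    qed
    from this[of "x - \<epsilon>" x] this[of x "x + \<epsilon>"] \<epsilon>
    obtain y z where y: "x - \<epsilon> < y" "y < x" "measure N {y} = 0" and z: "x < z" "z < x + \<epsilon>" "measure N {z} = 0"
      by auto
    have yz: "y \<le> z" using y z by simp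
    have "of_real (measure N {y<..z}) = 1 / (2 * pi) * (\<integral>u. (iexp (- (u * y)) - iexp (- (u * z))) / (\<i> * u) * char N u \<partial>lborel)"
      by (rule interval_measure_inversion[OF int_char yz y(3) z(3)])
    then have "norm (complex_of_real (measure N {y<..z})) = norm (1 / (2 * pi) * (\<integral>u. (iexp (- (u * y)) - iexp (- (u * z))) / (\<i> * u) * char N u \<partial>lborel))"
      by (simp only:)
    also have "\<dots> = norm (\<integral>u. (iexp (- (u * y)) - iexp (- (u * z))) / (\<i> * u) * char N u \<partial>lborel) / (2 * pi)"
      by (simp add: norm_mult norm_divide)
    also have "\<dots> \<le> (\<integral>u. \<bar>z - y\<bar> * norm (char N u) \<partial>lborel) / (2 * pi)"
    proof (intro divide_right_mono order_trans[OF integral_norm_bound] integral_mono_AE')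
      show "integrable lborel (\<lambda>u. \<bar>z - y\<bar> * norm (char N u))" using int_char by simp
      show "AE u in lborel. norm ((iexp (- (u * y)) - iexp (- (u * z))) / (\<i> * u) * char N u) \<le> \<bar>z - y\<bar> * norm (char N u)"
        unfolding norm_mult[of _ "char N _"] by (intro AE_I2 mult_right_mono norm_iexp_diff_div_le) simp
    qed auto
    also have "\<dots> \<le> (2 * \<epsilon> * (\<integral>u. norm (char N u) \<partial>lborel)) / (2 * pi)"
      unfolding Bochner_Integration.integral_mult_right_zero
      by (intro divide_right_mono mult_right_mono) (use y z in auto)
    also have "\<dots> = C * \<epsilon>" by (simp add: C_def)
    finally have "measure N {y<..z} \<le> e" using \<epsilon> by simp
    moreover have "measure N {x} \<le> measure N {y<..z}" using y z by (intro finite_measure_mono) auto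
    ultimately show ?thesis by simp
  qed
  then have "measure N {x} \<le> 0" by (rule field_le_epsilon)
  then show ?thesis by (simp add: measure_le_0_iff)
qed

text \<open>A distribution function up to an additive constant, normalised to vanish at 0; its
  increments are the masses of half-open intervals.\<close>

private definition "F x = (\<integral>u. (iexp (- (u * 0)) - iexp (- (u * x))) / (\<i> * of_real u) * char N u \<partial>lborel) / (2 * pi)"

private lemma F_int: "integrable lborel (\<lambda>u. (iexp (- (u * r)) - iexp (- (u * s))) / (\<i> * of_real u) * char N u)"
proof (rule Bochner_Integration.integrable_bound)
  show "integrable lborel (\<lambda>u. \<bar>s - r\<bar> * norm (char N u))" using int_char by simp
  show "AE u in lborel. norm ((iexp (- (u * r)) - iexp (- (u * s))) / (\<i> * of_real u) * char N u) \<le> norm (\<bar>s - r\<bar> * norm (char N u))"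
    unfolding norm_mult[of _ "char N _"]
    by (intro AE_I2 order_trans[OF mult_right_mono[OF norm_iexp_diff_div_le norm_ge_zero]]) simp
qed measurable

private lemma F_diff: "F s - F r = (\<integral>u. (iexp (- (u * r)) - iexp (- (u * s))) / (\<i> * of_real u) * char N u \<partial>lborel) / (2 * pi)"
proof -
  have "F s - F r = ((\<integral>u. (iexp (- (u * 0)) - iexp (- (u * s))) / (\<i> * of_real u) * char N u
     - (iexp (- (u * 0)) - iexp (- (u * r))) / (\<i> * of_real u) * char N u \<partial>lborel)) / (2 * pi)"
    unfolding F_def using F_int[of 0 s] F_int[of 0 r] by (subst Bochner_Integration.integral_diff) (auto simp: diff_divide_distrib)
  then show ?thesis by (simp add: left_diff_distrib[symmetric] diff_divide_distrib[symmetric])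
qed

private lemma F_deriv: "(F has_vector_derivative P x) (at x)"
proof -
  define C where "C = (\<integral>u. norm (of_real (u ^ 1) * char N u) \<partial>lborel) / (2 * pi)"
  have ip: "integrable lborel (\<lambda>u. iexp (- (x * u)) * char N u)"
    by (rule Bochner_Integration.integrable_bound[OF int_char]) (auto simp: norm_mult)
  have bound: "norm (F (x + h) - F x - h *\<^sub>R P x) \<le> C * h\<^sup>2" for h
  proof -
    let ?d = "\<lambda>u. (iexp (- (u * x)) - iexp (- (u * (x + h)))) / (\<i> * of_real u) * char N u - h *\<^sub>R (iexp (- (x * u)) * char N u)"
    have eq: "F (x + h) - F x - h *\<^sub>R P x = (\<integral>u. ?d u \<partial>lborel) / (2 * pi)"
      unfolding F_diff P_def using F_int[of x "x + h"] ip
      by (subst Bochner_Integration.integral_diff) (auto simp: diff_divide_distrib scaleR_conv_of_real)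
    have "norm (F (x + h) - F x - h *\<^sub>R P x) = norm (\<integral>u. ?d u \<partial>lborel) / (2 * pi)"
      unfolding eq by (simp add: norm_divide)
    also have "\<dots> \<le> (\<integral>u. h\<^sup>2 * norm (of_real (u ^ 1) * char N u) \<partial>lborel) / (2 * pi)"
    proof (rule divide_right_mono[OF order_trans[OF integral_norm_bound integral_mono_AE']])
      show "integrable lborel (\<lambda>u. h\<^sup>2 * norm (of_real (u ^ 1) * char N u))"
        by (rule integrable_mult_right, rule integrable_norm, rule integrable_weighted) simp
      have "AE u in lborel. u \<noteq> (0::real)" by (rule AE_lborel_singleton)
      then show "AE u in lborel. norm (?d u) \<le> h\<^sup>2 * norm (of_real (u ^ 1) * char N u)"
      proof eventually_elim
        case (elim u)
        define R where "R = iexp (- (u * h)) - (\<Sum>k\<le>1. (\<i> * (- (u * h))) ^ k / fact k)"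
        have "?d u = - (iexp (- (x * u)) * (char N u * (R / (\<i> * of_real u))))"
          using elim by (simp add: R_def exp_diff exp_minus exp_add scaleR_conv_of_real field_simps)
        then have "norm (?d u) = norm (char N u) * (norm R / \<bar>u\<bar>)"
          by (simp only: norm_minus_cancel norm_mult norm_exp_i_times norm_divide norm_of_real norm_ii mult_1_left)
        also have "norm R \<le> \<bar>- (u * h)\<bar> ^ Suc 1 / fact (Suc 1)" unfolding R_def by (rule iexp_approx1)
        also have "\<bar>- (u * h)\<bar> ^ Suc 1 / fact (Suc 1) \<le> u\<^sup>2 * h\<^sup>2"
          unfolding Suc_1 power2_abs by (simp add: power_mult_distrib)
        finally have "norm (?d u) \<le> norm (char N u) * (u\<^sup>2 * h\<^sup>2 / \<bar>u\<bar>)" by (simp add: divide_right_mono mult_left_mono)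
        also have "u\<^sup>2 * h\<^sup>2 / \<bar>u\<bar> = \<bar>u\<bar> * h\<^sup>2" using elim by (simp add: power2_eq_square abs_if)
        finally show "norm (?d u) \<le> h\<^sup>2 * norm (of_real (u ^ 1) * char N u)" by (simp add: norm_mult mult_ac)
      qed
    qed auto
    also have "\<dots> = C * h\<^sup>2" by (simp add: C_def)
    finally show ?thesis .
  qed
  show ?thesis
    unfolding has_vector_derivative_def has_derivative_at
  proof (intro conjI)
    show "bounded_linear (\<lambda>y. y *\<^sub>R P x)" by (rule bounded_linear_scaleR_left)
    show "((\<lambda>h. norm (F (x + h) - F x - h *\<^sub>R P x) / norm h) \<longlongrightarrow> 0) (at 0)"
    proof (rule Lim_null_comparison)
      show "\<forall>\<^sub>F h in at 0. norm (norm (F (x + h) - F x - h *\<^sub>R P x) / norm h) \<le> C * \<bar>h\<bar>"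
        unfolding eventually_at
      proof (intro exI[of _ 1] conjI ballI impI)
        fix h :: real assume h: "h \<noteq> 0 \<and> dist h 0 < 1"
        have "norm (F (x + h) - F x - h *\<^sub>R P x) / norm h \<le> C * h\<^sup>2 / norm h"
          by (rule divide_right_mono[OF bound]) simp
        also have "\<dots> = C * \<bar>h\<bar>" using h by (simp add: power2_eq_square abs_if)
        finally show "norm (norm (F (x + h) - F x - h *\<^sub>R P x) / norm h) \<le> C * \<bar>h\<bar>" by simp
      qed simp
      show "((\<lambda>h. C * \<bar>h\<bar>) \<longlongrightarrow> 0) (at 0)" by (rule tendsto_mult_right_zero[OF tendsto_rabs_zero[OF tendsto_ident_at]])
    qed
  qed
qed

private definition "p x = Re (P x)"
private definition "p' x = Re (P' x)"

private lemma p_deriv: "(p has_real_derivative p' x) (at x)"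
  unfolding has_real_derivative_iff_has_vector_derivative p_def[abs_def] p'_def
  by (rule bounded_linear.has_vector_derivative[OF bounded_linear_Re P_deriv])

private lemma ReF_deriv: "((\<lambda>x. Re (F x)) has_real_derivative p x) (at x)"
  unfolding has_real_derivative_iff_has_vector_derivative p_def
  by (rule bounded_linear.has_vector_derivative[OF bounded_linear_Re F_deriv])

private lemma measure_Ioc: "r \<le> s \<Longrightarrow> measure N {r<..s} = Re (F s) - Re (F r)"
proof -
  assume ab: "r \<le> s"
  have "complex_of_real (measure N {r<..s}) = F s - F r"
    unfolding F_diff by (subst interval_measure_inversion[OF int_char ab atomless atomless]) simp
  then show ?thesis by (metis Re_complex_of_real minus_complex.simps(1))
qed

text \<open>The function is the derivative of the real part of \<open>F\<close>, which increases
  because its increments are masses.\<close>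

private lemma p_nonneg: "p x \<ge> 0"
proof (rule mono_on_imp_deriv_nonneg[OF _ ReF_deriv])
  show "mono_on UNIV (\<lambda>x. Re (F x))"
    using measure_Ioc by (intro mono_onI) (metis diff_ge_0_iff_ge measure_nonneg)
qed simp

text \<open>Half-open intervals form an intersection-stable generator, and on them both measures are
  increments of the real part of \<open>F\<close>.\<close>

private lemma N_density: "N = density lborel (\<lambda>x. ennreal (p x))"
proof (rule measure_eqI_generator_eq[where E = "range (\<lambda>(r, s). {r<..s::real})" and \<Omega> = UNIV and A = "\<lambda>n. {- real n<..real n}"])
  have pc: "continuous_on UNIV p" using DERIV_isCont[OF p_deriv] by (intro continuous_at_imp_continuous_on) auto
  then have pm [measurable]: "p \<in> borel_measurable borel" by (rule borel_measurable_continuous_onI)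
  show "Int_stable (range (\<lambda>(r, s). {r<..s::real}))"
    by (auto simp: Int_stable_def image_iff)
  show "sets N = sigma_sets UNIV (range (\<lambda>(r, s). {r<..s::real}))"
    unfolding events_eq_borel borel_sigma_sets_Ioc by simp
  show "sets (density lborel (\<lambda>x. ennreal (p x))) = sigma_sets UNIV (range (\<lambda>(r, s). {r<..s::real}))"
    unfolding sets_density sets_lborel borel_sigma_sets_Ioc by simp
  show "emeasure N X = emeasure (density lborel (\<lambda>x. ennreal (p x))) X" if XI: "X \<in> range (\<lambda>(r, s). {r<..s::real})" for X
  proof -
    obtain r s where X: "X = {r<..s}" using XI by auto
    show ?thesis
    proof (cases "r \<le> s")
      case True
      have "emeasure (density lborel (\<lambda>x. ennreal (p x))) X = (\<integral>\<^sup>+x. ennreal (p x) * indicator {r<..s} x \<partial>lborel)"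
        unfolding X by (rule emeasure_density) auto
      also have "\<dots> = (\<integral>\<^sup>+x. ennreal (p x) * indicator {r..s} x \<partial>lborel)"
      proof (rule nn_integral_cong_AE)
        have "AE x in lborel. x \<noteq> r" by (rule AE_lborel_singleton)
        then show "AE x in lborel. ennreal (p x) * indicator {r<..s} x = ennreal (p x) * indicator {r..s} x"
          by eventually_elim (auto simp: indicator_def)
      qed
      also have "\<dots> = ennreal (Re (F s) - Re (F r))"
        by (rule nn_integral_FTC_Icc) (use ReF_deriv p_nonneg True in auto)
      also have "\<dots> = emeasure N X" by (simp add: X emeasure_eq_measure measure_Ioc[OF True])
      finally show ?thesis ..
    qed (simp add: X)
  qed
  show "(\<Union>n. {- real n<..real n}) = UNIV"
  proof (intro equalityI subsetI UNIV_I)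
    fix x :: real
    obtain n where "\<bar>x\<bar> < real n" using reals_Archimedean2 by blast
    then show "x \<in> (\<Union>n. {- real n<..real n})" by (intro UN_I[of n]) auto
  qed
qed auto

theorem stable_shift_bound:
  obtains C where "C \<ge> 1" "\<And>B f h. bounded_meas B f \<Longrightarrow> \<bar>(\<integral>z. f (h + z) \<partial>N) - (\<integral>z. f z \<partial>N)\<bar> \<le> C * B * \<bar>h\<bar>"
proof -
  obtain A where A: "A > 0" "\<And>x. norm (P' x) \<le> A * inverse (1 + x\<^sup>2)" by (rule P'_bound) (rule that; blast)
  have p'A: "\<bar>p' x\<bar> \<le> A * inverse (1 + x\<^sup>2)" for x
    using A(2)[of x] abs_Re_le_cmod[of "P' x"] by (simp add: p'_def)
  show ?thesis
  proof (rule that[of "2 + 3 * A * pi"])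
    show "2 + 3 * A * pi \<ge> 1" using A by simp
    show "\<bar>(\<integral>z. f (h + z) \<partial>N) - (\<integral>z. f z \<partial>N)\<bar> \<le> (2 + 3 * A * pi) * B * \<bar>h\<bar>" if "bounded_meas B f" for B f h
      by (rule shift_bound_of_density[OF p_deriv _ p'A prob_space_axioms N_density p_nonneg that]) (use A in auto)
  qed
qed

end

end

section \<open>Truncated moments and scaling of the driftless law\<close>

lemma norm_exp_diff_one_le: "Re z \<le> 0 \<Longrightarrow> norm (exp z - 1) \<le> norm z" for z :: complex
proof -
  assume z: "Re z \<le> 0"
  have "norm (exp z - exp 0) \<le> 1 * norm (z - 0)"
  proof (rule field_differentiable_bound[where S = "{z. Re z \<le> 0}" and f' = exp])
    show "convex {z. Re z \<le> 0}" by (rule convex_halfspace_Re_le)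
    show "(exp has_field_derivative exp z) (at z within {z. Re z \<le> 0})" for z :: complex
      by (rule DERIV_subset[OF DERIV_exp]) simp
  qed (use z in \<open>auto simp: norm_exp_eq_Re\<close>)
  then show ?thesis by simp
qed

text \<open>For |y| \<ge> 2 the right side is at least 4. Below that, the fifth-order Taylor bound
  gives 1 - sin y / y \<ge> 2 y^2 / 15, and 8 times 2/15 exceeds 1.\<close>

lemma min_one_square_le:
  fixes y :: real
  assumes "y \<noteq> 0"
  shows "min 1 (y\<^sup>2) \<le> 8 * (1 - sin y / y)"
proof -
  have pos: "min 1 (y\<^sup>2) \<le> 8 * (1 - sin y / y)" if y: "y > 0" for y :: real
  proof (cases "y \<ge> 2")
    case True
    have "2 * sin y \<le> y" using True sin_le_one[of y] by linarith
    then have "sin y / y \<le> 1 / 2" using y by (simp add: field_simps)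
    then show ?thesis by simp
  next
    case False
    have "\<bar>sin y - (\<Sum>m<5. sin_coeff m * y ^ m)\<bar> \<le> inverse (fact 5) * \<bar>y\<bar> ^ 5" by (rule Maclaurin_sin_bound)
    moreover have "(\<Sum>m<5. sin_coeff m * y ^ m) = y - y ^ 3 / 6"
    proof -
      have "{..<5::nat} = {0, 1, 2, 3, 4}" by auto
      then show ?thesis by (simp add: sin_coeff_def fact_numeral)
    qed
    ultimately have "\<bar>sin y - (y - y ^ 3 / 6)\<bar> \<le> y ^ 5 / 120"
      using y by (simp add: fact_numeral)
    then have "sin y \<le> y - y ^ 3 / 6 + y ^ 5 / 120" by linarith
    then have "sin y / y \<le> (y - y ^ 3 / 6 + y ^ 5 / 120) / y" using y by (intro divide_right_mono) auto
    also have "\<dots> = 1 - y\<^sup>2 / 6 + y\<^sup>2 * y\<^sup>2 / 120" using y by (simp add: field_simps eval_nat_numeral)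
    also have "y\<^sup>2 * y\<^sup>2 \<le> 2\<^sup>2 * y\<^sup>2" using False y by (intro mult_right_mono power_mono) auto
    finally have "sin y / y \<le> 1 - 2 * y\<^sup>2 / 15" by simp
    then have "8 * (sin y / y) \<le> 8 * (1 - 2 * y\<^sup>2 / 15)" by (intro mult_left_mono) auto
    also have "\<dots> = 8 - y\<^sup>2 - y\<^sup>2 / 15" by (simp add: algebra_simps)
    also have "\<dots> \<le> 8 - y\<^sup>2" by simp
    finally have "y\<^sup>2 \<le> 8 * (1 - sin y / y)" by (simp only: right_diff_distrib le_diff_eq diff_le_eq add.commute)
    then show ?thesis by simp
  qed
  show ?thesis using pos[of y] pos[of "- y"] assms by (cases "y > 0") auto
qed

context stable_exponent
begin

lemma norm_\<eta>_le: "u > 0 \<Longrightarrow> norm (\<eta> u) \<le> u powr \<alpha> * norm w + u * \<bar>ln u\<bar> * norm a"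
  unfolding \<eta>_def by (rule order_trans[OF norm_triangle_ineq]) (simp add: abs_mult)

lemma Re_\<eta>: "Re (\<eta> u) \<le> 0"
  using c by (simp add: \<eta>_def a c_def mult_nonneg_nonpos)

text \<open>At the frequency \<sigma> powr (-1/\<alpha>) the power term is exactly of order
  1/\<sigma>; only the logarithm, which is present for \<alpha> = 1 alone, costs a power of
  \<sigma>.\<close>

lemma \<eta>_at_scale:
  assumes aa: "\<alpha> \<noteq> 1 \<longrightarrow> a = 0" and \<sigma>: "0 < \<sigma>" "\<sigma> \<le> 1"
  shows "\<sigma> * norm (\<eta> (\<sigma> powr (-1/\<alpha>))) \<le> K * \<sigma> powr (\<alpha>/4 - 1)"
proof -
  define s where "s = \<sigma> powr (\<alpha>/4 - 1)"
  have s: "1 \<le> s" "\<sigma> powr (-1/2) \<le> s"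
    unfolding s_def using \<sigma> \<alpha> powr_mono'[of "\<alpha>/4 - 1" 0 \<sigma>] by (auto intro!: powr_mono')
  have w': "\<sigma> * ((\<sigma> powr (-1/\<alpha>)) powr \<alpha> * norm w) = norm w"
  proof -
    have "(\<sigma> powr (-1/\<alpha>)) powr \<alpha> = \<sigma> powr (-1)" using \<alpha> unfolding powr_powr by simp
    then show ?thesis using \<sigma> by (simp add: powr_minus)
  qed
  have a': "\<sigma> * (\<sigma> powr (-1/\<alpha>) * \<bar>ln (\<sigma> powr (-1/\<alpha>))\<bar> * norm a) \<le> 2 * s * norm a"
  proof (cases "a = 0")
    case False
    then have 1: "\<alpha> = 1" using aa by blast
    have "\<sigma> * (\<sigma> powr (-1/\<alpha>) * \<bar>ln (\<sigma> powr (-1/\<alpha>))\<bar> * norm a) = \<bar>ln \<sigma>\<bar> * norm a"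
      using \<sigma> by (simp add: 1 ln_powr powr_minus ln_inverse)
    also have "\<dots> \<le> 2 * s * norm a"
      using abs_ln_le[OF \<sigma>] s by (intro mult_right_mono) auto
    finally show ?thesis .
  qed simp
  have "\<sigma> * norm (\<eta> (\<sigma> powr (-1/\<alpha>))) \<le> \<sigma> * ((\<sigma> powr (-1/\<alpha>)) powr \<alpha> * norm w + \<sigma> powr (-1/\<alpha>) * \<bar>ln (\<sigma> powr (-1/\<alpha>))\<bar> * norm a)"
    using \<sigma> by (intro mult_left_mono norm_\<eta>_le) auto
  also have "\<dots> \<le> 1 * norm w + 2 * s * norm a" unfolding distrib_left using w' a' by linarith
  also have "\<dots> \<le> s * norm w + 2 * s * norm a" using s by (intro add_right_mono mult_right_mono) auto
  also have "\<dots> \<le> K * s"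
    using s by (simp add: K_def algebra_simps add_nonneg_nonneg)
  finally show ?thesis by (simp add: s_def)
qed

text \<open>The frequency \<sigma> powr (1/2 - 1/\<alpha>) matches the truncation level: its square
  is \<sigma> times the square of \<sigma> powr (-1/\<alpha>). There the power term is of order
  \<sigma> powr (\<alpha>/2 - 1), and the gap to \<alpha>/4 - 1 takes up the logarithm when \<alpha>
  = 1.\<close>

lemma \<eta>_below_scale:
  assumes aa: "\<alpha> \<noteq> 1 \<longrightarrow> a = 0" and \<sigma>: "0 < \<sigma>" "\<sigma> \<le> 1" and u: "0 < u" "u \<le> 1"
  shows "norm (\<eta> (u * \<sigma> powr (1/2 - 1/\<alpha>))) \<le> K * \<sigma> powr (\<alpha>/4 - 1)"
proof -
  define s where "s = \<sigma> powr (\<alpha>/4 - 1)"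
  define q where "q = \<sigma> powr (1/2 - 1/\<alpha>)"
  have q: "q > 0" using \<sigma> by (simp add: q_def)
  have "(u * q) powr \<alpha> = u powr \<alpha> * \<sigma> powr (\<alpha>/2 - 1)"
    using u \<sigma> \<alpha> by (simp add: q_def powr_mult powr_powr right_diff_distrib mult.commute[of _ \<alpha>])
  also have "\<dots> \<le> 1 * s" unfolding s_def using u \<sigma> \<alpha> by (intro mult_mono powr_mono' powr_le1) auto
  finally have w': "(u * q) powr \<alpha> * norm w \<le> s * norm w" by (intro mult_right_mono) auto
  have a': "u * q * \<bar>ln (u * q)\<bar> * norm a \<le> 3 * s * norm a"
  proof (cases "a = 0")
    case False
    then have 1: "\<alpha> = 1" using aa by blast
    have q1: "q = \<sigma> powr (-1/2)" by (simp add: q_def 1)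
    \<comment> \<open>The power 1/4 is what \<alpha> = 1 affords: \<sigma> powr (-1/2) times
      \<sigma> powr (-1/4) is \<sigma> powr (\<alpha>/4 - 1).\<close>
    have "ln (inverse \<sigma>) \<le> inverse \<sigma> powr (1/4) / (1/4)"
      using \<sigma> by (intro ln_powr_bound) (auto simp: one_le_inverse)
    then have l: "- ln \<sigma> \<le> 4 * \<sigma> powr (-1/4)" using \<sigma> by (simp add: ln_inverse powr_minus inverse_powr)
    have "u * \<bar>ln u\<bar> \<le> 1"
    proof -
      have "- ln u \<le> inverse u - 1" using ln_le_minus_one[of "inverse u"] u by (simp add: ln_inverse)
      then have "u * (- ln u) \<le> u * (inverse u - 1)" using u by (intro mult_left_mono) auto
      also have "\<dots> \<le> 1" using u by (simp add: algebra_simps)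
      finally show ?thesis using u by simp
    qed
    moreover have "u * \<bar>ln q\<bar> \<le> 1 * (2 * \<sigma> powr (-1/4))"
      using u \<sigma> l by (intro mult_mono) (auto simp: q1 ln_powr)
    moreover have "u * \<bar>ln (u * q)\<bar> \<le> u * (\<bar>ln u\<bar> + \<bar>ln q\<bar>)"
      using u q abs_triangle_ineq[of "ln u" "ln q"] by (intro mult_left_mono) (simp_all add: ln_mult)
    moreover have "1 \<le> \<sigma> powr (-1/4)" using powr_mono'[of "-1/4" 0 \<sigma>] \<sigma> by simp
    ultimately have "u * \<bar>ln (u * q)\<bar> \<le> 3 * \<sigma> powr (-1/4)" by (simp add: distrib_left)
    then have "q * (u * \<bar>ln (u * q)\<bar>) \<le> q * (3 * \<sigma> powr (-1/4))" using q by (intro mult_left_mono) auto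
    also have "\<dots> = 3 * s" using \<sigma> by (simp add: q1 s_def 1 powr_add[symmetric])
    finally have "q * (u * \<bar>ln (u * q)\<bar>) * norm a \<le> 3 * s * norm a" by (intro mult_right_mono) auto
    then show ?thesis by (simp add: mult_ac)
  qed simp
  have "norm (\<eta> (u * q)) \<le> s * norm w + 3 * s * norm a"
    using norm_\<eta>_le[of "u * q"] w' a' u q by simp
  also have "\<dots> \<le> K * s" using \<sigma> by (simp add: K_def s_def algebra_simps)
  finally show ?thesis by (simp add: s_def q_def)
qed

context
  fixes N :: "real measure" and t :: real
  assumes rd: "real_distribution N" and t: "t > 0" and ch: "\<And>u. u > 0 \<Longrightarrow> char N u = exp (of_real t * \<eta> u)"
begin

interpretation real_distribution N by (rule rd)

lemma char_diff_one_le: "u > 0 \<Longrightarrow> norm (char N u - 1) \<le> t * norm (\<eta> u)"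
  using norm_exp_diff_one_le[of "of_real t * \<eta> u"] t Re_\<eta>[of u] by (simp add: ch norm_mult mult_nonneg_nonpos)

private lemma int_iexp: "integrable N (\<lambda>z. iexp (u * z))"
  by (rule integrable_const_bound[where B = 1]) auto

private lemma Im_char: "Im (char N u) = (\<integral>z. sin (u * z) \<partial>N)"
  unfolding char_def integral_Im[OF int_iexp, symmetric] by (simp add: Im_exp)

private lemma Re_char: "Re (char N u) = (\<integral>z. cos (u * z) \<partial>N)"
  unfolding char_def integral_Re[OF int_iexp, symmetric] by (simp add: Re_exp)

text \<open>The mean of the sine is the imaginary part of the characteristic function minus 1, and
  this difference is linear in t.\<close>

lemma sine_bound:
  assumes aa: "\<alpha> \<noteq> 1 \<longrightarrow> a = 0" and \<sigma>: "0 < \<sigma>" "\<sigma> \<le> 1"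
  shows "\<sigma> * \<bar>\<integral>z. sin (\<sigma> powr (-1/\<alpha>) * z) \<partial>N\<bar> \<le> K * t * \<sigma> powr (\<alpha>/4 - 1)"
proof -
  have "\<bar>Im (char N (\<sigma> powr (-1/\<alpha>)) - 1)\<bar> \<le> t * norm (\<eta> (\<sigma> powr (-1/\<alpha>)))"
    by (rule order_trans[OF abs_Im_le_cmod char_diff_one_le]) (use \<sigma> in simp)
  then have "\<sigma> * \<bar>\<integral>z. sin (\<sigma> powr (-1/\<alpha>) * z) \<partial>N\<bar> \<le> \<sigma> * (t * norm (\<eta> (\<sigma> powr (-1/\<alpha>))))"
    using \<sigma> by (intro mult_left_mono) (auto simp: Im_char)
  also have "\<dots> = t * (\<sigma> * norm (\<eta> (\<sigma> powr (-1/\<alpha>))))" by simp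
  also have "\<dots> \<le> t * (K * \<sigma> powr (\<alpha>/4 - 1))" using t by (intro mult_left_mono \<eta>_at_scale aa \<sigma>) auto
  finally show ?thesis by (simp add: mult_ac)
qed

text \<open>Averaging \<open>1 - cos (u y)\<close> over \<open>u \<in> [0,1]\<close> gives \<open>1 - sin y / y\<close>, which is comparable to \<open>min 1 (y\<^sup>2)\<close>.\<close>

lemma truncated_second_moment:
  fixes q s :: real
  assumes q: "q > 0" and s: "\<And>u. 0 < u \<Longrightarrow> u \<le> 1 \<Longrightarrow> norm (\<eta> (u * q)) \<le> s"
  shows "(\<integral>z. min 1 ((q * z)\<^sup>2) \<partial>N) \<le> 8 * (t * s)"
proof -
  have s0: "s \<ge> 0" using s[of 1] norm_ge_zero[of "\<eta> (1 * q)"] by linarith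
  have pw: "ennreal (min 1 (y\<^sup>2)) \<le> 8 * (\<integral>\<^sup>+u. ennreal (1 - cos (u * y)) * indicator {0..1} u \<partial>lborel)" for y :: real
  proof (cases "y = 0")
    case False
    have "(\<integral>\<^sup>+u. ennreal (1 - cos (u * y)) * indicator {0..1} u \<partial>lborel) = ennreal ((1 - sin (1 * y) / y) - (0 - sin (0 * y) / y))"
    proof (rule nn_integral_FTC_Icc)
      show "((\<lambda>u. u - sin (u * y) / y) has_real_derivative 1 - cos (x * y)) (at x)" for x
        using False by (auto intro!: derivative_eq_intros)
    qed auto
    then have "8 * (\<integral>\<^sup>+u. ennreal (1 - cos (u * y)) * indicator {0..1} u \<partial>lborel) = ennreal (8 * (1 - sin y / y))"
      by (simp add: ennreal_mult'[symmetric] ennreal_numeral[symmetric] del: ennreal_numeral)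
    then show ?thesis using min_one_square_le[OF False] by (simp add: ennreal_leI)
  qed simp
  interpret pair_sigma_finite N lborel by standard
  have "(\<integral>\<^sup>+z. ennreal (min 1 ((q * z)\<^sup>2)) \<partial>N)
      \<le> (\<integral>\<^sup>+z. 8 * (\<integral>\<^sup>+u. ennreal (1 - cos (u * (q * z))) * indicator {0..1} u \<partial>lborel) \<partial>N)"
    by (rule nn_integral_mono) (rule pw)
  also have "\<dots> = 8 * (\<integral>\<^sup>+z. \<integral>\<^sup>+u. ennreal (1 - cos (u * (q * z))) * indicator {0..1} u \<partial>lborel \<partial>N)"
    by (rule nn_integral_cmult) measurable
  also have "\<dots> = 8 * (\<integral>\<^sup>+u. \<integral>\<^sup>+z. ennreal (1 - cos (u * (q * z))) * indicator {0..1} u \<partial>N \<partial>lborel)"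
    by (subst Fubini') measurable
  also have "\<dots> \<le> 8 * (\<integral>\<^sup>+(u::real). ennreal (t * s) * indicator {0..1} u \<partial>lborel)"
  proof (rule mult_left_mono[OF nn_integral_mono_AE])
    have "AE u in lborel. u \<noteq> (0::real)" by (rule AE_lborel_singleton)
    then show "AE u in lborel. (\<integral>\<^sup>+z. ennreal (1 - cos (u * (q * z))) * indicator {0..1} u \<partial>N) \<le> ennreal (t * s) * indicator {0..1} u"
    proof eventually_elim
      case (elim u)
      show ?case
      proof (cases "u \<in> {0..1}")
        case True
        then have u: "0 < u" "u \<le> 1" using elim by auto
        have ic: "integrable N (\<lambda>z. cos (u * (q * z)))" by (rule integrable_const_bound[where B = 1]) auto
        have "(\<integral>\<^sup>+z. ennreal (1 - cos (u * (q * z))) \<partial>N) = ennreal (\<integral>z. 1 - cos (u * (q * z)) \<partial>N)"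
          using ic by (intro nn_integral_eq_integral) auto
        also have "(\<integral>z. 1 - cos (u * (q * z)) \<partial>N) = 1 - Re (char N (u * q))"
          using ic by (simp add: Re_char mult.assoc prob_space[unfolded space_eq_univ])
        also have "\<dots> \<le> norm (char N (u * q) - 1)"
          using abs_Re_le_cmod[of "char N (u * q) - 1"] by simp
        also have "\<dots> \<le> t * norm (\<eta> (u * q))" using u q by (intro char_diff_one_le) auto
        also have "\<dots> \<le> t * s" using u t by (intro mult_left_mono s) auto
        finally show ?thesis using True by (simp add: ennreal_leI)
      qed simp
    qed
  qed simp
  also have "\<dots> = ennreal (8 * (t * s))"
    using t s0 by (subst nn_integral_cmult_indicator) (auto simp: ennreal_mult')
  finally have "(\<integral>\<^sup>+z. ennreal (min 1 ((q * z)\<^sup>2)) \<partial>N) \<le> ennreal (8 * (t * s))" .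
  moreover have "(\<integral>\<^sup>+z. ennreal (min 1 ((q * z)\<^sup>2)) \<partial>N) = ennreal (\<integral>z. min 1 ((q * z)\<^sup>2) \<partial>N)"
    by (intro nn_integral_eq_integral integrable_const_bound[where B = 1]) auto
  ultimately show ?thesis using t s0 by simp
qed

lemma trunc_bound:
  assumes aa: "\<alpha> \<noteq> 1 \<longrightarrow> a = 0" and \<sigma>: "0 < \<sigma>" "\<sigma> \<le> 1"
  shows "(\<integral>z. min 1 (\<sigma> * (\<sigma> powr (-1/\<alpha>))\<^sup>2 * z\<^sup>2) \<partial>N) \<le> 8 * K * t * \<sigma> powr (\<alpha>/4 - 1)"
proof -
  have eq: "\<sigma> * (\<sigma> powr (-1/\<alpha>))\<^sup>2 = (\<sigma> powr (1/2 - 1/\<alpha>))\<^sup>2"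
  proof -
    have "(\<sigma> powr (1/2 - 1/\<alpha>))\<^sup>2 = (\<sigma> powr (1/2))\<^sup>2 * (\<sigma> powr (-1/\<alpha>))\<^sup>2"
      by (simp add: power_mult_distrib[symmetric] powr_add[symmetric])
    also have "(\<sigma> powr (1/2))\<^sup>2 = \<sigma>" using \<sigma> by (simp add: powr_half_sqrt)
    finally show ?thesis by simp
  qed
  have "(\<integral>z. min 1 ((\<sigma> powr (1/2 - 1/\<alpha>) * z)\<^sup>2) \<partial>N) \<le> 8 * (t * (K * \<sigma> powr (\<alpha>/4 - 1)))"
    using \<sigma> by (intro truncated_second_moment \<eta>_below_scale aa) auto
  then show ?thesis unfolding eq by (simp add: power_mult_distrib mult_ac)
qed

text \<open>For \<alpha> = 1 the term u ln u turns the dilation by r into a dilation with an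
  additional shift; otherwise a = 0 and the scaling is exact. A shift does not affect the total
  variation bound for which this is used.\<close>

lemma scaled_law:
  assumes aa: "\<alpha> \<noteq> 1 \<longrightarrow> a = 0" and N1: "real_distribution N\<^sub>1" "\<And>u. u > 0 \<Longrightarrow> char N\<^sub>1 u = exp (\<eta> u)"
  defines "r \<equiv> t powr (1/\<alpha>)"
  shows "N = distr N\<^sub>1 borel (\<lambda>z. r * z + - (r * ln r * Im a))"
proof -
  let ?N = "distr N\<^sub>1 borel (\<lambda>z. r * z + - (r * ln r * Im a))"
  interpret N1: real_distribution N\<^sub>1 by (rule N1)
  have r: "r > 0" using t by (simp add: r_def)
  have rdN: "real_distribution ?N" by (intro N1.real_distribution_distr) auto
  interpret N': real_distribution ?N by (rule rdN)
  have ra: "r powr \<alpha> = t" using t \<alpha> by (simp add: r_def powr_powr)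
  have pos: "char ?N u = char N u" if u: "u > 0" for u
  proof -
    have e: "of_real t * \<eta> u = \<eta> (r * u) - of_real (u * (r * ln r)) * a"
    proof (cases "\<alpha> = 1")
      case True
      then have "t = r" using t by (simp add: r_def)
      then show ?thesis using u r
        unfolding \<eta>_def unfolding True by (simp add: ln_mult scaleR_conv_of_real algebra_simps)
    next
      case False
      then have "a = 0" using aa by blast
      then show ?thesis using u r ra unfolding \<eta>_def by (simp add: powr_mult scaleR_conv_of_real)
    qed
    have "char ?N u = (\<integral>z. iexp (u * (r * z + - (r * ln r * Im a))) \<partial>N\<^sub>1)"
      unfolding char_def by (rule integral_distr) measurable
    also have "\<dots> = (\<integral>z. iexp (r * u * z) * iexp (- (u * (r * ln r) * Im a)) \<partial>N\<^sub>1)"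
      by (intro Bochner_Integration.integral_cong refl) (simp add: exp_add[symmetric] algebra_simps)
    also have "\<dots> = char N\<^sub>1 (r * u) * iexp (- (u * (r * ln r) * Im a))" by (simp add: char_def)
    also have "\<dots> = exp (\<eta> (r * u) + \<i> * of_real (- (u * (r * ln r) * Im a)))"
      unfolding exp_add using r u by (simp add: N1(2))
    also have "\<i> * of_real (- (u * (r * ln r) * Im a)) = - (of_real (u * (r * ln r)) * a)"
      using a by (simp add: complex_eq_iff)
    finally show ?thesis unfolding ch[OF u] e by simp
  qed
  have "char ?N = char N"
  proof
    fix u :: real
    consider "u > 0" | "u = 0" | "- u > 0" by linarith
    then show "char ?N u = char N u"
    proof cases
      case 2 then show ?thesis by (simp only: N'.char_zero char_zero)
    next
      case 3
      have "cnj (char ?N u) = cnj (char N u)"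
        using pos[OF 3] by (simp only: char_uminus)
      then show ?thesis by simp
    qed (rule pos)
  qed
  then show ?thesis using Levy_uniqueness[OF rdN rd] by simp
qed

end

end

text \<open>The rate in t comes from scaling alone: a shift by h at time t corresponds to a shift by
  h / r with r = t powr (1/\<alpha>) at time 1. The summand 8 K in the constant covers both moment
  bounds.\<close>

theorem stable_noise_bounds:
  fixes \<zeta> :: "real \<Rightarrow> 'a \<Rightarrow> real"
  assumes M: "prob_space M" and \<alpha>: "0 < \<alpha>" "\<alpha> < 2" and \<zeta>: "stable_process \<alpha> M \<zeta>"
  obtains p C where "C \<ge> 1"
    "\<And>t B f h. t > 0 \<Longrightarrow> bounded_meas B f \<Longrightarrow>
      \<bar>(\<integral>\<omega>. f (h + (\<zeta> t \<omega> - t * p)) \<partial>M) - (\<integral>\<omega>. f (\<zeta> t \<omega> - t * p) \<partial>M)\<bar> \<le> C * t powr (-1/\<alpha>) * B * \<bar>h\<bar>"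
    "\<And>t \<sigma>. t > 0 \<Longrightarrow> 0 < \<sigma> \<Longrightarrow> \<sigma> \<le> 1 \<Longrightarrow>
      \<sigma> * \<bar>\<integral>\<omega>. sin (\<sigma> powr (-1/\<alpha>) * (\<zeta> t \<omega> - t * p)) \<partial>M\<bar> \<le> C * t * \<sigma> powr (\<alpha>/4 - 1)"
    "\<And>t \<sigma>. t > 0 \<Longrightarrow> 0 < \<sigma> \<Longrightarrow> \<sigma> \<le> 1 \<Longrightarrow>
      (\<integral>\<omega>. min 1 (\<sigma> * (\<sigma> powr (-1/\<alpha>))\<^sup>2 * (\<zeta> t \<omega> - t * p)\<^sup>2) \<partial>M) \<le> C * t * \<sigma> powr (\<alpha>/4 - 1)"
proof -
  interpret prob_space M by (rule M)
  have zm: "t > 0 \<Longrightarrow> \<zeta> t \<in> borel_measurable M" for t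
    using \<zeta> by (simp add: stable_process_def levy_process_def)
  obtain w a p where w: "Re w < 0" and a: "Re a = 0" and aa: "\<alpha> \<noteq> 1 \<longrightarrow> a = 0"
    and ch: "\<And>t u. t \<ge> 0 \<Longrightarrow> u > 0 \<Longrightarrow> char (distr M borel (\<zeta> t)) u =
        exp (of_real t * (w * of_real (u powr \<alpha>) + a * of_real (u * ln u))) * iexp (u * (t * p))"
    by (rule stable_process_exponent[OF M \<alpha> \<zeta>]) (rule that; blast)
  interpret E: stable_exponent w a \<alpha> by standard (use w a \<alpha> in auto)
  define N where "N t = distr M borel (\<lambda>\<omega>. \<zeta> t \<omega> - t * p)" for t
  have Nd: "real_distribution (N t)" if "t > 0" for t
    unfolding N_def using zm[OF that] by (intro real_distribution_distr) auto
  have Nc: "char (N t) u = exp (of_real t * E.\<eta> u)" if t: "t > 0" and u: "u > 0" for t u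
  proof -
    note [measurable] = zm[OF t]
    have "char (N t) u = (\<integral>\<omega>. iexp (u * (\<zeta> t \<omega> - t * p)) \<partial>M)"
      unfolding char_def N_def by (rule integral_distr) measurable
    also have "\<dots> = (\<integral>\<omega>. iexp (u * \<zeta> t \<omega>) * iexp (- (u * (t * p))) \<partial>M)"
      by (intro Bochner_Integration.integral_cong refl) (simp add: exp_add[symmetric] algebra_simps)
    also have "\<dots> = (\<integral>\<omega>. iexp (u * \<zeta> t \<omega>) \<partial>M) * iexp (- (u * (t * p)))" by simp
    also have "(\<integral>\<omega>. iexp (u * \<zeta> t \<omega>) \<partial>M) = char (distr M borel (\<zeta> t)) u"
      unfolding char_def by (rule integral_distr[symmetric]) measurable
    also have "char (distr M borel (\<zeta> t)) u = exp (of_real t * E.\<eta> u) * iexp (u * (t * p))"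
      using t u by (subst ch) (simp_all add: E.\<eta>_def scaleR_conv_of_real mult.commute)
    finally show ?thesis by (simp add: exp_minus)
  qed
  have int: "(\<integral>z. f z \<partial>N t) = (\<integral>\<omega>. f (\<zeta> t \<omega> - t * p) \<partial>M)"
    if "t > 0" "f \<in> borel_measurable borel" for t and f :: "real \<Rightarrow> real"
    unfolding N_def using zm[OF that(1)] that(2) by (intro integral_distr) auto
  have Nc1: "char (N 1) u = exp (E.\<eta> u)" if "u > 0" for u using Nc[of 1 u] that by simp
  obtain C where C: "C \<ge> 1" "\<And>B f h. bounded_meas B f \<Longrightarrow> \<bar>(\<integral>z. f (h + z) \<partial>N 1) - (\<integral>z. f z \<partial>N 1)\<bar> \<le> C * B * \<bar>h\<bar>"
    by (rule E.stable_shift_bound[OF Nd[OF zero_less_one] Nc1]) (simp, rule that, assumption, blast)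
  show ?thesis
  proof (rule that[of "C + 8 * E.K" p])
    show "C + 8 * E.K \<ge> 1" using C E.K by simp
    fix t :: real assume t: "t > 0"
    show "\<bar>(\<integral>\<omega>. f (h + (\<zeta> t \<omega> - t * p)) \<partial>M) - (\<integral>\<omega>. f (\<zeta> t \<omega> - t * p) \<partial>M)\<bar> \<le> (C + 8 * E.K) * t powr (-1/\<alpha>) * B * \<bar>h\<bar>"
      if f: "bounded_meas B f" for B f h
    proof -
      have fm [measurable]: "f \<in> borel_measurable borel" and B: "B \<ge> 0"
        using f bounded_meas_nonneg[OF f] by (auto simp: bounded_meas_def)
      define r where "r = t powr (1/\<alpha>)"
      define D where "D = - (r * ln r * Im a)"
      have r: "r > 0" using t by (simp add: r_def)
      have N: "N t = distr (N 1) borel (\<lambda>z. r * z + D)"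
        unfolding r_def D_def by (rule E.scaled_law[OF Nd[OF t] t Nc[OF t] aa Nd[OF zero_less_one] Nc1])
      have [measurable_cong]: "sets (N 1) = sets borel" by (simp add: N_def)
      define g where "g z = f (r * z + D)" for z
      have g: "bounded_meas B g" using f unfolding bounded_meas_def g_def by auto
      have "(\<integral>z. f (h + z) \<partial>N t) = (\<integral>z. f (h + (r * z + D)) \<partial>N 1)"
        unfolding N by (rule integral_distr) measurable
      also have "\<dots> = (\<integral>z. g (h / r + z) \<partial>N 1)" using r by (simp add: g_def distrib_left add.assoc)
      finally have 1: "(\<integral>z. f (h + z) \<partial>N t) = (\<integral>z. g (h / r + z) \<partial>N 1)" .
      have 2: "(\<integral>z. f z \<partial>N t) = (\<integral>z. g z \<partial>N 1)"
        unfolding N g_def by (rule integral_distr) measurable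
      have "\<bar>(\<integral>z. f (h + z) \<partial>N t) - (\<integral>z. f z \<partial>N t)\<bar> \<le> C * B * \<bar>h / r\<bar>"
        unfolding 1 2 by (rule C(2)[OF g])
      also have "\<bar>h / r\<bar> = t powr (-1/\<alpha>) * \<bar>h\<bar>" using t by (simp add: r_def abs_div powr_minus_divide)
      also have "C * B * (t powr (-1/\<alpha>) * \<bar>h\<bar>) \<le> (C + 8 * E.K) * B * (t powr (-1/\<alpha>) * \<bar>h\<bar>)"
        using E.K B by (intro mult_right_mono) auto
      finally show ?thesis
        by (simp add: int[OF t] mult_ac)
    qed
    fix \<sigma> :: real assume \<sigma>: "0 < \<sigma>" "\<sigma> \<le> 1"
    have s: "t * \<sigma> powr (\<alpha>/4 - 1) \<ge> 0" using t by simp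
    have "\<sigma> * \<bar>\<integral>\<omega>. sin (\<sigma> powr (-1/\<alpha>) * (\<zeta> t \<omega> - t * p)) \<partial>M\<bar> \<le> E.K * t * \<sigma> powr (\<alpha>/4 - 1)"
      using E.sine_bound[OF Nd[OF t] t Nc[OF t] aa \<sigma>] by (simp add: int[OF t])
    also have "\<dots> \<le> (C + 8 * E.K) * t * \<sigma> powr (\<alpha>/4 - 1)"
      using mult_right_mono[OF _ s, of E.K "C + 8 * E.K"] E.K C(1) by (simp add: mult.assoc)
    finally show "\<sigma> * \<bar>\<integral>\<omega>. sin (\<sigma> powr (-1/\<alpha>) * (\<zeta> t \<omega> - t * p)) \<partial>M\<bar> \<le> (C + 8 * E.K) * t * \<sigma> powr (\<alpha>/4 - 1)" .
    have "(\<integral>\<omega>. min 1 (\<sigma> * (\<sigma> powr (-1/\<alpha>))\<^sup>2 * (\<zeta> t \<omega> - t * p)\<^sup>2) \<partial>M) \<le> 8 * E.K * t * \<sigma> powr (\<alpha>/4 - 1)"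
      using E.trunc_bound[OF Nd[OF t] t Nc[OF t] aa \<sigma>] by (simp add: int[OF t])
    also have "\<dots> \<le> (C + 8 * E.K) * t * \<sigma> powr (\<alpha>/4 - 1)"
      using mult_right_mono[OF _ s, of "8 * E.K" "C + 8 * E.K"] C(1) by (simp add: mult.assoc)
    finally show "(\<integral>\<omega>. min 1 (\<sigma> * (\<sigma> powr (-1/\<alpha>))\<^sup>2 * (\<zeta> t \<omega> - t * p)\<^sup>2) \<partial>M) \<le> (C + 8 * E.K) * t * \<sigma> powr (\<alpha>/4 - 1)" .
  qed
qed

section \<open>The drift coefficient\<close>

text \<open>A displacement is made one coordinate after another, which costs the dimension as a
  factor.\<close>

lemma lip_of_axes:
  fixes f :: "'b::euclidean_space \<Rightarrow> 'c::real_normed_vector" and c :: real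
  assumes ax: "\<And>i x r. i \<in> Basis \<Longrightarrow> norm (f (x + r *\<^sub>R i) - f x) \<le> c * \<bar>r\<bar>" and c: "c \<ge> 0"
  shows "lip (DIM('b) * c) f"
  unfolding lip_def
proof (intro allI)
  fix x h :: 'b
  have "norm (f (x + (\<Sum>i\<in>A. (h \<bullet> i) *\<^sub>R i)) - f x) \<le> card A * c * norm h"
    if "finite A" "A \<subseteq> Basis" for A
    using that
  proof (induction A rule: finite_induct)
    case (insert i A)
    let ?y = "x + (\<Sum>i\<in>A. (h \<bullet> i) *\<^sub>R i)"
    have "norm (f (?y + (h \<bullet> i) *\<^sub>R i) - f ?y) \<le> c * \<bar>h \<bullet> i\<bar>" using insert.prems by (intro ax) auto
    also have "\<dots> \<le> c * norm h" using insert.prems c by (intro mult_left_mono Basis_le_norm) auto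
    finally have 1: "norm (f (?y + (h \<bullet> i) *\<^sub>R i) - f ?y) \<le> c * norm h" .
    have 2: "norm (f ?y - f x) \<le> card A * c * norm h" using insert by auto
    have "x + (\<Sum>i\<in>insert i A. (h \<bullet> i) *\<^sub>R i) = ?y + (h \<bullet> i) *\<^sub>R i" using insert by (simp add: ac_simps)
    then have "norm (f (x + (\<Sum>i\<in>insert i A. (h \<bullet> i) *\<^sub>R i)) - f x)
        = norm ((f (?y + (h \<bullet> i) *\<^sub>R i) - f ?y) + (f ?y - f x))" by (simp only:) simp
    also have "\<dots> \<le> c * norm h + card A * c * norm h" using 1 2 norm_triangle_mono by blast
    also have "\<dots> = card (insert i A) * c * norm h" using insert by (simp add: algebra_simps)
    finally show ?case .
  qed simp
  from this[of Basis] show "norm (f (x + h) - f x) \<le> DIM('b) * c * norm h"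
    by (simp add: euclidean_representation)
qed

text \<open>The derivative along e is supplied at parameter 0 only, but for every base point; by
  translation this gives it along the whole line.\<close>

lemma directional_mvt:
  fixes g :: "'b::real_normed_vector \<Rightarrow> 'c::real_normed_vector"
  assumes g: "\<And>x. ((\<lambda>s. g (x + s *\<^sub>R e)) has_vector_derivative g' x) (at 0)" and B: "\<And>x. norm (g' x) \<le> B"
  shows "norm (g (x + r *\<^sub>R e) - g x) \<le> B * \<bar>r\<bar>"
proof -
  have d: "((\<lambda>s. g (x + s *\<^sub>R e)) has_vector_derivative g' (x + s *\<^sub>R e)) (at s)" for s
  proof -
    have "((\<lambda>u. g (x + s *\<^sub>R e + u *\<^sub>R e)) has_vector_derivative g' (x + s *\<^sub>R e)) (at (- s + s))"
      using g[of "x + s *\<^sub>R e"] by simp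
    then have "((\<lambda>u. g (x + s *\<^sub>R e + u *\<^sub>R e)) \<circ> (+) (- s) has_vector_derivative g' (x + s *\<^sub>R e)) (at s)"
      unfolding has_vector_derivative_def
      by (intro diff_chain_at[where g' = "\<lambda>h. h *\<^sub>R g' (x + s *\<^sub>R e)" and f' = "\<lambda>h. h", unfolded o_def[of _ "\<lambda>h. h"]])
         (auto intro!: derivative_eq_intros)
    moreover have "(\<lambda>u. g (x + s *\<^sub>R e + u *\<^sub>R e)) \<circ> (+) (- s) = (\<lambda>s. g (x + s *\<^sub>R e))"
      by (simp add: fun_eq_iff algebra_simps)
    ultimately show ?thesis by simp
  qed
  have "norm ((\<lambda>s. g (x + s *\<^sub>R e)) r - (\<lambda>s. g (x + s *\<^sub>R e)) 0) \<le> B * norm (r - 0)"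
  proof (rule differentiable_bound[where S = UNIV and f' = "\<lambda>s h. h *\<^sub>R g' (x + s *\<^sub>R e)"])
    show "((\<lambda>s. g (x + s *\<^sub>R e)) has_derivative (\<lambda>h. h *\<^sub>R g' (x + s *\<^sub>R e))) (at s within UNIV)" for s
      using d[of s] by (simp add: has_vector_derivative_def)
    show "onorm (\<lambda>h::real. h *\<^sub>R g' (x + s *\<^sub>R e)) \<le> B" for s
    proof (rule onorm_bound)
      show "0 \<le> B" using order_trans[OF norm_ge_zero B] .
      show "norm (h *\<^sub>R g' (x + s *\<^sub>R e)) \<le> B * norm h" for h :: real
        using mult_left_mono[OF B, of "\<bar>h\<bar>" "x + s *\<^sub>R e"] by (simp add: mult.commute)
    qed
  qed auto
  then show ?thesis by simp
qed

lemma C1_map_partial: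
  "C1_map g \<Longrightarrow> ((\<lambda>s. g (x + s *\<^sub>R axis i 1)) has_vector_derivative partial i g x) (at 0)"
  unfolding C1_map_def partial_def by (simp add: vector_derivative_works[symmetric])

lemma axis_cases: "i \<in> (Basis :: (real ^ 'd) set) \<Longrightarrow> \<exists>j. i = axis j 1"
  by (auto simp: Basis_vec_def)

lemma uniform_bound:
  fixes g :: "'i::finite \<Rightarrow> 'b \<Rightarrow> 'c::real_normed_vector"
  assumes "\<And>i. bounded (range (g i))"
  obtains B where "B \<ge> 0" "\<And>i x. norm (g i x) \<le> B"
proof -
  have "bounded (\<Union>i. range (g i))" using assms by (intro bounded_UN) auto
  then obtain B where "\<And>i x. norm (g i x) \<le> B" unfolding bounded_iff by blast
  then show ?thesis using that[of B] order_trans[OF norm_ge_zero] by blast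
qed

lemma C1_map_lip:
  fixes g :: "real ^ 'd \<Rightarrow> 'c::real_normed_vector"
  assumes g: "C1_map g" and bd: "\<And>i. bounded (range (partial i g))"
  obtains A where "A \<ge> 0" "lip A g"
proof -
  obtain B where B: "B \<ge> 0" "\<And>i x. norm (partial i g x) \<le> B" by (rule uniform_bound[of "\<lambda>i. partial i g"]) (use bd in auto)
  have "lip (DIM(real ^ 'd) * B) g"
  proof (rule lip_of_axes)
    show "norm (g (x + r *\<^sub>R i) - g x) \<le> B * \<bar>r\<bar>" if i: "i \<in> Basis" for i x r
    proof -
      obtain j where "i = axis j 1" using axis_cases[OF i] by blast
      then show ?thesis using directional_mvt[OF C1_map_partial[OF g] B(2)] by simp
    qed
  qed (rule B)
  then show ?thesis by (intro that[of "DIM(real ^ 'd) * B"]) (use B(1) in auto)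
qed

text \<open>For fixed k the increment y \<mapsto> b (y + k) - b y has partial derivatives bounded by
  a multiple of \<open>norm k\<close>, since the partial derivatives of \<open>b\<close> are
  Lipschitz. So it is itself Lipschitz with that constant, and total derivatives never
  appear.\<close>

theorem C2_map_bounded_partials:
  fixes b :: "real ^ 'd \<Rightarrow> 'c::real_normed_vector"
  assumes b: "C2_map b" and b1: "\<And>i. bounded (range (partial i b))"
    and b2: "\<And>i j. bounded (range (partial j (partial i b)))"
  obtains L where "L \<ge> 0" "lip L b" "second_diff L b"
proof -
  have c1: "C1_map b" and c2: "\<And>i. C1_map (partial i b)" using b by (auto simp: C2_map_def)
  obtain A1 where A1: "A1 \<ge> 0" "lip A1 b" by (rule C1_map_lip[OF c1 b1]) (rule that; blast)
  have "\<exists>A. A \<ge> 0 \<and> lip A (partial i b)" for i by (rule C1_map_lip[OF c2 b2, of i]) blast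
  then obtain A where A: "\<And>i. A i \<ge> 0" "\<And>i. lip (A i) (partial i b)" by metis
  define A2 where "A2 = (\<Sum>i\<in>UNIV. A i)"
  have A2: "A2 \<ge> 0" "A i \<le> A2" for i
    unfolding A2_def using A(1) by (auto intro!: sum_nonneg member_le_sum)
  have sd: "norm (b (x + h + k) - b (x + h) - b (x + k) + b x) \<le> DIM(real ^ 'd) * A2 * norm h * norm k" for x h k
  proof -
    define D where "D y = b (y + k) - b y" for y
    have "lip (DIM(real ^ 'd) * (A2 * norm k)) D"
    proof (rule lip_of_axes[where f = D and c = "A2 * norm k"])
      show "norm (D (y + r *\<^sub>R i) - D y) \<le> A2 * norm k * \<bar>r\<bar>" if i: "i \<in> Basis" for i y r
      proof -
        obtain j where j: "i = axis j 1" using axis_cases[OF i] by blast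
        show ?thesis
          unfolding j
        proof (rule directional_mvt[where g' = "\<lambda>y. partial j b (y + k) - partial j b y"])
          show "((\<lambda>s. D (y + s *\<^sub>R axis j 1)) has_vector_derivative partial j b (y + k) - partial j b y) (at 0)" for y
            unfolding D_def using C1_map_partial[OF c1, of "y + k" j] C1_map_partial[OF c1, of y j]
            by (intro has_vector_derivative_diff) (simp_all add: algebra_simps)
          have "norm (partial j b (y + k) - partial j b y) \<le> A j * norm k" for y by (rule lipD[OF A(2)])
          also have "A j * norm k \<le> A2 * norm k" by (intro mult_right_mono A2) auto
          finally show "norm (partial j b (y + k) - partial j b y) \<le> A2 * norm k" for y .
        qed
      qed
    qed (use A2 in auto)
    from lipD[OF this, of x h] show ?thesis by (simp add: D_def algebra_simps)
  qed
  show ?thesis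
  proof (rule that[of "A1 + DIM(real ^ 'd) * A2"])
    show "lip (A1 + DIM(real ^ 'd) * A2) b" by (rule lip_mono[OF A1(2)]) (use A2 in simp)
    have "second_diff (DIM(real ^ 'd) * A2) b" using sd by (simp add: second_diff_def)
    then show "second_diff (A1 + DIM(real ^ 'd) * A2) b" by (rule second_diff_mono) (use A1 in simp)
  qed (use A1 A2 in auto)
qed

section \<open>The noise\<close>

lemma (in prob_space) indep_var_Fubini:
  fixes A B :: "'a \<Rightarrow> 'b::second_countable_topology" and f :: "'b \<times> 'b \<Rightarrow> real"
  assumes iv: "indep_var borel A borel B" and f [measurable]: "f \<in> borel_measurable (borel \<Otimes>\<^sub>M borel)"
    and c: "\<And>z. \<bar>f z\<bar> \<le> c"
  shows "(\<integral>\<omega>. f (A \<omega>, B \<omega>) \<partial>M) = (\<integral>a. (\<integral>\<omega>. f (a, B \<omega>) \<partial>M) \<partial>distr M borel A)"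
proof -
  have [measurable]: "A \<in> borel_measurable M" "B \<in> borel_measurable M"
    using indep_var_rv1[OF iv] indep_var_rv2[OF iv] by auto
  interpret A: prob_space "distr M borel A" by (rule prob_space_distr) measurable
  interpret B: prob_space "distr M borel B" by (rule prob_space_distr) measurable
  interpret P: pair_prob_space "distr M borel A" "distr M borel B" ..
  have "(\<integral>\<omega>. f (A \<omega>, B \<omega>) \<partial>M) = (\<integral>z. f z \<partial>distr M (borel \<Otimes>\<^sub>M borel) (\<lambda>\<omega>. (A \<omega>, B \<omega>)))"
    by (rule integral_distr[symmetric]) measurable
  also have "\<dots> = (\<integral>z. f z \<partial>(distr M borel A \<Otimes>\<^sub>M distr M borel B))"
    using iv indep_var_distribution_eq[of borel A borel B] by (simp only:)
  also have "\<dots> = (\<integral>a. (\<integral>b. f (a, b) \<partial>distr M borel B) \<partial>distr M borel A)"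
    by (rule P.integral_fst'[symmetric]) (rule P.integrable_const_bound[where B = c], use c in auto)
  also have "\<dots> = (\<integral>a. (\<integral>\<omega>. f (a, B \<omega>) \<partial>M) \<partial>distr M borel A)"
    by (intro Bochner_Integration.integral_cong refl integral_distr) measurable
  finally show ?thesis .
qed

lemma levy_process_drift:
  fixes Z :: "real \<Rightarrow> 'a \<Rightarrow> 'b::euclidean_space"
  assumes M: "prob_space M" and Z: "levy_process M Z"
  shows "levy_process M (\<lambda>t \<omega>. Z t \<omega> - t *\<^sub>R k)"
  unfolding levy_process_def
proof (intro conjI allI impI)
  interpret prob_space M by (rule M)
  have Zm [measurable]: "t \<ge> 0 \<Longrightarrow> Z t \<in> borel_measurable M" for t using Z by (simp add: levy_process_def)
  show "(\<lambda>\<omega>. Z t \<omega> - t *\<^sub>R k) \<in> borel_measurable M" if "0 \<le> t" for t using that by measurable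
  have "AE \<omega> in M. Z 0 \<omega> = 0" using Z by (simp add: levy_process_def)
  then show "AE \<omega> in M. Z 0 \<omega> - 0 *\<^sub>R k = 0" by simp
  show "indep_vars (\<lambda>_. borel) (\<lambda>i \<omega>. Z (t (Suc i)) \<omega> - t (Suc i) *\<^sub>R k - (Z (t i) \<omega> - t i *\<^sub>R k)) {..<n}"
    if t: "0 \<le> t 0 \<and> (\<forall>i<n. t i \<le> t (Suc i))" for n t
  proof -
    have "indep_vars (\<lambda>_. borel) (\<lambda>i \<omega>. Z (t (Suc i)) \<omega> - Z (t i) \<omega>) {..<n}"
      using Z t unfolding levy_process_def by blast
    then have "indep_vars (\<lambda>_. borel) (\<lambda>i \<omega>. (\<lambda>x. x - (t (Suc i) - t i) *\<^sub>R k) (Z (t (Suc i)) \<omega> - Z (t i) \<omega>)) {..<n}"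
      by (rule indep_vars_compose2) measurable
    then show ?thesis by (simp add: algebra_simps)
  qed
  show "distr M borel (\<lambda>\<omega>. Z (s + h) \<omega> - (s + h) *\<^sub>R k - (Z s \<omega> - s *\<^sub>R k)) = distr M borel (\<lambda>\<omega>. Z h \<omega> - h *\<^sub>R k)"
    if sh: "0 \<le> s" "0 \<le> h" for s h
  proof -
    have [measurable]: "Z s \<in> borel_measurable M" "Z h \<in> borel_measurable M" "Z (s + h) \<in> borel_measurable M"
      using sh by (auto intro: Zm)
    have "distr M borel (\<lambda>\<omega>. Z (s + h) \<omega> - (s + h) *\<^sub>R k - (Z s \<omega> - s *\<^sub>R k))
      = distr M borel ((\<lambda>x. x - h *\<^sub>R k) \<circ> (\<lambda>\<omega>. Z (s + h) \<omega> - Z s \<omega>))"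
      by (simp add: o_def algebra_simps)
    also have "\<dots> = distr (distr M borel (\<lambda>\<omega>. Z (s + h) \<omega> - Z s \<omega>)) borel (\<lambda>x. x - h *\<^sub>R k)"
      by (rule distr_distr[symmetric]) measurable
    also have "distr M borel (\<lambda>\<omega>. Z (s + h) \<omega> - Z s \<omega>) = distr M borel (Z h)"
      using Z sh unfolding levy_process_def by blast
    also have "distr (distr M borel (Z h)) borel (\<lambda>x. x - h *\<^sub>R k) = distr M borel (\<lambda>\<omega>. Z h \<omega> - h *\<^sub>R k)"
      by (subst distr_distr) (measurable, simp add: o_def)
    finally show ?thesis .
  qed
  have "AE \<omega> in M. cadlag (\<lambda>t. Z t \<omega>)" using Z by (simp add: levy_process_def)
  then show "AE \<omega> in M. cadlag (\<lambda>t. Z t \<omega> - t *\<^sub>R k)"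
  proof eventually_elim
    case (elim \<omega>)
    show ?case
      unfolding cadlag_def
    proof (intro conjI allI impI)
      show "((\<lambda>t. Z t \<omega> - t *\<^sub>R k) \<longlongrightarrow> Z t \<omega> - t *\<^sub>R k) (at_right t)" if "0 \<le> t" for t
        using elim that unfolding cadlag_def by (intro tendsto_intros) auto
      show "\<exists>l. ((\<lambda>t. Z t \<omega> - t *\<^sub>R k) \<longlongrightarrow> l) (at_left t)" if t: "0 < t" for t
      proof -
        obtain l where "((\<lambda>t. Z t \<omega>) \<longlongrightarrow> l) (at_left t)" using elim t unfolding cadlag_def by blast
        then have "((\<lambda>t. Z t \<omega> - t *\<^sub>R k) \<longlongrightarrow> l - t *\<^sub>R k) (at_left t)" by (intro tendsto_intros)
        then show ?thesis ..
      qed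
    qed
  qed
qed

text \<open>The drift taken out of the noise is returned to the coefficient, so the same process X
  solves the modified equation and its semigroup is unchanged.\<close>

lemma sde_solution_drift:
  assumes "sde_solution M b Z x X"
  shows "sde_solution M (\<lambda>x. b x + k) (\<lambda>t \<omega>. Z t \<omega> - t *\<^sub>R k) x X"
  unfolding sde_solution_def
proof (intro conjI)
  show "\<forall>t\<ge>0. X t \<in> borel_measurable M" using assms by (simp add: sde_solution_def)
  have "AE \<omega> in M. \<forall>t\<ge>0. (\<lambda>s. b (X s \<omega>)) integrable_on {0..t} \<and>
        X t \<omega> = x + integral {0..t} (\<lambda>s. b (X s \<omega>)) + Z t \<omega>" using assms by (simp add: sde_solution_def)
  then show "AE \<omega> in M. \<forall>t\<ge>0. (\<lambda>s. b (X s \<omega>) + k) integrable_on {0..t} \<and>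
        X t \<omega> = x + integral {0..t} (\<lambda>s. b (X s \<omega>) + k) + (Z t \<omega> - t *\<^sub>R k)"
  proof eventually_elim
    case (elim \<omega>)
    show ?case
    proof (intro allI impI)
      fix t :: real assume t: "0 \<le> t"
      have i: "(\<lambda>s. b (X s \<omega>)) integrable_on {0..t}" and X: "X t \<omega> = x + integral {0..t} (\<lambda>s. b (X s \<omega>)) + Z t \<omega>"
        using elim t by auto
      have "((\<lambda>s. b (X s \<omega>) + k) has_integral integral {0..t} (\<lambda>s. b (X s \<omega>)) + t *\<^sub>R k) {0..t}"
        using has_integral_add[OF integrable_integral[OF i] has_integral_const_real[of k 0 t]] t by simp
      then show "(\<lambda>s. b (X s \<omega>) + k) integrable_on {0..t} \<and>
        X t \<omega> = x + integral {0..t} (\<lambda>s. b (X s \<omega>) + k) + (Z t \<omega> - t *\<^sub>R k)"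
        using X by (auto simp: integrable_on_def integral_unique)
    qed
  qed
qed

lemma levy_semigroup:
  fixes Z :: "real \<Rightarrow> 'a \<Rightarrow> 'b::euclidean_space"
  assumes M: "prob_space M" and Z: "levy_process M Z" and st: "s > 0" "t > 0" and f: "bounded_meas B f"
  shows "conv_op (distr M borel (Z s)) (conv_op (distr M borel (Z t)) f) = conv_op (distr M borel (Z (s + t))) f"
proof
  fix x
  interpret prob_space M by (rule M)
  have fm [measurable]: "f \<in> borel_measurable borel" and fB: "\<And>x. \<bar>f x\<bar> \<le> B" using f by (auto simp: bounded_meas_def)
  obtain U V where iv: "indep_var borel U borel V" and d: "distr M borel U = distr M borel (Z s)"
    "distr M borel V = distr M borel (Z t)" "distr M borel (\<lambda>\<omega>. U \<omega> + V \<omega>) = distr M borel (Z (s + t))"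
    by (rule levy_convolution[OF M Z, of s t]) (use st in auto)
  have [measurable]: "U \<in> borel_measurable M" "V \<in> borel_measurable M"
    using indep_var_rv1[OF iv] indep_var_rv2[OF iv] by auto
  have "conv_op (distr M borel (Z (s + t))) f x = (\<integral>\<omega>. f (x + (U \<omega> + V \<omega>)) \<partial>M)"
    unfolding conv_op_def d(3)[symmetric] by (rule integral_distr) measurable
  also have "\<dots> = (\<integral>\<omega>. (\<lambda>(u, v). f (x + (u + v))) (U \<omega>, V \<omega>) \<partial>M)" by simp
  also have "\<dots> = (\<integral>u. (\<integral>\<omega>. (\<lambda>(u, v). f (x + (u + v))) (u, V \<omega>) \<partial>M) \<partial>distr M borel U)"
    by (rule indep_var_Fubini[OF iv, where c = B]) (use fB in auto)
  also have "\<dots> = (\<integral>u. (\<integral>v. f (x + u + v) \<partial>distr M borel V) \<partial>distr M borel U)"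
    by (intro Bochner_Integration.integral_cong refl) (simp add: integral_distr add.assoc)
  finally show "conv_op (distr M borel (Z s)) (conv_op (distr M borel (Z t)) f) x = conv_op (distr M borel (Z (s + t))) f x"
    by (simp only: conv_op_def d(1,2))
qed

text \<open>Conditioning on the other coordinates reduces a shift along one axis to the one-dimensional bound.\<close>

lemma coordinate_shift_bound:
  fixes Z :: "real \<Rightarrow> 'a \<Rightarrow> real ^ 'd"
  assumes M: "prob_space M" and ind: "independent_coordinates M Z" and t: "t \<ge> 0"
    and bound: "\<And>f h. bounded_meas B f \<Longrightarrow> \<bar>(\<integral>\<omega>. f (h + (Z t \<omega> $ i - q)) \<partial>M) - (\<integral>\<omega>. f (Z t \<omega> $ i - q) \<partial>M)\<bar> \<le> c * \<bar>h\<bar>"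
    and f: "bounded_meas B f" and k: "k $ i = q"
  shows "\<bar>(\<integral>\<omega>. f (r *\<^sub>R axis i 1 + (Z t \<omega> - k)) \<partial>M) - (\<integral>\<omega>. f (Z t \<omega> - k) \<partial>M)\<bar> \<le> c * \<bar>r\<bar>"
proof -
  interpret prob_space M by (rule M)
  have fm [measurable]: "f \<in> borel_measurable borel" and fB: "\<And>x. \<bar>f x\<bar> \<le> B" using f by (auto simp: bounded_meas_def)
  define W where "W j \<omega> = (\<lambda>t\<in>{0..}. Z t \<omega> $ j)" for j \<omega>
  define V where "V \<omega> = (\<Sum>j\<in>UNIV - {i}. (Z t \<omega> $ j - k $ j) *\<^sub>R axis j (1::real))" for \<omega>
  define U where "U \<omega> = (Z t \<omega> $ i - q) *\<^sub>R axis i (1::real)" for \<omega>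
  have "indep_vars (\<lambda>_. \<Pi>\<^sub>M t\<in>{0..}. borel) W UNIV"
    using ind unfolding independent_coordinates_def W_def[abs_def] .
  then have "indep_var (Pi\<^sub>M (UNIV - {i}) (\<lambda>_. \<Pi>\<^sub>M t\<in>{0..}. borel)) (\<lambda>\<omega>. restrict (\<lambda>j. W j \<omega>) (UNIV - {i}))
     (Pi\<^sub>M {i} (\<lambda>_. \<Pi>\<^sub>M t\<in>{0..}. borel)) (\<lambda>\<omega>. restrict (\<lambda>j. W j \<omega>) {i})"
    by (rule indep_var_restrict) auto
  then have "indep_var borel ((\<lambda>v. \<Sum>j\<in>UNIV - {i}. (v j t - k $ j) *\<^sub>R axis j (1::real)) \<circ> (\<lambda>\<omega>. restrict (\<lambda>j. W j \<omega>) (UNIV - {i})))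
     borel ((\<lambda>v. (v i t - q) *\<^sub>R axis i (1::real)) \<circ> (\<lambda>\<omega>. restrict (\<lambda>j. W j \<omega>) {i}))"
  proof (rule indep_var_compose)
    have c: "(\<lambda>v. v j t) \<in> borel_measurable (Pi\<^sub>M J (\<lambda>_. \<Pi>\<^sub>M t\<in>{0..}. borel))" if "j \<in> J" for J :: "'d set" and j
    proof (rule measurable_compose[of "\<lambda>v. v j"])
      show "(\<lambda>v. v j) \<in> Pi\<^sub>M J (\<lambda>_. \<Pi>\<^sub>M t\<in>{0..}. borel) \<rightarrow>\<^sub>M (\<Pi>\<^sub>M t\<in>{0..}. borel)"
        using that by (rule measurable_component_singleton)
      show "(\<lambda>v. v t) \<in> borel_measurable (\<Pi>\<^sub>M t\<in>{0..}. borel)"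
        by (rule measurable_component_singleton) (use t in simp)
    qed
    show "(\<lambda>v. \<Sum>j\<in>UNIV - {i}. (v j t - k $ j) *\<^sub>R axis j (1::real)) \<in> borel_measurable (Pi\<^sub>M (UNIV - {i}) (\<lambda>_. \<Pi>\<^sub>M t\<in>{0..}. borel))"
      by (intro borel_measurable_sum borel_measurable_scaleR borel_measurable_diff borel_measurable_const c)
    show "(\<lambda>v. (v i t - q) *\<^sub>R axis i (1::real)) \<in> borel_measurable (Pi\<^sub>M {i} (\<lambda>_. \<Pi>\<^sub>M t\<in>{0..}. borel))"
      by (intro borel_measurable_scaleR borel_measurable_diff borel_measurable_const c) simp
  qed
  moreover have "(\<lambda>v. \<Sum>j\<in>UNIV - {i}. (v j t - k $ j) *\<^sub>R axis j (1::real)) \<circ> (\<lambda>\<omega>. restrict (\<lambda>j. W j \<omega>) (UNIV - {i})) = V"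
    using t by (auto simp: fun_eq_iff V_def W_def intro!: sum.cong)
  moreover have "(\<lambda>v. (v i t - q) *\<^sub>R axis i (1::real)) \<circ> (\<lambda>\<omega>. restrict (\<lambda>j. W j \<omega>) {i}) = U"
    using t by (simp add: fun_eq_iff U_def W_def)
  ultimately have iv: "indep_var borel V borel U" by simp
  have [measurable]: "V \<in> borel_measurable M" "U \<in> borel_measurable M"
    using indep_var_rv1[OF iv] indep_var_rv2[OF iv] by auto
  interpret V: prob_space "distr M borel V" by (rule prob_space_distr) measurable
  have split: "Z t \<omega> - k = V \<omega> + U \<omega>" for \<omega>
  proof -
    have "Z t \<omega> - k = (\<Sum>j\<in>UNIV. (Z t \<omega> $ j - k $ j) *\<^sub>R axis j 1)"
      using basis_expansion[of "Z t \<omega> - k"] by (simp add: scalar_mult_eq_scaleR)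
    also have "\<dots> = (Z t \<omega> $ i - k $ i) *\<^sub>R axis i 1 + V \<omega>"
      unfolding V_def by (rule sum.remove) auto
    finally show ?thesis by (simp add: U_def k add.commute)
  qed
  have F: "(\<integral>\<omega>. f (s *\<^sub>R axis i 1 + (Z t \<omega> - k)) \<partial>M) = (\<integral>v. (\<integral>\<omega>. f (v + (s *\<^sub>R axis i 1 + U \<omega>)) \<partial>M) \<partial>distr M borel V)" for s
  proof -
    have "(\<integral>\<omega>. f (s *\<^sub>R axis i 1 + (Z t \<omega> - k)) \<partial>M) = (\<integral>\<omega>. (\<lambda>(v, u). f (v + (s *\<^sub>R axis i 1 + u))) (V \<omega>, U \<omega>) \<partial>M)"
      unfolding split by (simp add: algebra_simps)
    also have "\<dots> = (\<integral>v. (\<integral>\<omega>. (\<lambda>(v, u). f (v + (s *\<^sub>R axis i 1 + u))) (v, U \<omega>) \<partial>M) \<partial>distr M borel V)"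
      by (rule indep_var_Fubini[OF iv, where c = B]) (use fB in auto)
    finally show ?thesis by simp
  qed
  have m [measurable]: "(\<lambda>v. \<integral>\<omega>. f (v + (s *\<^sub>R axis i 1 + U \<omega>)) \<partial>M) \<in> borel_measurable borel" for s
    by measurable
  have le: "\<bar>\<integral>\<omega>. f (v + (s *\<^sub>R axis i 1 + U \<omega>)) \<partial>M\<bar> \<le> B" for v s
    by (rule abs_integral_le) (use fB in auto)
  have int: "integrable (distr M borel V) (\<lambda>v. \<integral>\<omega>. f (v + (s *\<^sub>R axis i 1 + U \<omega>)) \<partial>M)" for s
    by (rule V.integrable_const_bound[where B = B]) (use le in auto)
  have "(\<integral>\<omega>. f (r *\<^sub>R axis i 1 + (Z t \<omega> - k)) \<partial>M) - (\<integral>\<omega>. f (Z t \<omega> - k) \<partial>M)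
     = (\<integral>v. (\<integral>\<omega>. f (v + (r *\<^sub>R axis i 1 + U \<omega>)) \<partial>M) - (\<integral>\<omega>. f (v + (0 *\<^sub>R axis i 1 + U \<omega>)) \<partial>M) \<partial>distr M borel V)"
    using F[of r] F[of 0] int[of r] int[of 0] by simp
  also have "\<bar>\<dots>\<bar> \<le> c * \<bar>r\<bar>"
  proof (rule V.abs_integral_le)
    fix v
    have "bounded_meas B (\<lambda>u. f (v + u *\<^sub>R axis i 1))"
      using fB unfolding bounded_meas_def by auto
    from bound[OF this, of r]
    show "\<bar>(\<integral>\<omega>. f (v + (r *\<^sub>R axis i 1 + U \<omega>)) \<partial>M) - (\<integral>\<omega>. f (v + (0 *\<^sub>R axis i 1 + U \<omega>)) \<partial>M)\<bar> \<le> c * \<bar>r\<bar>"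
      by (simp add: U_def scaleR_add_left)
  qed simp
  finally show ?thesis .
qed

text \<open>The vector k collects the drifts of the coordinates. The sum of their constants serves
  all coordinates at once, and passing from shifts along the axes to arbitrary shifts costs the
  dimension.\<close>

theorem stable_euler_scheme:
  fixes Z :: "real \<Rightarrow> 'a \<Rightarrow> real ^ 'd" and b :: "real ^ 'd \<Rightarrow> real ^ 'd"
  assumes M: "prob_space M" and \<alpha>: "0 < \<alpha>" "\<alpha> < 2" and Z: "levy_process M Z"
    and ind: "independent_coordinates M Z" and st: "\<And>j. stable_process \<alpha> M (\<lambda>t \<omega>. Z t \<omega> $ j)"
    and b: "lip L b" "second_diff L b" and L: "L \<ge> 0"
  obtains k C where "euler_scheme (\<lambda>t. distr M borel (\<lambda>\<omega>. Z t \<omega> - t *\<^sub>R k)) (\<lambda>x. b x + k) \<alpha> C L"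
proof -
  interpret prob_space M by (rule M)
  have Zm [measurable]: "Z t \<in> borel_measurable M" if "t \<ge> 0" for t using Z that by (simp add: levy_process_def)
  \<comment> \<open>The bounds of one coordinate are packed into a predicate so that drift and
    constant can be chosen for all coordinates together.\<close>
  define R where "R j p C \<longleftrightarrow> C \<ge> 1 \<and>
    (\<forall>t B f h. t > 0 \<longrightarrow> bounded_meas B f \<longrightarrow>
      \<bar>(\<integral>\<omega>. f (h + (Z t \<omega> $ j - t * p)) \<partial>M) - (\<integral>\<omega>. f (Z t \<omega> $ j - t * p) \<partial>M)\<bar> \<le> C * t powr (-1/\<alpha>) * B * \<bar>h\<bar>) \<and>
    (\<forall>t \<sigma>. t > 0 \<longrightarrow> 0 < \<sigma> \<longrightarrow> \<sigma> \<le> 1 \<longrightarrow>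
      \<sigma> * \<bar>\<integral>\<omega>. sin (\<sigma> powr (-1/\<alpha>) * (Z t \<omega> $ j - t * p)) \<partial>M\<bar> \<le> C * t * \<sigma> powr (\<alpha>/4 - 1)) \<and>
    (\<forall>t \<sigma>. t > 0 \<longrightarrow> 0 < \<sigma> \<longrightarrow> \<sigma> \<le> 1 \<longrightarrow>
      (\<integral>\<omega>. min 1 (\<sigma> * (\<sigma> powr (-1/\<alpha>))\<^sup>2 * (Z t \<omega> $ j - t * p)\<^sup>2) \<partial>M) \<le> C * t * \<sigma> powr (\<alpha>/4 - 1))"
    for j p C
  have "\<exists>p C. R j p C" for j
  proof (rule stable_noise_bounds[OF M \<alpha> st, of j])
    fix p C :: real
    assume *: "1 \<le> C"
      "\<And>t B f h. 0 < t \<Longrightarrow> bounded_meas B f \<Longrightarrow>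
        \<bar>(\<integral>\<omega>. f (h + (Z t \<omega> $ j - t * p)) \<partial>M) - (\<integral>\<omega>. f (Z t \<omega> $ j - t * p) \<partial>M)\<bar> \<le> C * t powr (-1/\<alpha>) * B * \<bar>h\<bar>"
      "\<And>t \<sigma>. 0 < t \<Longrightarrow> 0 < \<sigma> \<Longrightarrow> \<sigma> \<le> 1 \<Longrightarrow>
        \<sigma> * \<bar>\<integral>\<omega>. sin (\<sigma> powr (-1/\<alpha>) * (Z t \<omega> $ j - t * p)) \<partial>M\<bar> \<le> C * t * \<sigma> powr (\<alpha>/4 - 1)"
      "\<And>t \<sigma>. 0 < t \<Longrightarrow> 0 < \<sigma> \<Longrightarrow> \<sigma> \<le> 1 \<Longrightarrow>
        (\<integral>\<omega>. min 1 (\<sigma> * (\<sigma> powr (-1/\<alpha>))\<^sup>2 * (Z t \<omega> $ j - t * p)\<^sup>2) \<partial>M) \<le> C * t * \<sigma> powr (\<alpha>/4 - 1)"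
    have "R j p C" unfolding R_def by (intro conjI allI impI *)
    then show ?thesis by blast
  qed
  then obtain p C where R: "\<And>j. R j (p j) (C j)" by metis
  have C1: "\<And>j. C j \<ge> 1" using R unfolding R_def by (rule conjunct1)
  note R' = R[unfolded R_def, THEN conjunct2]
  note tv = R'[THEN conjunct1, rule_format] and sine = R'[THEN conjunct2, THEN conjunct1, rule_format]
    and trunc = R'[THEN conjunct2, THEN conjunct2, rule_format]
  define k where "k = (\<chi> j. p j)"
  define C' where "C' = (\<Sum>j\<in>UNIV. C j)"
  have CC': "C j \<le> C'" for j
    unfolding C'_def using order_trans[OF zero_le_one C1] by (intro member_le_sum) auto
  have C': "C' \<ge> 1" using CC' C1 order_trans by blast
  define D where "D = real DIM(real ^ 'd) * C'"
  have D1: "real DIM(real ^ 'd) \<ge> 1" using DIM_positive[where 'a = "real ^ 'd"] by linarith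
  have CD: "C j \<le> D" for j
    unfolding D_def using mult_right_mono[OF D1, of C'] C' CC'[of j] by linarith
  define Z' where "Z' t \<omega> = Z t \<omega> - t *\<^sub>R k" for t \<omega>
  have Z'm [measurable]: "Z' t \<in> borel_measurable M" if "t \<ge> 0" for t
    unfolding Z'_def[abs_def] using that by measurable
  have Z'j: "Z' t \<omega> $ j = Z t \<omega> $ j - t * p j" for t \<omega> j by (simp add: Z'_def k_def)
  have Z'L: "levy_process M Z'" unfolding Z'_def[abs_def] by (rule levy_process_drift[OF M Z])
  have int: "(\<integral>z. f z \<partial>distr M borel (Z' t)) = (\<integral>\<omega>. f (Z' t \<omega>) \<partial>M)"
    if "t > 0" "f \<in> borel_measurable borel" for t and f :: "real ^ 'd \<Rightarrow> real"
    using Z'm[of t] that by (intro integral_distr) auto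
  have "euler_scheme (\<lambda>t. distr M borel (Z' t)) (\<lambda>x. b x + k) \<alpha> D L"
  proof (rule euler_scheme.intro)
    show "0 < \<alpha>" "\<alpha> < 2" "L \<ge> 0" by fact+
    show "D \<ge> 1" using CD C1 order_trans by blast
    show "lip L (\<lambda>x. b x + k)" "second_diff L (\<lambda>x. b x + k)"
      using b by (simp_all add: lip_def second_diff_def algebra_simps)
    fix t :: real assume t: "t > 0"
    show "prob_space (distr M borel (Z' t))" using Z'm[of t] t by (intro prob_space_distr) auto
    show "sets (distr M borel (Z' t)) = sets borel" by simp
    show "conv_op (distr M borel (Z' t)) (conv_op (distr M borel (Z' s)) f) = conv_op (distr M borel (Z' (t + s))) f"
      if "s > 0" "bounded_meas B f" for s B f
      by (rule levy_semigroup[OF M Z'L t that])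
    show "lip (D * t powr (-1/\<alpha>) * B) (conv_op (distr M borel (Z' t)) f)" if f: "bounded_meas B f" for B f
    proof -
      have fm [measurable]: "f \<in> borel_measurable borel" and B: "B \<ge> 0"
        using f bounded_meas_nonneg[OF f] by (auto simp: bounded_meas_def)
      have "lip (DIM(real ^ 'd) * (C' * t powr (-1/\<alpha>) * B)) (conv_op (distr M borel (Z' t)) f)"
      proof (rule lip_of_axes)
        show "C' * t powr (-1/\<alpha>) * B \<ge> 0" using C' B by simp
        fix i x :: "real ^ 'd" and r assume "i \<in> Basis"
        then obtain j where i: "i = axis j 1" using axis_cases by blast
        have g: "bounded_meas B (\<lambda>z. f (x + z))" by (rule bounded_meas_comp[OF f]) measurable
        have "\<bar>(\<integral>\<omega>. f (x + (r *\<^sub>R axis j 1 + (Z t \<omega> - t *\<^sub>R k))) \<partial>M) - (\<integral>\<omega>. f (x + (Z t \<omega> - t *\<^sub>R k)) \<partial>M)\<bar>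
           \<le> (C j * t powr (-1/\<alpha>) * B) * \<bar>r\<bar>"
          by (rule coordinate_shift_bound[OF M ind _ tv[OF t] g]) (use t in \<open>auto simp: k_def\<close>)
        also have "\<dots> \<le> (C' * t powr (-1/\<alpha>) * B) * \<bar>r\<bar>"
          using CC' B by (intro mult_right_mono) auto
        finally show "norm (conv_op (distr M borel (Z' t)) f (x + r *\<^sub>R i) - conv_op (distr M borel (Z' t)) f x) \<le> C' * t powr (-1/\<alpha>) * B * \<bar>r\<bar>"
          unfolding conv_op_def i by (simp add: int[OF t] add.assoc Z'_def)
      qed
      then show ?thesis by (simp add: D_def mult_ac)
    qed
    fix \<sigma> :: real and i :: "real ^ 'd" assume \<sigma>: "0 < \<sigma>" "\<sigma> \<le> 1" and "i \<in> Basis"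
    then obtain j where i: "i = axis j 1" using axis_cases by blast
    have "C j * (t * \<sigma> powr (\<alpha>/4 - 1)) \<le> D * (t * \<sigma> powr (\<alpha>/4 - 1))"
      using CD t by (intro mult_right_mono) auto
    then have le: "C j * t * \<sigma> powr (\<alpha>/4 - 1) \<le> D * t * \<sigma> powr (\<alpha>/4 - 1)" by (simp only: mult.assoc)
    show "\<sigma> * \<bar>\<integral>z. sin (\<sigma> powr (-1/\<alpha>) * (z \<bullet> i)) \<partial>distr M borel (Z' t)\<bar> \<le> D * t * \<sigma> powr (\<alpha>/4 - 1)"
      using order_trans[OF sine[OF t \<sigma>] le] by (simp add: int[OF t] i inner_axis Z'j)
    show "(\<integral>z. min 1 (\<sigma> * (\<sigma> powr (-1/\<alpha>))\<^sup>2 * (z \<bullet> i)\<^sup>2) \<partial>distr M borel (Z' t)) \<le> D * t * \<sigma> powr (\<alpha>/4 - 1)"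
      using order_trans[OF trunc[OF t \<sigma>] le] by (simp add: int[OF t] i inner_axis Z'j)
  qed
  then show ?thesis unfolding Z'_def[abs_def] by (rule that)
qed

section \<open>The gradient formula\<close>

text \<open>The limit estimates hold for continuous f. Read as bounds on signed combinations of the
  laws at two or four starting points, they extend to Borel f, which is the input that
  \<open>gradient_density\<close> requires.\<close>

theorem (in euler_scheme) transition_gradient:
  fixes Z :: "real \<Rightarrow> 'a \<Rightarrow> 'b" and X :: "'b \<Rightarrow> real \<Rightarrow> 'a \<Rightarrow> 'b"
  assumes M: "prob_space M" and Z: "levy_process M Z" and Z\<mu>: "\<And>t. t > 0 \<Longrightarrow> distr M borel (Z t) = \<mu> t"
    and X: "\<And>x. sde_solution M b Z x (X x)" and t: "t > 0"
  obtains y where "y \<in> borel_measurable borel" "integrable M (\<lambda>\<omega>. y (X x t \<omega>))"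
    "(\<integral>\<omega>. norm (y (X x t \<omega>)) \<partial>M) \<le> DIM('b) * (\<Lambda> * min t t\<^sub>0 powr (-1/\<alpha>))"
    "\<And>B f. bounded_meas B f \<Longrightarrow> GDERIV (\<lambda>x. \<integral>\<omega>. f (X x t \<omega>) \<partial>M) x :> (\<integral>\<omega>. f (X x t \<omega>) *\<^sub>R y (X x t \<omega>) \<partial>M)"
proof -
  define \<nu> where "\<nu> x = distr M borel (X x t)" for x
  interpret prob_space M by (rule M)
  have Xm [measurable]: "X x t \<in> borel_measurable M" for x using X[of x] t by (simp add: sde_solution_def)
  have \<nu>: "prob_space (\<nu> x)" "sets (\<nu> x) = sets borel" for x
    unfolding \<nu>_def by (auto intro!: prob_space_distr)
  have int: "(\<integral>z. f z \<partial>\<nu> x) = (\<integral>\<omega>. f (X x t \<omega>) \<partial>M)" if "f \<in> borel_measurable borel"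
    for f :: "'b \<Rightarrow> 'c::{banach, second_countable_topology}" and x
    unfolding \<nu>_def using that by (intro integral_distr) auto
  have lim: "(\<lambda>n. (S (t / real (Suc n)) ^^ Suc n) f x) \<longlonglongrightarrow> (\<integral>z. f z \<partial>\<nu> x)"
    if "continuous_on UNIV f" "bounded_meas B f" for f B x
    using transition_limit[OF M Z Z\<mu> X t that] that(2) by (simp add: int bounded_meas_def)
  \<comment> \<open>The corners of a parallelogram as an indexed family, the form in which
    \<open>borel_functional_bound\<close> takes finitely many measures; its first two members serve
    for the Lipschitz bound.\<close>
  define N where "N h k i = \<nu> ([x, x + h, x + k, x + h + k] ! i)" for h k and i :: nat
  have lipP: "\<bar>(\<integral>z. f z \<partial>\<nu> (x + h)) - (\<integral>z. f z \<partial>\<nu> x)\<bar> \<le> (\<Lambda> * min t t\<^sub>0 powr (-1/\<alpha>)) * B * norm h"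
    if f: "bounded_meas B f" for B f h
  proof -
    define s where "s i = [-1, 1 :: real] ! i" for i
    have "\<bar>\<Sum>i\<in>{0, 1}. s i * (\<integral>z. f z \<partial>N h 0 i)\<bar> \<le> \<Lambda> * min t t\<^sub>0 powr (-1/\<alpha>) * B * norm h"
    proof (rule borel_functional_bound[OF _ _ _ _ f])
      fix g :: "'b \<Rightarrow> real" assume g: "continuous_on UNIV g" "bounded_meas B g"
      show "\<bar>\<Sum>i\<in>{0, 1}. s i * (\<integral>z. g z \<partial>N h 0 i)\<bar> \<le> \<Lambda> * min t t\<^sub>0 powr (-1/\<alpha>) * B * norm h"
        using limit_lip[OF t g(2) lim[OF g], of x h] by (simp add: N_def s_def)
    qed (auto simp: N_def \<nu>)
    then show ?thesis by (simp add: N_def s_def)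
  qed
  have sd: "\<bar>(\<integral>z. f z \<partial>\<nu> (x + h + k)) - (\<integral>z. f z \<partial>\<nu> (x + h)) - (\<integral>z. f z \<partial>\<nu> (x + k)) + (\<integral>z. f z \<partial>\<nu> x)\<bar>
      \<le> K\<^sub>t t * B * (norm h + norm k) powr (1 + \<alpha>\<^sup>2/16)"
    if f: "bounded_meas B f" for B f h k
  proof -
    define s where "s i = [1, -1, -1, 1 :: real] ! i" for i
    have "\<bar>\<Sum>i\<in>{0, 1, 2, 3}. s i * (\<integral>z. f z \<partial>N h k i)\<bar> \<le> K\<^sub>t t * B * (norm h + norm k) powr (1 + \<alpha>\<^sup>2/16)"
    proof (rule borel_functional_bound[OF _ _ _ _ f])
      fix g :: "'b \<Rightarrow> real" assume g: "continuous_on UNIV g" "bounded_meas B g"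
      show "\<bar>\<Sum>i\<in>{0, 1, 2, 3}. s i * (\<integral>z. g z \<partial>N h k i)\<bar> \<le> K\<^sub>t t * B * (norm h + norm k) powr (1 + \<alpha>\<^sup>2/16)"
        using limit_second_diff[OF t g(2) lim[OF g], of x h k] by (simp add: N_def s_def algebra_simps)
    qed (auto simp: N_def \<nu>)
    then show ?thesis by (simp add: N_def s_def algebra_simps)
  qed
  have \<gamma>: "\<alpha>\<^sup>2/16 > 0" using \<alpha> by simp
  have K: "K\<^sub>t t \<ge> 0" using C\<^sub>1 by (simp add: K\<^sub>t_def)
  show ?thesis
  proof (rule gradient_density[OF \<nu> lipP sd \<gamma> K])
    fix y assume ym [measurable]: "y \<in> borel_measurable borel" and y: "integrable (\<nu> x) y"
      "(\<integral>z. norm (y z) \<partial>\<nu> x) \<le> DIM('b) * (\<Lambda> * min t t\<^sub>0 powr (-1/\<alpha>))"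
      "\<And>B f. bounded_meas B f \<Longrightarrow> GDERIV (\<lambda>x. \<integral>z. f z \<partial>\<nu> x) x :> (\<integral>z. f z *\<^sub>R y z \<partial>\<nu> x)"
    show ?thesis
    proof (rule that[OF ym])
      show "integrable M (\<lambda>\<omega>. y (X x t \<omega>))" using y(1) unfolding \<nu>_def by (rule integrable_distr[rotated]) measurable
      show "(\<integral>\<omega>. norm (y (X x t \<omega>)) \<partial>M) \<le> DIM('b) * (\<Lambda> * min t t\<^sub>0 powr (-1/\<alpha>))" using y(2) by (subst (asm) int) auto
      fix B and f :: "'b \<Rightarrow> real" assume f: "bounded_meas B f"
      then have fm [measurable]: "f \<in> borel_measurable borel" by (simp add: bounded_meas_def)
      have "(\<lambda>x. \<integral>z. f z \<partial>\<nu> x) = (\<lambda>x. \<integral>\<omega>. f (X x t \<omega>) \<partial>M)" by (simp add: int fun_eq_iff)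
      moreover have "(\<integral>z. f z *\<^sub>R y z \<partial>\<nu> x) = (\<integral>\<omega>. f (X x t \<omega>) *\<^sub>R y (X x t \<omega>) \<partial>M)" by (rule int) measurable
      ultimately show "GDERIV (\<lambda>x. \<integral>\<omega>. f (X x t \<omega>) \<partial>M) x :> (\<integral>\<omega>. f (X x t \<omega>) *\<^sub>R y (X x t \<omega>) \<partial>M)"
        using y(3)[OF f] by simp
    qed
  qed
qed

lemma grad_eq: "GDERIV f x :> D \<Longrightarrow> grad f x = D"
  unfolding grad_def
proof (rule the_equality)
  fix D' assume "GDERIV f x :> D" "GDERIV f x :> D'"
  then have "(\<lambda>h. h \<bullet> D') = (\<lambda>h. h \<bullet> D)" unfolding gderiv_def by (rule has_derivative_unique[rotated])
  then show "D' = D" by (metis inner_commute vector_eq_ldot)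
qed

text \<open>Beyond \<open>t\<^sub>0\<close> the bound no longer depends on t, and on (0, T] a
  constant is comparable with t powr (- \<beta>) at the price of a power of
  \<open>T / t\<^sub>0\<close>. The summand 1 is for the earlier times.\<close>

lemma min_powr_le:
  fixes t t\<^sub>0 T \<beta> :: real
  assumes "0 < t" "t \<le> T" "0 < t\<^sub>0" "\<beta> > 0"
  shows "min t t\<^sub>0 powr (- \<beta>) \<le> (1 + (T / t\<^sub>0) powr \<beta>) * t powr (- \<beta>)"
proof (cases "t \<le> t\<^sub>0")
  case True
  then show ?thesis by (simp add: distrib_right)
next
  case False
  have "t\<^sub>0 powr (- \<beta>) = (t / t\<^sub>0) powr \<beta> * t powr (- \<beta>)"
    using assms by (simp add: powr_divide powr_minus field_simps)
  also have "\<dots> \<le> (T / t\<^sub>0) powr \<beta> * t powr (- \<beta>)"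
    using assms by (intro mult_right_mono powr_mono2 divide_right_mono) auto
  finally show ?thesis using False by (simp add: distrib_right add_increasing)
qed

lemma bounded_borel_imp_bounded_meas:
  assumes "f \<in> bounded_borel"
  shows "bounded_meas (enn2real (sup_norm f)) f" "sup_norm f = ennreal (enn2real (sup_norm f))"
proof -
  obtain B where B: "\<And>x. norm (f x) \<le> B" using assms unfolding bounded_borel_def bounded_iff by auto
  have "sup_norm f \<le> ennreal B" unfolding sup_norm_def by (intro SUP_least ennreal_leI B)
  then have "sup_norm f < \<infinity>" by (rule order.strict_trans1) simp
  then show eq: "sup_norm f = ennreal (enn2real (sup_norm f))" by simp
  have "ennreal \<bar>f x\<bar> \<le> ennreal (enn2real (sup_norm f))" for x
    unfolding eq[symmetric] unfolding sup_norm_def by (rule SUP_upper2[of x]) auto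
  then show "bounded_meas (enn2real (sup_norm f)) f"
    using assms by (simp add: bounded_meas_def bounded_borel_def)
qed

theorem mainTheorem2:
  fixes M :: "'a measure"
    and \<alpha> :: real
    and b :: "real ^ 'd \<Rightarrow> real ^ 'd"
    and Z :: "real \<Rightarrow> 'a \<Rightarrow> real ^ 'd"
    and m :: "'d \<Rightarrow> real measure"
    and N :: "'d \<Rightarrow> 'a \<Rightarrow> (real \<times> real) measure"
    and X :: "real ^ 'd \<Rightarrow> real \<Rightarrow> 'a \<Rightarrow> real ^ 'd"
  assumes "prob_space M"
    and "0 < \<alpha>" and "\<alpha> < 2"
    and "levy_process M Z"
    and "independent_coordinates M Z"
    and "\<And>j. purely_jump M (m j) (N j) (\<lambda>t \<omega>. Z t \<omega> $ j)"
    and "\<And>j. stable_process \<alpha> M (\<lambda>t \<omega>. Z t \<omega> $ j)"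
    and "C2_map b"
    and "\<And>i. bounded (range (partial i b))"
    and "\<And>i j. bounded (range (partial j (partial i b)))"
    and "\<And>x. sde_solution M b Z x (X x)"
  shows
    "(\<exists>Y :: real \<Rightarrow> real ^ 'd \<Rightarrow> 'a \<Rightarrow> real ^ 'd.
        (\<forall>t>0. \<forall>x. integrable M (Y t x)) \<and>
        (\<forall>f\<in>bounded_borel. \<forall>t>0. \<forall>x.
           GDERIV (transition M X t f) x :> (LINT \<omega> | M. f (X x t \<omega>) *\<^sub>R Y t x \<omega>)) \<and>
        (\<forall>T>0. \<exists>C. \<forall>t\<in>{0<..T}. \<forall>x.
           (LINT \<omega> | M. norm (Y t x \<omega>)) \<le> C * t powr (- 1 / \<alpha>))) \<and>
     (\<forall>T>0. \<exists>C. \<forall>t\<in>{0<..T}. \<forall>f\<in>bounded_borel.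
        sup_norm (grad (transition M X t f)) \<le> ennreal (C * t powr (- 1 / \<alpha>)) * sup_norm f)"
proof -
  interpret prob_space M by fact
  obtain L where L: "L \<ge> 0" "lip L b" "second_diff L b"
    by (rule C2_map_bounded_partials[OF assms(8-10)])
  obtain k C where E: "euler_scheme (\<lambda>t. distr M borel (\<lambda>\<omega>. Z t \<omega> - t *\<^sub>R k)) (\<lambda>x. b x + k) \<alpha> C L"
    by (rule stable_euler_scheme[OF assms(1-5,7) L(2,3,1)])
  interpret E: euler_scheme "\<lambda>t. distr M borel (\<lambda>\<omega>. Z t \<omega> - t *\<^sub>R k)" "\<lambda>x. b x + k" \<alpha> C L by (rule E)
  have Xm: "X x t \<in> borel_measurable M" if "t \<ge> 0" for x t using assms(11)[of x] that by (simp add: sde_solution_def)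
  define A where "A t = DIM(real ^ 'd) * (E.\<Lambda> * min t E.t\<^sub>0 powr (-1/\<alpha>))" for t
  define P where "P t x y \<longleftrightarrow> integrable M (\<lambda>\<omega>. y (X x t \<omega>)) \<and> (LINT \<omega> | M. norm (y (X x t \<omega>))) \<le> A t \<and>
    (\<forall>f B. bounded_meas B f \<longrightarrow> GDERIV (transition M X t f) x :> (LINT \<omega> | M. f (X x t \<omega>) *\<^sub>R y (X x t \<omega>)))"
    for t x and y :: "real ^ 'd \<Rightarrow> real ^ 'd"
  have "\<exists>y. P t x y" if t: "t > 0" for t x
  proof (rule E.transition_gradient[OF assms(1) levy_process_drift[OF assms(1,4)] refl sde_solution_drift[OF assms(11)] t, of x])
    fix y assume "integrable M (\<lambda>\<omega>. y (X x t \<omega>))" "(LINT \<omega> | M. norm (y (X x t \<omega>))) \<le> DIM(real ^ 'd) * (E.\<Lambda> * min t E.t\<^sub>0 powr (-1/\<alpha>))"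
      "\<And>B f. bounded_meas B f \<Longrightarrow> GDERIV (\<lambda>x. LINT \<omega> | M. f (X x t \<omega>)) x :> (LINT \<omega> | M. f (X x t \<omega>) *\<^sub>R y (X x t \<omega>))"
    then have "P t x y" by (auto simp: P_def A_def transition_def[abs_def])
    then show ?thesis by blast
  qed
  \<comment> \<open>The density is chosen for each time and starting point, before any f is given;
    hence the field Y is the same for all f.\<close>
  then obtain y where y: "\<And>t x. t > 0 \<Longrightarrow> P t x (y t x)" by metis
  define Y where "Y t x \<omega> = y t x (X x t \<omega>)" for t x \<omega>
  have Yi: "integrable M (Y t x)" and YA: "(LINT \<omega> | M. norm (Y t x \<omega>)) \<le> A t"
    and YG: "\<And>f B. bounded_meas B f \<Longrightarrow> GDERIV (transition M X t f) x :> (LINT \<omega> | M. f (X x t \<omega>) *\<^sub>R Y t x \<omega>)"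
    if "t > 0" for t x
    using y[OF that, of x] unfolding P_def Y_def by blast+
  define C\<^sub>T where "C\<^sub>T T = DIM(real ^ 'd) * (E.\<Lambda> * (1 + (T / E.t\<^sub>0) powr (1/\<alpha>)))" for T
  have AC: "A t \<le> C\<^sub>T T * t powr (- 1 / \<alpha>)" if "t \<in> {0<..T}" for t T
  proof -
    have "E.\<Lambda> * min t E.t\<^sub>0 powr (- (1/\<alpha>)) \<le> E.\<Lambda> * ((1 + (T / E.t\<^sub>0) powr (1/\<alpha>)) * t powr (- (1/\<alpha>)))"
      using that E.t\<^sub>0(1) E.\<Lambda> assms(2) by (intro mult_left_mono min_powr_le) auto
    from mult_left_mono[OF this, of "real DIM(real ^ 'd)"] show ?thesis
      by (simp add: A_def C\<^sub>T_def mult.assoc)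
  qed
  have CT: "C\<^sub>T T \<ge> 0" for T using E.\<Lambda> by (simp add: C\<^sub>T_def)
  have bound: "sup_norm (grad (transition M X t f)) \<le> ennreal (C\<^sub>T T * t powr (- 1 / \<alpha>)) * sup_norm f"
    if t: "t \<in> {0<..T}" and f: "f \<in> bounded_borel" for t T f
  proof -
    define B where "B = enn2real (sup_norm f)"
    have bm: "bounded_meas B f" and fB: "sup_norm f = ennreal B"
      using bounded_borel_imp_bounded_meas[OF f] by (auto simp: B_def)
    have B: "B \<ge> 0" by (simp add: B_def)
    have fm [measurable]: "f \<in> borel_measurable borel" and fb: "\<And>z. \<bar>f z\<bar> \<le> B" using bm by (auto simp: bounded_meas_def)
    have t0: "t > 0" using t by simp
    note [measurable] = Xm[OF less_imp_le[OF t0]]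
    have "norm (grad (transition M X t f) x) \<le> C\<^sub>T T * t powr (- 1 / \<alpha>) * B" for x
    proof -
      have "norm (grad (transition M X t f) x) = norm (LINT \<omega> | M. f (X x t \<omega>) *\<^sub>R Y t x \<omega>)"
        by (simp add: grad_eq[OF YG[OF t0 bm]])
      also have "\<dots> \<le> (LINT \<omega> | M. B * norm (Y t x \<omega>))"
      proof (rule order_trans[OF integral_norm_bound integral_mono'])
        show "integrable M (\<lambda>\<omega>. B * norm (Y t x \<omega>))" using Yi[OF t0] by simp
        show "norm (f (X x t \<omega>) *\<^sub>R Y t x \<omega>) \<le> B * norm (Y t x \<omega>)" for \<omega>
          using fb by (simp add: mult_right_mono)
      qed (use B in simp)
      also have "\<dots> \<le> B * (C\<^sub>T T * t powr (- 1 / \<alpha>))"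
        using order_trans[OF YA[OF t0] AC[OF t]] B by (simp add: mult_left_mono)
      finally show ?thesis by (simp add: mult_ac)
    qed
    then have "sup_norm (grad (transition M X t f)) \<le> ennreal (C\<^sub>T T * t powr (- 1 / \<alpha>) * B)"
      unfolding sup_norm_def by (intro SUP_least ennreal_leI)
    also have "\<dots> = ennreal (C\<^sub>T T * t powr (- 1 / \<alpha>)) * ennreal B"
      using CT B by (intro ennreal_mult) auto
    finally show ?thesis by (simp add: fB)
  qed
  show ?thesis
  proof (intro conjI exI[of _ Y] allI ballI impI)
    show "integrable M (Y t x)" if "t > 0" for t x by (rule Yi[OF that])
    show "GDERIV (transition M X t f) x :> (LINT \<omega> | M. f (X x t \<omega>) *\<^sub>R Y t x \<omega>)"
      if "f \<in> bounded_borel" "t > 0" for f t x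
      by (rule YG[OF that(2) bounded_borel_imp_bounded_meas(1)[OF that(1)]])
    show "\<exists>C. \<forall>t\<in>{0<..T}. \<forall>x. (LINT \<omega> | M. norm (Y t x \<omega>)) \<le> C * t powr (- 1 / \<alpha>)" for T
      by (rule exI[of _ "C\<^sub>T T"]) (use order_trans[OF YA AC] in auto)
    show "\<exists>C. \<forall>t\<in>{0<..T}. \<forall>f\<in>bounded_borel.
        sup_norm (grad (transition M X t f)) \<le> ennreal (C * t powr (- 1 / \<alpha>)) * sup_norm f" for T
      using bound by blast
  qed
qed

end
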